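(* Let $n,N\geq 1$, let $\Omega\subset\mathbb{R}^n$ be a bounded Lipschitz domain, let $\lambda>0$, and let $K\subset\mathbb{R}^N$ be closed and convex. Let $f\in L^2(\Omega,\mathbb{R}^N)$ satisfy $f(x)\in K$ for almost all $x\in\Omega$. Let $\psi:[0,\infty)\to[0,\infty)$ satisfy $\psi\in C^2([0,\infty))$, $\psi(0)=0$, and for all $y\geq 0$: $\psi'(y)\leq\nu_1$, $\psi(y)\geq\nu_2 y-\nu_3$, $\psi''(y)>0$, with constants $\nu_1,\nu_2>0$, $\nu_3\in\mathbb{R}$. Put $\psi'_\infty:=\lim_{y\to\infty}\psi'(y)\in(0,\infty)$ and define $$J[w]:=\int_\Omega\psi(|\nabla w|)\,dx+\frac{\lambda}{2}\int_\Omega|w-f|^2\,dx,\quad w\in W^{1,1}(\Omega,\mathbb{R}^N),$$ $$\mathcal{K}[w]:=\int_\Omega\psi(|\nabla^a w|)\,dx+\psi'_\infty\,|\nabla^s w|(\Omega)+\frac{\lambda}{2}\int_\Omega|w-f|^2\,dx,\quad w\in BV(\Omega,\mathbb{R}^N).$$ Then the problem $\mathcal{K}\to\min$ in $BV(\Omega,\mathbb{R}^N)$ (where no constraint $w(x)\in K$ is imposed on competitors) admits a unique solution $u\in BV(\Omega,\mathbb{R}^N)$; this minimizer satisfies $u(x)\in K$ for almost all $x\in\Omega$; and $$\inf_{w\in BV(\Omega,\mathbb{R}^N)}\mathcal{K}[w]=\inf_{w\in W^{1,1}(\Omega,\mathbb{R}^N)}J[w].$$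
   Context: $|\cdot|$ denotes the Euclidean norm of vectors and the Euclidean (Frobenius) norm of matrices; for $w$ with values in $\mathbb{R}^N$, $\nabla w$ is the $(n\times N)$ Jacobian matrix $(\partial_\alpha w^i)$. For $w\in BV(\Omega,\mathbb{R}^N)$, $\nabla w=\nabla^a w\,\mathcal{L}^n+\nabla^s w$ is the Lebesgue decomposition of the matrix-valued Radon measure $\nabla w$ into its absolutely continuous part (with density $\nabla^a w$) and singular part $\nabla^s w$ with respect to Lebesgue measure $\mathcal{L}^n$, and $|\nabla^s w|(\Omega)$ is the total variation of $\nabla^s w$ on $\Omega$. The value $+\infty$ is allowed for the functionals. *)

theory Defs
  imports "HOL-Analysis.Analysis"
begin

text \<open>A bounded Lipschitz domain: nonempty, open, connected, bounded, and near each boundary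
point p the set is the supergraph (in a direction e) of a Lipschitz function g over the
hyperplane orthogonal to e (g is invariant along e, i.e. depends only on the orthogonal
projection onto the hyperplane).\<close>

definition bounded_lipschitz_domain :: "(real^'n) set \<Rightarrow> bool" where
  "bounded_lipschitz_domain \<Omega> \<longleftrightarrow>
     \<Omega> \<noteq> {} \<and> open \<Omega> \<and> connected \<Omega> \<and> bounded \<Omega> \<and>
     (\<forall>p \<in> frontier \<Omega>. \<exists>r > 0. \<exists>e :: real^'n. \<exists>g :: real^'n \<Rightarrow> real. \<exists>L.
        norm e = 1 \<and> L-lipschitz_on UNIV g \<and> (\<forall>x t. g (x + t *\<^sub>R e) = g x) \<and>
        \<Omega> \<inter> ball p r = {x \<in> ball p r. x \<bullet> e > g x})"

definition partial_deriv :: "'n::finite \<Rightarrow> (real^'n \<Rightarrow> real) \<Rightarrow> real^'n \<Rightarrow> real" where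
  "partial_deriv \<alpha> \<phi> x = frechet_derivative \<phi> (at x) (axis \<alpha> 1)"

fun Ck_fun :: "nat \<Rightarrow> (real^'n::finite \<Rightarrow> real) set" where
  "Ck_fun 0 = {\<phi>. continuous_on UNIV \<phi>}"
| "Ck_fun (Suc k) = {\<phi>. continuous_on UNIV \<phi> \<and> (\<forall>x. \<phi> differentiable (at x)) \<and>
                        (\<forall>\<alpha>. partial_deriv \<alpha> \<phi> \<in> Ck_fun k)}"

definition test_fun :: "(real^'n) set \<Rightarrow> (real^'n \<Rightarrow> real) \<Rightarrow> bool" where
  "test_fun \<Omega> \<phi> \<longleftrightarrow> (\<forall>k. \<phi> \<in> Ck_fun k) \<and>
     compact (closure {x. \<phi> x \<noteq> 0}) \<and> closure {x. \<phi> x \<noteq> 0} \<subseteq> \<Omega>"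

text \<open>Gradients are n x N matrices G x with entries G x \$ alpha \$ i = d_alpha w^i;
their norm (norm on real^'m^'n) is the Frobenius norm.\<close>

definition weak_grad :: "(real^'n) set \<Rightarrow> (real^'n \<Rightarrow> real^'m) \<Rightarrow> (real^'n \<Rightarrow> real^'m^'n) \<Rightarrow> bool" where
  "weak_grad \<Omega> w G \<longleftrightarrow>
     (\<forall>\<phi> \<alpha> i. test_fun \<Omega> \<phi> \<longrightarrow>
        (\<integral>x. w x $ i * partial_deriv \<alpha> \<phi> x \<partial>lebesgue_on \<Omega>)
          = - (\<integral>x. G x $ \<alpha> $ i * \<phi> x \<partial>lebesgue_on \<Omega>))"

definition W11 :: "(real^'n) set \<Rightarrow> (real^'n \<Rightarrow> real^'m) \<Rightarrow> bool" where
  "W11 \<Omega> w \<longleftrightarrow> integrable (lebesgue_on \<Omega>) w \<and>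
     (\<exists>G. integrable (lebesgue_on \<Omega>) G \<and> weak_grad \<Omega> w G)"

text \<open>BV decomposition: the distributional gradient of w is the finite matrix-valued Radon
measure  G dx + theta sigma  on Omega, where G is the density of the absolutely continuous part,
and the singular part is written in polar form theta sigma: sigma is a finite Borel measure
carried by Omega and by a Lebesgue-null set, and |theta| = 1 sigma-a.e., so that
sigma = |grad^s w| (total variation measure of the singular part).\<close>

definition BV_decomp :: "(real^'n) set \<Rightarrow> (real^'n \<Rightarrow> real^'m) \<Rightarrow> (real^'n \<Rightarrow> real^'m^'n)
     \<Rightarrow> (real^'n \<Rightarrow> real^'m^'n) \<Rightarrow> (real^'n) measure \<Rightarrow> bool" where
  "BV_decomp \<Omega> w G \<theta> \<sigma> \<longleftrightarrow>
     integrable (lebesgue_on \<Omega>) w \<and> integrable (lebesgue_on \<Omega>) G \<and>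
     sets \<sigma> = sets borel \<and> emeasure \<sigma> UNIV < \<infinity> \<and> emeasure \<sigma> (UNIV - \<Omega>) = 0 \<and>
     (\<exists>Z \<in> sets borel. emeasure lebesgue Z = 0 \<and> emeasure \<sigma> (UNIV - Z) = 0) \<and>
     \<theta> \<in> borel_measurable \<sigma> \<and> (AE x in \<sigma>. norm (\<theta> x) = 1) \<and>
     (\<forall>\<phi> \<alpha> i. test_fun \<Omega> \<phi> \<longrightarrow>
        (\<integral>x. w x $ i * partial_deriv \<alpha> \<phi> x \<partial>lebesgue_on \<Omega>)
          = - ((\<integral>x. G x $ \<alpha> $ i * \<phi> x \<partial>lebesgue_on \<Omega>)
               + (\<integral>x. \<theta> x $ \<alpha> $ i * \<phi> x \<partial>\<sigma>)))"

definition BV :: "(real^'n) set \<Rightarrow> (real^'n \<Rightarrow> real^'m) \<Rightarrow> bool" where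
  "BV \<Omega> w \<longleftrightarrow> (\<exists>G \<theta> \<sigma>. BV_decomp \<Omega> w G \<theta> \<sigma>)"

definition Jfun :: "(real^'n) set \<Rightarrow> (real \<Rightarrow> real) \<Rightarrow> real \<Rightarrow> (real^'n \<Rightarrow> real^'m)
     \<Rightarrow> (real^'n \<Rightarrow> real^'m) \<Rightarrow> ennreal" where
  "Jfun \<Omega> \<psi> lam f w = (SOME v. \<exists>G. integrable (lebesgue_on \<Omega>) G \<and> weak_grad \<Omega> w G \<and>
      v = (\<integral>\<^sup>+x. ennreal (\<psi> (norm (G x))) \<partial>lebesgue_on \<Omega>)
        + ennreal (lam / 2) * (\<integral>\<^sup>+x. ennreal ((norm (w x - f x))\<^sup>2) \<partial>lebesgue_on \<Omega>))"

definition Kfun :: "(real^'n) set \<Rightarrow> (real \<Rightarrow> real) \<Rightarrow> real \<Rightarrow> real \<Rightarrow> (real^'n \<Rightarrow> real^'m)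
     \<Rightarrow> (real^'n \<Rightarrow> real^'m) \<Rightarrow> ennreal" where
  "Kfun \<Omega> \<psi> \<psi>inf lam f w = (SOME v. \<exists>G \<theta> \<sigma>. BV_decomp \<Omega> w G \<theta> \<sigma> \<and>
      v = (\<integral>\<^sup>+x. ennreal (\<psi> (norm (G x))) \<partial>lebesgue_on \<Omega>)
        + ennreal \<psi>inf * emeasure \<sigma> \<Omega>
        + ennreal (lam / 2) * (\<integral>\<^sup>+x. ennreal ((norm (w x - f x))\<^sup>2) \<partial>lebesgue_on \<Omega>))"

end

theory Submission
  imports Defs "HOL-Probability.Helly_Selection"
begin

text \<open>By duality the relaxed energy of \<open>w\<close> is the supremum of \<open>\<integral> a - \<integral> w \<bullet> div \<Phi>\<close> over test pairs \<open>(a, \<Phi>)\<close> with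
  \<open>a + |\<Phi>| t \<le> \<psi> t\<close> for all \<open>t \<ge> 0\<close>. In this form it makes sense for every integrable \<open>w\<close>, is convex and lower
  semicontinuous, and is finite exactly on BV. The fidelity term is strongly convex, so minimizing sequences
  are Cauchy in the square mean, which gives existence and uniqueness. A smooth truncation by a half-space
  containing K decreases the fidelity term, and it does not increase the energy, because the transpose of
  its differential acts on the test pairs; hence the minimizer has values in K. Finally, a BV function is smoothed
  successively on annuli that exhaust the domain, by operators that nearly preserve the test pairs. Each step costs
  arbitrarily little, and the limit has no singular part, so both infima agree.\<close>

text \<open>The pieces of a decomposed gradient are hard to follow under limits, truncation and
  smoothing. In the dual form each operation is moved onto the test pair by its adjoint, and the
  only thing to check is that the new pair still obeys \<open>a + |\<Phi>| t \<le> \<psi> t\<close>,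
  a convex condition at each point. This dictates the operations: the truncation must be smooth
  enough for its transposed differential to produce C^1 fields again, and the smoothing must be
  symmetric, so that its adjoint is an average as well. The price is the way back from finite energy
  to a decomposition. Finite energy only bounds the integrals of w against derivatives of test
  functions. Mollified derivatives then have bounded mass; their weak limits are finite measures,
  where weak compactness in several dimensions is reduced to Helly's theorem on the line by a
  space-filling curve. Densities with respect to one dominating measure finally yield the Lebesgue
  and the polar decomposition by pointwise algebra.\<close>

text \<open>The names below are otherwise shadowed by the Henstock--Kurzweil versions.\<close>

lemmas integrable_add = Bochner_Integration.integrable_add
  and integrable_bound = Bochner_Integration.integrable_bound
  and integrable_diff = Bochner_Integration.integrable_diff
  and integrable_sum = Bochner_Integration.integrable_sum
  and integral_add = Bochner_Integration.integral_add
  and integral_cong = Bochner_Integration.integral_cong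
  and integral_diff = Bochner_Integration.integral_diff
  and integral_nonneg = Bochner_Integration.integral_nonneg
  and integral_sum = Bochner_Integration.integral_sum

abbreviation "L1 \<equiv> integrable lborel"

abbreviation "pd \<equiv> partial_deriv"

section \<open>Continuously differentiable functions and test functions\<close>

definition grd :: "(real^'n \<Rightarrow> real) \<Rightarrow> real^'n \<Rightarrow> real^'n" where
  "grd \<phi> x = (\<chi> \<alpha>. pd \<alpha> \<phi> x)"

lemma partial_deriv_eqI:
  assumes "(\<phi> has_derivative D) (at x)"
  shows "pd \<alpha> \<phi> x = D (axis \<alpha> 1)"
  using frechet_derivative_at[OF assms] by (simp add: partial_deriv_def)

lemma Ck_fun_SucD: "\<phi> \<in> Ck_fun (Suc k) \<Longrightarrow> \<phi> \<in> Ck_fun k"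
  by (induction k arbitrary: \<phi>) auto

lemma Ck_fun_antimono: "k \<le> l \<Longrightarrow> \<phi> \<in> Ck_fun l \<Longrightarrow> \<phi> \<in> Ck_fun k"
  by (induction l rule: dec_induct) (auto dest: Ck_fun_SucD simp del: Ck_fun.simps)

lemma Ck_fun_continuous: "\<phi> \<in> Ck_fun k \<Longrightarrow> continuous_on UNIV \<phi>"
  by (cases k) auto

lemma Ck_fun_partial: "\<phi> \<in> Ck_fun (Suc k) \<Longrightarrow> pd \<alpha> \<phi> \<in> Ck_fun k"
  by simp

lemma has_derivative_grd:
  assumes "\<phi> differentiable (at x)"
  shows "(\<phi> has_derivative (\<lambda>h. grd \<phi> x \<bullet> h)) (at x)"
proof -
  let ?D = "frechet_derivative \<phi> (at x)"
  have D: "(\<phi> has_derivative ?D) (at x)"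
    using assms frechet_derivative_works by blast
  then have lin: "linear ?D" by (simp add: has_derivative_linear)
  have "?D h = grd \<phi> x \<bullet> h" for h
  proof -
    have "?D h = ?D (\<Sum>\<alpha>\<in>UNIV. h $ \<alpha> *\<^sub>R axis \<alpha> 1)"
      using basis_expansion[of h] by (simp add: scalar_mult_eq_scaleR)
    also have "\<dots> = (\<Sum>\<alpha>\<in>UNIV. h $ \<alpha> * ?D (axis \<alpha> 1))"
      by (simp add: linear_sum[OF lin] linear_cmul[OF lin])
    finally show ?thesis
      by (simp add: grd_def inner_vec_def partial_deriv_def mult.commute)
  qed
  then have "?D = (\<lambda>h. grd \<phi> x \<bullet> h)" by blast
  with D show ?thesis by simp
qed

lemma C1_has_derivative:
  assumes "\<phi> \<in> Ck_fun (Suc k)"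
  shows "(\<phi> has_derivative (\<lambda>h. grd \<phi> x \<bullet> h)) (at x)"
  using assms by (intro has_derivative_grd) auto

lemma C1_continuous_grd:
  assumes "\<phi> \<in> Ck_fun (Suc k)"
  shows "continuous_on UNIV (grd \<phi>)"
  unfolding grd_def using Ck_fun_partial[OF assms] Ck_fun_continuous
  by (intro continuous_on_vec_lambda) blast

lemma C1_continuous_partial:
  assumes "\<phi> \<in> Ck_fun (Suc k)"
  shows "continuous_on UNIV (pd \<alpha> \<phi>)"
  using Ck_fun_partial[OF assms] Ck_fun_continuous by blast

lemma has_derivative_inner_partial:
  assumes "\<And>x. (\<phi> has_derivative (\<lambda>h. G x \<bullet> h)) (at x)"
  shows "pd \<alpha> \<phi> = (\<lambda>x. G x $ \<alpha>)"
  by (rule ext) (simp add: partial_deriv_eqI[OF assms] inner_axis)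

text \<open>The gradient is supplied as one explicit field G, so that membership in the next class
  becomes a statement about its components, which suits induction over the order.\<close>

lemma Ck_fun_SucI:
  assumes "\<And>x. (\<phi> has_derivative (\<lambda>h. G x \<bullet> h)) (at x)" "\<And>\<alpha>. (\<lambda>x. G x $ \<alpha>) \<in> Ck_fun k"
  shows "\<phi> \<in> Ck_fun (Suc k)"
proof -
  have "continuous_on UNIV \<phi>"
    using has_derivative_continuous[OF assms(1)] by (simp add: continuous_on_eq_continuous_at)
  moreover have "\<phi> differentiable (at x)" for x
    using assms(1) differentiable_def by blast
  ultimately show ?thesis
    using assms(2) by (simp add: has_derivative_inner_partial[OF assms(1)])
qed

lemma Ck_fun_const [simp, intro]: "(\<lambda>x. c) \<in> Ck_fun k"
proof (induction k arbitrary: c)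
  case (Suc k)
  show ?case
    by (rule Ck_fun_SucI[where G = "\<lambda>x. 0"]) (use Suc in \<open>auto intro!: derivative_eq_intros\<close>)
qed (simp add: continuous_on_const)

lemma Ck_fun_add:
  "f \<in> Ck_fun k \<Longrightarrow> g \<in> Ck_fun k \<Longrightarrow> (\<lambda>x. f x + g x) \<in> Ck_fun k"
proof (induction k arbitrary: f g)
  case (Suc k)
  show ?case
  proof (rule Ck_fun_SucI)
    show "((\<lambda>x. f x + g x) has_derivative (\<lambda>h. (grd f x + grd g x) \<bullet> h)) (at x)" for x
      using C1_has_derivative[OF Suc.prems(1), of x] C1_has_derivative[OF Suc.prems(2), of x]
      by (auto simp: inner_add_left intro: has_derivative_add)
  qed (use Suc in \<open>simp add: grd_def\<close>)
qed (auto intro: continuous_on_add)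

lemma Ck_fun_mult:
  "f \<in> Ck_fun k \<Longrightarrow> g \<in> Ck_fun k \<Longrightarrow> (\<lambda>x. f x * g x) \<in> Ck_fun k"
proof (induction k arbitrary: f g)
  case (Suc k)
  show ?case
  proof (rule Ck_fun_SucI)
    show "((\<lambda>x. f x * g x) has_derivative (\<lambda>h. (f x *\<^sub>R grd g x + g x *\<^sub>R grd f x) \<bullet> h)) (at x)" for x
      using has_derivative_mult[OF C1_has_derivative[OF Suc.prems(1), of x] C1_has_derivative[OF Suc.prems(2), of x]]
      by (simp add: inner_add_left algebra_simps)
    show "(\<lambda>x. (f x *\<^sub>R grd g x + g x *\<^sub>R grd f x) $ \<alpha>) \<in> Ck_fun k" for \<alpha>
      using Ck_fun_add[OF Suc.IH[OF Ck_fun_SucD[OF Suc.prems(1)] Ck_fun_partial[OF Suc.prems(2), of \<alpha>]]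
          Suc.IH[OF Ck_fun_SucD[OF Suc.prems(2)] Ck_fun_partial[OF Suc.prems(1), of \<alpha>]]]
      by (simp add: grd_def)
  qed
qed (auto intro: continuous_on_mult)

lemma Ck_fun_cmult: "f \<in> Ck_fun k \<Longrightarrow> (\<lambda>x. c * f x) \<in> Ck_fun k"
  by (intro Ck_fun_mult Ck_fun_const)

lemma Ck_fun_uminus: "f \<in> Ck_fun k \<Longrightarrow> (\<lambda>x. - f x) \<in> Ck_fun k"
  using Ck_fun_cmult[of f k "-1"] by simp

lemma Ck_fun_diff:
  "f \<in> Ck_fun k \<Longrightarrow> g \<in> Ck_fun k \<Longrightarrow> (\<lambda>x. f x - g x) \<in> Ck_fun k"
  using Ck_fun_add[OF _ Ck_fun_uminus, of f k g] by simp

lemma Ck_fun_sum: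
  "(\<And>i. i \<in> I \<Longrightarrow> f i \<in> Ck_fun k) \<Longrightarrow> (\<lambda>x. \<Sum>i\<in>I. f i x) \<in> Ck_fun k"
  by (induction I rule: infinite_finite_induct) (auto intro: Ck_fun_add simp del: Ck_fun.simps)

lemma Ck_fun_coord: "(\<lambda>x. x $ \<alpha>) \<in> Ck_fun k"
proof (cases k)
  case (Suc l)
  show ?thesis unfolding Suc
  proof (rule Ck_fun_SucI)
    show "((\<lambda>x. x $ \<alpha>) has_derivative (\<lambda>h. axis \<alpha> 1 \<bullet> h)) (at x)" for x
      by (auto simp: inner_axis' intro!: derivative_eq_intros bounded_linear_imp_has_derivative bounded_linear_vec_nth)
  qed auto
qed (auto intro!: continuous_intros)

lemma partial_deriv_add:
  assumes "f \<in> Ck_fun (Suc k)" "g \<in> Ck_fun (Suc l)"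
  shows "pd \<alpha> (\<lambda>x. f x + g x) x = pd \<alpha> f x + pd \<alpha> g x"
  using partial_deriv_eqI[OF has_derivative_add[OF C1_has_derivative[OF assms(1)] C1_has_derivative[OF assms(2)]]]
  by (simp add: inner_axis grd_def)

lemma partial_deriv_diff:
  assumes "f \<in> Ck_fun (Suc k)" "g \<in> Ck_fun (Suc l)"
  shows "pd \<alpha> (\<lambda>x. f x - g x) x = pd \<alpha> f x - pd \<alpha> g x"
  using partial_deriv_eqI[OF has_derivative_diff[OF C1_has_derivative[OF assms(1)] C1_has_derivative[OF assms(2)]]]
  by (simp add: inner_axis grd_def)

lemma partial_deriv_mult:
  assumes "f \<in> Ck_fun (Suc k)" "g \<in> Ck_fun (Suc l)"
  shows "pd \<alpha> (\<lambda>x. f x * g x) x = f x * pd \<alpha> g x + pd \<alpha> f x * g x"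
  using partial_deriv_eqI[OF has_derivative_mult[OF C1_has_derivative[OF assms(1)] C1_has_derivative[OF assms(2)]]]
  by (simp add: inner_axis grd_def)

lemma partial_deriv_const [simp]: "pd \<alpha> (\<lambda>x. c) x = 0"
  by (rule partial_deriv_eqI[of "\<lambda>x. c" "\<lambda>h. 0"]) simp

lemma partial_deriv_cmult:
  assumes "f \<in> Ck_fun (Suc k)"
  shows "pd \<alpha> (\<lambda>x. c * f x) x = c * pd \<alpha> f x"
  using partial_deriv_mult[OF Ck_fun_const assms] by simp

lemma partial_deriv_uminus:
  assumes "f \<in> Ck_fun (Suc k)"
  shows "pd \<alpha> (\<lambda>x. - f x) x = - pd \<alpha> f x"
  using partial_deriv_cmult[OF assms, of \<alpha> "-1"] by simp

lemma partial_deriv_sum: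
  assumes "\<And>i. i \<in> I \<Longrightarrow> f i \<in> Ck_fun (Suc k)"
  shows "pd \<alpha> (\<lambda>x. \<Sum>i\<in>I. f i x) x = (\<Sum>i\<in>I. pd \<alpha> (f i) x)"
  using assms
proof (induction I rule: infinite_finite_induct)
  case (insert i I)
  have "pd \<alpha> (\<lambda>x. f i x + (\<Sum>i\<in>I. f i x)) x
      = pd \<alpha> (f i) x + pd \<alpha> (\<lambda>x. \<Sum>i\<in>I. f i x) x"
    using insert.prems by (intro partial_deriv_add Ck_fun_sum) blast+
  with insert show ?case by simp
qed auto

lemma partial_deriv_zero_off:
  assumes "closed S" "\<And>x. x \<notin> S \<Longrightarrow> \<phi> x = 0" "x \<notin> S"
  shows "pd \<alpha> \<phi> x = 0"
proof -
  have "((\<lambda>x. 0::real) has_derivative (\<lambda>h. 0)) (at x)" by simp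
  then have "(\<phi> has_derivative (\<lambda>h. 0)) (at x)"
    by (rule has_derivative_transform_within_open[of _ _ _ _ "- S"]) (use assms in auto)
  from partial_deriv_eqI[OF this] show ?thesis .
qed

section \<open>Flat functions, smooth bumps and mollifiers\<close>

text \<open>For t > 0 this is t^(-j) exp(-1/t). The derivative of a member is a combination of the
  members j+1 and j+2, so the family is closed under differentiation and smoothness is an induction
  over the order. \<open>flat 0\<close> later also serves as the profile of the truncation.\<close>

definition flat :: "nat \<Rightarrow> real \<Rightarrow> real" where
  "flat j t = (if t > 0 then inverse t ^ j / exp (inverse t) else 0)"

lemma flat_tendsto_0: "(flat j \<longlongrightarrow> 0) (at 0)"
proof -
  have "((\<lambda>t. inverse t ^ j / exp (inverse t)) \<longlongrightarrow> (0::real)) (at_right 0)"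
    by (rule filterlim_compose[OF tendsto_power_div_exp_0 filterlim_inverse_at_top_right])
  then have "(flat j \<longlongrightarrow> 0) (at_right 0)"
    by (rule Lim_transform_eventually) (auto simp: eventually_at_right_field flat_def intro!: exI[of _ 1])
  moreover have "((\<lambda>t. 0::real) \<longlongrightarrow> 0) (at_left 0)" by simp
  then have "(flat j \<longlongrightarrow> 0) (at_left 0)"
    by (rule Lim_transform_eventually) (auto simp: eventually_at_left_field flat_def intro!: exI[of _ "-1"])
  ultimately show ?thesis
    by (rule filterlim_split_at[rotated])
qed

lemma flat_deriv: "(flat j has_real_derivative (flat (j + 2) t - real j * flat (j + 1) t)) (at t)"
proof -
  consider "t > 0" | "t < 0" | "t = 0" by linarith
  then show ?thesis
  proof cases
    case 1
    have "((\<lambda>t. inverse t ^ j / exp (inverse t)) has_real_derivative (flat (j + 2) t - real j * flat (j + 1) t)) (at t)"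
    proof -
      have "((\<lambda>t. inverse t ^ j / exp (inverse t)) has_real_derivative
          ((real j * inverse t ^ (j - 1) * (- (inverse t ^ 2))) * exp (inverse t)
            - inverse t ^ j * (exp (inverse t) * (- (inverse t ^ 2)))) / (exp (inverse t) * exp (inverse t))) (at t)"
        using 1 by (auto intro!: derivative_eq_intros simp: power2_eq_square)
      moreover have "((real j * inverse t ^ (j - 1) * (- (inverse t ^ 2))) * exp (inverse t)
            - inverse t ^ j * (exp (inverse t) * (- (inverse t ^ 2)))) / (exp (inverse t) * exp (inverse t))
          = flat (j + 2) t - real j * flat (j + 1) t"
        using 1 by (cases j) (simp_all add: flat_def power2_eq_square field_simps)
      ultimately show ?thesis by simp
    qed
    then show ?thesis
      by (rule has_field_derivative_transform_within_open[where S = "{0<..}"]) (use 1 in \<open>auto simp: flat_def\<close>)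
  next
    case 2
    have "((\<lambda>t. 0::real) has_real_derivative (flat (j + 2) t - real j * flat (j + 1) t)) (at t)"
      using 2 by (auto simp: flat_def)
    then show ?thesis
      by (rule has_field_derivative_transform_within_open[where S = "{..<0}"]) (use 2 in \<open>auto simp: flat_def\<close>)
  next
    case 3
    \<comment> \<open>The difference quotient of \<open>flat j\<close> at 0 is
      \<open>flat (Suc j)\<close>, whose limit is known.\<close>
    have "((\<lambda>h. (flat j (0 + h) - flat j 0) / h) \<longlongrightarrow> 0) (at 0)"
      by (rule Lim_transform_eventually[OF flat_tendsto_0[of "Suc j"]])
        (auto simp: flat_def eventually_at field_simps intro!: exI[of _ 1])
    then show ?thesis using 3 by (simp add: DERIV_def flat_def)
  qed
qed

lemma flat_nonneg: "flat j t \<ge> 0" by (simp add: flat_def)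

text \<open>The argument is a polynomial in x, so the origin is not singular. The index j is
  generalized because differentiation raises it.\<close>

lemma flat_bump_Ck: "(\<lambda>x::real^'n. flat j (1 - s * (x \<bullet> x))) \<in> Ck_fun k"
proof (induction k arbitrary: j)
  case 0
  have "continuous_on UNIV (flat j)"
    using flat_deriv DERIV_isCont by (force simp: continuous_on_eq_continuous_at)
  then show ?case
    by (auto intro!: continuous_on_compose2[of UNIV "flat j"] continuous_intros)
next
  case (Suc k)
  show ?case
  proof (rule Ck_fun_SucI)
    fix x :: "real^'n"
    let ?d = "flat (j + 2) (1 - s * (x \<bullet> x)) - real j * flat (j + 1) (1 - s * (x \<bullet> x))"
    have 1: "((\<lambda>x::real^'n. 1 - s * (x \<bullet> x)) has_derivative (\<lambda>h. - s * (2 * (x \<bullet> h)))) (at x)"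
      by (auto intro!: derivative_eq_intros simp: inner_commute)
    have "((\<lambda>x::real^'n. flat j (1 - s * (x \<bullet> x))) has_derivative (\<lambda>h. (- s * (2 * (x \<bullet> h))) * ?d)) (at x)"
      using has_derivative_compose[OF 1 flat_deriv[unfolded has_field_derivative_def, of j "1 - s * (x \<bullet> x)"]]
      by (simp add: mult.commute)
    then show "((\<lambda>x::real^'n. flat j (1 - s * (x \<bullet> x))) has_derivative (\<lambda>h. ((- 2 * s * ?d) *\<^sub>R x) \<bullet> h)) (at x)"
      by (simp add: algebra_simps)
  next
    fix \<alpha> :: 'n
    have "(\<lambda>x::real^'n. (- 2 * s) * (flat (j + 2) (1 - s * (x \<bullet> x)) - real j * flat (j + 1) (1 - s * (x \<bullet> x))) * x $ \<alpha>) \<in> Ck_fun k"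
      by (intro Ck_fun_mult Ck_fun_const Ck_fun_diff Ck_fun_coord Suc.IH)
    then show "(\<lambda>x::real^'n. ((- 2 * s * (flat (j + 2) (1 - s * (x \<bullet> x)) - real j * flat (j + 1) (1 - s * (x \<bullet> x)))) *\<^sub>R x) $ \<alpha>) \<in> Ck_fun k"
      by simp
  qed
qed

text \<open>Evenness makes convolution self-adjoint (\<open>conv_adjoint\<close>). Nonnegativity and
  unit mass make it an average, so that constants, bounds and convex sets of values are
  preserved.\<close>

definition mollifier :: "real \<Rightarrow> (real^'n \<Rightarrow> real) \<Rightarrow> bool" where
  "mollifier \<epsilon> \<eta> \<longleftrightarrow> (\<forall>k. \<eta> \<in> Ck_fun k) \<and> (\<forall>x. \<eta> x \<ge> 0) \<and> (\<forall>x. norm x \<ge> \<epsilon> \<longrightarrow> \<eta> x = 0)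
     \<and> (\<forall>x. \<eta> (- x) = \<eta> x) \<and> L1 \<eta> \<and> (LBINT x. \<eta> x) = 1"

lemma integrable_continuous_compact_support:
  fixes f :: "'a::euclidean_space \<Rightarrow> 'b::{banach, second_countable_topology}"
  assumes "continuous_on UNIV f" "compact S" "\<And>x. x \<notin> S \<Longrightarrow> f x = 0"
  shows "L1 f"
proof -
  have "L1 (\<lambda>x. indicator S x *\<^sub>R f x)"
    using borel_integrable_compact[OF assms(2) continuous_on_subset[OF assms(1)]] by auto
  moreover have "(\<lambda>x. indicator S x *\<^sub>R f x) = f"
    using assms(3) by (auto simp: indicator_def)
  ultimately show ?thesis by simp
qed

lemma mollifier_exists:
  assumes "\<epsilon> > 0"
  obtains \<eta> :: "real^'n \<Rightarrow> real" where "mollifier \<epsilon> \<eta>"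
proof -
  define b where "b x = flat 0 (1 - (1 / \<epsilon>\<^sup>2) * (x \<bullet> x))" for x :: "real^'n"
  have Ck: "b \<in> Ck_fun k" for k
    unfolding b_def[abs_def] by (rule flat_bump_Ck)
  have nn: "b x \<ge> 0" for x by (simp add: b_def flat_nonneg)
  have z: "b x = 0" if "norm x \<ge> \<epsilon>" for x
  proof -
    have "\<epsilon>\<^sup>2 \<le> x \<bullet> x"
      using that assms by (metis dot_square_norm less_imp_le power_mono)
    then have "(1 / \<epsilon>\<^sup>2) * (x \<bullet> x) \<ge> 1" using assms by (simp add: field_simps)
    then show ?thesis by (simp add: b_def flat_def)
  qed
  have cont: "continuous_on UNIV b" using Ck Ck_fun_continuous by blast
  have int: "L1 b"
    by (rule integrable_continuous_compact_support[OF cont, of "cball 0 \<epsilon>"]) (auto intro: z)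
  \<comment> \<open>A nonnegative function with integral 0 vanishes almost everywhere, but b is
    positive on a ball around 0.\<close>
  have pos: "(LBINT x. b x) > 0"
  proof -
    have "b 0 > 0" by (simp add: b_def flat_def)
    moreover have "open {x. b x > 0}" using cont by (simp add: open_Collect_less continuous_on_const)
    ultimately obtain r where r: "r > 0" "ball 0 r \<subseteq> {x. b x > 0}"
      using openE[of "{x. b x > 0}" 0] by auto
    have "emeasure lborel (ball (0::real^'n) r) > 0"
      using content_ball_pos[OF r(1), of "0::real^'n"] by (simp add: measure_def enn2real_positive_iff)
    then have nz: "\<not> (AE x in lborel. b x = 0)"
    proof -
      have "\<not> (AE x in lborel. x \<notin> ball (0::real^'n) r)"
        using \<open>emeasure lborel (ball (0::real^'n) r) > 0\<close> by (subst AE_iff_measurable[of "ball 0 r"]) (auto simp: )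
      then show ?thesis using r(2) by (metis (mono_tags, lifting) AE_cong less_irrefl mem_Collect_eq subsetD eventually_mono)
    qed
    have "(LBINT x. b x) \<noteq> 0"
      using integral_nonneg_eq_0_iff_AE[OF int] nn nz by auto
    moreover have "(LBINT x. b x) \<ge> 0" using nn by (simp add: integral_nonneg_AE)
    ultimately show ?thesis by simp
  qed
  let ?c = "(LBINT x. b x)"
  have "mollifier \<epsilon> (\<lambda>x. (1 / ?c) * b x)"
    unfolding mollifier_def
  proof (intro conjI allI impI)
    show "(\<lambda>x. 1 / ?c * b x) \<in> Ck_fun k" for k by (intro Ck_fun_cmult Ck)
    show "1 / ?c * b (- x) = 1 / ?c * b x" for x by (simp add: b_def)
    show "L1 (\<lambda>x. 1 / ?c * b x)" using int by simp
    show "(LBINT x. 1 / ?c * b x) = 1" using pos by simp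
  qed (use pos nn z in auto)
  then show thesis by (rule that)
qed

lemma mollifierD:
  assumes "mollifier \<epsilon> \<eta>"
  shows "\<eta> \<in> Ck_fun k" "\<eta> x \<ge> 0" "norm x \<ge> \<epsilon> \<Longrightarrow> \<eta> x = 0" "\<eta> (- x) = \<eta> x"
    "L1 \<eta>" "(LBINT x. \<eta> x) = 1" "continuous_on UNIV \<eta>"
    "\<eta> \<in> borel_measurable borel" "\<epsilon> > 0" "x \<notin> cball 0 \<epsilon> \<Longrightarrow> \<eta> x = 0" "\<eta> (x - y) = \<eta> (y - x)"
proof -
  show *: "\<eta> \<in> Ck_fun k" "\<eta> x \<ge> 0" "norm x \<ge> \<epsilon> \<Longrightarrow> \<eta> x = 0" "\<eta> (- x) = \<eta> x"
    "L1 \<eta>" "(LBINT x. \<eta> x) = 1" "x \<notin> cball 0 \<epsilon> \<Longrightarrow> \<eta> x = 0" for x k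
    using assms by (auto simp: mollifier_def)
  show c: "continuous_on UNIV \<eta>" using *(1) Ck_fun_continuous by blast
  then show "\<eta> \<in> borel_measurable borel" by (rule borel_measurable_continuous_onI)
  show "\<epsilon> > 0"
  proof (rule ccontr)
    assume "\<not> \<epsilon> > 0"
    then have "\<eta> x = 0" for x using *(3)[of x] norm_ge_zero[of x] by linarith
    then show False using *(6) by simp
  qed
  show "\<eta> (x - y) = \<eta> (y - x)" using *(4)[of "y - x"] by simp
qed

section \<open>Mollification\<close>

text \<open>Some compact subset of U serves as a support, in place of the closure of the nonzero set
  in \<open>test_fun\<close>; sums and products then inherit the property with evident compact sets.
  \<open>test_fun_iff\<close> relates the two.\<close>

definition csupp :: "'a::topological_space set \<Rightarrow> ('a \<Rightarrow> 'b::zero) \<Rightarrow> bool" where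
  "csupp U f \<longleftrightarrow> (\<exists>S. compact S \<and> S \<subseteq> U \<and> (\<forall>x. x \<notin> S \<longrightarrow> f x = 0))"

lemma csuppI: "compact S \<Longrightarrow> S \<subseteq> U \<Longrightarrow> (\<And>x. x \<notin> S \<Longrightarrow> f x = 0) \<Longrightarrow> csupp U f"
  by (auto simp: csupp_def)

lemma csupp_mono: "csupp U f \<Longrightarrow> U \<subseteq> V \<Longrightarrow> csupp V f"
  by (force simp: csupp_def)

lemma csupp_mult: "csupp U f \<Longrightarrow> csupp U (\<lambda>x. f x * g x)" for f :: "_ \<Rightarrow> real"
  by (auto simp: csupp_def)

lemma csupp_mult2: "csupp U f \<Longrightarrow> csupp U (\<lambda>x. g x * f x)" for f :: "_ \<Rightarrow> real"
  by (auto simp: csupp_def)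

lemma csupp_add:
  fixes f :: "_ \<Rightarrow> 'b::monoid_add"
  assumes "csupp U f" "csupp U g"
  shows "csupp U (\<lambda>x. f x + g x)"
proof -
  obtain S where S: "compact S" "S \<subseteq> U" "\<And>x. x \<notin> S \<Longrightarrow> f x = 0" using assms(1) by (auto simp: csupp_def)
  obtain T where T: "compact T" "T \<subseteq> U" "\<And>x. x \<notin> T \<Longrightarrow> g x = 0" using assms(2) by (auto simp: csupp_def)
  show ?thesis using S T by (intro csuppI[of "S \<union> T"]) (auto intro: compact_Un)
qed

lemma csupp_partial_deriv:
  assumes "csupp U \<phi>"
  shows "csupp U (pd \<alpha> \<phi>)"
proof -
  obtain S where S: "compact S" "S \<subseteq> U" "\<And>x. x \<notin> S \<Longrightarrow> \<phi> x = 0" using assms by (auto simp: csupp_def)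
  then show ?thesis
    by (intro csuppI[of S]) (auto intro!: partial_deriv_zero_off[of S \<phi>] compact_imp_closed)
qed

lemma test_fun_iff:
  "test_fun U \<phi> \<longleftrightarrow> (\<forall>k. \<phi> \<in> Ck_fun k) \<and> csupp U \<phi>"
proof -
  let ?C = "closure {x. \<phi> x \<noteq> 0}"
  have out: "\<phi> x = 0" if "x \<notin> ?C" for x
    using that closure_subset[of "{x. \<phi> x \<noteq> 0}"] by blast
  have "?C \<subseteq> S \<and> compact ?C" if "compact S" "\<forall>x. x \<notin> S \<longrightarrow> \<phi> x = 0" for S
  proof -
    have "?C \<subseteq> S"
      by (rule closure_minimal) (use that compact_imp_closed in auto)
    then show ?thesis
      using compact_Int_closed[OF that(1), of ?C] by (auto simp: inf.absorb2)
  qed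
  then have "(compact ?C \<and> ?C \<subseteq> U) \<longleftrightarrow> csupp U \<phi>"
    unfolding csupp_def using out by (intro iffI; elim conjE exE) (blast, meson subset_trans)
  then show ?thesis by (simp add: test_fun_def)
qed

lemma csupp_bounded:
  fixes f :: "'a::euclidean_space \<Rightarrow> 'b::real_normed_vector"
  assumes "continuous_on UNIV f" "csupp U f"
  obtains B where "B > 0" "\<And>x. norm (f x) \<le> B"
proof -
  obtain S where S: "compact S" "\<And>x. x \<notin> S \<Longrightarrow> f x = 0" "S \<subseteq> U" using assms(2) by (auto simp: csupp_def)
  have "bounded (f ` S)"
    using S assms(1) by (meson compact_continuous_image compact_imp_bounded continuous_on_subset subset_UNIV)
  then obtain B where "B > 0" "\<And>x. x \<in> S \<Longrightarrow> norm (f x) \<le> B"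
    by (auto simp: bounded_pos)
  then have "norm (f x) \<le> B" for x using S(2)[of x] by (cases "x \<in> S") auto
  then show thesis using that \<open>B > 0\<close> by blast
qed

lemma csupp_uniformly_continuous:
  fixes f :: "'a::euclidean_space \<Rightarrow> 'b::real_normed_vector"
  assumes "continuous_on UNIV f" "csupp U f"
  shows "uniformly_continuous_on UNIV f"
proof -
  obtain S where S: "compact S" "\<And>x. x \<notin> S \<Longrightarrow> f x = 0" "S \<subseteq> U" using assms(2) by (auto simp: csupp_def)
  obtain R where R: "S \<subseteq> cball 0 R" using compact_imp_bounded[OF S(1)] bounded_subset_ballD[of S 0] ball_subset_cball by blast
  \<comment> \<open>The margin 1 puts two points closer than 1 into this ball as soon as one of them
    lies in \<open>cball 0 R\<close>; otherwise f vanishes at both.\<close>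
  have uc: "uniformly_continuous_on (cball 0 (R + 1)) f"
    using assms(1) by (intro compact_uniformly_continuous) (auto intro: continuous_on_subset)
  show ?thesis unfolding uniformly_continuous_on_def
  proof (intro allI impI)
    fix e :: real assume "e > 0"
    with uc obtain d where d: "d > 0"
      "\<And>x y. x \<in> cball 0 (R + 1) \<Longrightarrow> y \<in> cball 0 (R + 1) \<Longrightarrow> dist y x < d \<Longrightarrow> dist (f y) (f x) < e"
      unfolding uniformly_continuous_on_def by metis
    have "dist (f y) (f x) < e" if "dist y x < min d 1" for x y
    proof (cases "x \<in> cball 0 R \<or> y \<in> cball 0 R")
      case True
      then have "x \<in> cball 0 (R + 1)" "y \<in> cball 0 (R + 1)"
        using that norm_triangle_ineq2[of x y] norm_triangle_ineq2[of y x] by (auto simp: dist_norm norm_minus_commute)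
      with d(2) that show ?thesis by simp
    next
      case False
      then have "f x = 0" "f y = 0" using S(2) R by blast+
      with \<open>e > 0\<close> show ?thesis by simp
    qed
    then show "\<exists>d>0. \<forall>x\<in>UNIV. \<forall>x'\<in>UNIV. dist x' x < d \<longrightarrow> dist (f x') (f x) < e"
      using d(1) by (intro exI[of _ "min d 1"]) auto
  qed
qed

lemma csupp_integrable:
  fixes f :: "'a::euclidean_space \<Rightarrow> 'b::{banach, second_countable_topology}"
  assumes "continuous_on UNIV f" "csupp U f"
  shows "L1 f"
proof -
  obtain S where S: "compact S" "\<And>x. x \<notin> S \<Longrightarrow> f x = 0" "S \<subseteq> U" using assms(2) by (auto simp: csupp_def)
  show ?thesis using integrable_continuous_compact_support[OF assms(1) S(1,2)] .
qed

lemma cont_borel: "continuous_on UNIV f \<Longrightarrow> f \<in> borel_measurable borel"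
  by (rule borel_measurable_continuous_onI)

lemma lborel_distr_reflect: "distr lborel borel (\<lambda>x. a - x) = (lborel :: 'a::euclidean_space measure)"
  using lborel_affine[of "-1" a] by (simp add: density_1)

lemma lborel_distr_shift: "distr lborel borel (\<lambda>x. x + a) = (lborel :: 'a::euclidean_space measure)"
  using lborel_affine[of "1" a] by (simp add: density_1 add.commute)

lemma integral_reflect:
  fixes f :: "'a::euclidean_space \<Rightarrow> 'b::{banach, second_countable_topology}"
  assumes [measurable]: "f \<in> borel_measurable borel"
  shows "(LBINT x. f (a - x)) = (LBINT x. f x)"
  by (subst lborel_distr_reflect[of a, symmetric], subst integral_distr) auto

lemma integral_shift:
  fixes f :: "'a::euclidean_space \<Rightarrow> 'b::{banach, second_countable_topology}"
  assumes [measurable]: "f \<in> borel_measurable borel"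
  shows "(LBINT x. f (x + a)) = (LBINT x. f x)"
  by (subst (2) lborel_distr_shift[of a, symmetric], subst integral_distr) auto

lemma integrable_reflect:
  fixes f :: "'a::euclidean_space \<Rightarrow> 'b::{banach, second_countable_topology}"
  assumes [measurable]: "f \<in> borel_measurable borel"
  shows "L1 (\<lambda>x. f (a - x)) \<longleftrightarrow> L1 f"
  by (subst (2) lborel_distr_reflect[of a, symmetric], subst integrable_distr_eq) auto

lemma integrable_shift:
  fixes f :: "'a::euclidean_space \<Rightarrow> 'b::{banach, second_countable_topology}"
  assumes [measurable]: "f \<in> borel_measurable borel"
  shows "L1 (\<lambda>x. f (x + a)) \<longleftrightarrow> L1 f"
  by (subst (2) lborel_distr_shift[of a, symmetric], subst integrable_distr_eq) auto

lemma integrable_bounded_scaleR: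
  fixes g :: "'a \<Rightarrow> 'b::{banach, second_countable_topology}"
  assumes "integrable M g" "h \<in> borel_measurable M" "\<And>x. \<bar>h x\<bar> \<le> (B::real)"
  shows "integrable M (\<lambda>x. h x *\<^sub>R g x)"
proof (rule integrable_bound[of M "\<lambda>x. B *\<^sub>R norm (g x)"])
  show "AE x in M. norm (h x *\<^sub>R g x) \<le> norm (B *\<^sub>R norm (g x))"
  proof (rule AE_I2)
    fix x
    have "\<bar>h x\<bar> * norm (g x) \<le> \<bar>B\<bar> * norm (g x)" using assms(3)[of x] by (intro mult_right_mono) auto
    then show "norm (h x *\<^sub>R g x) \<le> norm (B *\<^sub>R norm (g x))" by (simp add: abs_mult)
  qed
qed (use assms in auto)

lemma integrable_bounded_mult:
  fixes g :: "'a \<Rightarrow> real"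
  assumes "integrable M g" "h \<in> borel_measurable M" "\<And>x. \<bar>h x\<bar> \<le> (B::real)"
  shows "integrable M (\<lambda>x. h x * g x)" "integrable M (\<lambda>x. g x * h x)"
  using integrable_bounded_scaleR[OF assms] by (simp_all add: mult.commute)

definition conv :: "('a::euclidean_space \<Rightarrow> real) \<Rightarrow> ('a \<Rightarrow> 'b::{banach, second_countable_topology}) \<Rightarrow> 'a \<Rightarrow> 'b" where
  "conv \<eta> g x = (LBINT y. \<eta> (x - y) *\<^sub>R g y)"

lemma conv_integrable:
  fixes g :: "'a::euclidean_space \<Rightarrow> 'b::{banach, second_countable_topology}"
  assumes "continuous_on UNIV \<eta>" "csupp U \<eta>" "L1 g"
  shows "L1 (\<lambda>y. \<eta> (x - y) *\<^sub>R g y)"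
proof -
  obtain B where B: "\<And>x. norm (\<eta> x) \<le> B" using csupp_bounded[OF assms(1,2)] by metis
  have [measurable]: "\<eta> \<in> borel_measurable borel" using assms(1) by (rule cont_borel)
  show ?thesis
    using B by (intro integrable_bounded_scaleR[where B = B] assms) auto
qed

lemma conv_commute:
  fixes g :: "'a::euclidean_space \<Rightarrow> real"
  assumes [measurable]: "\<eta> \<in> borel_measurable borel" "g \<in> borel_measurable borel"
  shows "conv \<eta> g = conv g \<eta>"
proof
  fix x
  have "conv \<eta> g x = (LBINT y. \<eta> (x - (x - y)) *\<^sub>R g (x - y))"
    unfolding conv_def by (rule integral_reflect[symmetric]) simp
  then show "conv \<eta> g x = conv g \<eta> x" by (simp add: conv_def mult.commute)
qed

lemma conv_zero_off:
  assumes "\<And>z. norm z \<ge> \<epsilon> \<Longrightarrow> \<eta> z = 0" "\<And>y. dist x y < \<epsilon> \<Longrightarrow> g y = 0"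
  shows "conv \<eta> g x = 0"
proof -
  have "\<eta> (x - y) *\<^sub>R g y = 0" for y
    using assms(1)[of "x - y"] assms(2)[of y] by (cases "dist x y < \<epsilon>") (auto simp: dist_norm)
  then show ?thesis unfolding conv_def by (simp only: integral_zero)
qed

lemma conv_continuous:
  fixes g :: "'a::euclidean_space \<Rightarrow> 'b::{banach, second_countable_topology}"
  assumes c: "continuous_on UNIV \<eta>" and s: "csupp U \<eta>" and g: "L1 g"
  shows "continuous_on UNIV (conv \<eta> g)"
proof -
  have "continuous (at x) (conv \<eta> g)" for x
    unfolding continuous_at_eps_delta
  proof (intro allI impI)
    fix e :: real assume "e > 0"
    \<comment> \<open>The added 1 keeps the divisor positive when g vanishes almost
      everywhere.\<close>
    define G where "G = (LBINT y. norm (g y)) + 1"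
    have G: "G > 0" by (simp add: G_def add_nonneg_pos)
    obtain d where d: "d > 0" "\<And>a b. dist b a < d \<Longrightarrow> dist (\<eta> b) (\<eta> a) < e / G"
      using csupp_uniformly_continuous[OF c s] \<open>e > 0\<close> G
      unfolding uniformly_continuous_on_def by (metis UNIV_I divide_pos_pos)
    have "dist (conv \<eta> g x') (conv \<eta> g x) < e" if "dist x' x < d" for x'
    proof -
      have "norm (conv \<eta> g x' - conv \<eta> g x) = norm (LBINT y. (\<eta> (x' - y) - \<eta> (x - y)) *\<^sub>R g y)"
        unfolding conv_def scaleR_diff_left using conv_integrable[OF c s g] by simp
      also have "\<dots> \<le> (LBINT y. norm ((\<eta> (x' - y) - \<eta> (x - y)) *\<^sub>R g y))"
        by (rule integral_norm_bound)
      also have "\<dots> \<le> (LBINT y. (e / G) * norm (g y))"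
      proof (rule integral_mono)
        show "L1 (\<lambda>y. norm ((\<eta> (x' - y) - \<eta> (x - y)) *\<^sub>R g y))"
          unfolding scaleR_diff_left by (intro integrable_norm integrable_diff conv_integrable[OF c s g])
        show "norm ((\<eta> (x' - y) - \<eta> (x - y)) *\<^sub>R g y) \<le> (e / G) * norm (g y)" for y
        proof -
          have "\<bar>\<eta> (x' - y) - \<eta> (x - y)\<bar> \<le> e / G"
            using d(2)[of "x' - y" "x - y"] that by (auto simp: dist_norm)
          then have "\<bar>\<eta> (x' - y) - \<eta> (x - y)\<bar> * norm (g y) \<le> (e / G) * norm (g y)"
            by (rule mult_right_mono) simp
          then show ?thesis by simp
        qed
      qed (use g in auto)
      also have "\<dots> = (e / G) * (G - 1)" by (simp add: G_def)
      also have "\<dots> < e" using G \<open>e > 0\<close> by (simp add: field_simps)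
      finally show ?thesis by (simp add: dist_norm)
    qed
    then show "\<exists>d>0. \<forall>x'. dist x' x < d \<longrightarrow> dist (conv \<eta> g x') (conv \<eta> g x) < e"
      using d(1) by blast
  qed
  then show ?thesis by (simp add: continuous_on_eq_continuous_at)
qed

text \<open>A continuous gradient with compact support is uniformly continuous, so the remainder of
  the first-order expansion is small uniformly in the base point. This estimate serves both to
  differentiate convolutions and to integrate derivatives.\<close>

lemma C1_uniform_linearization:
  fixes \<phi> :: "real^'n \<Rightarrow> real"
  assumes \<phi>: "\<phi> \<in> Ck_fun (Suc k)" and s: "csupp U \<phi>" and "e > 0"
  obtains d where "d > 0" "\<And>z h. norm h < d \<Longrightarrow> \<bar>\<phi> (z + h) - \<phi> z - grd \<phi> z \<bullet> h\<bar> \<le> e * norm h"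
proof -
  obtain S where S: "compact S" "S \<subseteq> U" "\<And>x. x \<notin> S \<Longrightarrow> \<phi> x = 0" using s by (auto simp: csupp_def)
  have "csupp U (grd \<phi>)"
    by (rule csuppI[OF S(1,2)])
      (simp add: grd_def vec_eq_iff partial_deriv_zero_off[OF compact_imp_closed[OF S(1)] S(3)])
  from csupp_uniformly_continuous[OF C1_continuous_grd[OF \<phi>] this] \<open>e > 0\<close>
  obtain d where d: "d > 0" "\<And>a b. dist b a < d \<Longrightarrow> dist (grd \<phi> b) (grd \<phi> a) < e"
    unfolding uniformly_continuous_on_def by (metis UNIV_I)
  have "\<bar>\<phi> (z + h) - \<phi> z - grd \<phi> z \<bullet> h\<bar> \<le> e * norm h" if "norm h < d" for z h
  proof -
    have "norm (\<phi> (z + h) - \<phi> z - grd \<phi> z \<bullet> ((z + h) - z)) \<le> norm ((z + h) - z) * e"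
    proof (rule differentiable_bound_linearization[where S = "ball z d" and f' = "\<lambda>x h. grd \<phi> x \<bullet> h" and ?x0.0 = z and a = z and b = "z + h"])
      show "z + t *\<^sub>R (z + h - z) \<in> ball z d" if "t \<in> {0..1}" for t
      proof -
        have "norm (t *\<^sub>R h) \<le> norm h" using that by (auto intro: mult_left_le_one_le)
        then show ?thesis using \<open>norm h < d\<close> by (simp add: dist_norm)
      qed
      show "(\<phi> has_derivative (\<lambda>h. grd \<phi> x \<bullet> h)) (at x within ball z d)" for x
        using C1_has_derivative[OF \<phi>] has_derivative_at_withinI by blast
      show "onorm ((\<lambda>h. grd \<phi> x \<bullet> h) - (\<lambda>h. grd \<phi> z \<bullet> h)) \<le> e" if "x \<in> ball z d" for x
      proof (rule onorm_le)
        fix v :: "real^'n"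
        have "norm (((\<lambda>h. grd \<phi> x \<bullet> h) - (\<lambda>h. grd \<phi> z \<bullet> h)) v) = \<bar>(grd \<phi> x - grd \<phi> z) \<bullet> v\<bar>"
          by (simp add: inner_diff_left)
        also have "\<dots> \<le> norm (grd \<phi> x - grd \<phi> z) * norm v" by (rule Cauchy_Schwarz_ineq2)
        also have "\<dots> \<le> e * norm v"
          using d(2)[of x z] that by (intro mult_right_mono) (auto simp: dist_norm norm_minus_commute less_imp_le)
        finally show "norm (((\<lambda>h. grd \<phi> x \<bullet> h) - (\<lambda>h. grd \<phi> z \<bullet> h)) v) \<le> e * norm v" .
      qed
    qed (use d in auto)
    then show ?thesis by (simp add: mult.commute)
  qed
  then show thesis using that d(1) by blast
qed

text \<open>The uniform expansion of the kernel bounds the remainder under the integral by (e/G) |h|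
  |g y|, which integrates to at most e |h|.\<close>

lemma conv_has_derivative:
  fixes g :: "real^'n \<Rightarrow> real"
  assumes \<eta>: "\<eta> \<in> Ck_fun (Suc k)" and s: "csupp U \<eta>" and g: "L1 g"
  shows "(conv \<eta> g has_derivative (\<lambda>h. (\<chi> \<alpha>. conv (pd \<alpha> \<eta>) g x) \<bullet> h)) (at x)"
proof -
  let ?D = "\<lambda>h. (\<chi> \<alpha>. conv (pd \<alpha> \<eta>) g x) \<bullet> h"
  have c: "continuous_on UNIV \<eta>" using \<eta> Ck_fun_continuous by blast
  have int: "L1 (\<lambda>y. \<eta> (z - y) *\<^sub>R g y)" for z by (rule conv_integrable[OF c s g])
  have intp: "L1 (\<lambda>y. pd \<alpha> \<eta> (z - y) *\<^sub>R g y)" for \<alpha> z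
    by (rule conv_integrable[OF C1_continuous_partial[OF \<eta>] csupp_partial_deriv[OF s] g])
  have D: "?D h = (LBINT y. (grd \<eta> (x - y) \<bullet> h) * g y)"
    and intD: "L1 (\<lambda>y. (grd \<eta> (x - y) \<bullet> h) * g y)" for h
  proof -
    have e: "(grd \<eta> (x - y) \<bullet> h) * g y = (\<Sum>\<alpha>\<in>UNIV. (pd \<alpha> \<eta> (x - y) *\<^sub>R g y) * h $ \<alpha>)" for y
      by (simp add: inner_vec_def grd_def sum_distrib_right sum_distrib_left mult_ac)
    show "L1 (\<lambda>y. (grd \<eta> (x - y) \<bullet> h) * g y)"
      unfolding e using intp by (auto intro!: integrable_sum integrable_mult_left)
    show "?D h = (LBINT y. (grd \<eta> (x - y) \<bullet> h) * g y)"
      unfolding e using intp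
      by (subst integral_sum) (auto simp: inner_vec_def conv_def intro!: sum.cong integrable_mult_left)
  qed
  have "\<exists>d>0. \<forall>h. norm h < d \<longrightarrow> norm (conv \<eta> g (x + h) - conv \<eta> g x - ?D h) \<le> e * norm h" if "e > 0" for e
  proof -
    define G where "G = (LBINT y. norm (g y)) + 1"
    have G: "G > 0" by (simp add: G_def add_nonneg_pos)
    obtain d where d: "d > 0" "\<And>z h. norm h < d \<Longrightarrow> \<bar>\<eta> (z + h) - \<eta> z - grd \<eta> z \<bullet> h\<bar> \<le> (e / G) * norm h"
      using C1_uniform_linearization[OF \<eta> s divide_pos_pos[OF \<open>e > 0\<close> G]] by metis
    have "norm (conv \<eta> g (x + h) - conv \<eta> g x - ?D h) \<le> e * norm h" if "norm h < d" for h
    proof -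
      have "norm (conv \<eta> g (x + h) - conv \<eta> g x - ?D h)
          = norm (LBINT y. \<eta> (x + h - y) *\<^sub>R g y - \<eta> (x - y) *\<^sub>R g y - (grd \<eta> (x - y) \<bullet> h) * g y)"
        unfolding D unfolding conv_def using int intD by simp
      also have "\<dots> \<le> (LBINT y. norm (\<eta> (x + h - y) *\<^sub>R g y - \<eta> (x - y) *\<^sub>R g y - (grd \<eta> (x - y) \<bullet> h) * g y))"
        by (rule integral_norm_bound)
      also have "\<dots> \<le> (LBINT y. (e / G * norm h) * norm (g y))"
      proof (rule integral_mono)
        show "L1 (\<lambda>y. norm (\<eta> (x + h - y) *\<^sub>R g y - \<eta> (x - y) *\<^sub>R g y - (grd \<eta> (x - y) \<bullet> h) * g y))"
          by (intro integrable_norm integrable_diff int intD)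
        fix y
        have "norm (\<eta> (x + h - y) *\<^sub>R g y - \<eta> (x - y) *\<^sub>R g y - (grd \<eta> (x - y) \<bullet> h) * g y)
          = \<bar>\<eta> ((x - y) + h) - \<eta> (x - y) - grd \<eta> (x - y) \<bullet> h\<bar> * \<bar>g y\<bar>"
          by (simp add: algebra_simps flip: abs_mult)
        also have "\<dots> \<le> (e / G * norm h) * norm (g y)"
          using d(2)[OF that, of "x - y"] unfolding real_norm_def by (rule mult_right_mono) simp
        finally show "norm (\<eta> (x + h - y) *\<^sub>R g y - \<eta> (x - y) *\<^sub>R g y - (grd \<eta> (x - y) \<bullet> h) * g y)
          \<le> (e / G * norm h) * norm (g y)" .
      qed (use g in auto)
      also have "\<dots> = (e / G * norm h) * (G - 1)" by (simp add: G_def)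
      also have "\<dots> \<le> (e / G * norm h) * G" using G \<open>e > 0\<close> by (intro mult_left_mono) auto
      also have "\<dots> = e * norm h" using G by simp
      finally show ?thesis .
    qed
    then show ?thesis using d(1) by blast
  qed
  then have *: "\<forall>e>0. \<exists>d>0. \<forall>y. norm (y - x) < d \<longrightarrow> norm (conv \<eta> g y - conv \<eta> g x - ?D (y - x)) \<le> e * norm (y - x)"
    by (metis add.commute diff_add_cancel)
  show ?thesis
    unfolding has_derivative_at_alt using * by (auto intro: bounded_linear_inner_right)
qed

lemma conv_partial_deriv:
  fixes g :: "real^'n \<Rightarrow> real"
  assumes \<eta>: "\<eta> \<in> Ck_fun (Suc k)" and s: "csupp U \<eta>" and g: "L1 g"
  shows "pd \<alpha> (conv \<eta> g) = conv (pd \<alpha> \<eta>) g"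
  using has_derivative_inner_partial[of "conv \<eta> g" "\<lambda>x. \<chi> \<alpha>. conv (pd \<alpha> \<eta>) g x" \<alpha>, OF conv_has_derivative[OF assms]]
  by simp

lemma conv_Ck_fun:
  fixes g :: "real^'n \<Rightarrow> real"
  assumes "\<eta> \<in> Ck_fun k" and "csupp U \<eta>" and g: "L1 g"
  shows "conv \<eta> g \<in> Ck_fun k"
  using assms(1,2)
proof (induction k arbitrary: \<eta>)
  case 0
  then show ?case using conv_continuous[OF _ _ g] by simp
next
  case (Suc k)
  show ?case
  proof (rule Ck_fun_SucI[OF conv_has_derivative[OF Suc.prems g]])
    show "(\<lambda>x. (\<chi> \<alpha>. conv (pd \<alpha> \<eta>) g x) $ \<alpha>) \<in> Ck_fun k" for \<alpha>
      using Suc.IH[OF Ck_fun_partial[OF Suc.prems(1)] csupp_partial_deriv[OF Suc.prems(2)]] by simp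
  qed
qed

lemma mollifier_csupp: "mollifier \<epsilon> \<eta> \<Longrightarrow> csupp UNIV \<eta>"
  by (rule csuppI[of "cball 0 \<epsilon>"]) (auto dest: mollifierD(10))

lemma mollifier_conv_Ck:
  fixes g :: "real^'n \<Rightarrow> real"
  assumes "mollifier \<epsilon> \<eta>" "L1 g"
  shows "conv \<eta> g \<in> Ck_fun k"
  using conv_Ck_fun[OF mollifierD(1)[OF assms(1)] mollifier_csupp[OF assms(1)] assms(2)] .

text \<open>Here the derivative falls on \<phi> instead of the kernel: since convolution commutes,
  \<phi> can play the smooth kernel and \<eta> the integrable function.\<close>

lemma mollifier_conv_partial:
  fixes \<phi> :: "real^'n \<Rightarrow> real"
  assumes \<eta>: "mollifier \<epsilon> \<eta>" and \<phi>: "\<phi> \<in> Ck_fun (Suc k)" and s: "csupp U \<phi>"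
  shows "pd \<alpha> (conv \<eta> \<phi>) = conv \<eta> (pd \<alpha> \<phi>)"
proof -
  have m: "\<phi> \<in> borel_measurable borel" "pd \<alpha> \<phi> \<in> borel_measurable borel"
    using Ck_fun_continuous[OF \<phi>] C1_continuous_partial[OF \<phi>] by (auto intro: cont_borel)
  have "pd \<alpha> (conv \<phi> \<eta>) = conv (pd \<alpha> \<phi>) \<eta>"
    by (rule conv_partial_deriv[OF \<phi> s mollifierD(5)[OF \<eta>]])
  then show ?thesis
    using conv_commute[OF mollifierD(8)[OF \<eta>] m(1)] conv_commute[OF mollifierD(8)[OF \<eta>] m(2)] by simp
qed

lemma mollifier_integral_shift:
  assumes "mollifier \<epsilon> \<eta>"
  shows "(LBINT y. \<eta> (x - y)) = 1" "L1 (\<lambda>y. \<eta> (x - y))"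
  using integral_reflect[OF mollifierD(8)[OF assms], of x] integrable_reflect[OF mollifierD(8)[OF assms], of x]
    mollifierD(5,6)[OF assms] by auto

lemma mollifier_conv_integrable:
  fixes g :: "real^'n \<Rightarrow> 'b::{banach, second_countable_topology}"
  assumes "mollifier \<epsilon> \<eta>" "L1 g"
  shows "L1 (\<lambda>y. \<eta> (x - y) *\<^sub>R g y)"
  by (rule conv_integrable[OF mollifierD(7)[OF assms(1)] mollifier_csupp[OF assms(1)] assms(2)])

lemma mollifier_conv_diff:
  fixes g :: "real^'n \<Rightarrow> 'b::{banach, second_countable_topology}"
  assumes \<eta>: "mollifier \<epsilon> \<eta>" and g: "L1 g"
  shows "conv \<eta> g x - c = (LBINT y. \<eta> (x - y) *\<^sub>R (g y - c))"
    "L1 (\<lambda>y. \<eta> (x - y) *\<^sub>R (g y - c))"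
proof -
  have i: "L1 (\<lambda>y. \<eta> (x - y) *\<^sub>R c)"
    using mollifier_integral_shift(2)[OF \<eta>] by simp
  show "conv \<eta> g x - c = (LBINT y. \<eta> (x - y) *\<^sub>R (g y - c))"
    unfolding scaleR_diff_right
    using mollifier_conv_integrable[OF assms, of x] mollifier_integral_shift[OF \<eta>, of x] i by (simp add: conv_def)
  show "L1 (\<lambda>y. \<eta> (x - y) *\<^sub>R (g y - c))"
    unfolding scaleR_diff_right using mollifier_conv_integrable[OF assms, of x] i by simp
qed

text \<open>The weights \<open>\<eta> (x - y)\<close> have total mass 1, so the difference from a
  constant is the average of the differences, taken over points closer than \<epsilon> only.\<close>

lemma mollifier_conv_bound:
  fixes g :: "real^'n \<Rightarrow> 'b::{banach, second_countable_topology}"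
  assumes \<eta>: "mollifier \<epsilon> \<eta>" and g: "L1 g" and b: "\<And>y. dist x y < \<epsilon> \<Longrightarrow> norm (g y - c) \<le> e"
  shows "norm (conv \<eta> g x - c) \<le> e"
proof -
  have "norm (conv \<eta> g x - c) \<le> (LBINT y. norm (\<eta> (x - y) *\<^sub>R (g y - c)))"
    unfolding mollifier_conv_diff(1)[OF assms(1,2)] by (rule integral_norm_bound)
  also have "\<dots> \<le> (LBINT y. \<eta> (x - y) * e)"
  proof (rule integral_mono)
    show "norm (\<eta> (x - y) *\<^sub>R (g y - c)) \<le> \<eta> (x - y) * e" for y
      using b[of y] mollifierD(2,3)[OF \<eta>, of "x - y"] by (cases "dist x y < \<epsilon>") (auto simp: dist_norm intro: mult_left_mono)
  qed (use integrable_norm[OF mollifier_conv_diff(2)[OF assms(1,2)]] mollifier_integral_shift(2)[OF \<eta>] in simp_all)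
  also have "\<dots> = e" using mollifier_integral_shift[OF \<eta>] by simp
  finally show ?thesis .
qed

lemma mollifier_uniform_limit:
  fixes g :: "real^'n \<Rightarrow> 'b::{banach, second_countable_topology}"
  assumes "continuous_on UNIV g" "csupp U g" "e > 0"
  obtains d where "d > 0" "\<And>\<epsilon> \<eta> x. mollifier \<epsilon> \<eta> \<Longrightarrow> \<epsilon> \<le> d \<Longrightarrow> norm (conv \<eta> g x - g x) \<le> e"
proof -
  obtain d where d: "d > 0" "\<And>a b. dist b a < d \<Longrightarrow> dist (g b) (g a) < e"
    using csupp_uniformly_continuous[OF assms(1,2)] \<open>e > 0\<close>
    unfolding uniformly_continuous_on_def by (metis UNIV_I)
  have "norm (conv \<eta> g x - g x) \<le> e" if "mollifier \<epsilon> \<eta>" "\<epsilon> \<le> d" for \<epsilon> \<eta> x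
  proof (rule mollifier_conv_bound[OF that(1) csupp_integrable[OF assms(1,2)]])
    fix y assume "dist x y < \<epsilon>"
    then show "norm (g y - g x) \<le> e" using d(2)[of y x] that(2) by (auto simp: dist_norm norm_minus_commute)
  qed
  then show thesis using that d(1) by blast
qed

lemma mollifier_conv_le:
  fixes g :: "real^'n \<Rightarrow> real"
  assumes \<eta>: "mollifier \<epsilon> \<eta>" and g: "L1 g" and b: "\<And>y. g y \<le> c"
  shows "conv \<eta> g x \<le> c"
proof -
  have "conv \<eta> g x - c = (LBINT y. \<eta> (x - y) *\<^sub>R (g y - c))"
    by (rule mollifier_conv_diff(1)[OF \<eta> g])
  also have "\<dots> \<le> 0"
    using b mollifierD(2)[OF \<eta>] integral_nonneg[of lborel "\<lambda>y. - (\<eta> (x - y) *\<^sub>R (g y - c))"]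
    by (simp add: mult_nonneg_nonpos)
  finally show ?thesis by simp
qed

lemma conv_component:
  fixes g :: "real^'n \<Rightarrow> 'b::{banach, second_countable_topology}"
  assumes \<eta>: "mollifier \<epsilon> \<eta>" and g: "L1 g" and T: "bounded_linear T"
  shows "T (conv \<eta> g x) = conv \<eta> (\<lambda>y. T (g y)) x"
  unfolding conv_def using integral_bounded_linear[OF T mollifier_conv_integrable[OF \<eta> g]]
  by (simp add: linear_cmul[OF bounded_linear.linear[OF T]])

lemma conv_norm_le:
  fixes g :: "real^'n \<Rightarrow> 'b::{banach, second_countable_topology}"
  assumes \<eta>: "mollifier \<epsilon> \<eta>"
  shows "norm (conv \<eta> g x) \<le> conv \<eta> (\<lambda>y. norm (g y)) x"
  unfolding conv_def using integral_norm_bound[of lborel "\<lambda>y. \<eta> (x - y) *\<^sub>R g y"]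
  by (simp add: mollifierD(2)[OF \<eta>])

lemma compact_cball_Union:
  fixes K :: "'a::euclidean_space set"
  assumes "compact K"
  shows "compact (\<Union>x\<in>K. cball x d)"
proof -
  have e: "(\<Union>x\<in>K. cball x d) = {x + y |x y. x \<in> K \<and> y \<in> cball 0 d}"
    by (force simp: dist_norm norm_minus_commute intro: exI[of _ "_ - _"])
  show ?thesis unfolding e by (rule compact_sums) (use assms in auto)
qed

text \<open>T is the closed d-neighbourhood of S. Mollifying a function supported in S at a scale at
  most d therefore gives a function supported in T; see \<open>conv_csupp\<close>.\<close>

lemma csupp_enlarge:
  fixes S :: "'a::euclidean_space set"
  assumes "compact S" "S \<subseteq> U" "open U"
  obtains d T where "d > 0" "compact T" "S \<subseteq> T" "T \<subseteq> U" "\<And>x y. x \<notin> T \<Longrightarrow> dist x y \<le> d \<Longrightarrow> y \<notin> S"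
proof -
  obtain d where d: "d > 0" "(\<Union>x\<in>S. cball x d) \<subseteq> U"
    using compact_subset_open_imp_cball_epsilon_subset[OF assms(1,3,2)] by metis
  have "compact (\<Union>x\<in>S. cball x d)" by (rule compact_cball_Union[OF assms(1)])
  then show thesis
    by (rule that[OF d(1)]) (use d in \<open>auto simp: dist_commute\<close>)
qed

lemma conv_csupp:
  assumes "mollifier \<epsilon> \<eta>" "\<epsilon> \<le> d" "\<And>x y. x \<notin> T \<Longrightarrow> dist x y \<le> d \<Longrightarrow> y \<notin> S" "\<And>x. x \<notin> S \<Longrightarrow> g x = 0" "x \<notin> T"
  shows "conv \<eta> g x = 0"
proof (rule conv_zero_off[of \<epsilon>])
  show "g y = 0" if "dist x y < \<epsilon>" for y
    using that assms by (meson less_imp_le order_trans)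
qed (use mollifierD(3)[OF assms(1)] in auto)

lemma integrable_pair_product:
  fixes g :: "'a::euclidean_space \<Rightarrow> real" and h :: "'b::euclidean_space \<Rightarrow> real"
  assumes g: "L1 g" and h: "L1 h"
  shows "integrable (lborel \<Otimes>\<^sub>M lborel) (\<lambda>(x, y). g x * h y)"
proof (rule lborel_pair.Fubini_integrable)
  have [measurable]: "g \<in> borel_measurable borel" "h \<in> borel_measurable borel" using g h by auto
  show "(\<lambda>(x, y). g x * h y) \<in> borel_measurable (lborel \<Otimes>\<^sub>M lborel)" by measurable
  show "L1 (\<lambda>x. LBINT y. norm (case (x, y) of (x, y) \<Rightarrow> g x * h y))"
    using g h by (simp add: abs_mult)
qed (use h in auto)

text \<open>Fubini, with B |h x| |g y| as integrable majorant, exchanges the integrals; evenness of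
  \<eta> turns the new inner integral into a convolution of h.\<close>

lemma conv_adjoint:
  fixes g h :: "real^'n \<Rightarrow> 'b::euclidean_space"
  assumes \<eta>: "mollifier \<epsilon> \<eta>" and g: "L1 g" and h: "L1 h"
  shows "(LBINT x. conv \<eta> g x \<bullet> h x) = (LBINT x. g x \<bullet> conv \<eta> h x)"
proof -
  obtain B where B: "\<And>x. \<bar>\<eta> x\<bar> \<le> B"
    using csupp_bounded[OF mollifierD(7)[OF \<eta>] mollifier_csupp[OF \<eta>]] by (metis real_norm_def)
  have [measurable]: "\<eta> \<in> borel_measurable borel" "g \<in> borel_measurable borel" "h \<in> borel_measurable borel"
    using g h mollifierD(8)[OF \<eta>] by auto
  have int: "integrable (lborel \<Otimes>\<^sub>M lborel) (\<lambda>(x, y). \<eta> (x - y) * (g y \<bullet> h x))"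
  proof (rule integrable_bound)
    show "integrable (lborel \<Otimes>\<^sub>M lborel) (\<lambda>(x, y). (B * norm (h x)) * norm (g y))"
      using g h by (intro integrable_pair_product) auto
    show "AE x in lborel \<Otimes>\<^sub>M lborel. norm (case x of (x, y) \<Rightarrow> \<eta> (x - y) * (g y \<bullet> h x))
        \<le> norm (case x of (x, y) \<Rightarrow> B * norm (h x) * norm (g y))"
    proof (rule AE_I2, clarsimp simp: abs_mult)
      fix x y
      have "\<bar>\<eta> (x - y)\<bar> * \<bar>g y \<bullet> h x\<bar> \<le> B * (norm (g y) * norm (h x))"
        using B[of "x - y"] Cauchy_Schwarz_ineq2[of "g y" "h x"] by (intro mult_mono) (auto intro: order_trans[OF abs_ge_zero])
      also have "\<dots> \<le> \<bar>B\<bar> * norm (h x) * norm (g y)" by (simp add: mult_ac mult_right_mono)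
      finally show "\<bar>\<eta> (x - y)\<bar> * \<bar>g y \<bullet> h x\<bar> \<le> \<bar>B\<bar> * norm (h x) * norm (g y)" .
    qed
  qed measurable
  have "(LBINT x. conv \<eta> g x \<bullet> h x) = (LBINT x. (LBINT y. \<eta> (x - y) * (g y \<bullet> h x)))"
    unfolding conv_def
    by (intro integral_cong refl)
      (simp flip: integral_inner_left[OF mollifier_conv_integrable[OF \<eta> g]])
  also have "\<dots> = (LBINT y. (LBINT x. \<eta> (x - y) * (g y \<bullet> h x)))"
    using lborel_pair.Fubini_integral[OF int] by simp
  also have "\<dots> = (LBINT y. g y \<bullet> conv \<eta> h y)"
    unfolding conv_def
    by (intro integral_cong refl)
      (simp add: mollifierD(11)[OF \<eta>, of _ y for y] flip: integral_inner_right[OF mollifier_conv_integrable[OF \<eta> h]])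
  finally show ?thesis .
qed

section \<open>Integration by parts\<close>

text \<open>By translation invariance every difference quotient has integral 0. The quotients
  converge uniformly to the partial derivative, and for small shifts all of them vanish off one
  compact set T.\<close>

lemma integral_partial_deriv_zero:
  fixes h :: "real^'n \<Rightarrow> real"
  assumes h: "h \<in> Ck_fun (Suc k)" and s: "csupp U h"
  shows "(LBINT x. pd \<alpha> h x) = 0"
proof -
  obtain S where S: "compact S" "\<And>x. x \<notin> S \<Longrightarrow> h x = 0" "S \<subseteq> U" using s by (auto simp: csupp_def)
  obtain d0 T where T: "d0 > 0" "compact T" "S \<subseteq> T" "\<And>x y. x \<notin> T \<Longrightarrow> dist x y \<le> d0 \<Longrightarrow> y \<notin> S"
    using csupp_enlarge[OF S(1) subset_UNIV open_UNIV] by metis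
  have c: "continuous_on UNIV h" using h Ck_fun_continuous by blast
  have ih: "L1 h" by (rule csupp_integrable[OF c s])
  have ip: "L1 (pd \<alpha> h)"
    by (rule csupp_integrable[OF C1_continuous_partial[OF h] csupp_partial_deriv[OF s]])
  let ?I = "LBINT x. pd \<alpha> h x"
  have [measurable]: "T \<in> sets borel" using T(2) by (simp add: borel_compact)
  have fin: "L1 (indicator T :: _ \<Rightarrow> real)"
    using emeasure_compact_finite[OF T(2)] by (simp add: less_top)
  have "\<bar>?I\<bar> \<le> e * measure lborel T" if e: "e > 0" for e
  proof -
    obtain d where d: "d > 0" "\<And>z v. norm v < d \<Longrightarrow> \<bar>h (z + v) - h z - grd h z \<bullet> v\<bar> \<le> e * norm v"
      using C1_uniform_linearization[OF h s e] by metis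
    \<comment> \<open>Half of d gives the strict inequality demanded by the expansion, and d0 keeps
      the shifted support inside T.\<close>
    define t where "t = min (d / 2) d0"
    have t: "t > 0" "t < d" "t \<le> d0" using d(1) T(1) by (auto simp: t_def)
    let ?v = "t *\<^sub>R axis \<alpha> (1::real) :: real^'n"
    have nv: "norm ?v = t" using t by simp
    have ish: "L1 (\<lambda>x. h (x + ?v))" and isv: "(LBINT x. h (x + ?v)) = (LBINT x. h x)"
      using integrable_shift[of h ?v] integral_shift[of h ?v] ih by auto
    have "\<bar>t * ?I\<bar> = \<bar>LBINT x. h (x + ?v) - h x - t * pd \<alpha> h x\<bar>"
      using ish ih ip isv by simp
    also have "\<dots> \<le> (LBINT x. \<bar>h (x + ?v) - h x - t * pd \<alpha> h x\<bar>)"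
      by (rule integral_abs_bound)
    also have "\<dots> \<le> (LBINT x. (e * t) * indicator T x)"
    proof (rule integral_mono)
      show "\<bar>h (x + ?v) - h x - t * pd \<alpha> h x\<bar> \<le> (e * t) * indicator T x" for x
      proof (cases "x \<in> T")
        case True
        then show ?thesis
          using d(2)[of ?v x] nv t(2) by (simp add: inner_axis grd_def)
      next
        case False
        have "x + ?v \<notin> S" "x \<notin> S"
          using T(4)[OF False, of "x + ?v"] T(3) False nv t by (auto simp: dist_norm)
        then show ?thesis
          using False S(2) partial_deriv_zero_off[OF compact_imp_closed[OF S(1)] S(2)] by simp
      qed
    qed (use ish ih ip fin in auto)
    also have "\<dots> = t * (e * measure lborel T)" by (simp add: mult_ac)
    finally show ?thesis using t(1) by (simp add: abs_mult)
  qed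
  then have "\<bar>?I\<bar> \<le> 0"
  proof -
    have "((\<lambda>e. e * measure lborel T) \<longlongrightarrow> 0 * measure lborel T) (at_right 0)"
      by (intro tendsto_intros)
    moreover have "\<forall>\<^sub>F e in at_right 0. \<bar>?I\<bar> \<le> e * measure lborel T"
      using \<open>\<And>e. e > 0 \<Longrightarrow> _\<close> by (auto simp: eventually_at_right_field intro: exI[of _ 1])
    ultimately show ?thesis
      using tendsto_lowerbound[of "\<lambda>e. e * measure lborel T" "0 * measure lborel T" "at_right 0" "\<bar>?I\<bar>"] by simp
  qed
  then show ?thesis by simp
qed

lemma integration_by_parts:
  fixes f \<phi> :: "real^'n \<Rightarrow> real"
  assumes f: "f \<in> Ck_fun (Suc k)" and \<phi>: "\<phi> \<in> Ck_fun (Suc l)" and s: "csupp U \<phi>"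
  shows "(LBINT x. f x * pd \<alpha> \<phi> x) = - (LBINT x. pd \<alpha> f x * \<phi> x)"
proof -
  have c: "continuous_on UNIV f" "continuous_on UNIV \<phi>" using f \<phi> Ck_fun_continuous by blast+
  have i1: "L1 (\<lambda>x. f x * pd \<alpha> \<phi> x)"
    by (intro csupp_integrable[OF _ csupp_mult2[OF csupp_partial_deriv[OF s]]] continuous_on_mult c C1_continuous_partial[OF \<phi>])
  have i2: "L1 (\<lambda>x. pd \<alpha> f x * \<phi> x)"
    by (intro csupp_integrable[OF _ csupp_mult2[OF s]] continuous_on_mult c C1_continuous_partial[OF f])
  \<comment> \<open>Both factors are lowered to one common class, as \<open>Ck_fun_mult\<close>
    demands.\<close>
  have f': "f \<in> Ck_fun (Suc 0)" "\<phi> \<in> Ck_fun (Suc 0)"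
    using f \<phi> Ck_fun_antimono[of "Suc 0"] by (auto simp del: Ck_fun.simps)
  have "(LBINT x. pd \<alpha> (\<lambda>x. f x * \<phi> x) x) = 0"
    by (rule integral_partial_deriv_zero[OF Ck_fun_mult[OF f'] csupp_mult2[OF s]])
  then show ?thesis
    using i1 i2 by (simp add: partial_deriv_mult[OF f \<phi>])
qed

section \<open>Density of compactly supported functions\<close>

text \<open>Regularity of \<mu> squeezes A between a compact K and an open U of nearly the same
  measure. A distance cutoff that is 1 on K and 0 off a compact subset of U and \<Omega> differs
  from the indicator of A only on U without K.\<close>

lemma indicator_approx:
  fixes \<mu> :: "'a::euclidean_space measure"
  assumes sb: "sets \<mu> = sets borel" and fin: "emeasure \<mu> UNIV < \<infinity>"
    and A: "A \<in> sets borel" "A \<subseteq> \<Omega>" and op: "open \<Omega>" and "e > 0"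
  obtains \<phi> :: "'a \<Rightarrow> real" where "continuous_on UNIV \<phi>" "csupp \<Omega> \<phi>"
    "integrable \<mu> (\<lambda>x. \<bar>\<phi> x - indicator A x\<bar>)" "(\<integral>x. \<bar>\<phi> x - indicator A x\<bar> \<partial>\<mu>) < e"
proof -
  have sp: "space \<mu> = UNIV" using sets_eq_imp_space_eq[OF sb] by simp
  interpret finite_measure \<mu> by (rule finite_measureI) (use fin sp in auto)
  have ne: "emeasure \<mu> (space \<mu>) \<noteq> \<infinity>" using fin sp by simp
  have eA: "emeasure \<mu> A = ennreal (measure \<mu> A)" by (simp add: emeasure_eq_measure)
  obtain K where K: "K \<subseteq> A" "compact K" "measure \<mu> A - e/3 < measure \<mu> K"
  \<comment> \<open>A negative threshold would be cut to 0 by \<open>ennreal\<close>, so this case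
    is served by the empty set.\<close>
  proof (cases "measure \<mu> A - e/3 < 0")
    case True
    then show thesis by (intro that[of "{}"]) auto
  next
    case False
    have "ennreal (measure \<mu> A - e/3) < (SUP K \<in> {K. K \<subseteq> A \<and> compact K}. emeasure \<mu> K)"
      unfolding inner_regular[OF sb ne A(1), symmetric] eA using False \<open>e > 0\<close> by (simp add: ennreal_less_iff)
    then obtain K where "K \<subseteq> A" "compact K" "ennreal (measure \<mu> A - e/3) < emeasure \<mu> K"
      by (auto simp: less_SUP_iff)
    then show thesis using False by (intro that[of K]) (auto simp: emeasure_eq_measure ennreal_less_iff)
  qed
  obtain U where U: "A \<subseteq> U" "open U" "measure \<mu> U < measure \<mu> A + e/3"
  proof -
    have "(INF U \<in> {U. A \<subseteq> U \<and> open U}. emeasure \<mu> U) < ennreal (measure \<mu> A + e/3)"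
      unfolding outer_regular[OF sb ne A(1), symmetric] eA using \<open>e > 0\<close> by (simp add: ennreal_less_iff)
    then obtain U where "A \<subseteq> U" "open U" "emeasure \<mu> U < ennreal (measure \<mu> A + e/3)"
      by (auto simp: INF_less_iff)
    then show thesis using \<open>e > 0\<close> by (intro that[of U]) (auto simp: emeasure_eq_measure ennreal_less_iff simp flip: ennreal_plus)
  qed
  have meas: "K \<in> sets \<mu>" "U \<in> sets \<mu>" "A \<in> sets \<mu>" "U \<inter> \<Omega> - K \<in> sets \<mu>" using K U A op sb by (auto simp: borel_compact)
  have KU: "K \<subseteq> U \<inter> \<Omega>" using K U A by auto
  obtain d T where T: "d > 0" "compact T" "K \<subseteq> T" "T \<subseteq> U \<inter> \<Omega>" "\<And>x y. x \<notin> T \<Longrightarrow> dist x y \<le> d \<Longrightarrow> y \<notin> K"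
    using csupp_enlarge[OF K(2) KU open_Int[OF U(2) op]] by metis
  \<comment> \<open>\<open>infdist\<close> to the empty set is 0 by convention, which would make the
    cutoff 1 everywhere.\<close>
  define \<phi> where "\<phi> x = (if K = {} then 0 else max 0 (1 - infdist x K / d))" for x
  have c: "continuous_on UNIV \<phi>"
    unfolding \<phi>_def[abs_def] using T(1) by (cases "K = {}") (auto intro!: continuous_intros)
  have off: "\<phi> x = 0" if "x \<notin> T" for x
  proof (cases "K = {}")
    case False
    obtain y where y: "y \<in> K" "infdist x K = dist x y"
      using infdist_attains_inf[OF compact_imp_closed[OF K(2)] False] by metis
    then have "d < infdist x K" using T(5)[OF that, of y] by force
    then show ?thesis using T(1) by (simp add: \<phi>_def)
  qed (simp add: \<phi>_def)
  have s: "csupp \<Omega> \<phi>" using T off by (intro csuppI[of T]) auto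
  have b: "0 \<le> \<phi> x" "\<phi> x \<le> 1" for x using T(1) by (auto simp: \<phi>_def infdist_nonneg)
  have one: "\<phi> x = 1" if "x \<in> K" for x using that by (auto simp: \<phi>_def)
  have le: "\<bar>\<phi> x - indicator A x\<bar> \<le> indicator (U \<inter> \<Omega> - K) x" for x
  proof (cases "x \<in> K")
    case True
    then show ?thesis using one K(1) by (auto simp: indicator_def)
  next
    case False
    show ?thesis
    proof (cases "x \<in> U \<inter> \<Omega>")
      case True
      then show ?thesis using False b[of x] by (auto simp: indicator_def)
    next
      case F: False
      then have "x \<notin> A" "\<phi> x = 0" using U(1) A(2) off[of x] T(4) by auto
      then show ?thesis by simp
    qed
  qed
  have [measurable]: "\<phi> \<in> borel_measurable \<mu>"
    using cont_borel[OF c] by (simp add: measurable_cong_sets[OF sb refl])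
  have i2: "integrable \<mu> (indicator (U \<inter> \<Omega> - K) :: _ \<Rightarrow> real)"
    using meas by (simp add: emeasure_eq_measure)
  have i1: "integrable \<mu> (\<lambda>x. \<bar>\<phi> x - indicator A x\<bar>)"
    using meas le by (intro integrable_bound[OF i2]) auto
  have "(\<integral>x. \<bar>\<phi> x - indicator A x\<bar> \<partial>\<mu>) \<le> (\<integral>x. indicator (U \<inter> \<Omega> - K) x \<partial>\<mu>)"
    by (rule integral_mono[OF i1 i2 le])
  also have "\<dots> = measure \<mu> (U \<inter> \<Omega> - K)" using meas sp by simp
  also have "\<dots> \<le> measure \<mu> (U - K)" using meas by (intro finite_measure_mono) auto
  also have "\<dots> = measure \<mu> U - measure \<mu> K"
    using meas KU by (intro finite_measure_Diff) auto
  also have "\<dots> < e" using K(3) U(3) \<open>e > 0\<close> by linarith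
  finally show thesis using that[OF c s i1] by blast
qed

lemma csupp_integrable_finite:
  fixes \<phi> :: "'a::euclidean_space \<Rightarrow> 'b::euclidean_space"
  assumes sb: "sets \<mu> = sets borel" and fin: "emeasure \<mu> UNIV < \<infinity>"
    and c: "continuous_on UNIV \<phi>" and s: "csupp U \<phi>"
  shows "integrable \<mu> \<phi>"
proof -
  have sp: "space \<mu> = UNIV" using sets_eq_imp_space_eq[OF sb] by simp
  interpret finite_measure \<mu> by (rule finite_measureI) (use fin sp in auto)
  obtain B where "\<And>x. norm (\<phi> x) \<le> B" using csupp_bounded[OF c s] by metis
  moreover have "\<phi> \<in> borel_measurable \<mu>"
    using cont_borel[OF c] by (simp add: measurable_cong_sets[OF sb refl])
  ultimately show ?thesis by (intro integrable_const_bound[of _ B]) auto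
qed

text \<open>The quantifier over e is part of the induction goal, since sums and limits halve the
  error. The functions met during the induction need not vanish off \<Omega>, hence the factor
  \<open>indicator \<Omega>\<close>.\<close>

lemma csupp_dense_aux:
  fixes \<mu> :: "'a::euclidean_space measure" and h :: "'a \<Rightarrow> 'b::euclidean_space"
  assumes sb: "sets \<mu> = sets borel" and fin: "emeasure \<mu> UNIV < \<infinity>" and op: "open \<Omega>"
    and h: "integrable \<mu> h"
  shows "\<forall>e>0. \<exists>\<phi>. continuous_on UNIV \<phi> \<and> csupp \<Omega> \<phi> \<and> (\<integral>x. norm (\<phi> x - indicator \<Omega> x *\<^sub>R h x) \<partial>\<mu>) < e"
proof -
  have sp: "space \<mu> = UNIV" using sets_eq_imp_space_eq[OF sb] by simp
  interpret finite_measure \<mu> by (rule finite_measureI) (use fin sp in auto)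
  have O[measurable]: "\<Omega> \<in> sets \<mu>" using op sb by auto
  show ?thesis using h
  proof (induction rule: integrable_induct)
    case (base A c)
    show ?case
    proof (intro allI impI)
      fix e :: real assume "e > 0"
      then have e: "e / (norm c + 1) > 0" by (simp add: add_nonneg_pos)
      obtain \<phi> :: "'a \<Rightarrow> real" where \<phi>: "continuous_on UNIV \<phi>" "csupp \<Omega> \<phi>"
        "integrable \<mu> (\<lambda>x. \<bar>\<phi> x - indicator (A \<inter> \<Omega>) x\<bar>)" "(\<integral>x. \<bar>\<phi> x - indicator (A \<inter> \<Omega>) x\<bar> \<partial>\<mu>) < e / (norm c + 1)"
        by (rule indicator_approx[OF sb fin _ _ op e, of "A \<inter> \<Omega>"]) (use base O sb in auto)
      let ?I = "\<integral>x. \<bar>\<phi> x - indicator (A \<inter> \<Omega>) x\<bar> \<partial>\<mu>"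
      have eq: "norm (\<phi> x *\<^sub>R c - indicator \<Omega> x *\<^sub>R indicator A x *\<^sub>R c) = \<bar>\<phi> x - indicator (A \<inter> \<Omega>) x\<bar> * norm c" for x
        by (auto simp: indicator_def scaleR_diff_left[symmetric])
      have "(\<integral>x. norm (\<phi> x *\<^sub>R c - indicator \<Omega> x *\<^sub>R indicator A x *\<^sub>R c) \<partial>\<mu>) = ?I * norm c"
        unfolding eq by simp
      also have "\<dots> \<le> ?I * (norm c + 1)" by (intro mult_left_mono) auto
      also have "\<dots> < e" using \<phi>(4) by (subst (asm) pos_less_divide_eq) (auto simp: add_nonneg_pos)
      finally show "\<exists>\<phi>. continuous_on UNIV \<phi> \<and> csupp \<Omega> \<phi> \<and> (\<integral>x. norm (\<phi> x - indicator \<Omega> x *\<^sub>R indicator A x *\<^sub>R c) \<partial>\<mu>) < e"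
        using \<phi>(1,2) by (intro exI[of _ "\<lambda>x. \<phi> x *\<^sub>R c"]) (auto intro!: continuous_intros simp: csupp_def)
    qed
  next
    case (add f g)
    show ?case
    proof (intro allI impI)
      fix e :: real assume "e > 0"
      then have e: "e / 2 > 0" by simp
      obtain \<phi> where \<phi>: "continuous_on UNIV \<phi>" "csupp \<Omega> \<phi>" "(\<integral>x. norm (\<phi> x - indicator \<Omega> x *\<^sub>R f x) \<partial>\<mu>) < e / 2"
        using add(3) e by blast
      obtain \<psi> where \<psi>: "continuous_on UNIV \<psi>" "csupp \<Omega> \<psi>" "(\<integral>x. norm (\<psi> x - indicator \<Omega> x *\<^sub>R g x) \<partial>\<mu>) < e / 2"
        using add(4) e by blast
      have int: "integrable \<mu> (\<lambda>x. \<phi> x - indicator \<Omega> x *\<^sub>R f x)" "integrable \<mu> (\<lambda>x. \<psi> x - indicator \<Omega> x *\<^sub>R g x)"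
        by (intro integrable_diff integrable_mult_indicator[OF O] add(1,2)
            csupp_integrable_finite[OF sb fin \<phi>(1,2)] csupp_integrable_finite[OF sb fin \<psi>(1,2)])+
      have "(\<integral>x. norm ((\<phi> x + \<psi> x) - indicator \<Omega> x *\<^sub>R (f x + g x)) \<partial>\<mu>)
        \<le> (\<integral>x. norm (\<phi> x - indicator \<Omega> x *\<^sub>R f x) + norm (\<psi> x - indicator \<Omega> x *\<^sub>R g x) \<partial>\<mu>)"
      proof (rule integral_mono)
        have "integrable \<mu> (\<lambda>x. norm ((\<phi> x - indicator \<Omega> x *\<^sub>R f x) + (\<psi> x - indicator \<Omega> x *\<^sub>R g x)))"
          by (intro integrable_norm integrable_add int)
        then show "integrable \<mu> (\<lambda>x. norm ((\<phi> x + \<psi> x) - indicator \<Omega> x *\<^sub>R (f x + g x)))"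
          by (simp add: algebra_simps)
        show "norm ((\<phi> x + \<psi> x) - indicator \<Omega> x *\<^sub>R (f x + g x)) \<le> norm (\<phi> x - indicator \<Omega> x *\<^sub>R f x) + norm (\<psi> x - indicator \<Omega> x *\<^sub>R g x)" for x
          using norm_triangle_ineq[of "\<phi> x - indicator \<Omega> x *\<^sub>R f x" "\<psi> x - indicator \<Omega> x *\<^sub>R g x"] by (simp add: algebra_simps)
      qed (use int in auto)
      also have "\<dots> < e" using int \<phi>(3) \<psi>(3) by simp
      finally show "\<exists>\<phi>. continuous_on UNIV \<phi> \<and> csupp \<Omega> \<phi> \<and> (\<integral>x. norm (\<phi> x - indicator \<Omega> x *\<^sub>R (f x + g x)) \<partial>\<mu>) < e"
        using \<phi>(1,2) \<psi>(1,2) by (intro exI[of _ "\<lambda>x. \<phi> x + \<psi> x"]) (auto intro!: continuous_on_add csupp_add)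
    qed
  next
    case (lim f s)
    show ?case
    proof (intro allI impI)
      fix e :: real assume "e > 0"
      then have e: "e / 2 > 0" by simp
      have conv: "(\<lambda>i. \<integral>x. norm (s i x - f x) \<partial>\<mu>) \<longlonglongrightarrow> (\<integral>x. norm (0::'b) \<partial>\<mu>)"
      \<comment> \<open>The approximants of \<open>integrable_induct\<close> satisfy |s i| \<le> 2
        |f|, so 3 |f| is a majorant of the difference.\<close>
      proof (rule integral_dominated_convergence[where w = "\<lambda>x. 3 * norm (f x)"])
        show "AE x in \<mu>. (\<lambda>i. norm (s i x - f x)) \<longlonglongrightarrow> norm (0::'b)"
        proof (rule AE_I2)
          fix x assume "x \<in> space \<mu>"
          then have "(\<lambda>i. s i x - f x) \<longlonglongrightarrow> f x - f x" using lim(2) by (intro tendsto_intros) auto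
          then show "(\<lambda>i. norm (s i x - f x)) \<longlonglongrightarrow> norm (0::'b)" by (intro tendsto_norm) simp
        qed
        show "AE x in \<mu>. norm (norm (s i x - f x)) \<le> 3 * norm (f x)" for i
        proof (rule AE_I2)
          fix x assume x: "x \<in> space \<mu>"
          have "norm (s i x - f x) \<le> norm (s i x) + norm (f x)" by (rule norm_triangle_ineq4)
          also have "\<dots> \<le> 3 * norm (f x)" using lim(3)[OF x, of i] by simp
          finally show "norm (norm (s i x - f x)) \<le> 3 * norm (f x)" by simp
        qed
      qed (use lim(1,2) \<open>integrable \<mu> f\<close> in auto)
      then have "\<forall>\<^sub>F i in sequentially. (\<integral>x. norm (s i x - f x) \<partial>\<mu>) < e / 2"
        using e by (intro order_tendstoD(2)) auto
      then obtain i where i: "(\<integral>x. norm (s i x - f x) \<partial>\<mu>) < e / 2"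
        by (auto simp: eventually_sequentially)
      obtain \<phi> where \<phi>: "continuous_on UNIV \<phi>" "csupp \<Omega> \<phi>" "(\<integral>x. norm (\<phi> x - indicator \<Omega> x *\<^sub>R s i x) \<partial>\<mu>) < e / 2"
        using lim(5) e by blast
      have int: "integrable \<mu> (\<lambda>x. \<phi> x - indicator \<Omega> x *\<^sub>R s i x)" "integrable \<mu> (\<lambda>x. indicator \<Omega> x *\<^sub>R (s i x - f x))" "integrable \<mu> (\<lambda>x. s i x - f x)"
        by (intro integrable_diff integrable_mult_indicator[OF O] lim(1) \<open>integrable \<mu> f\<close>
            csupp_integrable_finite[OF sb fin \<phi>(1,2)])+
      have "(\<integral>x. norm (\<phi> x - indicator \<Omega> x *\<^sub>R f x) \<partial>\<mu>)
        \<le> (\<integral>x. norm (\<phi> x - indicator \<Omega> x *\<^sub>R s i x) + norm (s i x - f x) \<partial>\<mu>)"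
      proof (rule integral_mono)
        have "integrable \<mu> (\<lambda>x. norm ((\<phi> x - indicator \<Omega> x *\<^sub>R s i x) + indicator \<Omega> x *\<^sub>R (s i x - f x)))"
          by (intro integrable_norm integrable_add int)
        then show "integrable \<mu> (\<lambda>x. norm (\<phi> x - indicator \<Omega> x *\<^sub>R f x))"
          by (simp add: algebra_simps)
        show "norm (\<phi> x - indicator \<Omega> x *\<^sub>R f x) \<le> norm (\<phi> x - indicator \<Omega> x *\<^sub>R s i x) + norm (s i x - f x)" for x
          using norm_triangle_ineq[of "\<phi> x - indicator \<Omega> x *\<^sub>R s i x" "indicator \<Omega> x *\<^sub>R (s i x - f x)"]
          by (auto simp: algebra_simps indicator_def split: if_splits)
      qed (use int in auto)
      also have "\<dots> < e" using int \<phi>(3) i by simp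
      finally show "\<exists>\<phi>. continuous_on UNIV \<phi> \<and> csupp \<Omega> \<phi> \<and> (\<integral>x. norm (\<phi> x - indicator \<Omega> x *\<^sub>R f x) \<partial>\<mu>) < e"
        using \<phi>(1,2) by blast
    qed
  qed
qed

text \<open>The values are kept in a closed convex set by composing with the nearest point projection,
  which is nonexpansive and fixes 0.\<close>

lemma csupp_dense:
  fixes \<mu> :: "'a::euclidean_space measure" and h :: "'a \<Rightarrow> 'b::euclidean_space"
  assumes sb: "sets \<mu> = sets borel" and fin: "emeasure \<mu> UNIV < \<infinity>" and op: "open \<Omega>"
    and h: "integrable \<mu> h" and C: "closed C" "convex C" "0 \<in> C"
    and hC: "\<And>x. h x \<in> C" and off: "\<And>x. x \<notin> \<Omega> \<Longrightarrow> h x = 0" and "e > 0"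
  obtains \<phi> where "continuous_on UNIV \<phi>" "csupp \<Omega> \<phi>" "\<And>x. \<phi> x \<in> C" "(\<integral>x. norm (\<phi> x - h x) \<partial>\<mu>) < e"
proof -
  have ind: "indicator \<Omega> x *\<^sub>R h x = h x" for x using off[of x] by (auto simp: indicator_def)
  obtain \<phi> where \<phi>: "continuous_on UNIV \<phi>" "csupp \<Omega> \<phi>" "(\<integral>x. norm (\<phi> x - h x) \<partial>\<mu>) < e"
    using csupp_dense_aux[OF sb fin op h] \<open>e > 0\<close> unfolding ind by blast
  have ne: "C \<noteq> {}" using C(3) by auto
  let ?\<phi> = "\<lambda>x. closest_point C (\<phi> x)"
  have le: "norm (?\<phi> x - h x) \<le> norm (\<phi> x - h x)" for x
    using closest_point_lipschitz[OF C(2,1) ne, of "\<phi> x" "h x"] closest_point_self[OF hC[of x]] by (simp add: dist_norm)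
  have c: "continuous_on UNIV ?\<phi>"
    using continuous_on_compose2[OF continuous_on_closest_point[OF C(2,1) ne, of UNIV] \<phi>(1)] by simp
  have s: "csupp \<Omega> ?\<phi>"
    using \<phi>(2) closest_point_self[OF C(3)] by (auto simp: csupp_def)
  have "(\<integral>x. norm (?\<phi> x - h x) \<partial>\<mu>) \<le> (\<integral>x. norm (\<phi> x - h x) \<partial>\<mu>)"
    by (intro integral_mono le integrable_norm integrable_diff h
        csupp_integrable_finite[OF sb fin c s] csupp_integrable_finite[OF sb fin \<phi>(1,2)])
  then show thesis using \<phi>(3) closest_point_in_set[OF C(1) ne] by (intro that[OF c s]) auto
qed

text \<open>An average lies on the same side of every separating hyperplane as the averaged values,
  because linear functionals pass through the convolution.\<close>

lemma mollifier_conv_in_convex: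
  fixes g :: "real^'n \<Rightarrow> 'b::euclidean_space"
  assumes \<eta>: "mollifier \<epsilon> \<eta>" and g: "L1 g" and C: "closed C" "convex C" and gC: "\<And>x. g x \<in> C"
  shows "conv \<eta> g x \<in> C"
proof (rule ccontr)
  assume "conv \<eta> g x \<notin> C"
  then obtain a b where ab: "a \<bullet> conv \<eta> g x < b" "\<And>y. y \<in> C \<Longrightarrow> b < a \<bullet> y"
    using separating_hyperplane_closed_point[OF C(2,1)] by metis
  have "- (a \<bullet> conv \<eta> g x) = conv \<eta> (\<lambda>y. - (a \<bullet> g y)) x"
    by (rule conv_component[OF \<eta> g]) (intro bounded_linear_minus bounded_linear_inner_right)
  also have "\<dots> \<le> - b"
    using g ab(2)[OF gC] by (intro mollifier_conv_le[OF \<eta>]) (auto simp: less_imp_le)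
  finally show False using ab(1) by simp
qed

text \<open>A continuous approximation is mollified: the convergence is uniform, the measure finite,
  and the average of values in C stays in C. Smoothness is stated through scalar functions
  \<open>T (\<phi> x)\<close> because \<open>Ck_fun\<close> consists of real-valued functions;
  matrix entries and components of pairs are instances of T.\<close>

lemma smooth_dense:
  fixes \<mu> :: "(real^'n) measure" and h :: "real^'n \<Rightarrow> 'b::euclidean_space"
  assumes sb: "sets \<mu> = sets borel" and fin: "emeasure \<mu> UNIV < \<infinity>" and op: "open \<Omega>"
    and h: "integrable \<mu> h" and C: "closed C" "convex C" "0 \<in> C"
    and hC: "\<And>x. h x \<in> C" and off: "\<And>x. x \<notin> \<Omega> \<Longrightarrow> h x = 0" and "e > 0"
  obtains \<phi> where "continuous_on UNIV \<phi>" "csupp \<Omega> \<phi>" "\<And>x. \<phi> x \<in> C" "(\<integral>x. norm (\<phi> x - h x) \<partial>\<mu>) < e"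
    "\<And>T k. bounded_linear T \<Longrightarrow> (\<lambda>x. T (\<phi> x)) \<in> Ck_fun k"
proof -
  have sp: "space \<mu> = UNIV" using sets_eq_imp_space_eq[OF sb] by simp
  interpret finite_measure \<mu> by (rule finite_measureI) (use fin sp in auto)
  have e2: "e / 2 > 0" using \<open>e > 0\<close> by simp
  obtain \<phi> where \<phi>: "continuous_on UNIV \<phi>" "csupp \<Omega> \<phi>" "\<And>x. \<phi> x \<in> C" "(\<integral>x. norm (\<phi> x - h x) \<partial>\<mu>) < e / 2"
    using csupp_dense[OF sb fin op h C hC off e2] by metis
  obtain S where S: "compact S" "S \<subseteq> \<Omega>" "\<And>x. x \<notin> S \<Longrightarrow> \<phi> x = 0" using \<phi>(2) by (auto simp: csupp_def)
  obtain d T where T: "d > 0" "compact T" "S \<subseteq> T" "T \<subseteq> \<Omega>" "\<And>x y. x \<notin> T \<Longrightarrow> dist x y \<le> d \<Longrightarrow> y \<notin> S"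
    using csupp_enlarge[OF S(1,2) op] by metis
  define m where "m = measure \<mu> UNIV + 1"
  have m: "m > 0" by (simp add: m_def add_nonneg_pos)
  have em: "e / 2 / m > 0" using e2 m by simp
  obtain d' where d': "d' > 0" "\<And>\<epsilon> \<eta> x. mollifier \<epsilon> \<eta> \<Longrightarrow> \<epsilon> \<le> d' \<Longrightarrow> norm (conv \<eta> \<phi> x - \<phi> x) \<le> e / 2 / m"
    using mollifier_uniform_limit[OF \<phi>(1,2) em] by metis
  obtain \<eta> :: "real^'n \<Rightarrow> real" where \<eta>: "mollifier (min d d') \<eta>" using mollifier_exists[of "min d d'"] T(1) d'(1) by auto
  have i: "L1 \<phi>" by (rule csupp_integrable[OF \<phi>(1,2)])
  let ?\<phi> = "conv \<eta> \<phi>"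
  have c: "continuous_on UNIV ?\<phi>" by (rule conv_continuous[OF mollifierD(7)[OF \<eta>] mollifier_csupp[OF \<eta>] i])
  have s: "csupp \<Omega> ?\<phi>"
    by (rule csuppI[OF T(2,4)], rule conv_csupp[OF \<eta> _ T(5) S(3)]) auto
  have "(\<integral>x. norm (?\<phi> x - h x) \<partial>\<mu>) \<le> (\<integral>x. e / 2 / m + norm (\<phi> x - h x) \<partial>\<mu>)"
  proof (rule integral_mono)
    show "norm (?\<phi> x - h x) \<le> e / 2 / m + norm (\<phi> x - h x)" for x
      using d'(2)[OF \<eta>, of x] norm_triangle_ineq[of "?\<phi> x - \<phi> x" "\<phi> x - h x"] by simp
  qed (auto intro!: integrable_norm integrable_diff integrable_add h
        csupp_integrable_finite[OF sb fin c s] csupp_integrable_finite[OF sb fin \<phi>(1,2)])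
  also have "\<dots> = measure \<mu> UNIV * (e / 2 / m) + (\<integral>x. norm (\<phi> x - h x) \<partial>\<mu>)"
    by (subst integral_add)
      (auto simp: sp intro!: integrable_norm integrable_diff h csupp_integrable_finite[OF sb fin \<phi>(1,2)])
  also have "measure \<mu> UNIV * (e / 2 / m) \<le> m * (e / 2 / m)" using em by (intro mult_right_mono) (auto simp: m_def)
  also have "\<dots> = e / 2" using m by simp
  finally have "(\<integral>x. norm (?\<phi> x - h x) \<partial>\<mu>) < e" using \<phi>(4) by simp
  moreover have "(\<lambda>x. T (?\<phi> x)) \<in> Ck_fun k" if T: "bounded_linear T" for T k
    unfolding conv_component[OF \<eta> i T]
    using mollifier_conv_Ck[OF \<eta>] integrable_bounded_linear[OF T i] by blast
  ultimately show thesis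
    using mollifier_conv_in_convex[OF \<eta> i C(1,2) \<phi>(3)] by (intro that[OF c s]) auto
qed

text \<open>This bridges the gap between the smooth test functions of the distributional identities
  and the C^1 fields used in the duality: values and first derivatives converge uniformly.\<close>

lemma test_fun_approx:
  fixes \<phi> :: "real^'n \<Rightarrow> real"
  assumes \<phi>: "\<phi> \<in> Ck_fun (Suc k)" and s: "csupp \<Omega> \<phi>" and op: "open \<Omega>"
  obtains \<phi>s :: "nat \<Rightarrow> real^'n \<Rightarrow> real" where "\<And>j. test_fun \<Omega> (\<phi>s j)"
    "\<And>j x. \<bar>\<phi>s j x - \<phi> x\<bar> \<le> 1 / Suc j"
    "\<And>j \<alpha> x. \<bar>pd \<alpha> (\<phi>s j) x - pd \<alpha> \<phi> x\<bar> \<le> 1 / Suc j"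
proof -
  have c: "continuous_on UNIV \<phi>" using \<phi> Ck_fun_continuous by blast
  obtain S where S: "compact S" "S \<subseteq> \<Omega>" "\<And>x. x \<notin> S \<Longrightarrow> \<phi> x = 0" using s by (auto simp: csupp_def)
  obtain d T where T: "d > 0" "compact T" "S \<subseteq> T" "T \<subseteq> \<Omega>" "\<And>x y. x \<notin> T \<Longrightarrow> dist x y \<le> d \<Longrightarrow> y \<notin> S"
    using csupp_enlarge[OF S(1,2) op] by metis
  have i: "L1 \<phi>" by (rule csupp_integrable[OF c s])
  have "\<exists>\<xi>. test_fun \<Omega> \<xi> \<and> (\<forall>x. \<bar>\<xi> x - \<phi> x\<bar> \<le> e) \<and> (\<forall>\<alpha> x. \<bar>pd \<alpha> \<xi> x - pd \<alpha> \<phi> x\<bar> \<le> e)"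
    if e: "e > 0" for e :: real
  proof -
    obtain d0 where d0: "d0 > 0" "\<And>\<epsilon> \<eta> x. mollifier \<epsilon> \<eta> \<Longrightarrow> \<epsilon> \<le> d0 \<Longrightarrow> norm (conv \<eta> \<phi> x - \<phi> x) \<le> e"
      using mollifier_uniform_limit[OF c s e] by metis
    have "\<exists>d>0. \<forall>\<epsilon> \<eta> x. mollifier \<epsilon> \<eta> \<longrightarrow> \<epsilon> \<le> d \<longrightarrow> norm (conv \<eta> (pd \<alpha> \<phi>) x - pd \<alpha> \<phi> x) \<le> e" for \<alpha>
      using mollifier_uniform_limit[OF C1_continuous_partial[OF \<phi>] csupp_partial_deriv[OF s] e] by metis
    then obtain d1 where d1: "\<And>\<alpha>. d1 \<alpha> > 0"
      "\<And>\<alpha> \<epsilon> \<eta> x. mollifier \<epsilon> \<eta> \<Longrightarrow> \<epsilon> \<le> d1 \<alpha> \<Longrightarrow> norm (conv \<eta> (pd \<alpha> \<phi>) x - pd \<alpha> \<phi> x) \<le> e"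
      by metis
    \<comment> \<open>One radius serves the support, the function and its finitely many partial
      derivatives at once.\<close>
    define \<epsilon> where "\<epsilon> = Min (insert d (insert d0 (range d1)))"
    have \<epsilon>: "\<epsilon> > 0" "\<epsilon> \<le> d" "\<epsilon> \<le> d0" "\<And>\<alpha>. \<epsilon> \<le> d1 \<alpha>"
      using T(1) d0(1) d1(1) by (auto simp: \<epsilon>_def min_le_iff_disj)
    obtain \<eta> :: "real^'n \<Rightarrow> real" where \<eta>: "mollifier \<epsilon> \<eta>" using mollifier_exists[OF \<epsilon>(1)] .
    have "csupp \<Omega> (conv \<eta> \<phi>)"
      by (rule csuppI[OF T(2,4)], rule conv_csupp[OF \<eta> \<epsilon>(2) T(5) S(3)])
    then have "test_fun \<Omega> (conv \<eta> \<phi>)"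
      using mollifier_conv_Ck[OF \<eta> i] by (simp add: test_fun_iff del: Ck_fun.simps)
    then show ?thesis
      using d0(2)[OF \<eta> \<epsilon>(3)] d1(2)[OF \<eta> \<epsilon>(4)] mollifier_conv_partial[OF \<eta> \<phi> s]
      by (intro exI[of _ "conv \<eta> \<phi>"]) auto
  qed
  then have "\<exists>\<xi>. test_fun \<Omega> \<xi> \<and> (\<forall>x. \<bar>\<xi> x - \<phi> x\<bar> \<le> 1 / Suc j) \<and> (\<forall>\<alpha> x. \<bar>pd \<alpha> \<xi> x - pd \<alpha> \<phi> x\<bar> \<le> 1 / Suc j)" for j
    by simp
  then show thesis using that by metis
qed

lemma integral_uniform_limit:
  fixes h :: "'a \<Rightarrow> real"
  assumes h: "integrable \<mu> h" and m: "\<phi> \<in> borel_measurable \<mu>" "\<And>j. \<phi>s j \<in> borel_measurable \<mu>"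
    and b: "\<And>x. \<bar>\<phi> x\<bar> \<le> B" and u: "\<And>j x. \<bar>\<phi>s j x - \<phi> x\<bar> \<le> 1 / Suc j"
  shows "(\<lambda>j. \<integral>x. h x * \<phi>s j x \<partial>\<mu>) \<longlonglongrightarrow> (\<integral>x. h x * \<phi> x \<partial>\<mu>)"
proof (rule integral_dominated_convergence[where w = "\<lambda>x. \<bar>h x\<bar> * (\<bar>B\<bar> + 1)"])
  show "AE x in \<mu>. (\<lambda>j. h x * \<phi>s j x) \<longlonglongrightarrow> h x * \<phi> x"
  proof (rule AE_I2, rule tendsto_mult_left)
    fix x
    have "(\<lambda>j. \<phi>s j x - \<phi> x) \<longlonglongrightarrow> 0"
      by (rule Lim_null_comparison[OF _ LIMSEQ_inverse_real_of_nat])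
        (use u in \<open>auto simp: inverse_eq_divide\<close>)
    then show "(\<lambda>j. \<phi>s j x) \<longlonglongrightarrow> \<phi> x" by (simp add: LIM_zero_iff)
  qed
  show "AE x in \<mu>. norm (h x * \<phi>s j x) \<le> \<bar>h x\<bar> * (\<bar>B\<bar> + 1)" for j
  proof (rule AE_I2)
    fix x
    have "1 / real (Suc j) \<le> 1" by simp
    then have "\<bar>\<phi>s j x\<bar> \<le> \<bar>B\<bar> + 1" using u[of j x] b[of x] by linarith
    then show "norm (h x * \<phi>s j x) \<le> \<bar>h x\<bar> * (\<bar>B\<bar> + 1)" by (simp add: abs_mult mult_left_mono)
  qed
qed (use h m in auto)

section \<open>Continuity of translations in the square mean\<close>

lemma norm_sum3_sq:
  fixes a b c :: "'a::real_normed_vector"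
  shows "(norm (a + b + c))\<^sup>2 \<le> 3 * ((norm a)\<^sup>2 + (norm b)\<^sup>2 + (norm c)\<^sup>2)"
proof -
  have "norm (a + b + c) \<le> norm a + norm b + norm c"
    by (meson norm_triangle_ineq norm_triangle_mono order_refl order_trans add_mono)
  then have "(norm (a + b + c))\<^sup>2 \<le> (norm a + norm b + norm c)\<^sup>2" by (intro power_mono) auto
  also have "\<dots> \<le> 3 * ((norm a)\<^sup>2 + (norm b)\<^sup>2 + (norm c)\<^sup>2)"
    using sum_squares_bound[of "norm a" "norm b"] sum_squares_bound[of "norm a" "norm c"] sum_squares_bound[of "norm b" "norm c"]
    by (simp add: power2_eq_square algebra_simps)
  finally show ?thesis .
qed

text \<open>First w is truncated by projecting its values onto a ball of radius M, which is harmless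
  for large M. For functions with values in that ball, closeness in the mean implies closeness in
  the square mean.\<close>

lemma csupp_dense_sq:
  fixes w :: "'a::euclidean_space \<Rightarrow> 'b::euclidean_space"
  assumes wm[measurable]: "w \<in> borel_measurable borel" and w2: "L1 (\<lambda>x. (norm (w x))\<^sup>2)"
    and off: "\<And>x. x \<notin> \<Omega> \<Longrightarrow> w x = 0" and op: "open \<Omega>" and bd: "bounded \<Omega>" and "e > 0"
  obtains \<phi> where "continuous_on UNIV \<phi>" "csupp \<Omega> \<phi>"
    "L1 (\<lambda>x. (norm (\<phi> x - w x))\<^sup>2)" "(LBINT x. (norm (\<phi> x - w x))\<^sup>2) < e"
proof -
  define t where "t M x = closest_point (cball 0 (real M)) (w x)" for M x
  have ne: "cball (0::'b) (real M) \<noteq> {}" for M by simp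
  have tm[measurable]: "t M \<in> borel_measurable borel" for M
    unfolding t_def[abs_def]
    by (rule measurable_compose[OF wm borel_measurable_continuous_onI[OF continuous_on_closest_point]]) auto
  have tle: "norm (t M x) \<le> real M" for M x
    using closest_point_in_set[OF closed_cball ne, of M "w x"] by (simp add: t_def)
  have tw: "norm (t M x) \<le> norm (w x)" for M x
    using closest_point_lipschitz[OF convex_cball closed_cball ne, of M "w x" 0] closest_point_self[of 0 "cball (0::'b) (real M)"]
    by (simp add: t_def dist_norm)
  have toff: "t M x = 0" if "x \<notin> \<Omega>" for M x using tw[of M x] off[OF that] by simp
  have teq: "t M x = w x" if "norm (w x) \<le> real M" for M x
    using that by (simp add: t_def closest_point_self)
  have "(\<lambda>M. LBINT x. (norm (t M x - w x))\<^sup>2) \<longlonglongrightarrow> integral\<^sup>L lborel (\<lambda>x::'a. 0::real)"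
  proof (rule integral_dominated_convergence[where w = "\<lambda>x. 4 * (norm (w x))\<^sup>2"])
    show "AE x in lborel. (\<lambda>M. (norm (t M x - w x))\<^sup>2) \<longlonglongrightarrow> 0"
    proof (rule AE_I2, rule tendsto_eventually)
      fix x
      obtain M0 where "norm (w x) \<le> real M0" using real_arch_simple by blast
      then have "(norm (t M x - w x))\<^sup>2 = 0" if "M \<ge> M0" for M using teq[of x M] that by simp
      then show "\<forall>\<^sub>F M in sequentially. (norm (t M x - w x))\<^sup>2 = 0"
        by (auto simp: eventually_sequentially)
    qed
    show "AE x in lborel. norm ((norm (t M x - w x))\<^sup>2) \<le> 4 * (norm (w x))\<^sup>2" for M
    proof (rule AE_I2)
      fix x
      have "norm (t M x - w x) \<le> 2 * norm (w x)" using norm_triangle_ineq4[of "t M x" "w x"] tw[of M x] by simp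
      then have "(norm (t M x - w x))\<^sup>2 \<le> (2 * norm (w x))\<^sup>2" by (intro power_mono) auto
      then show "norm ((norm (t M x - w x))\<^sup>2) \<le> 4 * (norm (w x))\<^sup>2" by (simp add: power_mult_distrib)
    qed
  qed (use w2 in auto)
  then have "\<forall>\<^sub>F M in sequentially. (LBINT x. (norm (t M x - w x))\<^sup>2) < e / 4"
    using \<open>e > 0\<close> by (intro order_tendstoD(2)) auto
  then obtain M where M: "(LBINT x. (norm (t M x - w x))\<^sup>2) < e / 4" "M \<ge> 1"
    using eventually_conj[OF _ eventually_ge_at_top[of 1]] by (metis (mono_tags, lifting) eventually_happens' sequentially_bot)
  define \<mu> where "\<mu> = density lborel (indicator \<Omega> :: 'a \<Rightarrow> ennreal)"
  have Om[measurable]: "\<Omega> \<in> sets borel" using op by auto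
  have sb: "sets \<mu> = sets borel" by (simp add: \<mu>_def)
  have fin: "emeasure \<mu> UNIV < \<infinity>"
    using emeasure_bounded_finite[OF bd] by (simp add: \<mu>_def emeasure_density)
  have \<mu>i: "(\<integral>x. f x \<partial>\<mu>) = (LBINT x. f x)" "integrable \<mu> f \<longleftrightarrow> L1 f"
    if [measurable]: "f \<in> borel_measurable borel" and "\<And>x. x \<notin> \<Omega> \<Longrightarrow> f x = 0" for f :: "'a \<Rightarrow> real"
  proof -
    have *: "(\<lambda>x. indicator \<Omega> x * f x) = f" using that(2) by (auto simp: indicator_def fun_eq_iff)
    have d: "\<mu> = density lborel (\<lambda>x. ennreal (indicator \<Omega> x))" by (simp add: \<mu>_def ennreal_indicator)
    show "(\<integral>x. f x \<partial>\<mu>) = (LBINT x. f x)" unfolding d by (subst integral_density) (auto simp: *)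
    show "integrable \<mu> f \<longleftrightarrow> L1 f" unfolding d by (subst integrable_density) (auto simp: *)
  qed
  interpret finite_measure \<mu> by (rule finite_measureI) (use fin in \<open>auto simp: \<mu>_def\<close>)
  have it: "integrable \<mu> (t M)"
    using tle[of M] by (intro integrable_const_bound[of _ M]) (auto simp: measurable_cong_sets[OF sb refl])
  \<comment> \<open>For two functions with values in the ball of radius M the squared difference is
    at most 2 M times the difference, so this error yields e/4. Together with the truncation error,
    also below e/4 and both doubled, it stays below e.\<close>
  have e8: "e / (8 * M) > 0" using \<open>e > 0\<close> M(2) by simp
  obtain \<phi> where \<phi>: "continuous_on UNIV \<phi>" "csupp \<Omega> \<phi>" "\<And>x. \<phi> x \<in> cball 0 (real M)"
    "(\<integral>x. norm (\<phi> x - t M x) \<partial>\<mu>) < e / (8 * M)"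
    by (rule csupp_dense[OF sb fin op it closed_cball convex_cball _ _ toff e8, of 0 "real M"]) (use tle in auto)
  have [measurable]: "\<phi> \<in> borel_measurable borel" using \<phi>(1) by (rule cont_borel)
  have \<phi>off: "\<phi> x = 0" if "x \<notin> \<Omega>" for x using \<phi>(2) that by (auto simp: csupp_def)
  have i1: "integrable \<mu> (\<lambda>x. norm (\<phi> x - t M x))"
    by (intro integrable_norm integrable_diff it csupp_integrable_finite[OF sb fin \<phi>(1,2)])
  then have i1': "L1 (\<lambda>x. norm (\<phi> x - t M x))"
    using \<mu>i(2)[of "\<lambda>x. norm (\<phi> x - t M x)"] \<phi>off toff by simp
  have I1: "(LBINT x. norm (\<phi> x - t M x)) < e / (8 * M)"
    using \<mu>i(1)[of "\<lambda>x. norm (\<phi> x - t M x)"] \<phi>off toff \<phi>(4) by simp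
  have sq: "(norm (\<phi> x - t M x))\<^sup>2 \<le> (2 * M) * norm (\<phi> x - t M x)" for x
  proof -
    have "norm (\<phi> x - t M x) \<le> 2 * M"
      using norm_triangle_ineq4[of "\<phi> x" "t M x"] \<phi>(3)[of x] tle[of M x] by simp
    then show ?thesis by (simp add: power2_eq_square mult_right_mono)
  qed
  have i2: "L1 (\<lambda>x. (norm (\<phi> x - t M x))\<^sup>2)"
    using sq by (intro integrable_bound[OF integrable_mult_right[OF i1', of "2 * M"]]) (auto intro!: order_trans[OF sq])
  have "(LBINT x. (norm (\<phi> x - t M x))\<^sup>2) \<le> (LBINT x. (2 * M) * norm (\<phi> x - t M x))"
    by (rule integral_mono[OF i2 _ sq]) (use i1' in auto)
  also have "\<dots> = (2 * M) * (LBINT x. norm (\<phi> x - t M x))" by simp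
  also have "\<dots> < (2 * M) * (e / (8 * M))" using M(2) by (intro mult_strict_left_mono I1) auto
  also have "\<dots> = e / 4" using M(2) by simp
  finally have I2: "(LBINT x. (norm (\<phi> x - t M x))\<^sup>2) < e / 4" .
  have i3: "L1 (\<lambda>x. (norm (t M x - w x))\<^sup>2)"
  proof (rule integrable_bound[of _ "\<lambda>x. 4 * (norm (w x))\<^sup>2"])
    show "AE x in lborel. norm ((norm (t M x - w x))\<^sup>2) \<le> norm (4 * (norm (w x))\<^sup>2)"
    proof (rule AE_I2)
      fix x
      have "norm (t M x - w x) \<le> 2 * norm (w x)" using norm_triangle_ineq4[of "t M x" "w x"] tw[of M x] by simp
      then have "(norm (t M x - w x))\<^sup>2 \<le> (2 * norm (w x))\<^sup>2" by (intro power_mono) auto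
      then show "norm ((norm (t M x - w x))\<^sup>2) \<le> norm (4 * (norm (w x))\<^sup>2)" by (simp add: power_mult_distrib)
    qed
  qed (use w2 in auto)
  have le: "(norm (\<phi> x - w x))\<^sup>2 \<le> 2 * (norm (\<phi> x - t M x))\<^sup>2 + 2 * (norm (t M x - w x))\<^sup>2" for x
  proof -
    have "(norm (\<phi> x - w x))\<^sup>2 \<le> (norm (\<phi> x - t M x) + norm (t M x - w x))\<^sup>2"
      using norm_triangle_ineq[of "\<phi> x - t M x" "t M x - w x"] by (intro power_mono) auto
    then show ?thesis using sum_squares_bound[of "norm (\<phi> x - t M x)" "norm (t M x - w x)"] by (simp add: power2_sum)
  qed
  have i4: "L1 (\<lambda>x. (norm (\<phi> x - w x))\<^sup>2)"
    by (rule integrable_bound[of _ "\<lambda>x. 2 * (norm (\<phi> x - t M x))\<^sup>2 + 2 * (norm (t M x - w x))\<^sup>2"])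
      (use i2 i3 le in \<open>auto\<close>)
  have "(LBINT x. (norm (\<phi> x - w x))\<^sup>2) \<le> (LBINT x. 2 * (norm (\<phi> x - t M x))\<^sup>2 + 2 * (norm (t M x - w x))\<^sup>2)"
    by (rule integral_mono[OF i4 _ le]) (use i2 i3 in auto)
  also have "\<dots> < e" using i2 i3 I2 M(1) by simp
  finally show thesis by (rule that[OF \<phi>(1,2) i4])
qed

lemma translation_continuous_sq:
  fixes w :: "'a::euclidean_space \<Rightarrow> 'b::euclidean_space"
  assumes wm[measurable]: "w \<in> borel_measurable borel" and w2: "L1 (\<lambda>x. (norm (w x))\<^sup>2)"
    and off: "\<And>x. x \<notin> \<Omega> \<Longrightarrow> w x = 0" and op: "open \<Omega>" and bd: "bounded \<Omega>" and "e > 0"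
  obtains d where "d > 0" "\<And>z. norm z < d \<Longrightarrow> L1 (\<lambda>x. (norm (w (x + z) - w x))\<^sup>2)"
    "\<And>z. norm z < d \<Longrightarrow> (LBINT x. (norm (w (x + z) - w x))\<^sup>2) \<le> e"
proof -
  \<comment> \<open>In 3 (|a|^2 + |b|^2 + |c|^2) the two approximation terms cost e/12 each and the
    translation of the continuous function e/6, in total e.\<close>
  have e12: "e / 12 > 0" using \<open>e > 0\<close> by simp
  obtain \<phi> where \<phi>: "continuous_on UNIV \<phi>" "csupp \<Omega> \<phi>"
    "L1 (\<lambda>x. (norm (\<phi> x - w x))\<^sup>2)" "(LBINT x. (norm (\<phi> x - w x))\<^sup>2) < e / 12"
    by (rule csupp_dense_sq[OF wm w2 off op bd e12])
  have [measurable]: "\<phi> \<in> borel_measurable borel" using \<phi>(1) by (rule cont_borel)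
  obtain S where S: "compact S" "S \<subseteq> \<Omega>" "\<And>x. x \<notin> S \<Longrightarrow> \<phi> x = 0" using \<phi>(2) by (auto simp: csupp_def)
  obtain d0 T where T: "d0 > 0" "compact T" "S \<subseteq> T" "\<And>x y. x \<notin> T \<Longrightarrow> dist x y \<le> d0 \<Longrightarrow> y \<notin> S"
    using csupp_enlarge[OF S(1) subset_UNIV open_UNIV] by metis
  have [measurable]: "T \<in> sets borel" using T(2) by (simp add: borel_compact)
  have iT: "L1 (indicator T :: _ \<Rightarrow> real)"
    using emeasure_compact_finite[OF T(2)] by (simp add: less_top)
  define m where "m = measure lborel T + 1"
  have m: "m > 0" by (simp add: m_def add_nonneg_pos)
  define r where "r = sqrt (e / 6 / m)"
  have r: "r > 0" "r\<^sup>2 = e / 6 / m" using m \<open>e > 0\<close> by (auto simp: r_def)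
  obtain d1 where d1: "d1 > 0" "\<And>a b. dist b a < d1 \<Longrightarrow> dist (\<phi> b) (\<phi> a) < r"
    using csupp_uniformly_continuous[OF \<phi>(1,2)] r(1) unfolding uniformly_continuous_on_def by (metis UNIV_I)
  show thesis
  proof (rule that[of "min d0 d1"])
    fix z :: 'a assume z: "norm z < min d0 d1"
    have mid: "(norm (\<phi> (x + z) - \<phi> x))\<^sup>2 \<le> (e / 6 / m) * indicator T x" for x
    proof (cases "x \<in> T")
      case True
      have "norm (\<phi> (x + z) - \<phi> x) \<le> r" using d1(2)[of "x + z" x] z by (simp add: dist_norm)
      then have "(norm (\<phi> (x + z) - \<phi> x))\<^sup>2 \<le> r\<^sup>2" by (intro power_mono) auto
      then show ?thesis using True r(2) by simp
    next
      case False
      then have "x + z \<notin> S" "x \<notin> S" using T(4)[OF False, of "x + z"] T(3) z by (auto simp: dist_norm)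
      then show ?thesis using S(3) False by simp
    qed
    have i2: "L1 (\<lambda>x. (norm (\<phi> (x + z) - \<phi> x))\<^sup>2)"
      by (rule integrable_bound[OF integrable_mult_right[OF iT, of "e / 6 / m"]])
        (use mid \<open>e > 0\<close> m in \<open>auto simp: abs_mult\<close>)
    have "(LBINT x. (norm (\<phi> (x + z) - \<phi> x))\<^sup>2) \<le> (LBINT x. (e / 6 / m) * indicator T x)"
      by (rule integral_mono[OF i2 _ mid]) (use iT in auto)
    also have "\<dots> = (e / 6 / m) * measure lborel T" by simp
    also have "\<dots> \<le> (e / 6 / m) * m" using \<open>e > 0\<close> m by (intro mult_left_mono) (auto simp: m_def)
    also have "\<dots> = e / 6" using m by simp
    finally have I2: "(LBINT x. (norm (\<phi> (x + z) - \<phi> x))\<^sup>2) \<le> e / 6" .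
    have i1: "L1 (\<lambda>x. (norm (\<phi> (x + z) - w (x + z)))\<^sup>2)"
      and I1: "(LBINT x. (norm (\<phi> (x + z) - w (x + z)))\<^sup>2) < e / 12"
      using integrable_shift[of "\<lambda>x. (norm (\<phi> x - w x))\<^sup>2" z] integral_shift[of "\<lambda>x. (norm (\<phi> x - w x))\<^sup>2" z] \<phi>(3,4) by auto
    have le: "(norm (w (x + z) - w x))\<^sup>2 \<le> 3 * ((norm (\<phi> (x + z) - w (x + z)))\<^sup>2 + (norm (\<phi> (x + z) - \<phi> x))\<^sup>2 + (norm (\<phi> x - w x))\<^sup>2)" for x
      using norm_sum3_sq[of "w (x + z) - \<phi> (x + z)" "\<phi> (x + z) - \<phi> x" "\<phi> x - w x"] by (simp add: norm_minus_commute)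
    show i: "L1 (\<lambda>x. (norm (w (x + z) - w x))\<^sup>2)"
      by (rule integrable_bound[of _ "\<lambda>x. 3 * ((norm (\<phi> (x + z) - w (x + z)))\<^sup>2 + (norm (\<phi> (x + z) - \<phi> x))\<^sup>2 + (norm (\<phi> x - w x))\<^sup>2)"])
        (use i1 i2 \<phi>(3) le in auto)
    have "(LBINT x. (norm (w (x + z) - w x))\<^sup>2)
      \<le> (LBINT x. 3 * ((norm (\<phi> (x + z) - w (x + z)))\<^sup>2 + (norm (\<phi> (x + z) - \<phi> x))\<^sup>2 + (norm (\<phi> x - w x))\<^sup>2))"
      by (rule integral_mono[OF i _ le]) (use i1 i2 \<phi>(3) in auto)
    also have "\<dots> \<le> e" using i1 i2 \<phi>(3,4) I1 I2 by simp
    finally show "(LBINT x. (norm (w (x + z) - w x))\<^sup>2) \<le> e" .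
  qed (use T d1 in auto)
qed

section \<open>A space-filling curve and weak compactness of measures\<close>

text \<open>A continuous 2-periodic profile, 0 on [0, 1/3] and 1 on [2/3, 1], as in Schoenberg's
  curve; a clipped cosine takes the place of the usual piecewise linear function.\<close>

definition sch_p :: "real \<Rightarrow> real" where
  "sch_p t = max 0 (min 1 (1 / 2 - cos (pi * t)))"

lemma sch_p_bounds: "0 \<le> sch_p t" "sch_p t \<le> 1"
  by (auto simp: sch_p_def)

lemma sch_p_periodic: "sch_p (2 * of_int N + t) = sch_p t"
proof -
  have "pi * (2 * of_int N + t) = 2 * pi * of_int N + pi * t" by (simp add: algebra_simps)
  then have "cos (pi * (2 * of_int N + t)) = cos (pi * t)"
    by (simp add: cos_add cos_int_2pin sin_int_2pin)
  then show ?thesis by (simp add: sch_p_def)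
qed

lemma sch_p_0: "0 \<le> t \<Longrightarrow> t \<le> 1 / 3 \<Longrightarrow> sch_p t = 0"
proof -
  assume "0 \<le> t" "t \<le> 1 / 3"
  then have "cos (pi / 3) \<le> cos (pi * t)" by (intro cos_monotone_0_pi_le) auto
  then show ?thesis by (simp add: sch_p_def cos_60)
qed

lemma sch_p_1: "2 / 3 \<le> t \<Longrightarrow> t \<le> 1 \<Longrightarrow> sch_p t = 1"
proof -
  assume "2 / 3 \<le> t" "t \<le> 1"
  then have "cos (pi * t) \<le> cos (2 * pi / 3)" by (intro cos_monotone_0_pi_le) auto
  then show ?thesis by (simp add: sch_p_def cos_120)
qed

text \<open>Multiplying by 3^m moves the first m digits into an even integer, which periodicity
  removes. The rest lies in [0, 1/3] or in [2/3, 1] according to the next digit, since the later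
  digits contribute at most 1/3.\<close>

lemma ternary_digit:
  fixes a :: "nat \<Rightarrow> int"
  assumes a: "\<And>m. a m \<in> {0, 1}"
  defines "t \<equiv> \<Sum>m. 2 * real_of_int (a m) / 3 ^ Suc m"
  shows "sch_p (3 ^ m * t) = of_int (a m)" "0 \<le> t" "t \<le> 1"
proof -
  let ?f = "\<lambda>m. 2 * real_of_int (a m) / 3 ^ Suc m"
  have geo: "(\<lambda>m. 2 / 3 ^ Suc m :: real) sums 1"
    using sums_mult[OF geometric_sums[of "1/3::real"], of "2/3"] by (simp add: power_one_over field_simps)
  have a1: "0 \<le> real_of_int (a m)" "real_of_int (a m) \<le> 1" for m using a[of m] by auto
  have s: "summable (\<lambda>m. 2 * real_of_int (b m) / 3 ^ Suc m)"
    and b: "0 \<le> (\<Sum>m. 2 * real_of_int (b m) / 3 ^ Suc m)" "(\<Sum>m. 2 * real_of_int (b m) / 3 ^ Suc m) \<le> 1"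
    if "\<And>m. b m \<in> {0, 1}" for b :: "nat \<Rightarrow> int"
  proof -
    have b1: "0 \<le> real_of_int (b m)" "real_of_int (b m) \<le> 1" for m using that[of m] by auto
    show s: "summable (\<lambda>m. 2 * real_of_int (b m) / 3 ^ Suc m)"
      by (rule summable_comparison_test[OF _ sums_summable[OF geo]]) (use b1 in \<open>auto intro!: divide_right_mono\<close>)
    show "0 \<le> (\<Sum>m. 2 * real_of_int (b m) / 3 ^ Suc m)" using b1 by (intro suminf_nonneg s) auto
    have "(\<Sum>m. 2 * real_of_int (b m) / 3 ^ Suc m) \<le> (\<Sum>m. 2 / 3 ^ Suc m)"
      using b1 by (intro suminf_le s sums_summable[OF geo]) (auto intro!: divide_right_mono)
    then show "(\<Sum>m. 2 * real_of_int (b m) / 3 ^ Suc m) \<le> 1" using sums_unique[OF geo] by simp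
  qed
  show "0 \<le> t" "t \<le> 1" unfolding t_def using b[OF a] by auto
  define \<tau> where "\<tau> = (\<Sum>l. 2 * real_of_int (a (l + m)) / 3 ^ Suc l)"
  define \<rho> where "\<rho> = (\<Sum>l. 2 * real_of_int (a (Suc l + m)) / 3 ^ Suc l)"
  have \<rho>: "0 \<le> \<rho>" "\<rho> \<le> 1" unfolding \<rho>_def using b[of "\<lambda>l. a (Suc l + m)"] a by auto
  have "\<tau> = (\<Sum>l. 2 * real_of_int (a (Suc l + m)) / 3 ^ Suc (Suc l)) + 2 * real_of_int (a m) / 3"
    unfolding \<tau>_def using suminf_split_head[OF s[of "\<lambda>l. a (l + m)"]] a by simp
  also have "(\<Sum>l. 2 * real_of_int (a (Suc l + m)) / 3 ^ Suc (Suc l)) = (\<Sum>l. (2 * real_of_int (a (Suc l + m)) / 3 ^ Suc l) / 3)"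
    by (simp add: mult.commute)
  also have "\<dots> = \<rho> / 3" unfolding \<rho>_def using a by (intro suminf_divide s) auto
  finally have \<tau>: "\<tau> = \<rho> / 3 + 2 * real_of_int (a m) / 3" .
  \<comment> \<open>Half of the integer formed by the first m ternary digits; these digits are 0 or
    2, so the integer is even.\<close>
  define N where "N = (\<Sum>l<m. a l * 3 ^ (m - Suc l))"
  have "t = (\<Sum>l. ?f (l + m)) + (\<Sum>l<m. ?f l)"
    unfolding t_def by (rule suminf_split_initial_segment[OF s[OF a]])
  also have "(\<Sum>l. ?f (l + m)) = (\<Sum>l. (2 * real_of_int (a (l + m)) / 3 ^ Suc l) / 3 ^ m)"
    by (intro suminf_cong) (simp add: power_add field_simps)
  also have "\<dots> = \<tau> / 3 ^ m" unfolding \<tau>_def using a by (intro suminf_divide s) auto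
  finally have "3 ^ m * t = \<tau> + 3 ^ m * (\<Sum>l<m. ?f l)" by (simp add: field_simps)
  also have "3 ^ m * (\<Sum>l<m. ?f l) = 2 * of_int N"
  proof -
    have "3 ^ m * ?f l = 2 * (real_of_int (a l) * 3 ^ (m - Suc l))" if "l < m" for l
      using that power_add[of "3::real" "m - Suc l" "Suc l"] by (simp add: field_simps)
    then show ?thesis unfolding N_def sum_distrib_left of_int_sum by (intro sum.cong) auto
  qed
  finally have "sch_p (3 ^ m * t) = sch_p \<tau>" using sch_p_periodic[of N \<tau>] by (simp add: add.commute)
  also have "\<dots> = of_int (a m)"
    using a[of m] \<rho> sch_p_0[of \<tau>] sch_p_1[of \<tau>] unfolding \<tau> by auto
  finally show "sch_p (3 ^ m * t) = of_int (a m)" .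
qed

text \<open>The partial sums are floor(2^N y) / 2^N. The value 1 is excluded because all digits
  given by this formula would be 0 there.\<close>

lemma binary_expansion:
  fixes y :: real
  assumes "0 \<le> y" "y < 1"
  shows "(\<lambda>k. real_of_int (\<lfloor>2 ^ Suc k * y\<rfloor> mod 2) / 2 ^ Suc k) sums y"
proof -
  have fl: "\<lfloor>2 * x\<rfloor> div 2 = \<lfloor>x\<rfloor>" for x :: real by linarith
  have part: "(\<Sum>k<N. real_of_int (\<lfloor>2 ^ Suc k * y\<rfloor> mod 2) / 2 ^ Suc k) = real_of_int \<lfloor>2 ^ N * y\<rfloor> / 2 ^ N" for N
  proof (induction N)
    case 0
    have "\<lfloor>y\<rfloor> = 0" using assms by linarith
    then show ?case by simp
  next
    case (Suc N)
    have "\<lfloor>2 ^ Suc N * y\<rfloor> = 2 * \<lfloor>2 ^ N * y\<rfloor> + \<lfloor>2 ^ Suc N * y\<rfloor> mod 2"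
      using fl[of "2 ^ N * y"] mult_div_mod_eq[of 2 "\<lfloor>2 ^ Suc N * y\<rfloor>"] by (simp add: mult.assoc)
    then have "real_of_int \<lfloor>2 ^ Suc N * y\<rfloor> = 2 * real_of_int \<lfloor>2 ^ N * y\<rfloor> + real_of_int (\<lfloor>2 ^ Suc N * y\<rfloor> mod 2)"
      by (metis of_int_add of_int_mult of_int_numeral)
    then show ?case using Suc by (simp add: field_simps)
  qed
  have "(\<lambda>N. real_of_int \<lfloor>2 ^ N * y\<rfloor> / 2 ^ N) \<longlonglongrightarrow> y"
  proof (rule Lim_null[THEN iffD2], rule Lim_null_comparison)
    show "\<forall>\<^sub>F N in sequentially. norm (real_of_int \<lfloor>2 ^ N * y\<rfloor> / 2 ^ N - y) \<le> (1 / 2) ^ N"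
    proof (rule always_eventually, rule allI)
      fix N
      have "\<bar>real_of_int \<lfloor>2 ^ N * y\<rfloor> - 2 ^ N * y\<bar> \<le> 1" by linarith
      then have "\<bar>real_of_int \<lfloor>2 ^ N * y\<rfloor> - 2 ^ N * y\<bar> / 2 ^ N \<le> 1 / 2 ^ N" by (intro divide_right_mono) auto
      moreover have "real_of_int \<lfloor>2 ^ N * y\<rfloor> / 2 ^ N - y = (real_of_int \<lfloor>2 ^ N * y\<rfloor> - 2 ^ N * y) / 2 ^ N"
        by (simp add: field_simps)
      ultimately show "norm (real_of_int \<lfloor>2 ^ N * y\<rfloor> / 2 ^ N - y) \<le> (1 / 2) ^ N"
        by (simp add: power_one_over)
    qed
  qed (simp add: LIMSEQ_realpow_zero)
  then show ?thesis unfolding sums_def part .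
qed

text \<open>Schoenberg's curve; its parameter carries the binary digits of all coordinates as ternary digits.\<close>

lemma space_filling_curve:
  assumes "R > 0"
  obtains s :: "real \<Rightarrow> real^'n" where "continuous_on UNIV s" "bounded (range s)" "ball 0 R \<subseteq> s ` {0..1}"
proof -
  \<comment> \<open>The pairing function gives digit k of coordinate i a position of its
    own.\<close>
  define c where "c t = (\<chi> i::'n. \<Sum>k. sch_p (3 ^ prod_encode (k, to_nat i) * t) / 2 ^ Suc k)" for t
  have geo: "(\<lambda>k. 1 / 2 ^ Suc k :: real) sums 1"
    using sums_mult[OF geometric_sums[of "1/2::real"], of "1/2"] by (simp add: power_one_over field_simps)
  have cont: "continuous_on UNIV c"
    unfolding c_def[abs_def]
  proof (rule continuous_on_vec_lambda)
    fix i :: 'n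
    have "uniform_limit UNIV (\<lambda>N t. \<Sum>k<N. sch_p (3 ^ prod_encode (k, to_nat i) * t) / 2 ^ Suc k)
        (\<lambda>t. \<Sum>k. sch_p (3 ^ prod_encode (k, to_nat i) * t) / 2 ^ Suc k) sequentially"
      by (rule Weierstrass_m_test[OF _ sums_summable[OF geo]])
        (auto simp: sch_p_bounds abs_of_nonneg intro!: divide_right_mono)
    then show "continuous_on UNIV (\<lambda>t. \<Sum>k. sch_p (3 ^ prod_encode (k, to_nat i) * t) / 2 ^ Suc k)"
      by (rule uniform_limit_theorem[rotated]) (auto simp: sch_p_def intro!: continuous_intros always_eventually)
  qed
  have c01: "0 \<le> c t $ i" "c t $ i \<le> 1" for t i
  proof -
    have s: "summable (\<lambda>k. sch_p (3 ^ prod_encode (k, to_nat i) * t) / 2 ^ Suc k)"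
      by (rule summable_comparison_test[OF _ sums_summable[OF geo]])
        (auto simp: sch_p_bounds abs_of_nonneg intro!: divide_right_mono)
    show "0 \<le> c t $ i" unfolding c_def by (auto intro!: suminf_nonneg s simp: sch_p_bounds simp del: power_Suc)
    have "c t $ i \<le> (\<Sum>k. 1 / 2 ^ Suc k)"
      unfolding c_def by (auto intro!: suminf_le s sums_summable[OF geo] divide_right_mono simp: sch_p_bounds simp del: power_Suc)
    then show "c t $ i \<le> 1" using sums_unique[OF geo] by simp
  qed
  have surj: "\<exists>t\<in>{0..1}. c t = y" if y: "\<And>i. 0 \<le> y $ i" "\<And>i. y $ i < 1" for y :: "real^'n"
  proof -
    define a where "a m = (case prod_decode m of (k, j) \<Rightarrow> \<lfloor>2 ^ Suc k * y $ (from_nat j :: 'n)\<rfloor> mod 2)" for m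
    have a: "a m \<in> {0, 1}" for m by (auto simp: a_def split: prod.split)
    let ?t = "\<Sum>m. 2 * real_of_int (a m) / 3 ^ Suc m"
    have "c ?t $ i = y $ i" for i
      unfolding c_def vec_lambda_beta ternary_digit(1)[OF a]
      using binary_expansion[OF y, of i] by (simp add: a_def sums_iff del: power_Suc)
    then have "c ?t = y" by (simp add: vec_eq_iff)
    then show ?thesis using ternary_digit(2,3)[OF a] by (intro bexI[of _ ?t]) auto
  qed
  \<comment> \<open>This stretches the unit cube to a cube of half side R. Points of the open ball
    have rescaled coordinates strictly below 1, as the binary expansion requires.\<close>
  define s where "s t = (\<chi> i. 2 * R * c t $ i - R)" for t
  have "continuous_on UNIV s"
    unfolding s_def[abs_def] by (intro continuous_on_vec_lambda continuous_intros cont)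
  moreover have "bounded (range s)"
  proof -
    have "\<bar>s t $ i\<bar> \<le> R" for t i
      using c01[of t i] assms mult_left_mono[of "c t $ i" 1 "2 * R"] mult_left_mono[of 0 "c t $ i" "2 * R"] by (auto simp: s_def abs_le_iff)
    then have "s t \<in> cbox (- (\<chi> i. R)) (\<chi> i. R)" for t
      by (auto simp: mem_box_cart abs_le_iff) (metis minus_le_iff)
    then show ?thesis using bounded_subset[OF bounded_cbox] by blast
  qed
  moreover have "ball 0 R \<subseteq> s ` {0..1}"
  proof
    fix x :: "real^'n" assume "x \<in> ball 0 R"
    then have "\<bar>x $ i\<bar> < R" for i using component_le_norm_cart[of x i] by simp
    then have x: "- R < x $ i" "x $ i < R" for i by (auto simp: abs_less_iff minus_less_iff)
    have "\<exists>t\<in>{0..1}. c t = (\<chi> i. (x $ i + R) / (2 * R))"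
    proof (rule surj)
      show "0 \<le> (\<chi> i. (x $ i + R) / (2 * R)) $ i" for i using x(1)[of i] assms by simp
      show "(\<chi> i. (x $ i + R) / (2 * R)) $ i < 1" for i using x(2)[of i] assms by simp
    qed
    then obtain t where "t \<in> {0..1}" "c t = (\<chi> i. (x $ i + R) / (2 * R))" by blast
    then show "x \<in> s ` {0..1}" using assms by (intro image_eqI[of _ _ t]) (auto simp: s_def vec_eq_iff)
  qed
  ultimately show thesis by (rule that)
qed

text \<open>The inverse picks the least preimage, which is attained by compactness. For r \<ge> 0
  its sublevel set is the compact image of an interval together with the complement of the range,
  where the default value 0 is taken; this gives Borel measurability.\<close>

lemma borel_right_inverse:
  fixes s :: "real \<Rightarrow> 'a::euclidean_space"
  assumes c: "continuous_on UNIV s"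
  obtains b where "b \<in> borel_measurable borel" "\<And>x. x \<in> s ` {0..1} \<Longrightarrow> s (b x) = x" "\<And>x. b x \<in> {0..1}"
proof -
  let ?I = "\<lambda>x. {t \<in> {0..1}. s t = x}"
  define b where "b x = (if x \<in> s ` {0..1} then Inf (?I x) else 0)" for x
  have I: "Inf (?I x) \<in> ?I x" if "x \<in> s ` {0..1}" for x
  proof (rule closed_contains_Inf)
    have "closed ({0..1} \<inter> s -` {x})"
      by (intro closed_Int closed_vimage c) auto
    then show "closed (?I x)" by (simp add: vimage_def Int_def)
  qed (use that in auto)
  have lb: "Inf (?I x) \<le> t" if "t \<in> {0..1}" "s t = x" for t x
    using that by (intro cInf_lower) (auto intro!: bdd_belowI[of _ 0])
  have comp: "compact (s ` {0..r})" for r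
    by (intro compact_continuous_image continuous_on_subset[OF c]) auto
  have b01: "b x \<in> {0..1}" for x using I[of x] by (simp add: b_def)
  have "b \<in> borel_measurable borel"
  proof (rule borel_measurableI_le)
    fix r
    have "{x \<in> space borel. b x \<le> r} = (if r < 0 then {} else - (s ` {0..1}) \<union> s ` {0..min r 1})"
    proof (cases "r < 0")
      case True
      then have "\<not> b x \<le> r" for x using b01[of x] by auto
      then show ?thesis using True by auto
    next
      case False
      have "b x \<le> r \<longleftrightarrow> x \<in> - (s ` {0..1}) \<union> s ` {0..min r 1}" for x
      proof (cases "x \<in> s ` {0..1}")
        case True
        have "x \<in> s ` {0..min r 1}" if "b x \<le> r" using I[OF True] that True by (auto simp: b_def image_iff intro!: bexI[of _ "Inf (?I x)"])
        moreover have "b x \<le> r" if "x \<in> s ` {0..min r 1}" using that lb True by (force simp: b_def)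
        ultimately show ?thesis using True by auto
      qed (use False in \<open>auto simp: b_def\<close>)
      then show ?thesis using False by auto
    qed
    then show "{x \<in> space borel. b x \<le> r} \<in> sets borel"
      using borel_compact[OF comp[of 1]] borel_compact[OF comp[of "min r 1"]]
      by (auto intro!: sets.Un borel_comp simp del: Compl_iff)
  qed
  moreover have "s (b x) = x" if "x \<in> s ` {0..1}" for x using I[OF that] that by (simp add: b_def)
  ultimately show thesis using b01 by (rule that)
qed

text \<open>The measures are pushed to the real line by a Borel right inverse of the curve, where Helly's
  theorem applies, and the limit is pushed back by the (continuous) curve.\<close>

lemma weak_compactness:
  fixes h :: "nat \<Rightarrow> real^'n \<Rightarrow> real"
  assumes i: "\<And>k. L1 (h k)" and nn: "\<And>k x. h k x \<ge> 0"
    and lo: "\<And>k. (LBINT x. h k x) \<ge> 1" and up: "\<And>k. (LBINT x. h k x) \<le> M"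
    and off: "\<And>k x. norm x \<ge> R \<Longrightarrow> h k x = 0"
  shows "\<exists>(r::nat \<Rightarrow> nat) \<mu>. strict_mono r \<and> sets \<mu> = sets borel \<and> emeasure \<mu> UNIV < \<infinity> \<and>
    (\<forall>\<phi>::real^'n \<Rightarrow> real. continuous_on UNIV \<phi> \<longrightarrow> (\<lambda>k. LBINT x. h (r k) x * \<phi> x) \<longlonglongrightarrow> (\<integral>x. \<phi> x \<partial>\<mu>))"
proof -
  have R: "R > 0"
  proof (rule ccontr)
    assume "\<not> R > 0"
    then have "h 0 x = 0" for x using off[of x 0] norm_ge_zero[of x] by linarith
    then show False using lo[of 0] by simp
  qed
  obtain s :: "real \<Rightarrow> real^'n" where s: "continuous_on UNIV s" "bounded (range s)" "ball 0 R \<subseteq> s ` {0..1}"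
    by (rule space_filling_curve[OF R])
  obtain b where b[measurable]: "b \<in> borel_measurable borel" and sb: "\<And>x. x \<in> s ` {0..1} \<Longrightarrow> s (b x) = x"
    and b01: "\<And>x. b x \<in> {0..1}" using borel_right_inverse[OF s(1)] by metis
  have [measurable]: "h k \<in> borel_measurable borel" for k using i[of k] by auto
  have sm[measurable]: "s \<in> borel_measurable borel" using s(1) by (rule cont_borel)
  define m where "m k = (LBINT x. h k x)" for k
  have m: "m k \<ge> 1" "m k \<le> M" "m k > 0" for k using lo[of k] up[of k] by (auto simp: m_def)
  \<comment> \<open>Helly's theorem concerns probability measures, so the mass is divided out. The
    lower bound keeps it positive; the upper bound lets it converge along a subsequence, and the
    limit is multiplied back in.\<close>
  define \<nu> where "\<nu> k = density lborel (\<lambda>x. ennreal (h k x / m k))" for k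
  have p: "prob_space (\<nu> k)" for k
  proof (rule prob_spaceI)
    have "(\<integral>\<^sup>+x. ennreal (h k x / m k) \<partial>lborel) = ennreal (LBINT x. h k x / m k)"
      using i[of k] nn m(3)[of k] by (intro nn_integral_eq_integral) (auto simp: less_imp_le)
    also have "\<dots> = 1" using m(3)[of k] by (simp add: m_def)
    finally show "emeasure (\<nu> k) (space (\<nu> k)) = 1" by (simp add: \<nu>_def emeasure_density)
  qed
  define N where "N k = distr (\<nu> k) borel b" for k
  have bm: "b \<in> measurable (\<nu> k) borel" for k by (simp add: \<nu>_def)
  have pN: "prob_space (N k)" for k unfolding N_def by (rule prob_space.prob_space_distr[OF p bm])
  have rd: "real_distribution (N k)" for k
    unfolding real_distribution_def real_distribution_axioms_def using pN by (simp add: N_def)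
  have t: "tight N" unfolding tight_def
  proof (intro conjI allI impI)
    fix \<epsilon> :: real assume "\<epsilon> > 0"
    \<comment> \<open>The half-open interval of \<open>tight\<close> has to contain 0, a possible
      value of b; hence the left end -1.\<close>
    have "measure (N k) {-1<..1} = 1" for k
    proof -
      have "b -` {-1<..1} \<inter> space (\<nu> k) = space (\<nu> k)" using b01 by (force simp: \<nu>_def)
      then show ?thesis
        unfolding N_def using prob_space.prob_space[OF p] by (subst measure_distr[OF bm]) auto
    qed
    then show "\<exists>a b. a < b \<and> (\<forall>n. 1 - \<epsilon> < measure (N n) {a<..b})"
      using \<open>\<epsilon> > 0\<close> by (intro exI[of _ "-1"] exI[of _ 1]) auto
  qed (rule rd)
  obtain r1 N0 where r1: "strict_mono (r1 :: nat \<Rightarrow> nat)" "real_distribution N0" "weak_conv_m (N \<circ> id \<circ> r1) N0"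
    using tight_imp_convergent_subsubsequence[OF t strict_mono_id] by blast
  have "bounded (range (\<lambda>k. m (r1 k)))" using m by (intro boundedI[of _ M]) (auto simp: abs_of_nonneg less_imp_le)
  then obtain c r2 where r2: "strict_mono (r2 :: nat \<Rightarrow> nat)" "((\<lambda>k. m (r1 k)) \<circ> r2) \<longlonglongrightarrow> c"
    using bounded_imp_convergent_subsequence by blast
  interpret N0: real_distribution N0 by fact
  have c0: "c \<ge> 0" by (rule LIMSEQ_le_const[OF r2(2)]) (use m in \<open>auto simp: less_imp_le\<close>)
  define \<mu> where "\<mu> = density (distr N0 borel s) (\<lambda>_. ennreal c)"
  have sbm: "s \<in> measurable N0 borel" using sm by (simp add: measurable_cong_sets[OF N0.events_eq_borel refl])
  have fin: "emeasure \<mu> UNIV < \<infinity>"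
  proof -
    have "emeasure \<mu> UNIV = ennreal c * emeasure (distr N0 borel s) UNIV"
      unfolding \<mu>_def by (subst emeasure_density) auto
    also have "\<dots> = ennreal c * 1"
      using N0.emeasure_space_1 by (subst emeasure_distr[OF sbm]) auto
    finally show ?thesis by simp
  qed
  have conv: "(\<lambda>k. LBINT x. h (r1 (r2 k)) x * \<phi> x) \<longlonglongrightarrow> (\<integral>x. \<phi> x \<partial>\<mu>)"
    if \<phi>: "continuous_on UNIV \<phi>" for \<phi> :: "real^'n \<Rightarrow> real"
  proof -
    have [measurable]: "\<phi> \<in> borel_measurable borel" using \<phi> by (rule cont_borel)
    have ic: "isCont (\<lambda>t. \<phi> (s t)) t" for t
      using continuous_on_compose2[OF \<phi> s(1)] by (simp add: continuous_on_eq_continuous_at)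
    have "bounded (\<phi> ` closure (range s))"
      using s(2) \<phi> by (intro compact_imp_bounded compact_continuous_image continuous_on_subset[OF \<phi>]) (auto simp: compact_closure)
    then obtain B where "\<And>x. x \<in> closure (range s) \<Longrightarrow> norm (\<phi> x) \<le> B" by (auto simp: bounded_iff)
    then have B: "norm (\<phi> (s t)) \<le> B" for t using closure_subset by blast
    have wc: "(\<lambda>k. \<integral>t. \<phi> (s t) \<partial>((N \<circ> id \<circ> r1) k)) \<longlonglongrightarrow> (\<integral>t. \<phi> (s t) \<partial>N0)"
      by (rule weak_conv_imp_integral_bdd_continuous_conv[OF _ r1(2,3) ic B]) (simp add: rd)
    \<comment> \<open>Inside the ball of radius R the curve inverts b, and outside the density
      vanishes, so going to the line and back loses nothing.\<close>
    have e: "(\<integral>t. \<phi> (s t) \<partial>N k) = (LBINT x. h k x * \<phi> x) / m k" for k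
    proof -
      have "(\<integral>t. \<phi> (s t) \<partial>N k) = (\<integral>x. \<phi> (s (b x)) \<partial>\<nu> k)"
        unfolding N_def by (rule integral_distr[OF bm]) measurable
      also have "\<dots> = (LBINT x. (h k x / m k) *\<^sub>R \<phi> (s (b x)))"
        unfolding \<nu>_def using nn m(3)[of k] by (subst integral_density) (auto simp: less_imp_le)
      also have "\<dots> = (LBINT x. (h k x * \<phi> x) / m k)"
      proof (rule integral_cong[OF refl])
        fix x
        show "(h k x / m k) *\<^sub>R \<phi> (s (b x)) = (h k x * \<phi> x) / m k"
          using off[of x k] sb[of x] subsetD[OF s(3), of x] by (cases "norm x \<ge> R") auto
      qed
      finally show ?thesis by simp
    qed
    have "(\<lambda>k. m (r1 (r2 k)) * (\<integral>t. \<phi> (s t) \<partial>N (r1 (r2 k)))) \<longlonglongrightarrow> c * (\<integral>t. \<phi> (s t) \<partial>N0)"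
      using tendsto_mult[OF r2(2) LIMSEQ_subseq_LIMSEQ[OF wc r2(1)]] by (simp add: o_def)
    then have "(\<lambda>k. LBINT x. h (r1 (r2 k)) x * \<phi> x) \<longlonglongrightarrow> c * (\<integral>t. \<phi> (s t) \<partial>N0)"
      unfolding e using m(3) by (simp add: less_imp_neq[THEN not_sym])
    also have "c * (\<integral>t. \<phi> (s t) \<partial>N0) = (\<integral>x. \<phi> x \<partial>\<mu>)"
      unfolding \<mu>_def using c0 by (subst integral_density) (auto simp: integral_distr[OF sbm])
    finally show ?thesis .
  qed
  show ?thesis
    using strict_mono_o[OF r1(1) r2(1)] fin conv by (intro exI[of _ "r1 \<circ> r2"] exI[of _ \<mu>]) (auto simp: \<mu>_def)
qed

section \<open>Distributional derivatives that are measures\<close>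

lemma integral_csupp_restrict:
  fixes \<mu> :: "'a::euclidean_space measure" and \<phi> :: "'a \<Rightarrow> real"
  assumes sb: "sets \<mu> = sets borel" and op: "open \<Omega>" and m: "\<phi> \<in> borel_measurable borel" and off: "\<And>x. x \<notin> \<Omega> \<Longrightarrow> \<phi> x = 0"
  shows "(\<integral>x. \<phi> x \<partial>density \<mu> (indicator \<Omega>)) = (\<integral>x. \<phi> x \<partial>\<mu>)"
proof -
  have [measurable]: "\<phi> \<in> borel_measurable \<mu>" "\<Omega> \<in> sets \<mu>"
    using m op by (simp_all add: measurable_cong_sets[OF sb refl] sb)
  have *: "(\<lambda>x. indicator \<Omega> x * \<phi> x) = \<phi>" using off by (auto simp: indicator_def fun_eq_iff)
  have "(\<integral>x. \<phi> x \<partial>density \<mu> (\<lambda>x. ennreal (indicator \<Omega> x))) = (\<integral>x. \<phi> x \<partial>\<mu>)"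
    by (subst integral_density) (auto simp: *)
  then show ?thesis by (simp add: ennreal_indicator)
qed

text \<open>If \<phi> is supported in U with |\<phi>| \<le> 1, its mollification is a test function
  of \<Omega> with the same bound, so M also bounds the mollified derivative tested on U. Taking
  \<phi> close to the sign of that derivative gives the bound in the mean.\<close>

lemma mollified_derivative_bound:
  fixes g :: "real^'n \<Rightarrow> real"
  assumes g: "L1 g" and op: "open \<Omega>" and bd: "bounded \<Omega>"
    and M: "\<And>\<phi>. test_fun \<Omega> \<phi> \<Longrightarrow> (\<And>x. \<bar>\<phi> x\<bar> \<le> 1) \<Longrightarrow> (LBINT x. g x * pd \<alpha> \<phi> x) \<le> M"
    and \<eta>: "mollifier \<epsilon> \<eta>" and U: "open U" "\<And>x y. x \<in> U \<Longrightarrow> dist x y \<le> \<epsilon> \<Longrightarrow> y \<in> \<Omega>"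
  defines "G \<equiv> pd \<alpha> (conv \<eta> g)"
  shows "L1 (\<lambda>x. indicator U x * G x)" "(LBINT x. \<bar>indicator U x * G x\<bar>) \<le> M"
    "\<And>\<phi>. test_fun U \<phi> \<Longrightarrow> (LBINT x. (indicator U x * G x) * \<phi> x) = - (LBINT x. g x * conv \<eta> (pd \<alpha> \<phi>) x)"
proof -
  have e0: "\<epsilon> > 0" by (rule mollifierD(9)[OF \<eta>])
  have UO: "U \<subseteq> \<Omega>" using U(2)[of _ _] e0 by (metis dist_self less_imp_le subsetI)
  have Ck: "conv \<eta> g \<in> Ck_fun k" for k by (rule mollifier_conv_Ck[OF \<eta> g])
  have Gc: "continuous_on UNIV G" unfolding G_def by (rule C1_continuous_partial[OF Ck])
  have [measurable]: "G \<in> borel_measurable borel" "U \<in> sets borel" "g \<in> borel_measurable borel"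
    using Gc U(1) g by (auto intro: cont_borel)
  have "bounded (G ` closure \<Omega>)"
    using bd by (intro compact_imp_bounded compact_continuous_image continuous_on_subset[OF Gc]) (auto simp: compact_closure)
  then obtain B where B: "\<And>x. x \<in> closure \<Omega> \<Longrightarrow> \<bar>G x\<bar> \<le> B" by (auto simp: bounded_iff)
  have "L1 (indicator \<Omega> :: _ \<Rightarrow> real)"
    using op emeasure_bounded_finite[OF bd] by (simp add: less_top)
  then show i: "L1 (\<lambda>x. indicator U x * G x)"
    by (rule integrable_bound[OF integrable_mult_right[where c = B]])
      (use B UO closure_subset[of \<Omega>] in \<open>auto simp: indicator_def intro!: order_trans[OF B abs_ge_self]\<close>)
  have IBP: "(LBINT x. (indicator U x * G x) * \<phi> x) = - (LBINT x. g x * conv \<eta> (pd \<alpha> \<phi>) x)"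
    if "test_fun U \<phi>" for \<phi>
  proof -
    have \<phi>: "\<phi> \<in> Ck_fun k" "csupp U \<phi>" for k using that by (auto simp: test_fun_iff)
    have ip: "L1 (pd \<alpha> \<phi>)"
      by (rule csupp_integrable[OF C1_continuous_partial[OF \<phi>(1)] csupp_partial_deriv[OF \<phi>(2)]])
    have "\<phi> x = 0" if "x \<notin> U" for x using \<phi>(2) that by (auto simp: csupp_def)
    then have "(LBINT x. (indicator U x * G x) * \<phi> x) = (LBINT x. G x * \<phi> x)"
      by (intro integral_cong refl) (auto simp: indicator_def)
    also have "\<dots> = - (LBINT x. conv \<eta> g x * pd \<alpha> \<phi> x)"
      unfolding G_def using integration_by_parts[OF Ck \<phi>(1,2), where \<alpha> = \<alpha>] by simp
    also have "(LBINT x. conv \<eta> g x * pd \<alpha> \<phi> x) = (LBINT x. g x * conv \<eta> (pd \<alpha> \<phi>) x)"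
      using conv_adjoint[OF \<eta> g ip] by simp
    finally show ?thesis .
  qed
  then show "\<And>\<phi>. test_fun U \<phi> \<Longrightarrow> (LBINT x. (indicator U x * G x) * \<phi> x) = - (LBINT x. g x * conv \<eta> (pd \<alpha> \<phi>) x)" .
  define h where "h x = indicator U x * G x" for x
  have hi: "L1 h" and [measurable]: "h \<in> borel_measurable borel"
    using i unfolding h_def[abs_def] by auto
  \<comment> \<open>Approximating the sign with respect to the weight |h| controls the gap between
    the integral of |h| and that of h \<phi>.\<close>
  define \<mu> where "\<mu> = density lborel (\<lambda>x. ennreal \<bar>h x\<bar>)"
  have sb: "sets \<mu> = sets borel" by (simp add: \<mu>_def)
  have fin: "emeasure \<mu> UNIV < \<infinity>"
    using hi by (simp add: \<mu>_def emeasure_density integrable_iff_bounded)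
  interpret finite_measure \<mu> by (rule finite_measureI) (use fin in \<open>auto simp: \<mu>_def\<close>)
  have sgi: "integrable \<mu> (\<lambda>x. sgn (h x))"
    by (intro integrable_const_bound[of _ 1]) (auto simp: measurable_cong_sets[OF sb refl] abs_sgn_eq)
  have "(LBINT x. \<bar>h x\<bar>) \<le> M + e" if e: "e > 0" for e
  proof -
    obtain \<phi> where \<phi>: "continuous_on UNIV \<phi>" "csupp U \<phi>" "\<And>x. \<phi> x \<in> {-1..1}" "(\<integral>x. norm (\<phi> x - sgn (h x)) \<partial>\<mu>) < e"
      "\<And>T k. bounded_linear T \<Longrightarrow> (\<lambda>x. T (\<phi> x)) \<in> Ck_fun k"
    proof (rule smooth_dense[where C = "{-1..1}", OF sb fin U(1) sgi _ _ _ _ _ e])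
      show "sgn (h x) = 0" if "x \<notin> U" for x using that by (simp add: h_def)
      show "sgn (h x) \<in> {-1..1}" for x by (auto simp: sgn_real_def)
    qed auto
    have \<phi>k: "\<phi> \<in> Ck_fun k" for k using \<phi>(5)[OF bounded_linear_ident] by simp
    have tf: "test_fun U \<phi>" using \<phi>k \<phi>(2) by (simp add: test_fun_iff del: Ck_fun.simps)
    have b1: "\<bar>\<phi> x\<bar> \<le> 1" for x using \<phi>(3)[of x] by auto
    have \<phi>i: "L1 \<phi>" by (rule csupp_integrable[OF \<phi>(1,2)])
    have [measurable]: "\<phi> \<in> borel_measurable borel" using \<phi>(1) by (rule cont_borel)
    have ih: "L1 (\<lambda>x. h x * \<phi> x)" by (rule integrable_bounded_mult(2)[OF hi _ b1]) simp
    obtain S where S: "compact S" "S \<subseteq> U" "\<And>x. x \<notin> S \<Longrightarrow> \<phi> x = 0" using \<phi>(2) by (auto simp: csupp_def)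
    have "(LBINT x. \<bar>h x\<bar>) - (LBINT x. h x * \<phi> x) = (LBINT x. \<bar>h x\<bar> - h x * \<phi> x)"
      using hi ih by simp
    also have "\<dots> \<le> (LBINT x. \<bar>h x\<bar> * norm (\<phi> x - sgn (h x)))"
    proof (rule integral_mono)
      show "L1 (\<lambda>x. \<bar>h x\<bar> * norm (\<phi> x - sgn (h x)))"
      proof (rule integrable_bounded_mult(2)[OF integrable_abs[OF hi], where B = 2])
        show "\<bar>norm (\<phi> x - sgn (h x))\<bar> \<le> 2" for x using b1[of x] by (auto simp: sgn_real_def)
      qed simp
      show "\<bar>h x\<bar> - h x * \<phi> x \<le> \<bar>h x\<bar> * norm (\<phi> x - sgn (h x))" for x
      proof -
        have "\<bar>h x\<bar> - h x * \<phi> x = - (h x * (\<phi> x - sgn (h x)))"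
          by (simp add: algebra_simps abs_sgn mult.commute flip: abs_sgn)
        also have "\<dots> \<le> \<bar>h x * (\<phi> x - sgn (h x))\<bar>" by simp
        finally show ?thesis by (simp add: abs_mult)
      qed
    qed (use hi ih in auto)
    also have "\<dots> = (\<integral>x. norm (\<phi> x - sgn (h x)) \<partial>\<mu>)"
      unfolding \<mu>_def by (subst integral_density) auto
    also have "\<dots> < e" by fact
    finally have 1: "(LBINT x. \<bar>h x\<bar>) < (LBINT x. h x * \<phi> x) + e" by simp
    have "(LBINT x. h x * \<phi> x) = - (LBINT x. g x * conv \<eta> (pd \<alpha> \<phi>) x)"
      unfolding h_def by (rule IBP[OF tf])
    also have "\<dots> = (LBINT x. g x * pd \<alpha> (\<lambda>x. - conv \<eta> \<phi> x) x)"
      using partial_deriv_uminus[OF mollifier_conv_Ck[OF \<eta> \<phi>i]] mollifier_conv_partial[OF \<eta> \<phi>k \<phi>(2)]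
      by simp
    also have "\<dots> \<le> M"
    proof (rule M)
      have "compact (\<Union>x\<in>S. cball x \<epsilon>)" by (rule compact_cball_Union[OF S(1)])
      moreover have "(\<Union>x\<in>S. cball x \<epsilon>) \<subseteq> \<Omega>" using S(2) U(2) by auto
      moreover have "- conv \<eta> \<phi> x = 0" if "x \<notin> (\<Union>x\<in>S. cball x \<epsilon>)" for x
      proof -
        have "conv \<eta> \<phi> x = 0"
        proof (rule conv_zero_off)
          show "\<phi> y = 0" if "dist x y < \<epsilon>" for y
          proof (rule S(3))
            show "y \<notin> S" using that \<open>x \<notin> _\<close> by (auto simp: dist_commute less_imp_le)
          qed
        qed (use mollifierD(3)[OF \<eta>] in auto)
        then show ?thesis by simp
      qed
      ultimately have "csupp \<Omega> (\<lambda>x. - conv \<eta> \<phi> x)" by (rule csuppI)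
      then show "test_fun \<Omega> (\<lambda>x. - conv \<eta> \<phi> x)"
        using Ck_fun_uminus[OF mollifier_conv_Ck[OF \<eta> \<phi>i]] by (simp add: test_fun_iff del: Ck_fun.simps)
      show "\<bar>- conv \<eta> \<phi> x\<bar> \<le> 1" for x
        using mollifier_conv_in_convex[OF \<eta> \<phi>i, of "{-1..1}" x] \<phi>(3) by auto
    qed
    finally show ?thesis using 1 by simp
  qed
  then have "(LBINT x. \<bar>h x\<bar>) \<le> M" by (rule field_le_epsilon)
  then show "(LBINT x. \<bar>indicator U x * G x\<bar>) \<le> M" by (simp add: h_def)
qed

text \<open>A representation theorem of Riesz type for one partial derivative: the positive and
  negative parts of the mollified derivatives have mass at most M, and weak limits along a common
  subsequence give the two measures.\<close>

lemma measure_representation: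
  fixes g :: "real^'n \<Rightarrow> real"
  assumes g: "L1 g" and op: "open \<Omega>" and bd: "bounded \<Omega>"
    and M: "\<And>\<phi>. test_fun \<Omega> \<phi> \<Longrightarrow> (\<And>x. \<bar>\<phi> x\<bar> \<le> 1) \<Longrightarrow> (LBINT x. g x * pd \<alpha> \<phi> x) \<le> M"
  shows "\<exists>\<mu>1 \<mu>2. sets \<mu>1 = sets borel \<and> sets \<mu>2 = sets borel \<and> emeasure \<mu>1 UNIV < \<infinity> \<and> emeasure \<mu>2 UNIV < \<infinity>
    \<and> emeasure \<mu>1 (UNIV - \<Omega>) = 0 \<and> emeasure \<mu>2 (UNIV - \<Omega>) = 0
    \<and> (\<forall>\<phi>. test_fun \<Omega> \<phi> \<longrightarrow> (LBINT x. g x * pd \<alpha> \<phi> x) = - ((\<integral>x. \<phi> x \<partial>\<mu>1) - (\<integral>x. \<phi> x \<partial>\<mu>2)))"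
proof -
  obtain R0 where R0: "\<Omega> \<subseteq> ball 0 R0" using bounded_subset_ballD[OF bd] by blast
  define R where "R = max R0 1"
  have R: "\<Omega> \<subseteq> ball 0 R" "R \<ge> 1" using R0 by (auto simp: R_def)
  have ne: "- \<Omega> \<noteq> {}"
  proof
    assume "- \<Omega> = {}"
    then have "\<Omega> = UNIV" by auto
    then show False using bd not_bounded_UNIV by auto
  qed
  \<comment> \<open>At these points mollification at scale 1/(k+1) sees only \<Omega>. The
    complement of \<Omega> is known to be nonempty at this point; \<open>infdist\<close> to the
    empty set would be 0.\<close>
  define U where "U k = {x. 1 / real (Suc k) < infdist x (- \<Omega>)}" for k
  have Uo: "open (U k)" for k
    unfolding U_def by (intro open_Collect_less continuous_intros)
  have U2: "y \<in> \<Omega>" if "x \<in> U k" "dist x y \<le> 1 / real (Suc k)" for x y k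
  proof (rule ccontr)
    assume "y \<notin> \<Omega>"
    then have "infdist x (- \<Omega>) \<le> dist x y" by (intro infdist_le) auto
    then show False using that by (simp add: U_def)
  qed
  have "\<exists>\<eta>::real^'n \<Rightarrow> real. mollifier (1 / real (Suc k)) \<eta>" for k
    using mollifier_exists[of "1 / real (Suc k)"] by (metis divide_pos_pos of_nat_0_less_iff zero_less_Suc zero_less_one)
  then obtain \<eta> :: "nat \<Rightarrow> real^'n \<Rightarrow> real" where \<eta>: "\<And>k. mollifier (1 / real (Suc k)) (\<eta> k)" by metis
  define h where "h k x = indicator (U k) x * pd \<alpha> (conv (\<eta> k) g) x" for k x
  note mb = mollified_derivative_bound[OF g op bd M \<eta> Uo U2]
  have hi: "L1 (h k)" for k unfolding h_def[abs_def] by (rule mb(1)) auto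
  have hb: "(LBINT x. \<bar>h k x\<bar>) \<le> M" for k unfolding h_def by (rule mb(2)) auto
  have hI: "(LBINT x. h k x * \<phi> x) = - (LBINT x. g x * conv (\<eta> k) (pd \<alpha> \<phi>) x)" if "test_fun (U k) \<phi>" for k \<phi>
    unfolding h_def by (rule mb(3)) (use that in auto)
  have hoff: "h k x = 0" if "x \<notin> \<Omega>" for k x
    using that U2[of x k x] by (auto simp: h_def indicator_def)
  define v where "v = measure lborel (ball (0::real^'n) 1)"
  have v: "v > 0" unfolding v_def by (rule content_ball_pos) simp
  \<comment> \<open>A fixed density of mass 1 is added to both parts so that they reach the mass
    required by \<open>weak_compactness\<close>; it cancels in their difference. The radius R was
    taken at least 1 to contain its support.\<close>
  define q where "q x = indicator (ball 0 1) x / v" for x :: "real^'n"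
  have qi: "L1 q" "(LBINT x. q x) = 1" "\<And>x. q x \<ge> 0" "\<And>x. norm x \<ge> R \<Longrightarrow> q x = 0"
    using v emeasure_bounded_finite[OF bounded_ball, of "0::real^'n" 1] R(2)
    unfolding q_def by (auto simp: v_def less_top)
  define h1 where "h1 k x = max 0 (h k x) + q x" for k x
  define h2 where "h2 k x = max 0 (- h k x) + q x" for k x
  have hm: "L1 (\<lambda>x. max 0 (h k x))" "L1 (\<lambda>x. max 0 (- h k x))" for k
    using hi[of k] by auto
  have hR: "h k x = 0" if "norm x \<ge> R" for k x
    using that R(1) by (intro hoff) (auto simp: subset_iff)
  have mx: "0 \<le> (LBINT x. max 0 (h k x))" "(LBINT x. max 0 (h k x)) \<le> M"
    "0 \<le> (LBINT x. max 0 (- h k x))" "(LBINT x. max 0 (- h k x)) \<le> M" for k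
    using order_trans[OF integral_mono[OF hm(1)[of k] integrable_abs[OF hi]] hb[of k]]
      order_trans[OF integral_mono[OF hm(2)[of k] integrable_abs[OF hi]] hb[of k]]
    by (auto intro!: integral_nonneg)
  have H1: "L1 (h1 k)" "h1 k x \<ge> 0" "(LBINT x. h1 k x) \<ge> 1" "(LBINT x. h1 k x) \<le> M + 1"
    "norm x \<ge> R \<Longrightarrow> h1 k x = 0" for k x
    using hm(1)[of k] qi mx(1,2)[of k] hR by (auto simp: h1_def[abs_def])
  have H2: "L1 (h2 k)" "h2 k x \<ge> 0" "(LBINT x. h2 k x) \<ge> 1" "(LBINT x. h2 k x) \<le> M + 1"
    "norm x \<ge> R \<Longrightarrow> h2 k x = 0" for k x
    using hm(2)[of k] qi mx(3,4)[of k] hR by (auto simp: h2_def[abs_def])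
  obtain r1 \<mu>1 where r1: "strict_mono (r1::nat \<Rightarrow> nat)" "sets \<mu>1 = sets borel" "emeasure \<mu>1 UNIV < \<infinity>"
    "\<And>\<phi>::real^'n \<Rightarrow> real. continuous_on UNIV \<phi> \<Longrightarrow> (\<lambda>k. LBINT x. h1 (r1 k) x * \<phi> x) \<longlonglongrightarrow> (\<integral>x. \<phi> x \<partial>\<mu>1)"
    using weak_compactness[of h1, OF H1] by blast
  obtain r2 \<mu>2 where r2: "strict_mono (r2::nat \<Rightarrow> nat)" "sets \<mu>2 = sets borel" "emeasure \<mu>2 UNIV < \<infinity>"
    "\<And>\<phi>::real^'n \<Rightarrow> real. continuous_on UNIV \<phi> \<Longrightarrow> (\<lambda>k. LBINT x. h2 (r1 (r2 k)) x * \<phi> x) \<longlonglongrightarrow> (\<integral>x. \<phi> x \<partial>\<mu>2)"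
    using weak_compactness[of "\<lambda>k. h2 (r1 k)", OF H2] by blast
  define r where "r = r1 \<circ> r2"
  have r: "strict_mono r" unfolding r_def by (rule strict_mono_o[OF r1(1) r2(1)])
  have [measurable]: "\<Omega> \<in> sets borel" using op by auto
  have main: "(LBINT x. g x * pd \<alpha> \<phi> x) = - ((\<integral>x. \<phi> x \<partial>\<mu>1) - (\<integral>x. \<phi> x \<partial>\<mu>2))" if tf: "test_fun \<Omega> \<phi>" for \<phi>
  proof -
    have \<phi>: "\<phi> \<in> Ck_fun k" "csupp \<Omega> \<phi>" for k using tf by (auto simp: test_fun_iff)
    have c: "continuous_on UNIV \<phi>" using Ck_fun_continuous \<phi>(1) by blast
    have [measurable]: "\<phi> \<in> borel_measurable borel" using c by (rule cont_borel)
    obtain S where S: "compact S" "S \<subseteq> \<Omega>" "\<And>x. x \<notin> S \<Longrightarrow> \<phi> x = 0" using \<phi>(2) by (auto simp: csupp_def)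
    have "S \<inter> - \<Omega> = {}" using S(2) by auto
    then obtain \<delta> where \<delta>: "\<delta> > 0" "\<And>x y. x \<in> S \<Longrightarrow> y \<in> - \<Omega> \<Longrightarrow> \<delta> \<le> dist x y"
      using separate_compact_closed[OF S(1) closed_Compl[OF op]] by blast
    obtain k0 where k0: "1 / real (Suc k0) < \<delta>" using \<delta>(1) nat_approx_posE by blast
    have SU: "S \<subseteq> U k" if "k \<ge> k0" for k
    proof
      fix x assume "x \<in> S"
      then have "\<delta> \<le> infdist x (- \<Omega>)" using \<delta>(2) ne by (auto simp: infdist_def intro!: cINF_greatest)
      moreover have "1 / real (Suc k) \<le> 1 / real (Suc k0)" using that by (simp add: frac_le)
      ultimately show "x \<in> U k" using k0 by (simp add: U_def)
    qed
    obtain B where B: "\<And>x. \<bar>\<phi> x\<bar> \<le> B" using csupp_bounded[OF c \<phi>(2)] by (metis real_norm_def)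
    have "(\<lambda>k. (LBINT x. h1 (r k) x * \<phi> x) - (LBINT x. h2 (r k) x * \<phi> x)) \<longlonglongrightarrow> (\<integral>x. \<phi> x \<partial>\<mu>1) - (\<integral>x. \<phi> x \<partial>\<mu>2)"
      using tendsto_diff[OF LIMSEQ_subseq_LIMSEQ[OF r1(4)[OF c] r2(1)] r2(4)[OF c]] by (simp add: r_def o_def)
    also have "(\<lambda>k. (LBINT x. h1 (r k) x * \<phi> x) - (LBINT x. h2 (r k) x * \<phi> x)) = (\<lambda>k. LBINT x. h (r k) x * \<phi> x)"
    proof
      fix k
      have "L1 (\<lambda>x. h1 (r k) x * \<phi> x)" "L1 (\<lambda>x. h2 (r k) x * \<phi> x)"
        using H1(1) H2(1) by (auto intro!: integrable_bounded_mult(2)[OF _ _ B])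
      then have "(LBINT x. h1 (r k) x * \<phi> x) - (LBINT x. h2 (r k) x * \<phi> x)
          = (LBINT x. h1 (r k) x * \<phi> x - h2 (r k) x * \<phi> x)" by simp
      also have "\<dots> = (LBINT x. h (r k) x * \<phi> x)"
        by (intro integral_cong refl) (simp add: h1_def h2_def max_def algebra_simps)
      finally show "(LBINT x. h1 (r k) x * \<phi> x) - (LBINT x. h2 (r k) x * \<phi> x) = (LBINT x. h (r k) x * \<phi> x)" .
    qed
    finally have l1: "(\<lambda>k. LBINT x. h (r k) x * \<phi> x) \<longlonglongrightarrow> (\<integral>x. \<phi> x \<partial>\<mu>1) - (\<integral>x. \<phi> x \<partial>\<mu>2)" .
    have pc: "continuous_on UNIV (pd \<alpha> \<phi>)" "csupp \<Omega> (pd \<alpha> \<phi>)"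
      using C1_continuous_partial[OF \<phi>(1)] csupp_partial_deriv[OF \<phi>(2)] by auto
    have pi: "L1 (pd \<alpha> \<phi>)" by (rule csupp_integrable[OF pc])
    obtain B' where B': "\<And>x. \<bar>pd \<alpha> \<phi> x\<bar> \<le> B'" using csupp_bounded[OF pc] by (metis real_norm_def)
    have "(\<lambda>k. LBINT x. g x * conv (\<eta> k) (pd \<alpha> \<phi>) x) \<longlonglongrightarrow> (LBINT x. g x * pd \<alpha> \<phi> x)"
    proof (rule integral_dominated_convergence[where w = "\<lambda>x. \<bar>g x\<bar> * B'"])
      have [measurable]: "conv (\<eta> k) (pd \<alpha> \<phi>) \<in> borel_measurable borel" for k
        by (intro cont_borel conv_continuous[OF mollifierD(7)[OF \<eta>] mollifier_csupp[OF \<eta>] pi])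
      have [measurable]: "g \<in> borel_measurable borel" "pd \<alpha> \<phi> \<in> borel_measurable borel"
        using g pi by auto
      show "(\<lambda>x. g x * pd \<alpha> \<phi> x) \<in> borel_measurable lborel" by measurable
      show "(\<lambda>x. g x * conv (\<eta> k) (pd \<alpha> \<phi>) x) \<in> borel_measurable lborel" for k by measurable
      show "L1 (\<lambda>x. \<bar>g x\<bar> * B')" using g by simp
      show "AE x in lborel. norm (g x * conv (\<eta> k) (pd \<alpha> \<phi>) x) \<le> \<bar>g x\<bar> * B'" for k
      proof (rule AE_I2)
        fix x
        have "conv (\<eta> k) (pd \<alpha> \<phi>) x \<in> {-B'..B'}"
          using B' by (intro mollifier_conv_in_convex[OF \<eta> pi]) (auto simp: abs_le_iff minus_le_iff)
        then show "norm (g x * conv (\<eta> k) (pd \<alpha> \<phi>) x) \<le> \<bar>g x\<bar> * B'"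
          by (auto simp: abs_mult intro!: mult_left_mono)
      qed
      show "AE x in lborel. (\<lambda>k. g x * conv (\<eta> k) (pd \<alpha> \<phi>) x) \<longlonglongrightarrow> g x * pd \<alpha> \<phi> x"
      proof (rule AE_I2, rule tendsto_mult_left, rule LIMSEQ_I)
        fix x and e :: real assume "e > 0"
        then have "e / 2 > 0" by simp
        then obtain d where d: "d > 0" "\<And>\<epsilon> \<eta> x. mollifier \<epsilon> \<eta> \<Longrightarrow> \<epsilon> \<le> d \<Longrightarrow> norm (conv \<eta> (pd \<alpha> \<phi>) x - pd \<alpha> \<phi> x) \<le> e / 2"
          using mollifier_uniform_limit[OF pc] by metis
        obtain k1 where k1: "1 / real (Suc k1) < d" using d(1) nat_approx_posE by blast
        have "norm (conv (\<eta> k) (pd \<alpha> \<phi>) x - pd \<alpha> \<phi> x) < e" if "k \<ge> k1" for k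
        proof -
          have "1 / real (Suc k) \<le> 1 / real (Suc k1)" using that by (simp add: frac_le)
          then show ?thesis using d(2)[OF \<eta>[of k], of x] k1 \<open>e > 0\<close> by linarith
        qed
        then show "\<exists>no. \<forall>n\<ge>no. norm (conv (\<eta> n) (pd \<alpha> \<phi>) x - pd \<alpha> \<phi> x) < e" by blast
      qed
    qed
    then have l2: "(\<lambda>k. - (LBINT x. g x * conv (\<eta> (r k)) (pd \<alpha> \<phi>) x)) \<longlonglongrightarrow> - (LBINT x. g x * pd \<alpha> \<phi> x)"
      using LIMSEQ_subseq_LIMSEQ[OF _ r] by (auto simp: o_def intro: tendsto_minus)
    have "\<forall>\<^sub>F k in sequentially. (LBINT x. h (r k) x * \<phi> x) = - (LBINT x. g x * conv (\<eta> (r k)) (pd \<alpha> \<phi>) x)"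
      unfolding eventually_sequentially
    proof (intro exI[of _ k0] allI impI)
      fix k assume "k0 \<le> k"
      then have "k0 \<le> r k" using seq_suble[OF r, of k] by simp
      then have "csupp (U (r k)) \<phi>" using S SU by (intro csuppI[of S]) auto
      then show "(LBINT x. h (r k) x * \<phi> x) = - (LBINT x. g x * conv (\<eta> (r k)) (pd \<alpha> \<phi>) x)"
        using \<phi>(1) by (intro hI) (simp add: test_fun_iff del: Ck_fun.simps)
    qed
    then have "(\<lambda>k. LBINT x. h (r k) x * \<phi> x) \<longlonglongrightarrow> - (LBINT x. g x * pd \<alpha> \<phi> x)"
      by (rule Lim_transform_eventually[OF l2 eventually_mono]) simp
    from LIMSEQ_unique[OF l1 this] show ?thesis by simp
  qed
  \<comment> \<open>Weak limits may charge the boundary of \<Omega>. Restricting them to \<Omega> is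
    invisible to test functions.\<close>
  have restr: "emeasure (density \<mu> (indicator \<Omega>)) UNIV < \<infinity>" "emeasure (density \<mu> (indicator \<Omega>)) (UNIV - \<Omega>) = 0"
    if "sets \<mu> = sets borel" "emeasure \<mu> UNIV < \<infinity>" for \<mu> :: "(real^'n) measure"
  proof -
    have [measurable]: "\<Omega> \<in> sets \<mu>" "UNIV \<in> sets \<mu>" "UNIV - \<Omega> \<in> sets \<mu>" using that(1) op by auto
    have "emeasure (density \<mu> (indicator \<Omega>)) UNIV = emeasure \<mu> \<Omega>"
      by (subst emeasure_density) auto
    also have "\<dots> \<le> emeasure \<mu> UNIV" by (rule emeasure_mono) auto
    finally show "emeasure (density \<mu> (indicator \<Omega>)) UNIV < \<infinity>" using that(2) by simp
    have "emeasure (density \<mu> (indicator \<Omega>)) (UNIV - \<Omega>) = (\<integral>\<^sup>+x. 0 \<partial>\<mu>)"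
      by (subst emeasure_density) (auto intro!: nn_integral_cong simp del: nn_integral_const simp: indicator_def of_bool_def)
    then show "emeasure (density \<mu> (indicator \<Omega>)) (UNIV - \<Omega>) = 0" by simp
  qed
  have ir: "(\<integral>x. \<phi> x \<partial>density \<mu> (indicator \<Omega>)) = (\<integral>x. \<phi> x \<partial>\<mu>)" if "test_fun \<Omega> \<phi>" "sets \<mu> = sets borel" for \<phi> \<mu>
  proof (rule integral_csupp_restrict[OF that(2) op])
    show "\<phi> \<in> borel_measurable borel" using that(1) Ck_fun_continuous by (auto simp: test_fun_iff intro!: cont_borel simp del: Ck_fun.simps)
    show "\<phi> x = 0" if "x \<notin> \<Omega>" for x using \<open>test_fun \<Omega> \<phi>\<close> that by (auto simp: test_fun_iff csupp_def)
  qed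
  show ?thesis
    using restr[OF r1(2,3)] restr[OF r2(2,3)] r1(2) r2(2) main
    by (intro exI[of _ "density \<mu>1 (indicator \<Omega>)"] exI[of _ "density \<mu>2 (indicator \<Omega>)"]) (auto simp: ir)
qed

section \<open>Finite sums of measures\<close>

definition msum :: "'i set \<Rightarrow> ('i \<Rightarrow> 'a::topological_space measure) \<Rightarrow> 'a measure" where
  "msum I M = measure_of UNIV (sets borel) (\<lambda>A. \<Sum>i\<in>I. emeasure (M i) A)"

lemma sets_msum [simp]: "sets (msum I M) = sets borel"
  using sets.sigma_sets_eq[of borel] by (simp add: msum_def)

lemma emeasure_msum:
  assumes "\<And>i. i \<in> I \<Longrightarrow> sets (M i) = sets borel" "A \<in> sets borel"
  shows "emeasure (msum I M) A = (\<Sum>i\<in>I. emeasure (M i) A)"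
  unfolding msum_def
proof (rule emeasure_measure_of_sigma)
  show "sigma_algebra UNIV (sets borel)" using sets.sigma_algebra_axioms[of borel] by simp
  show "countably_additive (sets borel) (\<lambda>A. \<Sum>i\<in>I. emeasure (M i) A)"
  proof (rule countably_additiveI)
    fix A :: "nat \<Rightarrow> 'b set"
    assume A: "range A \<subseteq> sets borel" "disjoint_family A"
    have "(\<Sum>n. \<Sum>i\<in>I. emeasure (M i) (A n)) = (\<Sum>i\<in>I. \<Sum>n. emeasure (M i) (A n))"
      by (rule suminf_sum) auto
    also have "\<dots> = (\<Sum>i\<in>I. emeasure (M i) (\<Union>n. A n))"
      using A assms(1) by (intro sum.cong refl suminf_emeasure) auto
    finally show "(\<Sum>n. \<Sum>i\<in>I. emeasure (M i) (A n)) = (\<Sum>i\<in>I. emeasure (M i) (\<Union>n. A n))" .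
  qed
qed (use assms in \<open>auto simp: positive_def\<close>)

lemma msum_le:
  assumes I: "finite I" "i \<in> I" and s: "\<And>i. i \<in> I \<Longrightarrow> sets (M i) = sets borel"
  shows "M i \<le> msum I M"
proof -
  have "emeasure (M i) A \<le> emeasure (msum I M) A" for A
  proof (cases "A \<in> sets borel")
    case True
    then show ?thesis using I member_le_sum[OF I(2), of "\<lambda>i. emeasure (M i) A"] by (simp add: emeasure_msum[OF s])
  qed (use s[OF I(2)] in \<open>simp add: emeasure_notin_sets\<close>)
  moreover have "space (M i) = space (msum I M)" using s[OF I(2)] by (intro sets_eq_imp_space_eq) simp
  ultimately show ?thesis using s[OF I(2)] by (auto simp: le_measure_iff le_fun_def)
qed

lemma msum_finite:
  assumes "finite I" "\<And>i. i \<in> I \<Longrightarrow> sets (M i) = sets borel" "\<And>i. i \<in> I \<Longrightarrow> emeasure (M i) UNIV < \<infinity>"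
  shows "emeasure (msum I M) UNIV < \<infinity>"
  using assms by (simp add: emeasure_msum)

text \<open>An approximation in the mean for the larger measure is one for M and N simultaneously;
  this is how a single field is adapted to Lebesgue measure and a singular measure at once.\<close>

lemma dominating_measure:
  fixes M N :: "'a::topological_space measure"
  assumes "sets M = sets borel" "emeasure M UNIV < \<infinity>" "sets N = sets borel" "emeasure N UNIV < \<infinity>"
  obtains \<mu> where "sets \<mu> = sets borel" "emeasure \<mu> UNIV < \<infinity>" "M \<le> \<mu>" "N \<le> \<mu>"
proof (rule that)
  let ?F = "\<lambda>b. if b then M else N"
  show "sets (msum UNIV ?F) = sets borel" "emeasure (msum UNIV ?F) UNIV < \<infinity>" "M \<le> msum UNIV ?F" "N \<le> msum UNIV ?F"
    using msum_finite[of UNIV ?F] msum_le[of UNIV True ?F] msum_le[of UNIV False ?F] assms by auto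
qed

lemma le_measure_integral:
  fixes f :: "'a \<Rightarrow> real"
  assumes le: "M \<le> N" and s: "sets M = sets N" and f: "integrable N f" "\<And>x. f x \<ge> 0"
  shows "integrable M f" "(\<integral>x. f x \<partial>M) \<le> (\<integral>x. f x \<partial>N)"
proof -
  have m: "f \<in> borel_measurable M" using f(1) by (simp add: measurable_cong_sets[OF s refl] borel_measurable_integrable)
  have nn: "(\<integral>\<^sup>+x. ennreal (f x) \<partial>M) \<le> (\<integral>\<^sup>+x. ennreal (f x) \<partial>N)" by (rule nn_integral_mono_measure[OF s le])
  also have "\<dots> < \<infinity>" using f by (simp add: integrable_iff_bounded)
  finally show i: "integrable M f" using f(2) m by (simp add: integrable_iff_bounded)
  show "(\<integral>x. f x \<partial>M) \<le> (\<integral>x. f x \<partial>N)"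
    using nn nn_integral_eq_integral[OF i] nn_integral_eq_integral[OF f(1)] f(2)
    by (simp add: ennreal_le_iff integral_nonneg)
qed

section \<open>The convex functional as a supremum over test fields\<close>

definition C1_field :: "(real^'n \<Rightarrow> real^'m^'n) \<Rightarrow> bool" where
  "C1_field \<Phi> \<longleftrightarrow> (\<forall>\<alpha> i. (\<lambda>x. \<Phi> x $ \<alpha> $ i) \<in> Ck_fun (Suc 0))"

definition dv :: "(real^'n \<Rightarrow> real^'m^'n) \<Rightarrow> real^'n \<Rightarrow> real^'m" where
  "dv \<Phi> x = (\<chi> i. \<Sum>\<alpha>\<in>UNIV. pd \<alpha> (\<lambda>x. \<Phi> x $ \<alpha> $ i) x)"

lemma C1_field_entry: "C1_field \<Phi> \<Longrightarrow> (\<lambda>x. \<Phi> x $ \<alpha> $ i) \<in> Ck_fun (Suc 0)"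
  by (auto simp: C1_field_def simp del: Ck_fun.simps)

lemma C1_field_continuous: "C1_field \<Phi> \<Longrightarrow> continuous_on UNIV \<Phi>"
  unfolding continuous_on_componentwise[of UNIV \<Phi>] 
  by (auto simp: Basis_vec_def inner_axis simp del: Ck_fun.simps intro!: Ck_fun_continuous[OF C1_field_entry])

lemma dv_continuous: "C1_field \<Phi> \<Longrightarrow> continuous_on UNIV (dv \<Phi>)"
  unfolding dv_def by (intro continuous_on_vec_lambda continuous_on_sum C1_continuous_partial[OF C1_field_entry])

lemma csupp_entry: "csupp U \<Phi> \<Longrightarrow> csupp U (\<lambda>x. \<Phi> x $ \<alpha> $ i)" for \<Phi> :: "_ \<Rightarrow> real^'m^'n"
  by (auto simp: csupp_def)

lemma dv_zero_off:
  assumes "closed S" "\<And>x. x \<notin> S \<Longrightarrow> \<Phi> x = 0" "x \<notin> S"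
  shows "dv \<Phi> x = 0"
  unfolding dv_def using partial_deriv_zero_off[OF assms(1) _ assms(3)] assms(2)
  by (simp add: vec_eq_iff)

lemma dv_csupp: "csupp U \<Phi> \<Longrightarrow> csupp U (dv \<Phi>)"
proof -
  assume "csupp U \<Phi>"
  then obtain S where S: "compact S" "S \<subseteq> U" "\<And>x. x \<notin> S \<Longrightarrow> \<Phi> x = 0" by (auto simp: csupp_def)
  show ?thesis by (rule csuppI[OF S(1,2)], rule dv_zero_off[OF compact_imp_closed[OF S(1)] S(3)])
qed

lemma dv_add:
  assumes "C1_field \<Phi>" "C1_field \<Psi>"
  shows "dv (\<lambda>x. \<Phi> x + \<Psi> x) x = dv \<Phi> x + dv \<Psi> x"
  using partial_deriv_add[OF C1_field_entry[OF assms(1)] C1_field_entry[OF assms(2)]]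
  by (simp add: dv_def vec_eq_iff sum.distrib)

lemma C1_field_add:
  assumes "C1_field \<Phi>" "C1_field \<Psi>"
  shows "C1_field (\<lambda>x. \<Phi> x + \<Psi> x)"
  unfolding C1_field_def vector_add_component
  by (intro allI Ck_fun_add C1_field_entry assms)

lemma C1_field_scale:
  assumes "\<zeta> \<in> Ck_fun (Suc 0)" "C1_field \<Phi>"
  shows "C1_field (\<lambda>x. \<zeta> x *\<^sub>R \<Phi> x)"
  unfolding C1_field_def vector_scaleR_component real_scaleR_def
  by (intro allI Ck_fun_mult C1_field_entry assms)

lemma dv_scale:
  assumes "\<zeta> \<in> Ck_fun (Suc 0)" "C1_field \<Phi>"
  shows "dv (\<lambda>x. \<zeta> x *\<^sub>R \<Phi> x) x = \<zeta> x *\<^sub>R dv \<Phi> x + (\<Sum>\<alpha>\<in>UNIV. pd \<alpha> \<zeta> x *\<^sub>R \<Phi> x $ \<alpha>)"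
  using partial_deriv_mult[OF assms(1) C1_field_entry[OF assms(2)]]
  by (simp add: dv_def vec_eq_iff sum.distrib sum_distrib_left)

text \<open>The last condition says that \<open>a x\<close> is at most minus the convex conjugate of
  \<psi> at \<open>norm (\<Phi> x)\<close>. As a family of linear inequalities in a and |\<Phi>|, it
  passes directly to averages.\<close>

definition adm :: "(real^'n) set \<Rightarrow> (real \<Rightarrow> real) \<Rightarrow> (real^'n \<Rightarrow> real) \<Rightarrow> (real^'n \<Rightarrow> real^'m^'n) \<Rightarrow> bool" where
  "adm \<Omega> \<psi> a \<Phi> \<longleftrightarrow> C1_field \<Phi> \<and> L1 a \<and> csupp \<Omega> a \<and> csupp \<Omega> \<Phi>
     \<and> (\<forall>x. \<forall>t\<ge>0. a x + norm (\<Phi> x) * t \<le> \<psi> t)"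

text \<open>\<open>ennreal\<close> cuts negative values to 0. This does not disturb the supremum:
  for nonnegative \<psi> the zero pair is admissible and has value 0.\<close>

definition Rfun :: "(real^'n) set \<Rightarrow> (real \<Rightarrow> real) \<Rightarrow> (real^'n \<Rightarrow> real^'m) \<Rightarrow> ennreal" where
  "Rfun \<Omega> \<psi> w = (SUP p\<in>{p. adm \<Omega> \<psi> (fst p) (snd p)}.
     ennreal ((LBINT x. fst p x) - (LBINT x. w x \<bullet> dv (snd p) x)))"

lemma Rfun_upper:
  "adm \<Omega> \<psi> a \<Phi> \<Longrightarrow> ennreal ((LBINT x. a x) - (LBINT x. w x \<bullet> dv \<Phi> x)) \<le> Rfun \<Omega> \<psi> w"
  unfolding Rfun_def by (rule SUP_upper2[of "(a, \<Phi>)"]) auto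

lemma Rfun_least:
  "(\<And>a \<Phi>. adm \<Omega> \<psi> a \<Phi> \<Longrightarrow> ennreal ((LBINT x. a x) - (LBINT x. w x \<bullet> dv \<Phi> x)) \<le> c) \<Longrightarrow> Rfun \<Omega> \<psi> w \<le> c"
  unfolding Rfun_def by (rule SUP_least) auto

lemma Rfun_upper_real:
  assumes "adm \<Omega> \<psi> a \<Phi>" "Rfun \<Omega> \<psi> w \<le> ennreal r" "r \<ge> 0"
  shows "(LBINT x. a x) - (LBINT x. w x \<bullet> dv \<Phi> x) \<le> r"
  using order_trans[OF Rfun_upper[OF assms(1)] assms(2)] assms(3) by (auto simp: ennreal_le_iff2)

lemma admI:
  assumes "C1_field \<Phi>" "L1 a" "compact S" "S \<subseteq> \<Omega>" "\<And>x. x \<notin> S \<Longrightarrow> a x = 0" "\<And>x. x \<notin> S \<Longrightarrow> \<Phi> x = 0"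
    "\<And>x t. t \<ge> 0 \<Longrightarrow> a x + norm (\<Phi> x) * t \<le> \<psi> t"
  shows "adm \<Omega> \<psi> a \<Phi>"
  unfolding adm_def using assms csuppI[OF assms(3,4), of a] csuppI[OF assms(3,4), of \<Phi>] by auto

lemma admD:
  assumes "adm \<Omega> \<psi> a \<Phi>"
  shows "C1_field \<Phi>" "L1 a" "csupp \<Omega> a" "csupp \<Omega> \<Phi>"
    "t \<ge> 0 \<Longrightarrow> a x + norm (\<Phi> x) * t \<le> \<psi> t" "continuous_on UNIV \<Phi>" "continuous_on UNIV (dv \<Phi>)" "csupp \<Omega> (dv \<Phi>)"
  using assms C1_field_continuous dv_continuous dv_csupp by (auto simp: adm_def)

lemma adm_support:
  assumes "adm \<Omega> \<psi> a \<Phi>"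
  obtains S where "compact S" "S \<subseteq> \<Omega>" "\<And>x. x \<notin> S \<Longrightarrow> a x = 0" "\<And>x. x \<notin> S \<Longrightarrow> \<Phi> x = 0"
proof -
  obtain S where S: "compact S" "S \<subseteq> \<Omega>" "\<And>x. x \<notin> S \<Longrightarrow> a x = 0" using admD(3)[OF assms] by (auto simp: csupp_def)
  obtain T where T: "compact T" "T \<subseteq> \<Omega>" "\<And>x. x \<notin> T \<Longrightarrow> \<Phi> x = 0" using admD(4)[OF assms] by (auto simp: csupp_def)
  show thesis by (rule that[of "S \<union> T"]) (use S T in \<open>auto intro: compact_Un\<close>)
qed

lemma integrable_inner_csupp:
  fixes w v :: "'a::euclidean_space \<Rightarrow> 'b::euclidean_space"
  assumes w: "L1 w" and v: "continuous_on UNIV v" "csupp U v"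
  shows "L1 (\<lambda>x. w x \<bullet> v x)"
proof -
  obtain B where B: "\<And>x. norm (v x) \<le> B" using csupp_bounded[OF v] by metis
  have [measurable]: "w \<in> borel_measurable borel" "v \<in> borel_measurable borel" using w v(1) by (auto intro: cont_borel)
  show ?thesis
  proof (rule integrable_bound[of _ "\<lambda>x. B * norm (w x)"])
    show "AE x in lborel. norm (w x \<bullet> v x) \<le> norm (B * norm (w x))"
    proof (rule AE_I2)
      fix x
      have "\<bar>w x \<bullet> v x\<bar> \<le> norm (w x) * norm (v x)" by (rule Cauchy_Schwarz_ineq2)
      also have "\<dots> \<le> norm (w x) * \<bar>B\<bar>" using B[of x] by (intro mult_left_mono) auto
      finally show "norm (w x \<bullet> v x) \<le> norm (B * norm (w x))" by (simp add: abs_mult mult.commute)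
    qed
  qed (use w in auto)
qed

text \<open>The analogue of \<open>BV_decomp\<close> for Borel functions on the whole space that vanish off the domain.\<close>

definition bvd :: "(real^'n) set \<Rightarrow> (real^'n \<Rightarrow> real^'m) \<Rightarrow> (real^'n \<Rightarrow> real^'m^'n)
     \<Rightarrow> (real^'n \<Rightarrow> real^'m^'n) \<Rightarrow> (real^'n) measure \<Rightarrow> bool" where
  "bvd \<Omega> w G \<theta> \<sigma> \<longleftrightarrow> L1 w \<and> L1 G \<and> (\<forall>x. x \<notin> \<Omega> \<longrightarrow> G x = 0)
     \<and> sets \<sigma> = sets borel \<and> emeasure \<sigma> UNIV < \<infinity> \<and> emeasure \<sigma> (UNIV - \<Omega>) = 0
     \<and> (\<exists>Z \<in> sets borel. emeasure lborel Z = 0 \<and> emeasure \<sigma> (UNIV - Z) = 0)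
     \<and> \<theta> \<in> borel_measurable borel \<and> (AE x in \<sigma>. norm (\<theta> x) = 1)
     \<and> (\<forall>\<phi> \<alpha> i. test_fun \<Omega> \<phi> \<longrightarrow> (LBINT x. w x $ i * pd \<alpha> \<phi> x)
          = - ((LBINT x. G x $ \<alpha> $ i * \<phi> x) + (\<integral>x. \<theta> x $ \<alpha> $ i * \<phi> x \<partial>\<sigma>)))"

lemma integrable_entry:
  fixes G :: "'a \<Rightarrow> real^'m^'n"
  assumes "integrable M G"
  shows "integrable M (\<lambda>x. G x $ \<alpha> $ i)"
  using integrable_bounded_linear[OF bounded_linear_compose[OF bounded_linear_vec_nth bounded_linear_vec_nth] assms] .

lemma integrable_component:
  fixes w :: "'a \<Rightarrow> real^'m"
  assumes "integrable M w"
  shows "integrable M (\<lambda>x. w x $ i)"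
  using integrable_bounded_linear[OF bounded_linear_vec_nth assms] .

lemma bvd_theta_integrable:
  assumes "bvd \<Omega> w G \<theta> \<sigma>"
  shows "integrable \<sigma> \<theta>" "finite_measure \<sigma>" "space \<sigma> = UNIV"
proof -
  have s: "sets \<sigma> = sets borel" "emeasure \<sigma> UNIV < \<infinity>" "\<theta> \<in> borel_measurable borel" "AE x in \<sigma>. norm (\<theta> x) = 1"
    using assms by (auto simp: bvd_def)
  show sp: "space \<sigma> = UNIV" using sets_eq_imp_space_eq[OF s(1)] by simp
  show fm: "finite_measure \<sigma>" by (rule finite_measureI) (use s sp in auto)
  show "integrable \<sigma> \<theta>"
    using s by (intro finite_measure.integrable_const_bound[OF fm, of _ 1]) (auto simp: measurable_cong_sets[OF s(1) refl])
qed

text \<open>The definition tests with smooth functions, while the entries of admissible fields are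
  C^1; both sides pass to the limit along \<open>test_fun_approx\<close>.\<close>

lemma bvd_C1:
  fixes \<phi> :: "real^'n \<Rightarrow> real"
  assumes bv: "bvd \<Omega> w G \<theta> \<sigma>" and op: "open \<Omega>" and \<phi>: "\<phi> \<in> Ck_fun (Suc k)" "csupp \<Omega> \<phi>"
  shows "(LBINT x. w x $ i * pd \<alpha> \<phi> x)
          = - ((LBINT x. G x $ \<alpha> $ i * \<phi> x) + (\<integral>x. \<theta> x $ \<alpha> $ i * \<phi> x \<partial>\<sigma>))"
proof -
  obtain \<phi>s :: "nat \<Rightarrow> real^'n \<Rightarrow> real" where s: "\<And>j. test_fun \<Omega> (\<phi>s j)"
    "\<And>j x. \<bar>\<phi>s j x - \<phi> x\<bar> \<le> 1 / Suc j" "\<And>j \<alpha> x. \<bar>pd \<alpha> (\<phi>s j) x - pd \<alpha> \<phi> x\<bar> \<le> 1 / Suc j"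
    using test_fun_approx[OF \<phi> op] by metis
  have c: "continuous_on UNIV \<phi>" "continuous_on UNIV (pd \<alpha> \<phi>)"
    using Ck_fun_continuous[OF \<phi>(1)] C1_continuous_partial[OF \<phi>(1)] by auto
  have cs: "continuous_on UNIV (\<phi>s j)" "continuous_on UNIV (pd \<alpha> (\<phi>s j))" for j
    using s(1)[of j] Ck_fun_continuous C1_continuous_partial[of "\<phi>s j" 0] unfolding test_fun_iff by blast+
  have sb: "sets \<sigma> = sets borel" using bv by (simp add: bvd_def)
  have int: "L1 (\<lambda>x. w x $ i)" "L1 (\<lambda>x. G x $ \<alpha> $ i)" "integrable \<sigma> (\<lambda>x. \<theta> x $ \<alpha> $ i)"
    using bv bvd_theta_integrable(1)[OF bv] by (auto simp: bvd_def intro: integrable_entry integrable_component)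
  obtain B where B: "\<And>x. \<bar>\<phi> x\<bar> \<le> B" using csupp_bounded[OF c(1) \<phi>(2)] by (metis real_norm_def)
  obtain B' where B': "\<And>x. \<bar>pd \<alpha> \<phi> x\<bar> \<le> B'"
    using csupp_bounded[OF c(2) csupp_partial_deriv[OF \<phi>(2)]] by (metis real_norm_def)
  have m: "\<phi> \<in> borel_measurable borel" "pd \<alpha> \<phi> \<in> borel_measurable borel"
    "\<And>j. \<phi>s j \<in> borel_measurable borel" "\<And>j. pd \<alpha> (\<phi>s j) \<in> borel_measurable borel"
    using c cs by (auto intro: cont_borel)
  have l1: "(\<lambda>j. LBINT x. w x $ i * pd \<alpha> (\<phi>s j) x) \<longlonglongrightarrow> (LBINT x. w x $ i * pd \<alpha> \<phi> x)"
    using m by (intro integral_uniform_limit[OF int(1) _ _ B' s(3)]) auto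
  have l2: "(\<lambda>j. LBINT x. G x $ \<alpha> $ i * \<phi>s j x) \<longlonglongrightarrow> (LBINT x. G x $ \<alpha> $ i * \<phi> x)"
    using m by (intro integral_uniform_limit[OF int(2) _ _ B s(2)]) auto
  have l3: "(\<lambda>j. \<integral>x. \<theta> x $ \<alpha> $ i * \<phi>s j x \<partial>\<sigma>) \<longlonglongrightarrow> (\<integral>x. \<theta> x $ \<alpha> $ i * \<phi> x \<partial>\<sigma>)"
    using m by (intro integral_uniform_limit[OF int(3) _ _ B s(2)]) (auto simp: measurable_cong_sets[OF sb refl])
  have e: "(LBINT x. w x $ i * pd \<alpha> (\<phi>s j) x)
          = - ((LBINT x. G x $ \<alpha> $ i * \<phi>s j x) + (\<integral>x. \<theta> x $ \<alpha> $ i * \<phi>s j x \<partial>\<sigma>))" for j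
    using bv s(1)[of j] by (auto simp: bvd_def)
  show ?thesis
    using LIMSEQ_unique[OF l1[unfolded e] tendsto_minus[OF tendsto_add[OF l2 l3]]] .
qed

lemma integral_inner_entries:
  fixes F \<Phi> :: "'a \<Rightarrow> real^'m^'n"
  assumes "\<And>\<alpha> i. integrable M (\<lambda>x. F x $ \<alpha> $ i * \<Phi> x $ \<alpha> $ i)"
  shows "integrable M (\<lambda>x. F x \<bullet> \<Phi> x)"
    "(\<integral>x. F x \<bullet> \<Phi> x \<partial>M) = (\<Sum>\<alpha>\<in>UNIV. \<Sum>i\<in>UNIV. \<integral>x. F x $ \<alpha> $ i * \<Phi> x $ \<alpha> $ i \<partial>M)"
  using assms by (auto simp: inner_vec_def integral_sum)

lemma bvd_field:
  assumes bv: "bvd \<Omega> w G \<theta> \<sigma>" and op: "open \<Omega>" and \<Phi>: "C1_field \<Phi>" "csupp \<Omega> \<Phi>"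
  shows "(LBINT x. w x \<bullet> dv \<Phi> x) = - ((LBINT x. G x \<bullet> \<Phi> x) + (\<integral>x. \<theta> x \<bullet> \<Phi> x \<partial>\<sigma>))"
    "L1 (\<lambda>x. G x \<bullet> \<Phi> x)" "integrable \<sigma> (\<lambda>x. \<theta> x \<bullet> \<Phi> x)"
proof -
  have sb: "sets \<sigma> = sets borel" using bv by (simp add: bvd_def)
  have int: "L1 (\<lambda>x. w x $ i)" "L1 (\<lambda>x. G x $ \<alpha> $ i)" "integrable \<sigma> (\<lambda>x. \<theta> x $ \<alpha> $ i)" for \<alpha> i
    using bv bvd_theta_integrable(1)[OF bv] by (auto simp: bvd_def intro: integrable_entry integrable_component)
  note c1 = C1_field_entry[OF \<Phi>(1)] and cs = csupp_entry[OF \<Phi>(2)]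
  have cont: "continuous_on UNIV (\<lambda>x. \<Phi> x $ \<alpha> $ i)" for \<alpha> i using c1 Ck_fun_continuous by blast
  have m: "(\<lambda>x. \<Phi> x $ \<alpha> $ i) \<in> borel_measurable borel" for \<alpha> i using cont by (rule cont_borel)
  have i2: "L1 (\<lambda>x. G x $ \<alpha> $ i * \<Phi> x $ \<alpha> $ i)" for \<alpha> i
    using integrable_inner_csupp[OF int(2) cont cs] by simp
  have i3: "integrable \<sigma> (\<lambda>x. \<theta> x $ \<alpha> $ i * \<Phi> x $ \<alpha> $ i)" for \<alpha> i
  proof -
    obtain B where B: "\<And>x. \<bar>\<Phi> x $ \<alpha> $ i\<bar> \<le> B" using csupp_bounded[OF cont cs] by (metis real_norm_def)
    show ?thesis by (rule integrable_bounded_mult(2)[OF int(3) _ B]) (simp add: measurable_cong_sets[OF sb refl] m)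
  qed
  have i1: "L1 (\<lambda>x. w x $ i * pd \<alpha> (\<lambda>x. \<Phi> x $ \<alpha> $ i) x)" for \<alpha> i
    using integrable_inner_csupp[OF int(1) C1_continuous_partial[OF c1] csupp_partial_deriv[OF cs]] by simp
  show "L1 (\<lambda>x. G x \<bullet> \<Phi> x)" "integrable \<sigma> (\<lambda>x. \<theta> x \<bullet> \<Phi> x)"
    using integral_inner_entries(1)[OF i2] integral_inner_entries(1)[OF i3] .
  have "(LBINT x. w x \<bullet> dv \<Phi> x) = (LBINT x. (\<Sum>i\<in>UNIV. \<Sum>\<alpha>\<in>UNIV. w x $ i * pd \<alpha> (\<lambda>x. \<Phi> x $ \<alpha> $ i) x))"
    by (simp add: inner_vec_def dv_def sum_distrib_left)
  also have "\<dots> = (\<Sum>i\<in>UNIV. \<Sum>\<alpha>\<in>UNIV. LBINT x. w x $ i * pd \<alpha> (\<lambda>x. \<Phi> x $ \<alpha> $ i) x)"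
    using i1 by (simp add: integral_sum)
  also have "\<dots> = (\<Sum>\<alpha>\<in>UNIV. \<Sum>i\<in>UNIV. - ((LBINT x. G x $ \<alpha> $ i * \<Phi> x $ \<alpha> $ i) + (\<integral>x. \<theta> x $ \<alpha> $ i * \<Phi> x $ \<alpha> $ i \<partial>\<sigma>)))"
    by (subst sum.swap) (simp only: bvd_C1[OF bv op c1 cs])
  also have "\<dots> = - ((LBINT x. G x \<bullet> \<Phi> x) + (\<integral>x. \<theta> x \<bullet> \<Phi> x \<partial>\<sigma>))"
    using integral_inner_entries(2)[OF i2] integral_inner_entries(2)[OF i3] by (simp add: sum_negf sum.distrib sum_subtractf)
  finally show "(LBINT x. w x \<bullet> dv \<Phi> x) = - ((LBINT x. G x \<bullet> \<Phi> x) + (\<integral>x. \<theta> x \<bullet> \<Phi> x \<partial>\<sigma>))" .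
qed

section \<open>Integrands of linear growth\<close>

text \<open>Convexity appears as monotonicity of the derivative, \<open>pinf\<close> is the slope of
  \<psi> at infinity, and the linear lower bound supplies coercivity. Derivatives are taken within
  the half-line, hence one-sided at 0.\<close>

locale psi =
  fixes \<psi> \<psi>' :: "real \<Rightarrow> real" and pinf \<nu>2 \<nu>3 :: real
  assumes psi_deriv: "\<And>y. y \<ge> 0 \<Longrightarrow> (\<psi> has_real_derivative \<psi>' y) (at y within {0..})"
    and psi'_mono: "\<And>x y. 0 \<le> x \<Longrightarrow> x \<le> y \<Longrightarrow> \<psi>' x \<le> \<psi>' y"
    and psi'_cont: "continuous_on {0..} \<psi>'"
    and psi'_lim: "(\<psi>' \<longlongrightarrow> pinf) at_top"
    and psi_0: "\<psi> 0 = 0" and psi_nn: "\<And>y. y \<ge> 0 \<Longrightarrow> \<psi> y \<ge> 0"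
    and growth: "\<nu>2 > 0" "\<And>y. y \<ge> 0 \<Longrightarrow> \<nu>2 * y - \<nu>3 \<le> \<psi> y"
begin

lemma psi_tangent:
  assumes "t \<ge> 0" "y \<ge> 0"
  shows "\<psi> y + \<psi>' y * (t - y) \<le> \<psi> t"
proof -
  have mvt: "\<exists>z. a \<le> z \<and> z \<le> b \<and> \<psi> b - \<psi> a = \<psi>' z * (b - a)" if ab: "0 \<le> a" "a < b" for a b
  proof -
    have "\<exists>z\<in>{a<..<b}. \<psi> b - \<psi> a = (\<lambda>h. \<psi>' z * h) (b - a)"
    proof (rule mvt_simple[OF ab(2)])
      fix x assume "a \<le> x" "x \<le> b"
      then have "(\<psi> has_real_derivative \<psi>' x) (at x within {a..b})"
        using ab by (intro DERIV_subset[OF psi_deriv]) auto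
      then show "(\<psi> has_derivative (\<lambda>h. \<psi>' x * h)) (at x within {a..b})"
        by (simp add: has_field_derivative_def mult_commute_abs)
    qed
    then show ?thesis by (metis greaterThanLessThan_iff less_imp_le)
  qed
  consider "t = y" | "y < t" | "t < y" by linarith
  then show ?thesis
  proof cases
    case 2
    then obtain z where z: "y \<le> z" "\<psi> t - \<psi> y = \<psi>' z * (t - y)" using mvt[OF assms(2)] by metis
    have "\<psi>' y * (t - y) \<le> \<psi>' z * (t - y)" using psi'_mono[OF assms(2) z(1)] 2 by (intro mult_right_mono) auto
    then show ?thesis using z(2) by simp
  next
    case 3
    then obtain z where z: "t \<le> z" "z \<le> y" "\<psi> y - \<psi> t = \<psi>' z * (y - t)" using mvt[OF assms(1)] by metis
    have "\<psi>' z * (y - t) \<le> \<psi>' y * (y - t)" using psi'_mono[OF _ z(2)] z(1) assms(1) 3 by (intro mult_right_mono) auto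
    then show ?thesis using z(3) by (simp add: algebra_simps)
  qed simp
qed

lemma psi'_le: "y \<ge> 0 \<Longrightarrow> \<psi>' y \<le> pinf"
proof (rule tendsto_lowerbound[OF psi'_lim])
  assume "y \<ge> 0"
  then show "\<forall>\<^sub>F x in at_top. \<psi>' y \<le> \<psi>' x"
    using psi'_mono by (auto simp: eventually_at_top_linorder intro!: exI[of _ y])
qed simp

lemma psi'_nonneg: "y \<ge> 0 \<Longrightarrow> \<psi>' y \<ge> 0"
proof -
  assume y: "y \<ge> 0"
  have "\<psi>' 0 \<ge> 0"
  proof (rule tendsto_lowerbound)
    show "((\<lambda>t. (\<psi> t - \<psi> 0) / (t - 0)) \<longlongrightarrow> \<psi>' 0) (at 0 within {0..})"
      using psi_deriv[of 0] by (simp add: has_field_derivative_iff)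
    show "\<forall>\<^sub>F t in at 0 within {0..}. 0 \<le> (\<psi> t - \<psi> 0) / (t - 0)"
      using psi_nn psi_0 by (auto simp: eventually_at_filter)
    have "at 0 within {0::real..} = at_right 0" by (simp add: at_within_Ici_at_right)
    then show "at 0 within {0::real..} \<noteq> bot" by simp
  qed
  then show ?thesis using psi'_mono[of 0 y] y by simp
qed

lemma pinf_nonneg: "pinf \<ge> 0"
  using psi'_nonneg[of 0] psi'_le[of 0] by simp

lemma psi_le: "t \<ge> 0 \<Longrightarrow> \<psi> t \<le> pinf * t"
  using psi_tangent[of 0 t] psi'_le[of t] psi_0 mult_right_mono[of "\<psi>' t" pinf t] by simp

lemma psi_mono: "0 \<le> s \<Longrightarrow> s \<le> t \<Longrightarrow> \<psi> s \<le> \<psi> t"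
  using psi_tangent[of t s] psi'_nonneg[of s] mult_nonneg_nonneg[of "\<psi>' s" "t - s"] by linarith

text \<open>Since \<open>\<psi> t \<le> pinf * t\<close>, a line of slope above pinf + e overtakes
  \<psi> once e t exceeds |a|; the evaluation point t + 1 with e t = |a| is far enough out. It
  follows that admissible fields are bounded by \<open>pinf\<close>.\<close>

lemma slope_le:
  assumes "\<And>t. t \<ge> 0 \<Longrightarrow> a + b * t \<le> \<psi> t"
  shows "b \<le> pinf"
proof (rule field_le_epsilon)
  fix e :: real assume e: "e > 0"
  define t where "t = \<bar>a\<bar> / e"
  have t: "t \<ge> 0" "e * t = \<bar>a\<bar>" using e by (auto simp: t_def)
  show "b \<le> pinf + e"
  proof (rule ccontr)
    assume "\<not> b \<le> pinf + e"
    then have "b > pinf + e" by simp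
    then have "(pinf + e) * (t + 1) < b * (t + 1)" using t by (intro mult_strict_right_mono) auto
    moreover have "a + b * (t + 1) \<le> pinf * (t + 1)" using assms[of "t + 1"] psi_le[of "t + 1"] t by simp
    ultimately show False using t e by (simp add: algebra_simps)
  qed
qed

lemma psi_cont: "continuous_on {0..} \<psi>"
  using DERIV_continuous_on[OF psi_deriv] by auto

lemma psi_norm_measurable:
  fixes F :: "'a \<Rightarrow> 'b::euclidean_space"
  assumes "F \<in> borel_measurable M"
  shows "(\<lambda>x. \<psi> (norm (F x))) \<in> borel_measurable M"
proof -
  have "continuous_on UNIV (\<lambda>v::'b. \<psi> (norm v))"
    by (intro continuous_on_compose2[OF psi_cont] continuous_intros) auto
  from measurable_compose[OF assms cont_borel[OF this]] show ?thesis .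
qed

lemma adm_field_le: "adm \<Omega> \<psi> a \<Phi> \<Longrightarrow> norm (\<Phi> x) \<le> pinf"
  using slope_le[of "a x" "norm (\<Phi> x)"] admD(5) by blast

section \<open>Duality formula for the energy of a BV function\<close>

definition bval :: "(real^'n \<Rightarrow> real^'m^'n) \<Rightarrow> (real^'n) measure \<Rightarrow> real" where
  "bval G \<sigma> = (LBINT x. \<psi> (norm (G x))) + pinf * measure \<sigma> UNIV"

lemma psi_integrable:
  fixes G :: "'a::euclidean_space \<Rightarrow> 'b::euclidean_space"
  assumes G: "L1 G"
  shows "L1 (\<lambda>x. \<psi> (norm (G x)))"
proof (rule integrable_bound[of _ "\<lambda>x. pinf * norm (G x)"])
  show "(\<lambda>x. \<psi> (norm (G x))) \<in> borel_measurable lborel" using G by (intro psi_norm_measurable) auto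
  show "AE x in lborel. norm (\<psi> (norm (G x))) \<le> norm (pinf * norm (G x))"
    using psi_le psi_nn pinf_nonneg by (intro AE_I2) simp
qed (use G in auto)

text \<open>Inserting the decomposition turns the value of a test pair into an integral of a + G
  \<bullet> \<Phi> and an integral of \<theta> \<bullet> \<Phi>. The admissibility condition with t
  = |G| bounds the first integrand by \<psi> (|G|), and \<open>adm_field_le\<close> bounds the
  second by \<open>pinf\<close>.\<close>

lemma duality_le:
  fixes w :: "real^'n \<Rightarrow> real^'m"
  assumes bv: "bvd \<Omega> w G \<theta> \<sigma>" and op: "open \<Omega>"
  shows "Rfun \<Omega> \<psi> w \<le> ennreal (bval G \<sigma>)"
proof (rule Rfun_least)
  fix a and \<Phi> :: "real^'n \<Rightarrow> real^'m^'n" assume ad: "adm \<Omega> \<psi> a \<Phi>"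
  have G: "L1 G" using bv by (auto simp: bvd_def)
  interpret finite_measure \<sigma> by (rule bvd_theta_integrable(2)[OF bv])
  note f = bvd_field[OF bv op admD(1,4)[OF ad]]
  have "(LBINT x. a x) - (LBINT x. w x \<bullet> dv \<Phi> x) = (LBINT x. a x + G x \<bullet> \<Phi> x) + (\<integral>x. \<theta> x \<bullet> \<Phi> x \<partial>\<sigma>)"
    using f admD(2)[OF ad] by simp
  also have "(LBINT x. a x + G x \<bullet> \<Phi> x) \<le> (LBINT x. \<psi> (norm (G x)))"
  proof (rule integral_mono)
    fix x
    have "G x \<bullet> \<Phi> x \<le> norm (\<Phi> x) * norm (G x)" using norm_cauchy_schwarz[of "G x" "\<Phi> x"] by (simp add: mult.commute)
    then show "a x + G x \<bullet> \<Phi> x \<le> \<psi> (norm (G x))" using admD(5)[OF ad, of "norm (G x)" x] by simp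
  qed (use f admD(2)[OF ad] psi_integrable[OF G] in auto)
  also have "(\<integral>x. \<theta> x \<bullet> \<Phi> x \<partial>\<sigma>) \<le> (\<integral>x. pinf \<partial>\<sigma>)"
  proof (rule integral_mono_AE)
    have "AE x in \<sigma>. norm (\<theta> x) = 1" using bv by (simp add: bvd_def)
    then show "AE x in \<sigma>. \<theta> x \<bullet> \<Phi> x \<le> pinf"
    proof (rule AE_mp, intro AE_I2 impI)
      fix x assume "norm (\<theta> x) = 1"
      then show "\<theta> x \<bullet> \<Phi> x \<le> pinf" using norm_cauchy_schwarz[of "\<theta> x" "\<Phi> x"] adm_field_le[OF ad, of x] by simp
    qed
  qed (use f in auto)
  also have "(\<integral>x. pinf \<partial>\<sigma>) = pinf * measure \<sigma> UNIV" using bvd_theta_integrable(3)[OF bv] by simp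
  finally have le: "(LBINT x. a x) - (LBINT x. w x \<bullet> dv \<Phi> x) \<le> bval G \<sigma>" by (simp add: bval_def)
  then show "ennreal ((LBINT x. a x) - (LBINT x. w x \<bullet> dv \<Phi> x)) \<le> ennreal (bval G \<sigma>)"
    by (rule ennreal_leI)
qed

text \<open>The admissibility condition at a single point. It is closed, convex and contains 0,
  exactly what \<open>smooth_dense\<close> asks of the set of values.\<close>

definition slopes :: "(real \<times> 'b::real_inner) set" where
  "slopes = {p. \<forall>t\<ge>0. fst p + norm (snd p) * t \<le> \<psi> t}"

lemma slopes_closed: "closed (slopes :: (real \<times> 'b::euclidean_space) set)"
proof -
  have e: "slopes = (\<Inter>t\<in>{0..}. {p :: real \<times> 'b. fst p + norm (snd p) * t \<le> \<psi> t})"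
    by (auto simp: slopes_def)
  show ?thesis unfolding e by (intro closed_INT ballI closed_Collect_le continuous_intros)
qed

lemma slopes_convex: "convex (slopes :: (real \<times> 'b::euclidean_space) set)"
proof (rule convexI)
  fix p q :: "real \<times> 'b" and u v :: real
  assume p: "p \<in> slopes" and q: "q \<in> slopes" and uv: "0 \<le> u" "0 \<le> v" "u + v = 1"
  show "u *\<^sub>R p + v *\<^sub>R q \<in> slopes" unfolding slopes_def
  proof (safe)
    fix t :: real assume t: "t \<ge> 0"
    have "norm (snd (u *\<^sub>R p + v *\<^sub>R q)) \<le> u * norm (snd p) + v * norm (snd q)"
      using norm_triangle_ineq[of "u *\<^sub>R snd p" "v *\<^sub>R snd q"] uv by simp
    then have "norm (snd (u *\<^sub>R p + v *\<^sub>R q)) * t \<le> (u * norm (snd p) + v * norm (snd q)) * t"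
      using t by (rule mult_right_mono)
    then have "fst (u *\<^sub>R p + v *\<^sub>R q) + norm (snd (u *\<^sub>R p + v *\<^sub>R q)) * t
        \<le> u * (fst p + norm (snd p) * t) + v * (fst q + norm (snd q) * t)"
      by (simp add: algebra_simps)
    also have "\<dots> \<le> u * \<psi> t + v * \<psi> t"
      using p q uv t by (intro add_mono mult_left_mono) (auto simp: slopes_def)
    also have "\<dots> = \<psi> t" using uv by (simp flip: distrib_right)
    finally show "fst (u *\<^sub>R p + v *\<^sub>R q) + norm (snd (u *\<^sub>R p + v *\<^sub>R q)) * t \<le> \<psi> t" .
  qed
qed

lemma slopes_tangent:
  assumes "y \<ge> 0" "norm B \<le> \<psi>' y"
  shows "(\<psi> y - \<psi>' y * y, B) \<in> slopes"
  unfolding slopes_def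
proof (safe)
  fix t :: real assume t: "t \<ge> 0"
  have "\<psi> y - \<psi>' y * y + norm B * t \<le> \<psi> y - \<psi>' y * y + \<psi>' y * t"
    using assms(2) t by (intro add_left_mono mult_right_mono) auto
  then show "fst (\<psi> y - \<psi>' y * y, B) + norm (snd (\<psi> y - \<psi>' y * y, B)) * t \<le> \<psi> t"
    using psi_tangent[OF t assms(1)] by (simp add: algebra_simps)
qed

lemma slopes_0: "0 \<in> slopes"
  using psi_nn by (simp add: slopes_def)

lemma psi'_norm_measurable:
  fixes f :: "'a \<Rightarrow> real"
  assumes "f \<in> borel_measurable M" "\<And>x. f x \<ge> 0"
  shows "(\<lambda>x. \<psi>' (f x)) \<in> borel_measurable M" "(\<lambda>x. \<psi> (f x)) \<in> borel_measurable M"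
proof -
  have c: "continuous_on UNIV (\<lambda>v. \<psi>' \<bar>v\<bar>)" "continuous_on UNIV (\<lambda>v. \<psi> \<bar>v\<bar>)"
    by (intro continuous_on_compose2[OF psi'_cont] continuous_on_compose2[OF psi_cont] continuous_intros; auto)+
  show "(\<lambda>x. \<psi>' (f x)) \<in> borel_measurable M" "(\<lambda>x. \<psi> (f x)) \<in> borel_measurable M"
    using measurable_compose[OF assms(1) cont_borel[OF c(1)]] measurable_compose[OF assms(1) cont_borel[OF c(2)]] assms(2)
    by (auto simp: abs_of_nonneg)
qed

text \<open>The optimal pair is \<open>(\<psi>(|G|) - \<psi>'(|G|)|G|, \<psi>'(|G|) G/|G|)\<close> off the singular set and \<open>\<psi>' y \<theta>\<close> with large y
  on it, truncated at y and then approximated by test pairs.\<close>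

lemma duality_ge_aux:
  fixes w :: "real^'n \<Rightarrow> real^'m"
  assumes bv: "bvd \<Omega> w G \<theta> \<sigma>" and op: "open \<Omega>" and bd: "bounded \<Omega>" and y: "y \<ge> 0" and e: "e > 0"
  shows "ennreal ((LBINT x. \<psi> (min (norm (G x)) y)) + \<psi>' y * measure \<sigma> UNIV - 2 * e) \<le> Rfun \<Omega> \<psi> w"
proof -
  have G: "L1 G" "\<And>x. x \<notin> \<Omega> \<Longrightarrow> G x = 0" and sb: "sets \<sigma> = sets borel" and s\<sigma>: "emeasure \<sigma> UNIV < \<infinity>"
    and \<sigma>\<Omega>: "emeasure \<sigma> (UNIV - \<Omega>) = 0" and \<theta>[measurable]: "\<theta> \<in> borel_measurable borel" and \<theta>1: "AE x in \<sigma>. norm (\<theta> x) = 1"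
    using bv by (auto simp: bvd_def)
  obtain Z where Z[measurable]: "Z \<in> sets borel" and Z0: "emeasure lborel Z = 0" "emeasure \<sigma> (UNIV - Z) = 0"
    using bv by (auto simp: bvd_def)
  have [measurable]: "G \<in> borel_measurable borel" "\<Omega> \<in> sets borel" using G(1) op by auto
  \<comment> \<open>Truncating the gradient norm at y keeps the optimal pair bounded, hence
    integrable for every finite measure.\<close>
  define m where "m x = min (norm (G x)) y" for x
  have m0: "m x \<ge> 0" "m x \<le> y" "m x \<le> norm (G x)" for x using y by (auto simp: m_def)
  have [measurable]: "m \<in> borel_measurable borel" unfolding m_def[abs_def] by measurable
  have [measurable]: "(\<lambda>x. \<psi> (m x)) \<in> borel_measurable borel" "(\<lambda>x. \<psi>' (m x)) \<in> borel_measurable borel"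
    using psi'_norm_measurable[of m borel] m0(1) by auto
  \<comment> \<open>Z carries \<sigma> but no Lebesgue mass, so the two prescriptions do not
    interfere. The value 0 where \<theta> is not a unit vector concerns a \<sigma>-null set and
    keeps h in \<open>slopes\<close>.\<close>
  define h where "h x = (if x \<notin> \<Omega> then 0 else if x \<in> Z then (if norm (\<theta> x) = 1 then (\<psi> y - \<psi>' y * y, \<psi>' y *\<^sub>R \<theta> x) else 0)
     else (\<psi> (m x) - \<psi>' (m x) * m x, (\<psi>' (m x) / norm (G x)) *\<^sub>R G x))" for x
  have hm[measurable]: "h \<in> borel_measurable borel" unfolding h_def[abs_def] by measurable
  have nB: "norm ((\<psi>' (m x) / norm (G x)) *\<^sub>R G x) \<le> \<psi>' (m x)" for x
    using psi'_nonneg[OF m0(1)[of x]] by (cases "G x = 0") auto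
  have hC: "h x \<in> slopes" for x
  proof -
    have "h x \<in> {0, (\<psi> y - \<psi>' y * y, \<psi>' y *\<^sub>R \<theta> x), (\<psi> (m x) - \<psi>' (m x) * m x, (\<psi>' (m x) / norm (G x)) *\<^sub>R G x)}"
      by (simp add: h_def)
    moreover have "(\<psi> y - \<psi>' y * y, \<psi>' y *\<^sub>R \<theta> x) \<in> slopes" if "norm (\<theta> x) = 1"
      using slopes_tangent[OF y, of "\<psi>' y *\<^sub>R \<theta> x"] that psi'_nonneg[OF y] by simp
    ultimately show ?thesis
      using slopes_tangent[OF m0(1) nB, of x] slopes_0 by (auto simp: h_def)
  qed
  have hoff: "h x = 0" if "x \<notin> \<Omega>" for x using that by (simp add: h_def)
  have a_bd: "\<bar>\<psi> t - \<psi>' t * t\<bar> \<le> \<psi>' y * y" if "0 \<le> t" "t \<le> y" for t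
  proof -
    have "\<psi> t - \<psi>' t * t \<le> 0" using psi_tangent[of 0 t] that psi_0 by simp
    moreover have "\<psi>' t * t \<le> \<psi>' y * y" using psi'_mono[OF that] psi'_nonneg[OF that(1)] that by (intro mult_mono) auto
    moreover have "\<psi> t \<ge> 0" using psi_nn that by simp
    ultimately show ?thesis by linarith
  qed
  have h_bd: "norm (h x) \<le> \<psi>' y * y + \<psi>' y" for x
  proof -
    have p: "0 \<le> \<psi>' y" "0 \<le> \<psi>' y * y" using psi'_nonneg[OF y] y by auto
    have "norm (\<psi> (m x) - \<psi>' (m x) * m x, (\<psi>' (m x) / norm (G x)) *\<^sub>R G x) \<le> \<psi>' y * y + \<psi>' y"
      using a_bd[OF m0(1,2)[of x]] nB[of x] psi'_mono[OF m0(1,2)[of x]]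
      by (intro order_trans[OF norm_Pair_le]) (auto intro: add_mono)
    moreover have "norm (\<psi> y - \<psi>' y * y, \<psi>' y *\<^sub>R \<theta> x) \<le> \<psi>' y * y + \<psi>' y" if "norm (\<theta> x) = 1"
      using a_bd[OF y order_refl] that p by (intro order_trans[OF norm_Pair_le]) auto
    ultimately show ?thesis using p by (auto simp: h_def)
  qed
  \<comment> \<open>Replacing h by a smooth pair changes a + G \<bullet> \<Phi> by at most (1 + |G|)
    times the distance of the pairs; this weight is therefore built into the measure.\<close>
  define N where "N = density lborel (\<lambda>x. ennreal (indicator \<Omega> x * (1 + norm (G x))))"
  have i\<Omega>: "L1 (indicator \<Omega> :: _ \<Rightarrow> real)" using emeasure_bounded_finite[OF bd] by (simp add: less_top)
  have iN: "L1 (\<lambda>x. indicator \<Omega> x * (1 + norm (G x)))"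
    using i\<Omega> G(1) by (auto simp: distrib_left intro!: integrable_add integrable_mult_indicator[where 'b = real, simplified])
  have sN: "sets N = sets borel" by (simp add: N_def)
  have fN: "emeasure N UNIV < \<infinity>"
    using iN by (simp add: N_def emeasure_density integrable_iff_bounded)
  obtain \<mu> where s\<mu>: "sets \<mu> = sets borel" "emeasure \<mu> UNIV < \<infinity>" and le: "N \<le> \<mu>" "\<sigma> \<le> \<mu>"
    using dominating_measure[OF sN fN sb s\<sigma>] .
  interpret \<mu>: finite_measure \<mu>
    by (rule finite_measureI) (use s\<mu> sets_eq_imp_space_eq[OF s\<mu>(1)] in auto)
  have hi: "integrable \<mu> h"
    using h_bd by (intro \<mu>.integrable_const_bound[of _ "\<psi>' y * y + \<psi>' y"]) (auto simp: measurable_cong_sets[OF s\<mu>(1) refl])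
  obtain \<phi> where \<phi>: "continuous_on UNIV \<phi>" "csupp \<Omega> \<phi>" "\<And>x. \<phi> x \<in> slopes" "(\<integral>x. norm (\<phi> x - h x) \<partial>\<mu>) < e"
      "\<And>T k. bounded_linear T \<Longrightarrow> (\<lambda>x. T (\<phi> x)) \<in> Ck_fun k"
    by (rule smooth_dense[OF s\<mu> op hi slopes_closed slopes_convex slopes_0 hC hoff e], assumption, rule that) auto
  define a where "a x = fst (\<phi> x)" for x
  define \<Phi> where "\<Phi> x = snd (\<phi> x)" for x
  have "(\<lambda>x. \<Phi> x $ \<alpha> $ i) \<in> Ck_fun (Suc 0)" for \<alpha> i
    unfolding \<Phi>_def
    by (rule \<phi>(5)) (intro bounded_linear_compose[OF bounded_linear_vec_nth bounded_linear_compose[OF bounded_linear_vec_nth bounded_linear_snd]])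
  then have C1: "C1_field \<Phi>" by (simp add: C1_field_def del: Ck_fun.simps)
  have ac: "continuous_on UNIV a" unfolding a_def[abs_def] by (intro continuous_on_fst \<phi>(1))
  have asupp: "csupp \<Omega> a" "csupp \<Omega> \<Phi>" using \<phi>(2) by (auto simp: csupp_def a_def \<Phi>_def zero_prod_def)
  have ai: "L1 a" by (rule csupp_integrable[OF ac asupp(1)])
  have ad: "adm \<Omega> \<psi> a \<Phi>"
    unfolding adm_def using C1 ai asupp \<phi>(3) by (auto simp: slopes_def a_def \<Phi>_def)
  note f = bvd_field[OF bv op C1 asupp(2)]
  define d where "d x = norm (\<phi> x - h x)" for x
  have di: "integrable \<mu> d" unfolding d_def[abs_def]
    by (intro integrable_norm integrable_diff hi csupp_integrable_finite[OF s\<mu> \<phi>(1,2)])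
  have dN: "integrable N d" "(\<integral>x. d x \<partial>N) < e" and d\<sigma>: "integrable \<sigma> d" "(\<integral>x. d x \<partial>\<sigma>) < e"
    using le_measure_integral[OF le(1) _ di] le_measure_integral[OF le(2) _ di] \<phi>(4) sN sb s\<mu>(1)
    by (auto simp: d_def[abs_def])
  have [measurable]: "d \<in> borel_measurable borel" using cont_borel[OF \<phi>(1)] unfolding d_def[abs_def] by measurable
  have dl: "L1 (\<lambda>x. indicator \<Omega> x * (1 + norm (G x)) * d x)" "(LBINT x. indicator \<Omega> x * (1 + norm (G x)) * d x) < e"
  proof -
    let ?k = "\<lambda>x. indicator \<Omega> x * (1 + norm (G x))"
    have k: "?k \<in> borel_measurable lborel" "AE x in lborel. 0 \<le> ?k x" "d \<in> borel_measurable lborel" by auto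
    show "L1 (\<lambda>x. ?k x * d x)"
      using dN(1) integrable_density[OF k(3,1,2)] by (simp add: N_def)
    show "(LBINT x. ?k x * d x) < e"
      using dN(2) integral_density[OF k(3,1,2)] by (simp add: N_def)
  qed
  have im: "L1 (\<lambda>x. \<psi> (m x))"
    by (rule integrable_bound[OF psi_integrable[OF G(1)]])
      (use psi_mono[OF m0(1,3)] psi_nn m0(1) in auto)
  have close: "\<bar>a x - fst (h x)\<bar> \<le> d x" "norm (\<Phi> x - snd (h x)) \<le> d x" for x
    unfolding a_def \<Phi>_def d_def
    using norm_fst_le[of "fst (\<phi> x - h x)" "snd (\<phi> x - h x)"] norm_snd_le[of "snd (\<phi> x - h x)" "fst (\<phi> x - h x)"]
    unfolding prod.collapse by simp_all
  have "(LBINT x. \<psi> (m x) - indicator \<Omega> x * (1 + norm (G x)) * d x) \<le> (LBINT x. a x + G x \<bullet> \<Phi> x)"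
  proof (rule integral_mono_AE)
    have "AE x in lborel. x \<notin> Z" using Z0 by (intro AE_not_in) (auto simp: null_sets_def)
    then show "AE x in lborel. \<psi> (m x) - indicator \<Omega> x * (1 + norm (G x)) * d x \<le> a x + G x \<bullet> \<Phi> x"
    proof (rule AE_mp, intro AE_I2 impI)
      fix x assume xZ: "x \<notin> Z"
      show "\<psi> (m x) - indicator \<Omega> x * (1 + norm (G x)) * d x \<le> a x + G x \<bullet> \<Phi> x"
      proof (cases "x \<in> \<Omega>")
        case False
        then have "a x = 0" "G x = 0" using asupp(1) G(2) by (auto simp: csupp_def)
        then show ?thesis using False psi_0 y by (simp add: m_def)
      next
        case True
        have h: "fst (h x) = \<psi> (m x) - \<psi>' (m x) * m x" "snd (h x) = (\<psi>' (m x) / norm (G x)) *\<^sub>R G x"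
          using True xZ by (auto simp: h_def)
        have "G x \<bullet> snd (h x) = \<psi>' (m x) * norm (G x)"
          unfolding h by (cases "G x = 0") (auto simp: dot_square_norm power2_eq_square)
        moreover have "\<psi>' (m x) * m x \<le> \<psi>' (m x) * norm (G x)"
          using m0(3) psi'_nonneg[OF m0(1)] by (intro mult_left_mono) auto
        ultimately have 1: "\<psi> (m x) \<le> fst (h x) + G x \<bullet> snd (h x)" unfolding h(1) by simp
        have "G x \<bullet> (snd (h x) - \<Phi> x) \<le> norm (G x) * d x"
          using norm_cauchy_schwarz[of "G x" "snd (h x) - \<Phi> x"] close(2)[of x]
          by (smt (verit) mult_left_mono norm_ge_zero norm_minus_commute)
        then show ?thesis using 1 close(1)[of x] True by (simp add: inner_diff_right algebra_simps)
      qed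
    qed
  qed (use im dl f ai in auto)
  moreover have "(\<integral>x. \<psi>' y - d x \<partial>\<sigma>) \<le> (\<integral>x. \<theta> x \<bullet> \<Phi> x \<partial>\<sigma>)"
  proof (rule integral_mono_AE)
    have "AE x in \<sigma>. x \<notin> UNIV - Z" "AE x in \<sigma>. x \<notin> UNIV - \<Omega>"
      using AE_not_in[of "UNIV - Z" \<sigma>] AE_not_in[of "UNIV - \<Omega>" \<sigma>] Z0 \<sigma>\<Omega> sb op by (auto simp: null_sets_def)
    with \<theta>1 show "AE x in \<sigma>. \<psi>' y - d x \<le> \<theta> x \<bullet> \<Phi> x"
    proof eventually_elim
      case (elim x)
      then have "snd (h x) = \<psi>' y *\<^sub>R \<theta> x" by (simp add: h_def)
      then have "\<theta> x \<bullet> snd (h x) = \<psi>' y" using elim by (simp add: dot_square_norm)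
      moreover have "\<theta> x \<bullet> (snd (h x) - \<Phi> x) \<le> d x"
        using norm_cauchy_schwarz[of "\<theta> x" "snd (h x) - \<Phi> x"] close(2)[of x] elim by (simp add: norm_minus_commute)
      ultimately show ?case by (simp add: inner_diff_right)
    qed
    show "integrable \<sigma> (\<lambda>x. \<psi>' y - d x)"
      by (intro integrable_diff d\<sigma>(1) finite_measure.integrable_const[OF bvd_theta_integrable(2)[OF bv]])
  qed (use f in auto)
  moreover have "(\<integral>x. \<psi>' y - d x \<partial>\<sigma>) = \<psi>' y * measure \<sigma> UNIV - (\<integral>x. d x \<partial>\<sigma>)"
    using bvd_theta_integrable(3)[OF bv]
    by (subst integral_diff[OF finite_measure.integrable_const[OF bvd_theta_integrable(2)[OF bv]] d\<sigma>(1)]) auto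
  moreover have "(LBINT x. \<psi> (m x) - indicator \<Omega> x * (1 + norm (G x)) * d x)
      = (LBINT x. \<psi> (m x)) - (LBINT x. indicator \<Omega> x * (1 + norm (G x)) * d x)"
    using im dl by (intro integral_diff)
  moreover have "(LBINT x. a x) - (LBINT x. w x \<bullet> dv \<Phi> x) = (LBINT x. a x + G x \<bullet> \<Phi> x) + (\<integral>x. \<theta> x \<bullet> \<Phi> x \<partial>\<sigma>)"
    using f ai by simp
  ultimately have "(LBINT x. \<psi> (m x)) + \<psi>' y * measure \<sigma> UNIV - 2 * e \<le> (LBINT x. a x) - (LBINT x. w x \<bullet> dv \<Phi> x)"
    using dl(2) d\<sigma>(2) by linarith
  then show ?thesis
    unfolding m_def[symmetric] by (rule order_trans[OF ennreal_leI Rfun_upper[OF ad]])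
qed

text \<open>In \<open>duality_ge_aux\<close> the truncation level tends to infinity: the truncated
  energies converge by dominated convergence, and \<psi>' tends to \<open>pinf\<close>.\<close>

theorem duality:
  fixes w :: "real^'n \<Rightarrow> real^'m"
  assumes bv: "bvd \<Omega> w G \<theta> \<sigma>" and op: "open \<Omega>" and bd: "bounded \<Omega>"
  shows "Rfun \<Omega> \<psi> w = ennreal (bval G \<sigma>)"
proof (rule antisym[OF duality_le[OF bv op]])
  have G: "L1 G" using bv by (auto simp: bvd_def)
  then have [measurable]: "G \<in> borel_measurable borel" by auto
  obtain r where r: "r \<ge> 0" "Rfun \<Omega> \<psi> w = ennreal r"
    using duality_le[OF bv op] by (metis ennreal_cases ennreal_less_top leD)
  have le: "(LBINT x. \<psi> (min (norm (G x)) (real k))) + \<psi>' (real k) * measure \<sigma> UNIV \<le> r" for k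
  proof (rule field_le_epsilon)
    fix e :: real assume "e > 0"
    then have "e / 2 > 0" by simp
    from duality_ge_aux[OF bv op bd _ this, of "real k"]
    have "(LBINT x. \<psi> (min (norm (G x)) (real k))) + \<psi>' (real k) * measure \<sigma> UNIV - 2 * (e / 2) \<le> r"
      unfolding r(2) using r(1) by (auto simp: ennreal_le_iff2)
    then show "(LBINT x. \<psi> (min (norm (G x)) (real k))) + \<psi>' (real k) * measure \<sigma> UNIV \<le> r + e" by simp
  qed
  have "(\<lambda>k. LBINT x. \<psi> (min (norm (G x)) (real k))) \<longlonglongrightarrow> (LBINT x. \<psi> (norm (G x)))"
  proof (rule integral_dominated_convergence[where w = "\<lambda>x. \<psi> (norm (G x))"])
    show "(\<lambda>x. \<psi> (min (norm (G x)) (real k))) \<in> borel_measurable lborel" for k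
      by (rule psi'_norm_measurable(2)) auto
    show "AE x in lborel. (\<lambda>k. \<psi> (min (norm (G x)) (real k))) \<longlonglongrightarrow> \<psi> (norm (G x))"
    proof (rule AE_I2, rule tendsto_eventually)
      fix x
      obtain k0 where "norm (G x) \<le> real k0" using real_arch_simple by blast
      then have "min (norm (G x)) (real k) = norm (G x)" if "k \<ge> k0" for k using that by linarith
      then show "\<forall>\<^sub>F k in sequentially. \<psi> (min (norm (G x)) (real k)) = \<psi> (norm (G x))"
        unfolding eventually_sequentially by metis
    qed
    show "AE x in lborel. norm (\<psi> (min (norm (G x)) (real k))) \<le> \<psi> (norm (G x))" for k
      using psi_nn psi_mono by (intro AE_I2) auto
  qed (use psi_integrable[OF G] in auto)
  moreover have "(\<lambda>k. \<psi>' (real k) * measure \<sigma> UNIV) \<longlonglongrightarrow> pinf * measure \<sigma> UNIV"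
    by (intro tendsto_mult_right filterlim_compose[OF psi'_lim filterlim_real_sequentially])
  ultimately have "(\<lambda>k. (LBINT x. \<psi> (min (norm (G x)) (real k))) + \<psi>' (real k) * measure \<sigma> UNIV) \<longlonglongrightarrow> bval G \<sigma>"
    unfolding bval_def by (rule tendsto_add)
  then have "bval G \<sigma> \<le> r"
    by (rule LIMSEQ_le_const2) (use le in auto)
  then show "ennreal (bval G \<sigma>) \<le> Rfun \<Omega> \<psi> w" unfolding r(2) by (rule ennreal_leI)
qed

end

section \<open>Radon-Nikodym densities; finite energy implies bounded variation\<close>

text \<open>Domination gives absolute continuity. The density is made real and nonnegative
  everywhere so that quotients of densities can be formed pointwise.\<close>

lemma real_density:
  fixes M N :: "'a::euclidean_space measure"
  assumes M: "sets M = sets borel" "emeasure M UNIV < \<infinity>" and N: "sets N = sets borel" "emeasure N UNIV < \<infinity>" and le: "N \<le> M"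
  shows "\<exists>D. D \<in> borel_measurable borel \<and> (\<forall>x. 0 \<le> D x) \<and> integrable M D \<and> N = density M (\<lambda>x. ennreal (D x))"
proof -
  have sp: "space M = UNIV" "space N = UNIV" using sets_eq_imp_space_eq[OF M(1)] sets_eq_imp_space_eq[OF N(1)] by simp_all
  interpret M: finite_measure M by (rule finite_measureI) (use M sp in auto)
  have fN: "finite_measure N" by (rule finite_measureI) (use N sp in auto)
  have s: "sets N = sets M" using M N by simp
  have ac: "absolutely_continuous M N"
    unfolding absolutely_continuous_def
  proof
    fix A assume "A \<in> null_sets M"
    then show "A \<in> null_sets N" using le_measureD3[OF le s, of A] s by (auto simp: null_sets_def)
  qed
  obtain D where D: "D \<in> borel_measurable M" "AE x in M. RN_deriv M N x = ennreal (D x)" "\<And>x. 0 \<le> D x"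
    using M.real_RN_deriv[OF fN ac s] by metis
  have "N = density M (RN_deriv M N)" using M.density_RN_deriv[OF ac s] by simp
  also have "\<dots> = density M (\<lambda>x. ennreal (D x))" using D by (intro density_cong) auto
  finally have eq: "N = density M (\<lambda>x. ennreal (D x))" .
  have "(\<integral>\<^sup>+x. ennreal (D x) \<partial>M) = emeasure N UNIV"
    using D(1) sp by (subst eq, subst emeasure_density) (auto simp: M(1))
  then have "integrable M D" using D(1,3) N(2) by (simp add: integrable_iff_bounded)
  then show ?thesis using D(1,3) eq by (auto simp: measurable_cong_sets[OF M(1) refl])
qed

lemma integral_density_real:
  fixes f :: "'a::euclidean_space \<Rightarrow> real"
  assumes M: "sets M = sets borel" and D: "D \<in> borel_measurable borel" "\<And>x. 0 \<le> D x" and f: "f \<in> borel_measurable borel"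
  shows "(\<integral>x. f x \<partial>density M (\<lambda>x. ennreal (D x))) = (\<integral>x. D x * f x \<partial>M)"
    "integrable (density M (\<lambda>x. ennreal (D x))) f \<longleftrightarrow> integrable M (\<lambda>x. D x * f x)"
  using D f by (auto simp: integral_density integrable_density measurable_cong_sets[OF M refl])

text \<open>Polar decomposition and Lebesgue decomposition of the vector measure \<open>H \<tau>\<close>.\<close>

lemma bvd_of_density:
  fixes w :: "real^'n \<Rightarrow> real^'m" and H :: "real^'n \<Rightarrow> real^'m^'n"
  assumes w: "L1 w" and op: "open \<Omega>" and bd: "bounded \<Omega>"
    and \<tau>: "sets \<tau> = sets borel" "emeasure \<tau> UNIV < \<infinity>" "emeasure \<tau> (UNIV - \<Omega>) = 0"
    and H: "integrable \<tau> H"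
    and eq: "\<And>\<phi> \<alpha> i. test_fun \<Omega> \<phi> \<Longrightarrow> (LBINT x. w x $ i * pd \<alpha> \<phi> x) = - (\<integral>x. H x $ \<alpha> $ i * \<phi> x \<partial>\<tau>)"
  shows "\<exists>G \<theta> \<sigma>. bvd \<Omega> w G \<theta> \<sigma>"
proof -
  have [measurable]: "\<Omega> \<in> sets borel" using op by auto
  have Hm[measurable]: "H \<in> borel_measurable borel" using H by (simp add: measurable_cong_sets[OF \<tau>(1) refl] borel_measurable_integrable flip: measurable_cong_sets[OF \<tau>(1) refl])
  define \<Lambda> where "\<Lambda> = density lborel (\<lambda>x::real^'n. ennreal (indicator \<Omega> x))"
  have s\<Lambda>: "sets \<Lambda> = sets borel" by (simp add: \<Lambda>_def)
  have e\<Lambda>: "emeasure \<Lambda> A = emeasure lborel (A \<inter> \<Omega>)" if [measurable]: "A \<in> sets borel" for A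
  proof -
    have *: "ennreal (indicator \<Omega> x) * indicator A x = indicator (A \<inter> \<Omega>) x" for x
      by (cases "x \<in> \<Omega>"; cases "x \<in> A") auto
    show ?thesis unfolding \<Lambda>_def by (subst emeasure_density) (auto simp: *)
  qed
  have f\<Lambda>: "emeasure \<Lambda> UNIV < \<infinity>" using e\<Lambda>[of UNIV] emeasure_bounded_finite[OF bd] by simp
  \<comment> \<open>One measure dominates Lebesgue measure on \<Omega> and \<tau>, so that the
    Lebesgue decomposition can be read off from the densities p and q.\<close>
  obtain \<rho> where \<rho>: "sets \<rho> = sets borel" "emeasure \<rho> UNIV < \<infinity>" and le: "\<Lambda> \<le> \<rho>" "\<tau> \<le> \<rho>"
    using dominating_measure[OF s\<Lambda> f\<Lambda> \<tau>(1,2)] .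
  obtain p where p[measurable]: "p \<in> borel_measurable borel" and p0: "\<And>x. 0 \<le> p x" and pi: "integrable \<rho> p" and p\<Lambda>: "\<Lambda> = density \<rho> (\<lambda>x. ennreal (p x))"
    using real_density[OF \<rho> s\<Lambda> f\<Lambda> le(1)] by blast
  obtain q where q[measurable]: "q \<in> borel_measurable borel" and q0: "\<And>x. 0 \<le> q x" and qi: "integrable \<rho> q" and q\<tau>: "\<tau> = density \<rho> (\<lambda>x. ennreal (q x))"
    using real_density[OF \<rho> \<tau>(1,2) le(2)] by blast
  \<comment> \<open>Where p = 0 there is no Lebesgue mass, and \<tau> restricted to this set is
    singular. On the rest of \<Omega> the measure H \<tau> has the Lebesgue density q H / p.\<close>
  define Z where "Z = {x \<in> \<Omega>. p x = 0}"
  have Z[measurable]: "Z \<in> sets borel" unfolding Z_def by measurable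
  have Z0: "emeasure lborel Z = 0"
  proof -
    have "emeasure lborel Z = emeasure \<Lambda> Z" using e\<Lambda>[OF Z] by (simp add: Z_def Int_absorb2)
    also have "\<dots> = (\<integral>\<^sup>+x. ennreal (p x) * indicator Z x \<partial>\<rho>)"
      unfolding p\<Lambda> by (rule emeasure_density) (auto simp: measurable_cong_sets[OF \<rho>(1) refl] \<rho>(1))
    also have "\<dots> = (\<integral>\<^sup>+x. 0 \<partial>\<rho>)" by (intro nn_integral_cong) (auto simp: Z_def indicator_def)
    finally show ?thesis by simp
  qed
  define G where "G x = (if x \<in> \<Omega> \<and> p x \<noteq> 0 then (q x / p x) *\<^sub>R H x else 0)" for x
  have [measurable]: "G \<in> borel_measurable borel" unfolding G_def[abs_def] by measurable
  define k where "k x = indicator Z x * norm (H x)" for x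
  have [measurable]: "k \<in> borel_measurable borel" unfolding k_def[abs_def] by measurable
  have k0: "k x \<ge> 0" for x by (simp add: k_def)
  define \<sigma> where "\<sigma> = density \<tau> (\<lambda>x. ennreal (k x))"
  \<comment> \<open>Where H = 0 the division gives 0 instead of a unit vector, but the density k of
    \<sigma> vanishes there.\<close>
  define \<theta> where "\<theta> x = (1 / norm (H x)) *\<^sub>R H x" for x
  have [measurable]: "\<theta> \<in> borel_measurable borel" unfolding \<theta>_def[abs_def] by measurable
  note m\<tau> = measurable_cong_sets[OF \<tau>(1) refl]
  have s\<sigma>: "sets \<sigma> = sets borel" by (simp add: \<sigma>_def \<tau>(1))
  have e\<sigma>: "emeasure \<sigma> A = (\<integral>\<^sup>+x. ennreal (k x) * indicator A x \<partial>\<tau>)" if "A \<in> sets borel" for A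
    unfolding \<sigma>_def using that by (intro emeasure_density) (auto simp: m\<tau> \<tau>(1))
  have ki: "integrable \<tau> k"
    using H by (intro integrable_bound[OF integrable_norm[OF H]]) (auto simp: k_def m\<tau> indicator_def)
  have f\<sigma>: "emeasure \<sigma> UNIV < \<infinity>"
    using ki k0 by (simp add: e\<sigma> integrable_iff_bounded)
  have zero: "emeasure \<sigma> A = 0" if "A \<in> sets borel" "A \<inter> Z = {}" for A
  proof -
    have "emeasure \<sigma> A = (\<integral>\<^sup>+x. 0 \<partial>\<tau>)"
      unfolding e\<sigma>[OF that(1)] using that(2) by (intro nn_integral_cong) (auto simp: k_def indicator_def)
    then show ?thesis by simp
  qed
  have \<theta>1: "AE x in \<sigma>. norm (\<theta> x) = 1"
    unfolding \<sigma>_def by (subst AE_density) (auto simp: m\<tau> \<theta>_def k_def)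
  have Gn: "p x * norm (G x) \<le> q x * norm (H x)" for x
    using p0[of x] q0[of x] by (auto simp: G_def)
  have tau_int: "integrable \<rho> (\<lambda>x. q x * norm (H x))"
    using integral_density_real(2)[OF \<rho>(1) q q0, of "\<lambda>x. norm (H x)"] integrable_norm[OF H] by (simp add: q\<tau>)
  have "integrable \<rho> (\<lambda>x. p x * norm (G x))"
    by (rule integrable_bound[OF tau_int])
      (use Gn p0 q0 in \<open>auto simp: measurable_cong_sets[OF \<rho>(1) refl] abs_mult\<close>)
  then have "integrable \<Lambda> (\<lambda>x. norm (G x))"
    using integral_density_real(2)[OF \<rho>(1) p p0, of "\<lambda>x. norm (G x)"] by (simp add: p\<Lambda>)
  then have "L1 (\<lambda>x. indicator \<Omega> x * norm (G x))"
    using integral_density_real(2)[of lborel "indicator \<Omega>" "\<lambda>x. norm (G x)"] by (simp add: \<Lambda>_def)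
  moreover have "(\<lambda>x. indicator \<Omega> x * norm (G x)) = (\<lambda>x. norm (G x))" by (auto simp: G_def indicator_def)
  ultimately have Gi: "L1 G" by (simp add: integrable_norm_iff)
  have ident: "(\<integral>x. H x $ \<alpha> $ i * \<phi> x \<partial>\<tau>) = (LBINT x. G x $ \<alpha> $ i * \<phi> x) + (\<integral>x. \<theta> x $ \<alpha> $ i * \<phi> x \<partial>\<sigma>)"
    if tf: "test_fun \<Omega> \<phi>" for \<phi> \<alpha> i
  proof -
    have \<phi>c: "continuous_on UNIV \<phi>" "csupp \<Omega> \<phi>" using tf Ck_fun_continuous unfolding test_fun_iff by blast+
    have [measurable]: "\<phi> \<in> borel_measurable borel" using \<phi>c(1) by (rule cont_borel)
    obtain B where B: "\<And>x. \<bar>\<phi> x\<bar> \<le> B" using csupp_bounded[OF \<phi>c] by (metis real_norm_def)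
    have me: "(\<lambda>x. F x $ \<alpha> $ i) \<in> borel_measurable borel" if "F \<in> borel_measurable borel" for F :: "real^'n \<Rightarrow> real^'m^'n"
    proof -
      have "continuous_on UNIV (\<lambda>v::real^'m^'n. v $ \<alpha> $ i)" by (intro continuous_intros)
      from measurable_compose[OF that cont_borel[OF this]] show ?thesis .
    qed
    have mH[measurable]: "(\<lambda>x. H x $ \<alpha> $ i) \<in> borel_measurable borel" "(\<lambda>x. G x $ \<alpha> $ i) \<in> borel_measurable borel" "(\<lambda>x. \<theta> x $ \<alpha> $ i) \<in> borel_measurable borel"
      by (rule me; measurable)+
    let ?f = "\<lambda>x. H x $ \<alpha> $ i * \<phi> x"
    have fi: "integrable \<tau> ?f"
      by (rule integrable_bounded_mult(2)[OF integrable_entry[OF H] _ B]) (simp add: m\<tau>)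
    have fi1: "integrable \<tau> (\<lambda>x. indicator Z x * ?f x)" "integrable \<tau> (\<lambda>x. indicator (- Z) x * ?f x)"
      using integrable_mult_indicator[OF _ fi, of Z] integrable_mult_indicator[OF _ fi, of "- Z"] \<tau>(1) by auto
    have "(\<integral>x. ?f x \<partial>\<tau>) = (\<integral>x. indicator (- Z) x * ?f x + indicator Z x * ?f x \<partial>\<tau>)"
      by (intro integral_cong refl) (auto simp: indicator_def)
    also have "\<dots> = (\<integral>x. indicator (- Z) x * ?f x \<partial>\<tau>) + (\<integral>x. indicator Z x * ?f x \<partial>\<tau>)"
      using fi1 by simp
    also have "(\<integral>x. indicator Z x * ?f x \<partial>\<tau>) = (\<integral>x. k x * (\<theta> x $ \<alpha> $ i * \<phi> x) \<partial>\<tau>)"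
      by (intro integral_cong refl) (auto simp: k_def \<theta>_def indicator_def)
    also have "\<dots> = (\<integral>x. \<theta> x $ \<alpha> $ i * \<phi> x \<partial>\<sigma>)"
      unfolding \<sigma>_def by (rule integral_density_real(1)[OF \<tau>(1), symmetric]) (use k0 in auto)
    also have "(\<integral>x. indicator (- Z) x * ?f x \<partial>\<tau>) = (\<integral>x. q x * (indicator (- Z) x * ?f x) \<partial>\<rho>)"
      unfolding q\<tau> by (rule integral_density_real(1)[OF \<rho>(1) q q0]) measurable
    also have "\<dots> = (\<integral>x. p x * (G x $ \<alpha> $ i * \<phi> x) \<partial>\<rho>)"
    proof (intro integral_cong refl)
      fix x
      have "\<phi> x = 0" if "x \<notin> \<Omega>" using \<phi>c(2) that by (auto simp: csupp_def)
      then show "q x * (indicator (- Z) x * ?f x) = p x * (G x $ \<alpha> $ i * \<phi> x)"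
        by (auto simp: G_def Z_def indicator_def)
    qed
    also have "\<dots> = (\<integral>x. G x $ \<alpha> $ i * \<phi> x \<partial>\<Lambda>)"
      unfolding p\<Lambda> by (rule integral_density_real(1)[OF \<rho>(1) p p0, symmetric]) measurable
    also have "\<dots> = (LBINT x. indicator \<Omega> x * (G x $ \<alpha> $ i * \<phi> x))"
      unfolding \<Lambda>_def by (rule integral_density_real(1)) auto
    also have "\<dots> = (LBINT x. G x $ \<alpha> $ i * \<phi> x)"
      by (intro integral_cong refl) (auto simp: G_def indicator_def)
    finally show ?thesis .
  qed
  have "bvd \<Omega> w G \<theta> \<sigma>"
    unfolding bvd_def
  proof (intro conjI allI impI)
    show "emeasure \<sigma> (UNIV - \<Omega>) = 0" by (rule zero) (auto simp: Z_def)
    show "\<exists>Z\<in>sets borel. emeasure lborel Z = 0 \<and> emeasure \<sigma> (UNIV - Z) = 0"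
      using Z0 by (intro bexI[of _ Z] conjI zero) auto
    show "G x = 0" if "x \<notin> \<Omega>" for x using that by (simp add: G_def)
  qed (use w Gi s\<sigma> f\<sigma> \<theta>1 eq ident in auto)
  then show ?thesis by blast
qed

text \<open>Used as a test field, it isolates one scalar entry of the distributional
  gradient.\<close>

definition entry_field :: "'n \<Rightarrow> 'm \<Rightarrow> real \<Rightarrow> (real^'n \<Rightarrow> real) \<Rightarrow> real^'n \<Rightarrow> real^'m^'n" where
  "entry_field \<alpha> i c \<phi> x = (c * \<phi> x) *\<^sub>R axis \<alpha> (axis i 1)"

lemma entry_field_nth: "entry_field \<alpha> i c \<phi> x $ \<beta> $ j = (if \<beta> = \<alpha> \<and> j = i then c * \<phi> x else 0)"
  by (auto simp: entry_field_def axis_def)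

lemma entry_field_C1: "\<phi> \<in> Ck_fun (Suc 0) \<Longrightarrow> C1_field (entry_field \<alpha> i c \<phi>)"
  unfolding C1_field_def entry_field_nth
proof (intro allI)
  fix \<beta> j assume "\<phi> \<in> Ck_fun (Suc 0)"
  then show "(\<lambda>x. if \<beta> = \<alpha> \<and> j = i then c * \<phi> x else 0) \<in> Ck_fun (Suc 0)"
    by (cases "\<beta> = \<alpha> \<and> j = i") (auto simp del: Ck_fun.simps intro: Ck_fun_cmult)
qed

lemma entry_field_dv:
  assumes "\<phi> \<in> Ck_fun (Suc 0)"
  shows "w \<bullet> dv (entry_field \<alpha> i c \<phi>) x = c * (w $ i * pd \<alpha> \<phi> x)"
proof -
  have e: "pd \<beta> (\<lambda>x. entry_field \<alpha> i c \<phi> x $ \<beta> $ j) x = (if \<beta> = \<alpha> then if j = i then c * pd \<alpha> \<phi> x else 0 else 0)" for \<beta> j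
    unfolding entry_field_nth using partial_deriv_cmult[OF assms, of \<alpha> c x] by (cases "\<beta> = \<alpha> \<and> j = i") auto
  have "dv (entry_field \<alpha> i c \<phi>) x $ j = (if j = i then c * pd \<alpha> \<phi> x else 0)" for j
    unfolding dv_def e by simp
  then have "w \<bullet> dv (entry_field \<alpha> i c \<phi>) x = (\<Sum>j\<in>UNIV. if j = i then w $ i * (c * pd \<alpha> \<phi> x) else 0)"
    unfolding inner_vec_def by (intro sum.cong) auto
  then show ?thesis by simp
qed

lemma entry_field_norm: "norm (entry_field \<alpha> i c \<phi> x) = \<bar>c * \<phi> x\<bar>"
  by (simp add: entry_field_def)

context psi
begin

text \<open>By linear growth the field with the single entry -\<nu>2 \<phi>, |\<phi>| \<le> 1, is
  admissible together with a constant on its support. Finite energy thus bounds the integral of w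
  against every partial derivative, and \<open>measure_representation\<close> yields measures entry
  by entry.\<close>

lemma Rfun_imp_bvd:
  fixes w :: "real^'n \<Rightarrow> real^'m"
  assumes w: "L1 w" and op: "open \<Omega>" and bd: "bounded \<Omega>" and R: "Rfun \<Omega> \<psi> w < \<infinity>"
  shows "\<exists>G \<theta> \<sigma>. bvd \<Omega> w G \<theta> \<sigma>"
proof -
  obtain r where r: "r \<ge> 0" "Rfun \<Omega> \<psi> w = ennreal r" using R by (metis ennreal_cases infinity_ennreal_def less_irrefl)
  \<comment> \<open>The nonnegative part of \<nu>3: it compensates the constant in the growth
    condition on the support and makes the loss monotone in the size of the support.\<close>
  define c where "c = max \<nu>3 0"
  define M where "M = (r + c * measure lborel \<Omega>) / \<nu>2"
  have i\<Omega>: "L1 (indicator \<Omega> :: _ \<Rightarrow> real)" using op emeasure_bounded_finite[OF bd] by (simp add: less_top)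
  have bound: "(LBINT x. w x $ i * pd \<alpha> \<phi> x) \<le> M"
    if tf: "test_fun \<Omega> \<phi>" and b1: "\<And>x. \<bar>\<phi> x\<bar> \<le> 1" for \<phi> \<alpha> i
  proof -
    have \<phi>: "\<phi> \<in> Ck_fun (Suc 0)" "csupp \<Omega> \<phi>" using tf unfolding test_fun_iff by blast+
    obtain S where S: "compact S" "S \<subseteq> \<Omega>" "\<And>x. x \<notin> S \<Longrightarrow> \<phi> x = 0" using \<phi>(2) by (auto simp: csupp_def)
    have [measurable]: "S \<in> sets borel" "\<Omega> \<in> sets borel" using S(1) op by (auto simp: borel_compact)
    define a where "a x = - c * indicator S x" for x
    have iS: "L1 (indicator S :: _ \<Rightarrow> real)" using emeasure_compact_finite[OF S(1)] by (simp add: less_top)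
    have ad: "adm \<Omega> \<psi> a (entry_field \<alpha> i (- \<nu>2) \<phi>)"
    proof (rule admI[OF entry_field_C1[OF \<phi>(1)] _ S(1,2)])
      show "L1 a" unfolding a_def[abs_def] using iS by simp
      show "a x = 0" if "x \<notin> S" for x using that by (simp add: a_def)
      show "entry_field \<alpha> i (- \<nu>2) \<phi> x = 0" if "x \<notin> S" for x using S(3)[OF that] by (simp add: entry_field_def)
      show "a x + norm (entry_field \<alpha> i (- \<nu>2) \<phi> x) * t \<le> \<psi> t" if t: "t \<ge> 0" for x t
      proof (cases "x \<in> S")
        case True
        have "\<nu>2 * \<bar>\<phi> x\<bar> * t \<le> \<nu>2 * t" using b1[of x] growth(1) t by (intro mult_right_mono) auto
        moreover have "norm (entry_field \<alpha> i (- \<nu>2) \<phi> x) * t = \<nu>2 * \<bar>\<phi> x\<bar> * t"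
          using growth(1) by (simp add: entry_field_norm abs_mult)
        moreover have "a x \<le> - \<nu>3" using True by (simp add: a_def c_def)
        ultimately show ?thesis using growth(2)[OF t] by linarith
      next
        case False
        then show ?thesis using S(3)[OF False] psi_nn[OF t] by (simp add: a_def entry_field_norm)
      qed
    qed
    have "(LBINT x. a x) - (LBINT x. w x \<bullet> dv (entry_field \<alpha> i (- \<nu>2) \<phi>) x) \<le> r"
      by (rule Rfun_upper_real[OF ad]) (use r in auto)
    moreover have "(LBINT x. a x) = - c * measure lborel S" unfolding a_def[abs_def] by simp
    moreover have "c * measure lborel S \<le> c * measure lborel \<Omega>"
    proof (rule mult_left_mono)
      have "(LBINT x. indicator S x) \<le> (LBINT x. indicator \<Omega> x :: real)"
        by (rule integral_mono[OF iS i\<Omega>]) (use S(2) in \<open>auto simp: indicator_def\<close>)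
      then show "measure lborel S \<le> measure lborel \<Omega>" by simp
    qed (simp add: c_def)
    ultimately have "\<nu>2 * (LBINT x. w x $ i * pd \<alpha> \<phi> x) \<le> r + c * measure lborel \<Omega>"
      unfolding entry_field_dv[OF \<phi>(1)] by simp
    then show ?thesis using growth(1) by (simp add: M_def field_simps)
  qed
  define P where "P \<alpha> i \<mu>1 \<mu>2 \<longleftrightarrow> sets \<mu>1 = sets borel \<and> sets \<mu>2 = sets borel \<and> emeasure \<mu>1 UNIV < \<infinity> \<and> emeasure \<mu>2 UNIV < \<infinity>
    \<and> emeasure \<mu>1 (UNIV - \<Omega>) = 0 \<and> emeasure \<mu>2 (UNIV - \<Omega>) = 0
    \<and> (\<forall>\<phi>. test_fun \<Omega> \<phi> \<longrightarrow> (LBINT x. w x $ i * pd \<alpha> \<phi> x) = - ((\<integral>x. \<phi> x \<partial>\<mu>1) - (\<integral>x. \<phi> x \<partial>\<mu>2)))" for \<alpha> i \<mu>1 \<mu>2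
  have "\<exists>\<mu>1 \<mu>2. P \<alpha> i \<mu>1 \<mu>2" for \<alpha> i
    unfolding P_def by (rule measure_representation[OF integrable_component[OF w] op bd bound])
  then obtain \<mu>1 \<mu>2 where P: "\<And>\<alpha> i. P \<alpha> i (\<mu>1 \<alpha> i) (\<mu>2 \<alpha> i)" by metis
  note \<mu> = P[unfolded P_def]
  \<comment> \<open>The positive and negative parts of all entries are indexed together, so that one
    sum \<tau> dominates them all and the differences of their densities form the matrix H.\<close>
  define N where "N = (\<lambda>(b, \<alpha>, i). if b then \<mu>1 \<alpha> i else \<mu>2 \<alpha> i)"
  have N: "sets (N j) = sets borel" "emeasure (N j) UNIV < \<infinity>" "emeasure (N j) (UNIV - \<Omega>) = 0" for j
    using \<mu> by (auto simp: N_def split: prod.splits)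
  define \<tau> where "\<tau> = msum UNIV N"
  have \<tau>: "sets \<tau> = sets borel" "emeasure \<tau> UNIV < \<infinity>" "emeasure \<tau> (UNIV - \<Omega>) = 0"
    using msum_finite[of UNIV N] N op by (auto simp: \<tau>_def emeasure_msum)
  have le: "N j \<le> \<tau>" for j unfolding \<tau>_def by (rule msum_le) (auto simp: N)
  define Q where "Q j E \<longleftrightarrow> E \<in> borel_measurable borel \<and> (\<forall>x. 0 \<le> E x) \<and> integrable \<tau> E \<and> N j = density \<tau> (\<lambda>x. ennreal (E x))" for j E
  have "\<exists>E. Q j E" for j
    unfolding Q_def by (rule real_density[OF \<tau>(1,2) N(1,2) le])
  then obtain D where Q: "\<And>j. Q j (D j)" by metis
  have D: "D j \<in> borel_measurable borel" "0 \<le> D j x" "integrable \<tau> (D j)" "N j = density \<tau> (\<lambda>x. ennreal (D j x))" for j x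
    using Q[of j] by (auto simp: Q_def)
  define H where "H x = (\<chi> \<alpha> i. D (True, \<alpha>, i) x - D (False, \<alpha>, i) x)" for x
  have He: "H x $ \<alpha> $ i = D (True, \<alpha>, i) x - D (False, \<alpha>, i) x" for x \<alpha> i by (simp add: H_def)
  have "integrable \<tau> (\<lambda>x. \<Sum>b\<in>Basis. (H x \<bullet> b) *\<^sub>R b)"
    by (intro integrable_sum integrable_scaleR_left)
      (auto simp: Basis_vec_def inner_axis He intro!: integrable_diff D(3))
  then have Hi: "integrable \<tau> H" by (simp add: euclidean_representation)
  have eq: "(LBINT x. w x $ i * pd \<alpha> \<phi> x) = - (\<integral>x. H x $ \<alpha> $ i * \<phi> x \<partial>\<tau>)"
    if tf: "test_fun \<Omega> \<phi>" for \<phi> \<alpha> i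
  proof -
    have \<phi>c: "continuous_on UNIV \<phi>" "csupp \<Omega> \<phi>" using tf Ck_fun_continuous unfolding test_fun_iff by blast+
    have m[measurable]: "\<phi> \<in> borel_measurable borel" using \<phi>c(1) by (rule cont_borel)
    obtain B where B: "\<And>x. \<bar>\<phi> x\<bar> \<le> B" using csupp_bounded[OF \<phi>c] by (metis real_norm_def)
    have Di: "integrable \<tau> (\<lambda>x. D j x * \<phi> x)" for j
      by (rule integrable_bounded_mult(2)[OF D(3) _ B]) (simp add: measurable_cong_sets[OF \<tau>(1) refl])
    have "(LBINT x. w x $ i * pd \<alpha> \<phi> x) = - ((\<integral>x. \<phi> x \<partial>N (True, \<alpha>, i)) - (\<integral>x. \<phi> x \<partial>N (False, \<alpha>, i)))"
      using \<mu>[of \<alpha> i] tf by (auto simp: N_def)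
    moreover have "(\<integral>x. \<phi> x \<partial>N j) = (\<integral>x. D j x * \<phi> x \<partial>\<tau>)" for j
      unfolding D(4) by (rule integral_density_real(1)[OF \<tau>(1) D(1,2) m])
    ultimately show ?thesis using Di by (simp add: He left_diff_distrib)
  qed
  show ?thesis by (rule bvd_of_density[OF w op bd \<tau> Hi eq])
qed

end

section \<open>Existence and uniqueness of the minimizer\<close>

text \<open>Normal form for the analysis: Borel functions on the whole space that vanish off
  \<Omega>, so that all integrals and convolutions live on the whole space.\<close>

definition Xs :: "(real^'n) set \<Rightarrow> (real^'n \<Rightarrow> real^'m) \<Rightarrow> bool" where
  "Xs \<Omega> w \<longleftrightarrow> L1 w \<and> (\<forall>x. x \<notin> \<Omega> \<longrightarrow> w x = 0)"

lemma Xs_borel: "Xs \<Omega> w \<Longrightarrow> w \<in> borel_measurable borel"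
  by (auto simp: Xs_def)

definition Fval :: "(real^'n) set \<Rightarrow> (real \<Rightarrow> real) \<Rightarrow> real \<Rightarrow> (real^'n \<Rightarrow> real^'m) \<Rightarrow> (real^'n \<Rightarrow> real^'m) \<Rightarrow> ennreal" where
  "Fval \<Omega> \<psi> lam f w = Rfun \<Omega> \<psi> w + ennreal (lam / 2) * (\<integral>\<^sup>+x. ennreal ((norm (w x - f x))\<^sup>2) \<partial>lborel)"

lemma Rfun_midpoint:
  fixes v w :: "real^'n \<Rightarrow> real^'m"
  assumes i: "L1 v" "L1 w"
    and R: "Rfun \<Omega> \<psi> v \<le> ennreal a" "Rfun \<Omega> \<psi> w \<le> ennreal b" "a \<ge> 0" "b \<ge> 0"
  shows "Rfun \<Omega> \<psi> (\<lambda>x. (1/2) *\<^sub>R (v x + w x)) \<le> ennreal ((a + b) / 2)"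
proof (rule Rfun_least, rule ennreal_leI)
  fix c and \<Phi> :: "real^'n \<Rightarrow> real^'m^'n" assume ad: "adm \<Omega> \<psi> c \<Phi>"
  have ii: "L1 (\<lambda>x. v x \<bullet> dv \<Phi> x)" "L1 (\<lambda>x. w x \<bullet> dv \<Phi> x)"
    using integrable_inner_csupp[OF i(1) admD(7,8)[OF ad]] integrable_inner_csupp[OF i(2) admD(7,8)[OF ad]] .
  have "(LBINT x. ((1/2) *\<^sub>R (v x + w x)) \<bullet> dv \<Phi> x) = (LBINT x. (1/2) * (v x \<bullet> dv \<Phi> x + w x \<bullet> dv \<Phi> x))"
    by (simp add: inner_add_left)
  also have "\<dots> = (1/2) * ((LBINT x. v x \<bullet> dv \<Phi> x) + (LBINT x. w x \<bullet> dv \<Phi> x))"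
    using ii by (simp only: integral_mult_right_zero integral_add)
  finally show "(LBINT x. c x) - (LBINT x. ((1/2) *\<^sub>R (v x + w x)) \<bullet> dv \<Phi> x) \<le> (a + b) / 2"
    using Rfun_upper_real[OF ad R(1,3)] Rfun_upper_real[OF ad R(2,4)] by (simp add: field_simps)
qed

lemma Fval_leI:
  fixes w f :: "real^'n \<Rightarrow> real^'m"
  assumes "Rfun \<Omega> \<psi> w \<le> ennreal r" "r \<ge> 0" "lam > 0" "L1 (\<lambda>x. (norm (w x - f x))\<^sup>2)"
  shows "Fval \<Omega> \<psi> lam f w \<le> ennreal (r + lam / 2 * (LBINT x. (norm (w x - f x))\<^sup>2))"
proof -
  have "(\<integral>\<^sup>+x. ennreal ((norm (w x - f x))\<^sup>2) \<partial>lborel) = ennreal (LBINT x. (norm (w x - f x))\<^sup>2)"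
    by (rule nn_integral_eq_integral[OF assms(4)]) auto
  moreover have "ennreal (lam / 2 * (LBINT x. (norm (w x - f x))\<^sup>2)) = ennreal (lam / 2) * ennreal (LBINT x. (norm (w x - f x))\<^sup>2)"
    using assms(3) by (intro ennreal_mult) (auto simp: integral_nonneg)
  ultimately have "Fval \<Omega> \<psi> lam f w = Rfun \<Omega> \<psi> w + ennreal (lam / 2 * (LBINT x. (norm (w x - f x))\<^sup>2))"
    by (simp only: Fval_def)
  also have "\<dots> \<le> ennreal r + ennreal (lam / 2 * (LBINT x. (norm (w x - f x))\<^sup>2))"
    by (intro add_right_mono assms(1))
  also have "\<dots> = ennreal (r + lam / 2 * (LBINT x. (norm (w x - f x))\<^sup>2))"
    using assms(2,3) by (subst ennreal_plus) (auto simp: integral_nonneg)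
  finally show ?thesis .
qed

lemma Fval_leE:
  fixes w f :: "real^'n \<Rightarrow> real^'m"
  assumes F: "Fval \<Omega> \<psi> lam f w \<le> ennreal A" and A: "A \<ge> 0" and lam: "lam > 0"
    and m: "w \<in> borel_measurable borel" "f \<in> borel_measurable borel"
  obtains r where "r \<ge> 0" "Rfun \<Omega> \<psi> w = ennreal r" "L1 (\<lambda>x. (norm (w x - f x))\<^sup>2)"
    "r + lam / 2 * (LBINT x. (norm (w x - f x))\<^sup>2) \<le> A"
proof -
  let ?J = "\<integral>\<^sup>+x. ennreal ((norm (w x - f x))\<^sup>2) \<partial>lborel"
  have fin: "Rfun \<Omega> \<psi> w < \<infinity>" "ennreal (lam / 2) * ?J < \<infinity>"
    using le_less_trans[OF F ennreal_less_top] by (auto simp: Fval_def)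
  then have J: "?J < \<infinity>" using lam by (auto simp: ennreal_mult_less_top)
  obtain r where r: "r \<ge> 0" "Rfun \<Omega> \<psi> w = ennreal r" using fin(1) by (metis ennreal_cases infinity_ennreal_def less_irrefl)
  have i: "L1 (\<lambda>x. (norm (w x - f x))\<^sup>2)"
    using m J by (auto simp: integrable_iff_bounded)
  have "?J = ennreal (LBINT x. (norm (w x - f x))\<^sup>2)"
    by (rule nn_integral_eq_integral[OF i]) auto
  moreover have "ennreal (lam / 2 * (LBINT x. (norm (w x - f x))\<^sup>2)) = ennreal (lam / 2) * ennreal (LBINT x. (norm (w x - f x))\<^sup>2)"
    using lam by (intro ennreal_mult) (auto simp: integral_nonneg)
  moreover have "ennreal (r + lam / 2 * (LBINT x. (norm (w x - f x))\<^sup>2)) = ennreal r + ennreal (lam / 2 * (LBINT x. (norm (w x - f x))\<^sup>2))"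
    using lam r by (intro ennreal_plus) (auto simp: integral_nonneg)
  ultimately have "Fval \<Omega> \<psi> lam f w = ennreal (r + lam / 2 * (LBINT x. (norm (w x - f x))\<^sup>2))"
    using r(2) by (simp only: Fval_def)
  then have "r + lam / 2 * (LBINT x. (norm (w x - f x))\<^sup>2) \<le> A"
    using F A by simp
  then show thesis by (rule that[OF r i])
qed

lemma sq_midpoint:
  fixes v w f :: "'a::real_inner"
  shows "(norm ((1/2) *\<^sub>R (v + w) - f))\<^sup>2 = (norm (v - f))\<^sup>2 / 2 + (norm (w - f))\<^sup>2 / 2 - (norm (v - w))\<^sup>2 / 4"
  by (simp add: power2_norm_eq_inner inner_add_left inner_add_right inner_diff_left inner_diff_right inner_commute field_simps)

text \<open>At the midpoint the energy is at most the mean of the two energies, and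
  \<open>sq_midpoint\<close> lowers the fidelity by lam/2 times 1/4 of the squared distance. As the
  midpoint has value at least m, that gain is at most A - m.\<close>

lemma Fval_strong_convexity:
  fixes v w f :: "real^'n \<Rightarrow> real^'m"
  assumes v: "Xs \<Omega> v" and w: "Xs \<Omega> w" and f: "f \<in> borel_measurable borel" and lam: "lam > 0"
    and F: "Fval \<Omega> \<psi> lam f v \<le> ennreal A" "Fval \<Omega> \<psi> lam f w \<le> ennreal A" "A \<ge> 0"
    and m: "m \<ge> 0" "\<And>z. Xs \<Omega> z \<Longrightarrow> ennreal m \<le> Fval \<Omega> \<psi> lam f z"
  shows "L1 (\<lambda>x. (norm (v x - w x))\<^sup>2)" "lam / 8 * (LBINT x. (norm (v x - w x))\<^sup>2) \<le> A - m"
proof -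
  note vm = Xs_borel[OF v] and wm = Xs_borel[OF w]
  obtain r where r: "r \<ge> 0" "Rfun \<Omega> \<psi> v = ennreal r" "L1 (\<lambda>x. (norm (v x - f x))\<^sup>2)"
    "r + lam / 2 * (LBINT x. (norm (v x - f x))\<^sup>2) \<le> A"
    by (rule Fval_leE[OF F(1,3) lam vm f])
  obtain s where s: "s \<ge> 0" "Rfun \<Omega> \<psi> w = ennreal s" "L1 (\<lambda>x. (norm (w x - f x))\<^sup>2)"
    "s + lam / 2 * (LBINT x. (norm (w x - f x))\<^sup>2) \<le> A"
    by (rule Fval_leE[OF F(2,3) lam wm f])
  show i: "L1 (\<lambda>x. (norm (v x - w x))\<^sup>2)"
  proof (rule integrable_bound[of _ "\<lambda>x. 2 * (norm (v x - f x))\<^sup>2 + 2 * (norm (w x - f x))\<^sup>2"])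
    show "AE x in lborel. norm ((norm (v x - w x))\<^sup>2) \<le> norm (2 * (norm (v x - f x))\<^sup>2 + 2 * (norm (w x - f x))\<^sup>2)"
    proof (rule AE_I2)
      fix x
      have "0 \<le> (norm ((1/2) *\<^sub>R (v x + w x) - f x))\<^sup>2" by simp
      then show "norm ((norm (v x - w x))\<^sup>2) \<le> norm (2 * (norm (v x - f x))\<^sup>2 + 2 * (norm (w x - f x))\<^sup>2)"
        unfolding sq_midpoint by simp
    qed
  qed (use r s vm wm in auto)
  define z where "z x = (1/2) *\<^sub>R (v x + w x)" for x
  have z: "Xs \<Omega> z" using v w by (auto simp: Xs_def z_def[abs_def])
  have iz: "L1 (\<lambda>x. (norm (z x - f x))\<^sup>2)"
    and Iz: "(LBINT x. (norm (z x - f x))\<^sup>2) = (LBINT x. (norm (v x - f x))\<^sup>2) / 2 + (LBINT x. (norm (w x - f x))\<^sup>2) / 2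
      - (LBINT x. (norm (v x - w x))\<^sup>2) / 4"
    unfolding z_def sq_midpoint using r(3) s(3) i by auto
  have "Rfun \<Omega> \<psi> z \<le> ennreal ((r + s) / 2)"
    unfolding z_def[abs_def] using v w r s by (intro Rfun_midpoint) (auto simp: Xs_def)
  then have "Fval \<Omega> \<psi> lam f z \<le> ennreal ((r + s) / 2 + lam / 2 * (LBINT x. (norm (z x - f x))\<^sup>2))"
    using r s lam iz by (intro Fval_leI) auto
  with m(2)[OF z] have "ennreal m \<le> ennreal ((r + s) / 2 + lam / 2 * (LBINT x. (norm (z x - f x))\<^sup>2))" by (rule order_trans)
  then have "m \<le> (r + s) / 2 + lam / 2 * (LBINT x. (norm (z x - f x))\<^sup>2)"
    using m(1) r(1) s(1) lam by (subst (asm) ennreal_le_iff) (auto intro!: add_nonneg_nonneg mult_nonneg_nonneg integral_nonneg)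
  then show "lam / 8 * (LBINT x. (norm (v x - w x))\<^sup>2) \<le> A - m"
    unfolding Iz using r(4) s(4) by (simp add: field_simps)
qed

text \<open>On a bounded domain the geometric decay in the square mean makes the sum of the
  increments integrable. Hence the sequence converges almost everywhere, and the first function plus
  the sum of increments dominates it.\<close>

lemma geometric_limit:
  fixes w :: "nat \<Rightarrow> real^'n \<Rightarrow> real^'m"
  assumes X: "\<And>k. Xs \<Omega> (w k)" and op: "open \<Omega>" and bd: "bounded \<Omega>"
    and d: "\<And>k. L1 (\<lambda>x. (norm (w (Suc k) x - w k x))\<^sup>2)"
      "\<And>k. (LBINT x. (norm (w (Suc k) x - w k x))\<^sup>2) \<le> (1/4) ^ k"
  obtains u h where "Xs \<Omega> u" "AE x in lborel. (\<lambda>k. w k x) \<longlonglongrightarrow> u x" "L1 h"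
    "\<And>k. AE x in lborel. norm (w k x) \<le> h x"
proof -
  have i: "L1 (w k)" and off: "x \<notin> \<Omega> \<Longrightarrow> w k x = 0" for k x using X by (auto simp: Xs_def)
  have [measurable]: "w k \<in> borel_measurable borel" for k using Xs_borel[OF X] .
  have i\<Omega>: "L1 (indicator \<Omega> :: _ \<Rightarrow> real)" using op emeasure_bounded_finite[OF bd] by (simp add: less_top)
  define D where "D k x = norm (w (Suc k) x - w k x)" for k x
  have [measurable]: "D k \<in> borel_measurable borel" for k unfolding D_def[abs_def] by measurable
  have Di: "L1 (D k)" for k using i[of k] i[of "Suc k"] unfolding D_def[abs_def] by auto
  define c where "c = (measure lborel \<Omega> + 1) / 2"
  have Db: "(LBINT x. D k x) \<le> (1/2) ^ k * c" for k
  proof -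
    \<comment> \<open>The bound D \<le> q/2 + D^2/(2 q) converts square means into means; with q =
      2^(-k) both terms are of order q after integration.\<close>
    define q where "q = ((1/2) ^ k :: real)"
    have q: "q > 0" "q\<^sup>2 = (1/4) ^ k" by (simp_all add: q_def power_mult[symmetric] power2_eq_square power_mult_distrib[symmetric])
    have pw: "D k x \<le> q / 2 * indicator \<Omega> x + (1 / (2 * q)) * (norm (w (Suc k) x - w k x))\<^sup>2" for x
    proof (cases "x \<in> \<Omega>")
      case True
      have "0 \<le> (D k x - q)\<^sup>2" by simp
      then have "2 * q * D k x \<le> q * q + (D k x)\<^sup>2" by (simp add: power2_diff power2_eq_square algebra_simps)
      then have "D k x \<le> (q * q + (D k x)\<^sup>2) / (2 * q)" using q by (simp add: field_simps)
      also have "\<dots> = q / 2 + (1 / (2 * q)) * (D k x)\<^sup>2" using q by (simp add: field_simps)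
      finally show ?thesis using True by (simp add: D_def)
    qed (use off in \<open>simp add: D_def\<close>)
    have "(LBINT x. D k x) \<le> (LBINT x. q / 2 * indicator \<Omega> x + (1 / (2 * q)) * (norm (w (Suc k) x - w k x))\<^sup>2)"
      by (rule integral_mono[OF Di _ pw]) (use i\<Omega> d(1) in auto)
    also have "\<dots> = q / 2 * measure lborel \<Omega> + (1 / (2 * q)) * (LBINT x. (norm (w (Suc k) x - w k x))\<^sup>2)"
      using i\<Omega> d(1)[of k] by simp
    also have "\<dots> \<le> q / 2 * measure lborel \<Omega> + (1 / (2 * q)) * q\<^sup>2"
      unfolding q(2) using q(1) by (intro add_left_mono mult_left_mono d(2)) auto
    also have "\<dots> = q * c" using q(1) by (simp add: c_def field_simps power2_eq_square)
    finally show ?thesis by (simp add: q_def)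
  qed
  define S where "S x = (\<Sum>k. ennreal (D k x))" for x
  have [measurable]: "S \<in> borel_measurable borel" unfolding S_def[abs_def] by measurable
  have "(\<integral>\<^sup>+x. S x \<partial>lborel) = (\<Sum>k. \<integral>\<^sup>+x. ennreal (D k x) \<partial>lborel)"
    unfolding S_def by (rule nn_integral_suminf) measurable
  also have "\<dots> = (\<Sum>k. ennreal (LBINT x. D k x))"
    by (intro suminf_cong nn_integral_eq_integral Di) (simp add: D_def)
  also have "\<dots> \<le> (\<Sum>k. ennreal ((1/2) ^ k * c))" by (intro suminf_le ennreal_leI Db summableI)
  also have "\<dots> < \<infinity>"
  proof -
    have "c \<ge> 0" by (simp add: c_def)
    have "summable (\<lambda>k. (1/2) ^ k * c)" by (intro summable_mult2 summable_geometric) simp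
    then have "(\<Sum>k. ennreal ((1/2) ^ k * c)) = ennreal (\<Sum>k. (1/2) ^ k * c)"
      using \<open>c \<ge> 0\<close> by (intro suminf_ennreal2) auto
    then show ?thesis by simp
  qed
  finally have Sfin: "(\<integral>\<^sup>+x. S x \<partial>lborel) < \<infinity>" .
  then have AES: "AE x in lborel. S x \<noteq> \<infinity>" by (intro nn_integral_PInf_AE) auto
  define h where "h x = norm (w 0 x) + enn2real (S x)" for x
  have "L1 (\<lambda>x. enn2real (S x))"
    unfolding integrable_iff_bounded
  proof
    have "(\<integral>\<^sup>+x. ennreal (norm (enn2real (S x))) \<partial>lborel) \<le> (\<integral>\<^sup>+x. S x \<partial>lborel)"
      by (intro nn_integral_mono) (simp add: ennreal_enn2real_if)
    then show "(\<integral>\<^sup>+x. ennreal (norm (enn2real (S x))) \<partial>lborel) < \<infinity>" using Sfin by (rule le_less_trans)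
  qed measurable
  then have hi: "L1 h" unfolding h_def[abs_def] using i[of 0] by auto
  define u where "u x = lim (\<lambda>k. w k x)" for x
  have um[measurable]: "u \<in> borel_measurable borel" unfolding u_def[abs_def] by (rule borel_measurable_lim_metric) auto
  have both: "(\<lambda>k. w k x) \<longlonglongrightarrow> u x \<and> (\<forall>k. norm (w k x) \<le> h x)" if "S x \<noteq> \<infinity>" for x
  proof -
    have sm: "summable (\<lambda>k. D k x)"
      by (rule summable_suminf_not_top) (use that in \<open>auto simp: D_def S_def\<close>)
    then have "summable (\<lambda>k. w (Suc k) x - w k x)" unfolding D_def by (rule summable_norm_cancel)
    then have "(\<lambda>n. \<Sum>k<n. w (Suc k) x - w k x) \<longlonglongrightarrow> (\<Sum>k. w (Suc k) x - w k x)" by (rule summable_LIMSEQ)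
    then have "(\<lambda>n. w 0 x + (\<Sum>k<n. w (Suc k) x - w k x)) \<longlonglongrightarrow> w 0 x + (\<Sum>k. w (Suc k) x - w k x)" by (intro tendsto_intros)
    then have "(\<lambda>n. w n x) \<longlonglongrightarrow> w 0 x + (\<Sum>k. w (Suc k) x - w k x)" by (simp add: sum_lessThan_telescope[of "\<lambda>k. w k x"])
    then have 1: "(\<lambda>k. w k x) \<longlonglongrightarrow> u x" unfolding u_def using limI by metis
    have "norm (w n x) \<le> h x" for n
    proof -
      have Se: "S x = ennreal (\<Sum>k. D k x)" unfolding S_def by (rule suminf_ennreal2[OF _ sm]) (simp add: D_def)
      have "w n x = w 0 x + (\<Sum>k<n. w (Suc k) x - w k x)" by (simp add: sum_lessThan_telescope[of "\<lambda>k. w k x"])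
      then have "norm (w n x) \<le> norm (w 0 x) + norm (\<Sum>k<n. w (Suc k) x - w k x)" by (metis norm_triangle_ineq)
      also have "norm (\<Sum>k<n. w (Suc k) x - w k x) \<le> (\<Sum>k<n. D k x)" unfolding D_def by (rule norm_sum)
      also have "\<dots> \<le> (\<Sum>k. D k x)" by (rule sum_le_suminf[OF sm]) (auto simp: D_def)
      also have "\<dots> = enn2real (S x)" unfolding Se using suminf_nonneg[OF sm] by (simp add: D_def)
      finally show ?thesis by (simp add: h_def)
    qed
    with 1 show ?thesis by blast
  qed
  have AEc: "AE x in lborel. (\<lambda>k. w k x) \<longlonglongrightarrow> u x" using AES both by (auto elim!: eventually_mono)
  have AEh: "AE x in lborel. norm (w k x) \<le> h x" for k using AES both by (auto elim!: eventually_mono)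
  have ui: "L1 u"
    by (rule integrable_dominated_convergence[OF _ _ hi AEc AEh]) auto
  have "u x = 0" if "x \<notin> \<Omega>" for x unfolding u_def using off[OF that] by (simp add: limI)
  then have "Xs \<Omega> u" using ui by (simp add: Xs_def)
  then show thesis using that AEc AEh hi by blast
qed

lemma dominated_inner_limit:
  fixes w :: "nat \<Rightarrow> real^'n \<Rightarrow> real^'m"
  assumes w: "\<And>k. L1 (w k)" and u: "L1 u" and c: "AE x in lborel. (\<lambda>k. w k x) \<longlonglongrightarrow> u x"
    and h: "L1 h" "\<And>k. AE x in lborel. norm (w k x) \<le> h x"
    and v: "continuous_on UNIV v" "csupp U v"
  shows "(\<lambda>k. LBINT x. w k x \<bullet> v x) \<longlonglongrightarrow> (LBINT x. u x \<bullet> v x)"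
proof -
  obtain B where B: "B > 0" "\<And>x. norm (v x) \<le> B" using csupp_bounded[OF v] by metis
  have [measurable]: "w k \<in> borel_measurable borel" "u \<in> borel_measurable borel" "v \<in> borel_measurable borel" for k
    using w[of k] u cont_borel[OF v(1)] by auto
  show ?thesis
  proof (rule integral_dominated_convergence[where w = "\<lambda>x. h x * B"])
    show "AE x in lborel. (\<lambda>k. w k x \<bullet> v x) \<longlonglongrightarrow> u x \<bullet> v x"
      using c by eventually_elim (intro tendsto_intros)
    show "AE x in lborel. norm (w k x \<bullet> v x) \<le> h x * B" for k
      using h(2)[of k]
    proof eventually_elim
      case (elim x)
      have "norm (w k x \<bullet> v x) \<le> norm (w k x) * norm (v x)" using Cauchy_Schwarz_ineq2 by simp
      also have "\<dots> \<le> h x * B" using elim B by (intro mult_mono) (auto intro: order_trans[OF norm_ge_zero])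
      finally show ?case .
    qed
  qed (use h in auto)
qed

text \<open>Only the sum of energy and fidelity is controlled along the sequence. A fixed test pair
  bounds the energy of w k from below by a convergent quantity, which leaves an upper bound for the
  fidelity; Fatou carries it to u, and the supremum over test pairs comes last.\<close>

lemma Fval_lsc:
  fixes w :: "nat \<Rightarrow> real^'n \<Rightarrow> real^'m"
  assumes w: "\<And>k. Xs \<Omega> (w k)" and u: "Xs \<Omega> u" and c: "AE x in lborel. (\<lambda>k. w k x) \<longlonglongrightarrow> u x"
    and h: "L1 h" "\<And>k. AE x in lborel. norm (w k x) \<le> h x"
    and f: "f \<in> borel_measurable borel" and lam: "lam > 0" and psi: "\<And>t. t \<ge> 0 \<Longrightarrow> \<psi> t \<ge> 0"
    and F: "\<And>k. Fval \<Omega> \<psi> lam f (w k) \<le> ennreal (A k)" "\<And>k. A k \<ge> 0" "A \<longlonglongrightarrow> A0"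
  shows "Fval \<Omega> \<psi> lam f u \<le> ennreal A0"
proof -
  have [measurable]: "w k \<in> borel_measurable borel" "u \<in> borel_measurable borel" "f \<in> borel_measurable borel" for k
    using w[of k] u f by (auto intro: Xs_borel)
  have wi: "L1 (w k)" "L1 u" for k using w[of k] u by (auto simp: Xs_def)
  let ?J = "\<lambda>v. \<integral>\<^sup>+x. ennreal ((norm (v x - f x))\<^sup>2) \<partial>lborel"
  have fatou: "?J u \<le> liminf (\<lambda>k. ?J (w k))"
  proof -
    have "?J u = (\<integral>\<^sup>+x. liminf (\<lambda>k. ennreal ((norm (w k x - f x))\<^sup>2)) \<partial>lborel)"
    proof (rule nn_integral_cong_AE)
      show "AE x in lborel. ennreal ((norm (u x - f x))\<^sup>2) = liminf (\<lambda>k. ennreal ((norm (w k x - f x))\<^sup>2))"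
        using c
      proof eventually_elim
        case (elim x)
        have "(\<lambda>k. ennreal ((norm (w k x - f x))\<^sup>2)) \<longlonglongrightarrow> ennreal ((norm (u x - f x))\<^sup>2)"
          by (intro tendsto_ennrealI tendsto_intros elim)
        then show ?case by (rule lim_imp_Liminf[OF sequentially_bot, symmetric])
      qed
    qed
    also have "\<dots> \<le> liminf (\<lambda>k. ?J (w k))" by (rule nn_integral_liminf) measurable
    finally show ?thesis .
  qed
  have main: "?J u \<le> ennreal (2 / lam * (A0 - X + e))" 
    if ad: "adm \<Omega> \<psi> a \<Phi>" and X: "X = (LBINT x. a x) - (LBINT x. u x \<bullet> dv \<Phi> x)" and e: "e > 0" for a \<Phi> X e
  proof -
    have "(\<lambda>k. A k - ((LBINT x. a x) - (LBINT x. w k x \<bullet> dv \<Phi> x))) \<longlonglongrightarrow> A0 - X"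
      unfolding X by (intro tendsto_diff F(3) tendsto_const dominated_inner_limit[OF wi c h admD(7,8)[OF ad]])
    then have ev: "\<forall>\<^sub>F k in sequentially. A k - ((LBINT x. a x) - (LBINT x. w k x \<bullet> dv \<Phi> x)) < A0 - X + e"
      using e by (intro order_tendstoD(2)) auto
    have "\<forall>\<^sub>F k in sequentially. ?J (w k) \<le> ennreal (2 / lam * (A0 - X + e))"
      using ev
    proof eventually_elim
      case (elim k)
      obtain r where r: "r \<ge> 0" "Rfun \<Omega> \<psi> (w k) = ennreal r" "L1 (\<lambda>x. (norm (w k x - f x))\<^sup>2)"
        "r + lam / 2 * (LBINT x. (norm (w k x - f x))\<^sup>2) \<le> A k"
        by (rule Fval_leE[OF F(1,2) lam]) auto
      have "(LBINT x. a x) - (LBINT x. w k x \<bullet> dv \<Phi> x) \<le> r"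
        by (rule Rfun_upper_real[OF ad]) (use r in auto)
      then have "lam / 2 * (LBINT x. (norm (w k x - f x))\<^sup>2) \<le> A0 - X + e" using r(4) elim by linarith
      then have "(LBINT x. (norm (w k x - f x))\<^sup>2) \<le> 2 / lam * (A0 - X + e)" using lam by (simp add: field_simps)
      moreover have "?J (w k) = ennreal (LBINT x. (norm (w k x - f x))\<^sup>2)"
        by (rule nn_integral_eq_integral[OF r(3)]) auto
      ultimately show ?case by (simp add: ennreal_leI)
    qed
    then have "liminf (\<lambda>k. ?J (w k)) \<le> ennreal (2 / lam * (A0 - X + e))"
      by (intro Liminf_le) auto
    with fatou show ?thesis by (rule order_trans)
  qed
  have ad0: "adm \<Omega> \<psi> (\<lambda>x. 0) (\<lambda>x. 0 :: real^'m^'n)"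
    using psi by (intro admI[of _ _ "{}"]) (auto simp: C1_field_def simp del: Ck_fun.simps)
  have "?J u < \<infinity>" using main[OF ad0 refl, of 1] by (simp add: le_less_trans)
  then have ui: "L1 (\<lambda>x. (norm (u x - f x))\<^sup>2)" by (auto simp: integrable_iff_bounded)
  let ?I = "LBINT x. (norm (u x - f x))\<^sup>2"
  have I: "?J u = ennreal ?I" "?I \<ge> 0" using nn_integral_eq_integral[OF ui] by (auto simp: integral_nonneg)
  have le: "(LBINT x. a x) - (LBINT x. u x \<bullet> dv \<Phi> x) \<le> A0 - lam / 2 * ?I" if ad: "adm \<Omega> \<psi> a \<Phi>" for a \<Phi>
  proof -
    let ?X = "(LBINT x. a x) - (LBINT x. u x \<bullet> dv \<Phi> x)"
    \<comment> \<open>The second alternative is the price of comparing through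
      \<open>ennreal\<close>: a negative right-hand side is read as 0. It is settled by
      \<open>XA\<close>.\<close>
    have p: "?I \<le> 2 / lam * (A0 - ?X + e) \<or> (?I = 0 \<and> 2 / lam * (A0 - ?X + e) \<le> 0)" if "e > 0" for e
      using main[OF ad refl that] unfolding I(1) using I(2) by (auto simp: ennreal_le_iff2)
    have XA: "?X \<le> A0"
    proof (rule LIMSEQ_le[OF _ F(3)])
      show "(\<lambda>k. (LBINT x. a x) - (LBINT x. w k x \<bullet> dv \<Phi> x)) \<longlonglongrightarrow> ?X"
        by (intro tendsto_diff tendsto_const dominated_inner_limit[OF wi c h admD(7,8)[OF ad]])
      show "\<exists>N. \<forall>n\<ge>N. (LBINT x. a x) - (LBINT x. w n x \<bullet> dv \<Phi> x) \<le> A n"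
      proof (intro exI allI impI)
        fix k
        have "Rfun \<Omega> \<psi> (w k) \<le> ennreal (A k)"
          using F(1)[of k] unfolding Fval_def by (rule order_trans[rotated]) simp
        then show "(LBINT x. a x) - (LBINT x. w k x \<bullet> dv \<Phi> x) \<le> A k"
          by (rule Rfun_upper_real[OF ad]) (rule F(2))
      qed
    qed
    have "lam / 2 * ?I \<le> A0 - ?X"
    proof (rule field_le_epsilon)
      fix e :: real assume e: "e > 0"
      from p[OF e] show "lam / 2 * ?I \<le> A0 - ?X + e"
      proof
        assume "?I \<le> 2 / lam * (A0 - ?X + e)"
        then show ?thesis using lam by (simp add: field_simps)
      next
        assume "?I = 0 \<and> 2 / lam * (A0 - ?X + e) \<le> 0"
        then show ?thesis using XA e by simp
      qed
    qed
    then show ?thesis by simp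
  qed
  have A0: "0 \<le> A0 - lam / 2 * ?I" using le[OF ad0] by (simp add: dv_def zero_vec_def[symmetric])
  have "Rfun \<Omega> \<psi> u \<le> ennreal (A0 - lam / 2 * ?I)"
    by (rule Rfun_least, rule ennreal_leI, rule le)
  from Fval_leI[OF this A0 lam ui] show ?thesis by simp
qed

lemma minimizer_exists:
  fixes f :: "real^'n \<Rightarrow> real^'m"
  assumes op: "open \<Omega>" and bd: "bounded \<Omega>" and f: "f \<in> borel_measurable borel"
    and f2: "L1 (\<lambda>x. (norm (f x))\<^sup>2)" and lam: "lam > 0"
    and psi: "\<And>t. t \<ge> 0 \<Longrightarrow> \<psi> t \<ge> 0" "\<psi> 0 = 0"
  shows "\<exists>u. Xs \<Omega> u \<and> Fval \<Omega> \<psi> lam f u < \<infinity> \<and> (\<forall>w. Xs \<Omega> w \<longrightarrow> Fval \<Omega> \<psi> lam f u \<le> Fval \<Omega> \<psi> lam f w)"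
proof -
  define I where "I = (INF w\<in>{w. Xs \<Omega> w}. Fval \<Omega> \<psi> lam f w)"
  have X0: "Xs \<Omega> (\<lambda>x. 0 :: real^'m)" by (simp add: Xs_def)
  have "Rfun \<Omega> \<psi> (\<lambda>x. 0 :: real^'m) \<le> ennreal 0"
  proof (rule Rfun_least, rule ennreal_leI)
    fix a and \<Phi> :: "real^'n \<Rightarrow> real^'m^'n" assume ad: "adm \<Omega> \<psi> a \<Phi>"
    have "a x \<le> 0" for x using admD(5)[OF ad, of 0 x] psi(2) by simp
    then have "0 \<le> (LBINT x. - a x)" by (intro integral_nonneg) auto
    then show "(LBINT x. a x) - (LBINT x. 0 \<bullet> dv \<Phi> x) \<le> 0" by simp
  qed
  then have "Fval \<Omega> \<psi> lam f (\<lambda>x. 0) \<le> ennreal (0 + lam / 2 * (LBINT x. (norm (0 - f x))\<^sup>2))"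
    using f2 lam by (intro Fval_leI) auto
  then have "Fval \<Omega> \<psi> lam f (\<lambda>x. 0) < \<infinity>"
    by (rule le_less_trans) simp
  then have "I < \<infinity>" unfolding I_def using X0 by (intro le_less_trans[OF INF_lower]) auto
  then obtain m where m: "m \<ge> 0" "I = ennreal m" by (metis ennreal_cases infinity_ennreal_def less_irrefl)
  have lower: "ennreal m \<le> Fval \<Omega> \<psi> lam f z" if "Xs \<Omega> z" for z
    unfolding m(2)[symmetric] I_def using that by (intro INF_lower) auto
  \<comment> \<open>The excess is chosen so that strong convexity gives exactly the rate (1/4)^k
    expected by \<open>geometric_limit\<close>.\<close>
  define A where "A k = m + lam / 8 * (1/4) ^ k" for k :: nat
  have A: "A k > m" for k using lam by (simp add: A_def)
  have "\<exists>w. Xs \<Omega> w \<and> Fval \<Omega> \<psi> lam f w \<le> ennreal (A k)" for k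
  proof -
    have "I < ennreal (A k)" unfolding m(2) using A[of k] m(1) by (simp add: ennreal_less_iff)
    then show ?thesis unfolding I_def by (auto simp: INF_less_iff less_imp_le)
  qed
  then obtain w where w: "\<And>k. Xs \<Omega> (w k)" "\<And>k. Fval \<Omega> \<psi> lam f (w k) \<le> ennreal (A k)" by metis
  have A0: "A k \<ge> 0" for k using A[of k] m(1) by linarith
  have "A (Suc k) \<le> A k" for k using lam by (simp add: A_def)
  then have F': "Fval \<Omega> \<psi> lam f (w (Suc k)) \<le> ennreal (A k)" for k
    using order_trans[OF w(2)[of "Suc k"] ennreal_leI] by blast
  note sc = Fval_strong_convexity[OF w(1) w(1) f lam F' w(2) A0 m(1) lower]
  have d: "L1 (\<lambda>x. (norm (w (Suc k) x - w k x))\<^sup>2)" "(LBINT x. (norm (w (Suc k) x - w k x))\<^sup>2) \<le> (1/4) ^ k" for k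
    using sc[of k] lam by (auto simp: A_def)
  obtain u h where u: "Xs \<Omega> u" "AE x in lborel. (\<lambda>k. w k x) \<longlonglongrightarrow> u x" "L1 h" "\<And>k. AE x in lborel. norm (w k x) \<le> h x"
    by (rule geometric_limit[OF w(1) op bd d]) blast
  have "A \<longlonglongrightarrow> m + lam / 8 * 0" unfolding A_def[abs_def]
    by (intro tendsto_intros LIMSEQ_realpow_zero) auto
  then have "Fval \<Omega> \<psi> lam f u \<le> ennreal m"
    by (intro Fval_lsc[OF w(1) u f lam psi(1) w(2) A0]) auto
  then show ?thesis using u(1) lower by (intro exI[of _ u]) (auto intro: order_trans le_less_trans)
qed

text \<open>Both functions have the minimal value, so strong convexity with A = m leaves no room for
  a positive distance.\<close>

lemma minimizer_unique:
  fixes f :: "real^'n \<Rightarrow> real^'m"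
  assumes f: "f \<in> borel_measurable borel" and lam: "lam > 0"
    and u: "Xs \<Omega> u" "Fval \<Omega> \<psi> lam f u < \<infinity>" "\<And>w. Xs \<Omega> w \<Longrightarrow> Fval \<Omega> \<psi> lam f u \<le> Fval \<Omega> \<psi> lam f w"
    and v: "Xs \<Omega> v" "Fval \<Omega> \<psi> lam f v \<le> Fval \<Omega> \<psi> lam f u"
  shows "AE x in lborel. v x = u x"
proof -
  obtain m where m: "m \<ge> 0" "Fval \<Omega> \<psi> lam f u = ennreal m" using u(2) by (metis ennreal_cases infinity_ennreal_def less_irrefl)
  have "L1 (\<lambda>x. (norm (v x - u x))\<^sup>2)" "lam / 8 * (LBINT x. (norm (v x - u x))\<^sup>2) \<le> m - m"
    using Fval_strong_convexity[OF v(1) u(1) f lam, of \<psi> m m] v(2) u(3) m by auto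
  moreover have "0 \<le> (LBINT x. (norm (v x - u x))\<^sup>2)" by (simp add: integral_nonneg)
  ultimately have "AE x in lborel. (norm (v x - u x))\<^sup>2 = 0"
    using lam by (subst integral_nonneg_eq_0_iff_AE[symmetric]) (auto simp: mult_le_0_iff)
  then show ?thesis by simp
qed

section \<open>Mollification of test fields\<close>

lemma conv_pair_integrable:
  fixes g :: "real^'n \<Rightarrow> 'b::euclidean_space"
  assumes \<eta>: "mollifier \<epsilon> \<eta>" and g: "L1 g"
  shows "integrable (lborel \<Otimes>\<^sub>M lborel) (\<lambda>(y, x). \<eta> (x - y) *\<^sub>R g y)"
proof (rule lborel_pair.Fubini_integrable)
  have [measurable]: "\<eta> \<in> borel_measurable borel" "g \<in> borel_measurable borel" using mollifierD(8)[OF \<eta>] g by auto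
  show "(\<lambda>(y, x). \<eta> (x - y) *\<^sub>R g y) \<in> borel_measurable (lborel \<Otimes>\<^sub>M lborel)" by measurable
  have sh: "(LBINT x. \<eta> (x - y)) = 1" "L1 (\<lambda>x. \<eta> (x - y))" for y
    using mollifier_integral_shift[OF \<eta>, of y] mollifierD(11)[OF \<eta>, of _ y] by simp_all
  have "(LBINT x. norm (\<eta> (x - y) *\<^sub>R g y)) = norm (g y)" for y
    using sh[of y] mollifierD(2)[OF \<eta>] by simp
  then show "L1 (\<lambda>y. LBINT x. norm (case (y, x) of (y, x) \<Rightarrow> \<eta> (x - y) *\<^sub>R g y))"
    unfolding prod.case using integrable_norm[OF g] by (simp only:)
  show "AE y in lborel. L1 (\<lambda>x. case (y, x) of (y, x) \<Rightarrow> \<eta> (x - y) *\<^sub>R g y)"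
    using sh by (intro AE_I2) simp
qed

lemma conv_integral:
  fixes g :: "real^'n \<Rightarrow> 'b::euclidean_space"
  assumes \<eta>: "mollifier \<epsilon> \<eta>" and g: "L1 g"
  shows "L1 (conv \<eta> g)" "(LBINT x. conv \<eta> g x) = (LBINT x. g x)"
proof -
  note p = conv_pair_integrable[OF assms]
  show "L1 (conv \<eta> g)"
    using lborel_pair.integrable_snd[OF p] by (simp add: conv_def[abs_def])
  have "(LBINT x. (LBINT y. \<eta> (x - y) *\<^sub>R g y)) = (LBINT y. (LBINT x. \<eta> (x - y) *\<^sub>R g y))"
    by (rule lborel_pair.Fubini_integral[OF p])
  also have "\<dots> = (LBINT y. g y)"
    using mollifier_integral_shift[OF \<eta>] mollifierD(11)[OF \<eta>] 
    by (intro integral_cong refl) (simp add: mollifierD(11)[OF \<eta>, of _ y for y])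
  finally show "(LBINT x. conv \<eta> g x) = (LBINT x. g x)" by (simp add: conv_def)
qed

lemma conv_entry:
  fixes \<Phi> :: "real^'n \<Rightarrow> real^'m^'k"
  assumes "mollifier \<epsilon> \<eta>" "L1 \<Phi>"
  shows "conv \<eta> \<Phi> x $ \<alpha> $ i = conv \<eta> (\<lambda>x. \<Phi> x $ \<alpha> $ i) x"
  using conv_component[OF assms bounded_linear_compose[OF bounded_linear_vec_nth bounded_linear_vec_nth]] .

lemma conv_vec_nth:
  fixes w :: "real^'n \<Rightarrow> real^'m"
  assumes "mollifier \<epsilon> \<eta>" "L1 w"
  shows "conv \<eta> w x $ i = conv \<eta> (\<lambda>x. w x $ i) x"
  using conv_component[OF assms bounded_linear_vec_nth] .

lemma conv_sum:
  fixes g :: "'i \<Rightarrow> real^'n \<Rightarrow> real"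
  assumes \<eta>: "mollifier \<epsilon> \<eta>" and g: "\<And>i. i \<in> I \<Longrightarrow> L1 (g i)"
  shows "conv \<eta> (\<lambda>x. \<Sum>i\<in>I. g i x) x = (\<Sum>i\<in>I. conv \<eta> (g i) x)"
  unfolding conv_def using mollifier_conv_integrable[OF \<eta> g]
  by (simp add: sum_distrib_left integral_sum)

lemma conv_field:
  fixes \<Phi> :: "real^'n \<Rightarrow> real^'m^'n"
  assumes \<eta>: "mollifier \<epsilon> \<eta>" and \<Phi>: "C1_field \<Phi>" "csupp U \<Phi>"
  shows "C1_field (conv \<eta> \<Phi>)" "dv (conv \<eta> \<Phi>) x = conv \<eta> (dv \<Phi>) x"
proof -
  have i: "L1 \<Phi>" by (rule csupp_integrable[OF C1_field_continuous[OF \<Phi>(1)] \<Phi>(2)])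
  note e = C1_field_entry[OF \<Phi>(1)] and c = csupp_entry[OF \<Phi>(2)]
  show "C1_field (conv \<eta> \<Phi>)"
    unfolding C1_field_def conv_entry[OF \<eta> i] using mollifier_conv_Ck[OF \<eta> integrable_entry[OF i]] by blast
  have di: "L1 (dv \<Phi>)"
    by (rule csupp_integrable[OF dv_continuous[OF \<Phi>(1)] dv_csupp[OF \<Phi>(2)]])
  have pi: "L1 (pd \<alpha> (\<lambda>x. \<Phi> x $ \<alpha> $ i))" for \<alpha> i
    by (rule csupp_integrable[OF C1_continuous_partial[OF e] csupp_partial_deriv[OF c]])
  show "dv (conv \<eta> \<Phi>) x = conv \<eta> (dv \<Phi>) x"
  proof (rule vec_eq_iff[THEN iffD2], rule allI)
    fix i
    have "dv (conv \<eta> \<Phi>) x $ i = (\<Sum>\<alpha>\<in>UNIV. conv \<eta> (pd \<alpha> (\<lambda>x. \<Phi> x $ \<alpha> $ i)) x)"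
      unfolding dv_def by (simp add: conv_entry[OF \<eta> i] mollifier_conv_partial[OF \<eta> e c])
    also have "\<dots> = conv \<eta> (dv \<Phi>) x $ i"
      unfolding conv_vec_nth[OF \<eta> di] by (simp add: dv_def conv_sum[OF \<eta> pi])
    finally show "dv (conv \<eta> \<Phi>) x $ i = conv \<eta> (dv \<Phi>) x $ i" .
  qed
qed

text \<open>For fixed t the left-hand side is convex in the pair, so averaging with a probability
  density preserves the bound.\<close>

lemma conv_slope:
  fixes a :: "real^'n \<Rightarrow> real" and \<Phi> :: "real^'n \<Rightarrow> 'b::euclidean_space"
  assumes \<eta>: "mollifier \<epsilon> \<eta>" and a: "L1 a" and \<Phi>: "L1 \<Phi>"
    and le: "\<And>x. a x + norm (\<Phi> x) * t \<le> c" and t: "t \<ge> 0"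
  shows "conv \<eta> a x + norm (conv \<eta> \<Phi> x) * t \<le> c"
proof -
  have "conv \<eta> a x + norm (conv \<eta> \<Phi> x) * t \<le> conv \<eta> a x + conv \<eta> (\<lambda>y. norm (\<Phi> y)) x * t"
    by (intro add_left_mono mult_right_mono conv_norm_le[OF \<eta>] t)
  also have "\<dots> = conv \<eta> (\<lambda>y. a y + norm (\<Phi> y) * t) x"
    unfolding conv_def using mollifier_conv_integrable[OF \<eta> a, of x] mollifier_conv_integrable[OF \<eta> integrable_norm[OF \<Phi>], of x]
    by (simp add: distrib_left mult.assoc[symmetric])
  also have "\<dots> \<le> c" using a \<Phi> le by (intro mollifier_conv_le[OF \<eta>]) auto
  finally show ?thesis .
qed

lemma field_integration_by_parts:
  fixes g :: "real^'n \<Rightarrow> real^'m"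
  assumes g: "\<And>i. (\<lambda>x. g x $ i) \<in> Ck_fun (Suc 0)" and \<Phi>: "C1_field \<Phi>" "csupp U \<Phi>"
  shows "(LBINT x. g x \<bullet> dv \<Phi> x) = - (LBINT x. (\<Sum>\<alpha>\<in>UNIV. \<Sum>i\<in>UNIV. pd \<alpha> (\<lambda>x. g x $ i) x * \<Phi> x $ \<alpha> $ i))"
proof -
  note e = C1_field_entry[OF \<Phi>(1)] and c = csupp_entry[OF \<Phi>(2)]
  have gc: "continuous_on UNIV (\<lambda>x. g x $ i)" for i using g Ck_fun_continuous by blast
  have i1: "L1 (\<lambda>x. g x $ i * pd \<alpha> (\<lambda>x. \<Phi> x $ \<alpha> $ i) x)" for \<alpha> i
    by (intro csupp_integrable[OF _ csupp_mult2[OF csupp_partial_deriv[OF c]]] continuous_on_mult gc C1_continuous_partial[OF e])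
  have i2: "L1 (\<lambda>x. pd \<alpha> (\<lambda>x. g x $ i) x * \<Phi> x $ \<alpha> $ i)" for \<alpha> i
    by (intro csupp_integrable[OF _ csupp_mult2[OF c]] continuous_on_mult C1_continuous_partial[OF g] Ck_fun_continuous[OF e])
  have "(LBINT x. g x \<bullet> dv \<Phi> x) = (LBINT x. (\<Sum>i\<in>UNIV. \<Sum>\<alpha>\<in>UNIV. g x $ i * pd \<alpha> (\<lambda>x. \<Phi> x $ \<alpha> $ i) x))"
    by (simp add: inner_vec_def dv_def sum_distrib_left)
  also have "\<dots> = (\<Sum>i\<in>UNIV. \<Sum>\<alpha>\<in>UNIV. LBINT x. g x $ i * pd \<alpha> (\<lambda>x. \<Phi> x $ \<alpha> $ i) x)"
    using i1 by (simp add: integral_sum)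
  also have "\<dots> = (\<Sum>\<alpha>\<in>UNIV. \<Sum>i\<in>UNIV. - (LBINT x. pd \<alpha> (\<lambda>x. g x $ i) x * \<Phi> x $ \<alpha> $ i))"
    by (subst sum.swap) (simp only: integration_by_parts[OF g e c])
  also have "\<dots> = - (LBINT x. (\<Sum>\<alpha>\<in>UNIV. \<Sum>i\<in>UNIV. pd \<alpha> (\<lambda>x. g x $ i) x * \<Phi> x $ \<alpha> $ i))"
    using i2 by (simp add: integral_sum sum_negf)
  finally show ?thesis .
qed

section \<open>Quadratic mean estimates for mollifications\<close>

text \<open>Jensen's inequality for the probability density \<open>\<eta> (x - y)\<close>, obtained
  from the nonnegative variance about the mean. An infinite right-hand side is a trivial
  case.\<close>

lemma mollifier_sq_mean:
  fixes g :: "real^'n \<Rightarrow> 'b::euclidean_space"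
  assumes \<eta>: "mollifier \<epsilon> \<eta>" and g[measurable]: "g \<in> borel_measurable borel" and i: "L1 (\<lambda>y. \<eta> (x - y) *\<^sub>R g y)"
  shows "ennreal ((norm (LBINT y. \<eta> (x - y) *\<^sub>R g y))\<^sup>2) \<le> (\<integral>\<^sup>+y. ennreal (\<eta> (x - y) * (norm (g y))\<^sup>2) \<partial>lborel)"
proof (cases "(\<integral>\<^sup>+y. ennreal (\<eta> (x - y) * (norm (g y))\<^sup>2) \<partial>lborel) = \<infinity>")
  case False
  have [measurable]: "\<eta> \<in> borel_measurable borel" by (rule mollifierD(8)[OF \<eta>])
  have i2: "L1 (\<lambda>y. \<eta> (x - y) * (norm (g y))\<^sup>2)"
    using False mollifierD(2)[OF \<eta>] by (auto simp: integrable_iff_bounded less_top)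
  define m where "m = (LBINT y. \<eta> (x - y) *\<^sub>R g y)"
  note sh = mollifier_integral_shift[OF \<eta>, of x]
  have i3: "L1 (\<lambda>y. (\<eta> (x - y) *\<^sub>R g y) \<bullet> m)" by (rule integrable_inner_left) (rule i)
  have e: "\<eta> (x - y) * (norm (g y - m))\<^sup>2 = \<eta> (x - y) * (norm (g y))\<^sup>2 - 2 * ((\<eta> (x - y) *\<^sub>R g y) \<bullet> m) + (norm m)\<^sup>2 * \<eta> (x - y)" for y
    by (simp add: power2_norm_eq_inner inner_diff_left inner_diff_right inner_commute algebra_simps)
  have "0 \<le> (LBINT y. \<eta> (x - y) * (norm (g y - m))\<^sup>2)"
    using mollifierD(2)[OF \<eta>] by (intro integral_nonneg) auto
  also have "\<dots> = (LBINT y. \<eta> (x - y) * (norm (g y))\<^sup>2) - 2 * (LBINT y. (\<eta> (x - y) *\<^sub>R g y) \<bullet> m) + (norm m)\<^sup>2 * (LBINT y. \<eta> (x - y))"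
    unfolding e using i2 i3 sh(2) by simp
  also have "(LBINT y. (\<eta> (x - y) *\<^sub>R g y) \<bullet> m) = (norm m)\<^sup>2"
    using integral_inner_left[OF i, of m] by (simp add: m_def power2_norm_eq_inner)
  finally have "(norm m)\<^sup>2 \<le> (LBINT y. \<eta> (x - y) * (norm (g y))\<^sup>2)" using sh(1) by simp
  moreover have "(\<integral>\<^sup>+y. ennreal (\<eta> (x - y) * (norm (g y))\<^sup>2) \<partial>lborel) = ennreal (LBINT y. \<eta> (x - y) * (norm (g y))\<^sup>2)"
    using mollifierD(2)[OF \<eta>] by (intro nn_integral_eq_integral[OF i2]) auto
  ultimately show ?thesis by (simp add: m_def ennreal_leI)
qed simp

text \<open>The mean squared deviation of w from \<open>w x\<close> at the scale of \<eta>. It is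
  the single quantity that controls all errors of mollification and of the partial
  smoothing.\<close>

abbreviation oscillation :: "(real^'n \<Rightarrow> real) \<Rightarrow> (real^'n \<Rightarrow> 'b::euclidean_space) \<Rightarrow> real^'n \<Rightarrow> ennreal" where
  "oscillation \<eta> w x \<equiv> \<integral>\<^sup>+y. ennreal (\<eta> (x - y) * (norm (w y - w x))\<^sup>2) \<partial>lborel"

text \<open>With y = x + z and the integrals exchanged, this is an average over short vectors z of
  squared translation differences, each at most e.\<close>

lemma mollifier_oscillation:
  fixes w :: "real^'n \<Rightarrow> 'b::euclidean_space"
  assumes wm[measurable]: "w \<in> borel_measurable borel" and w2: "L1 (\<lambda>x. (norm (w x))\<^sup>2)"
    and off: "\<And>x. x \<notin> \<Omega> \<Longrightarrow> w x = 0" and op: "open \<Omega>" and bd: "bounded \<Omega>" and e: "e > 0"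
  obtains d where "d > 0" "\<And>\<epsilon> \<eta>. mollifier \<epsilon> \<eta> \<Longrightarrow> \<epsilon> \<le> d \<Longrightarrow>
      (\<integral>\<^sup>+x. oscillation \<eta> w x \<partial>lborel) \<le> ennreal e"
proof -
  obtain d where d: "d > 0" "\<And>z. norm z < d \<Longrightarrow> L1 (\<lambda>x. (norm (w (x + z) - w x))\<^sup>2)"
    "\<And>z. norm z < d \<Longrightarrow> (LBINT x. (norm (w (x + z) - w x))\<^sup>2) \<le> e"
    by (rule translation_continuous_sq[OF wm w2 off op bd e], assumption, rule that) auto
  have "(\<integral>\<^sup>+x. oscillation \<eta> w x \<partial>lborel) \<le> ennreal e"
    if \<eta>: "mollifier \<epsilon> \<eta>" "\<epsilon> \<le> d" for \<epsilon> \<eta>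
  proof -
    have [measurable]: "\<eta> \<in> borel_measurable borel" by (rule mollifierD(8)[OF \<eta>(1)])
    have "oscillation \<eta> w x
        = (\<integral>\<^sup>+z. ennreal (\<eta> z * (norm (w (x + z) - w x))\<^sup>2) \<partial>lborel)" for x
    proof -
      have "oscillation \<eta> w x
        = (\<integral>\<^sup>+y. ennreal (\<eta> (y - x) * (norm (w y - w x))\<^sup>2) \<partial>distr lborel borel (\<lambda>z. z + x))"
        by (simp add: lborel_distr_shift mollifierD(11)[OF \<eta>(1), of x])
      also have "\<dots> = (\<integral>\<^sup>+z. ennreal (\<eta> z * (norm (w (z + x) - w x))\<^sup>2) \<partial>lborel)"
        by (subst nn_integral_distr) auto
      finally show ?thesis by (simp add: add.commute)
    qed
    then have "(\<integral>\<^sup>+x. oscillation \<eta> w x \<partial>lborel)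
        = (\<integral>\<^sup>+x. (\<integral>\<^sup>+z. ennreal (\<eta> z * (norm (w (x + z) - w x))\<^sup>2) \<partial>lborel) \<partial>lborel)" by simp
    also have "\<dots> = (\<integral>\<^sup>+z. (\<integral>\<^sup>+x. ennreal (\<eta> z * (norm (w (x + z) - w x))\<^sup>2) \<partial>lborel) \<partial>lborel)"
      by (rule lborel_pair.Fubini') measurable
    also have "\<dots> \<le> (\<integral>\<^sup>+z. ennreal (\<eta> z * e) \<partial>lborel)"
    proof (rule nn_integral_mono)
      fix z
      show "(\<integral>\<^sup>+x. ennreal (\<eta> z * (norm (w (x + z) - w x))\<^sup>2) \<partial>lborel) \<le> ennreal (\<eta> z * e)"
      proof (cases "norm z < d")
        case True
        have "(\<integral>\<^sup>+x. ennreal (\<eta> z * (norm (w (x + z) - w x))\<^sup>2) \<partial>lborel) = ennreal (LBINT x. \<eta> z * (norm (w (x + z) - w x))\<^sup>2)"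
          using d(2)[OF True] mollifierD(2)[OF \<eta>(1)] by (intro nn_integral_eq_integral) auto
        also have "\<dots> \<le> ennreal (\<eta> z * e)"
          using d(3)[OF True] mollifierD(2)[OF \<eta>(1), of z] by (intro ennreal_leI) (simp add: mult_left_mono)
        finally show ?thesis .
      next
        case False
        then have "\<eta> z = 0" using mollifierD(3)[OF \<eta>(1), of z] \<eta>(2) by simp
        then show ?thesis by simp
      qed
    qed
    also have "\<dots> = ennreal (LBINT z. \<eta> z * e)"
      using mollifierD(2,5)[OF \<eta>(1)] e by (intro nn_integral_eq_integral) auto
    also have "\<dots> = ennreal e" using mollifierD(5,6)[OF \<eta>(1)] by simp
    finally show ?thesis .
  qed
  then show thesis using that d(1) by blast
qed

lemma mollifier_sq_limit:
  fixes w :: "real^'n \<Rightarrow> 'b::euclidean_space"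
  assumes wi: "L1 w" and w2: "L1 (\<lambda>x. (norm (w x))\<^sup>2)"
    and off: "\<And>x. x \<notin> \<Omega> \<Longrightarrow> w x = 0" and op: "open \<Omega>" and bd: "bounded \<Omega>" and e: "e > 0"
  obtains d where "d > 0" "\<And>\<epsilon> \<eta>. mollifier \<epsilon> \<eta> \<Longrightarrow> \<epsilon> \<le> d \<Longrightarrow> L1 (\<lambda>x. (norm (conv \<eta> w x - w x))\<^sup>2)"
      "\<And>\<epsilon> \<eta>. mollifier \<epsilon> \<eta> \<Longrightarrow> \<epsilon> \<le> d \<Longrightarrow> (LBINT x. (norm (conv \<eta> w x - w x))\<^sup>2) \<le> e"
proof -
  have [measurable]: "w \<in> borel_measurable borel" using wi by auto
  obtain d where d: "d > 0" "\<And>\<epsilon> \<eta>. mollifier \<epsilon> \<eta> \<Longrightarrow> \<epsilon> \<le> d \<Longrightarrow>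
      (\<integral>\<^sup>+x. oscillation \<eta> w x \<partial>lborel) \<le> ennreal e"
    by (rule mollifier_oscillation[OF _ w2 off op bd e]) auto
  have *: "L1 (\<lambda>x. (norm (conv \<eta> w x - w x))\<^sup>2) \<and> (LBINT x. (norm (conv \<eta> w x - w x))\<^sup>2) \<le> e"
    if \<eta>: "mollifier \<epsilon> \<eta>" "\<epsilon> \<le> d" for \<epsilon> \<eta>
  proof -
    have [measurable]: "conv \<eta> w \<in> borel_measurable borel" using conv_integral(1)[OF \<eta>(1) wi] by auto
    have "(\<integral>\<^sup>+x. ennreal ((norm (conv \<eta> w x - w x))\<^sup>2) \<partial>lborel)
      \<le> (\<integral>\<^sup>+x. oscillation \<eta> w x \<partial>lborel)"
    proof (rule nn_integral_mono)
      fix x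
      show "ennreal ((norm (conv \<eta> w x - w x))\<^sup>2) \<le> oscillation \<eta> w x"
        unfolding mollifier_conv_diff(1)[OF \<eta>(1) wi]
        by (rule mollifier_sq_mean[OF \<eta>(1) _ mollifier_conv_diff(2)[OF \<eta>(1) wi]]) measurable
    qed
    also have "\<dots> \<le> ennreal e" by (rule d(2)[OF \<eta>])
    finally have le: "(\<integral>\<^sup>+x. ennreal ((norm (conv \<eta> w x - w x))\<^sup>2) \<partial>lborel) \<le> ennreal e" .
    then have i: "L1 (\<lambda>x. (norm (conv \<eta> w x - w x))\<^sup>2)"
      by (auto simp: integrable_iff_bounded intro: le_less_trans)
    then have "ennreal (LBINT x. (norm (conv \<eta> w x - w x))\<^sup>2) \<le> ennreal e"
      using le by (subst (asm) nn_integral_eq_integral) auto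
    then show ?thesis using i e by simp
  qed
  show thesis by (rule that[OF d(1)]) (use * in blast)+
qed

section \<open>Truncation by a half-space\<close>

lemma flat_continuous: "continuous_on UNIV (flat j)"
  using DERIV_isCont[OF flat_deriv] by (simp add: continuous_on_eq_continuous_at)

text \<open>\<open>flat 2\<close> is the derivative of \<open>flat 0\<close>, so the bound 1 is what
  makes the differential of the truncation a contraction. With t = 1/s it reads t^2 \<le> exp t,
  which follows from the quadratic Taylor bound for exp (t/2).\<close>

lemma flat2_le_1: "flat 2 s \<le> 1"
proof (cases "s > 0")
  case True
  define t where "t = inverse s"
  have t: "t > 0" using True by (simp add: t_def)
  have "t \<le> 1 + t / 2 + (t / 2)\<^sup>2 / 2"
  proof -
    have "0 \<le> (t / 2 - 1)\<^sup>2" by simp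
    then show ?thesis by (simp add: power2_eq_square algebra_simps)
  qed
  also have "\<dots> \<le> exp (t / 2)" using t by (intro exp_lower_Taylor_quadratic) simp
  finally have "t\<^sup>2 \<le> (exp (t / 2))\<^sup>2" using t by (intro power_mono) auto
  also have "\<dots> = exp t" by (simp add: exp_double[symmetric])
  finally have "t ^ 2 / exp t \<le> 1" by simp
  then show ?thesis using True by (simp add: flat_def t_def)
qed (simp add: flat_def)

lemma flat0_le: "s \<ge> 0 \<Longrightarrow> flat 0 s \<le> s"
proof (cases "s > 0")
  case True
  have "inverse s \<le> exp (inverse s)" using exp_ge_add_one_self[of "inverse s"] by linarith
  then have "1 / exp (inverse s) \<le> 1 / inverse s" using True by (intro divide_left_mono) auto
  then show ?thesis using True by (simp add: flat_def inverse_eq_divide)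
qed (simp add: flat_def)

lemma flat0_lipschitz: "\<bar>flat 0 s - flat 0 t\<bar> \<le> \<bar>s - t\<bar>"
proof -
  have "norm (flat 0 s - flat 0 t) \<le> 1 * norm (s - t)"
  proof (rule field_differentiable_bound[of UNIV _ "flat 2"])
    show "(flat 0 has_field_derivative flat 2 z) (at z within UNIV)" for z using flat_deriv[of 0 z] by (simp add: numeral_2_eq_2)
    show "norm (flat 2 z) \<le> 1" for z using flat2_le_1[of z] flat_nonneg[of 2 z] by simp
  qed auto
  then show ?thesis by simp
qed

lemma flat_pos: "s > 0 \<Longrightarrow> flat 0 s > 0"
  by (simp add: flat_def)

text \<open>A smooth substitute for the projection onto the half-space e \<bullet> y \<le> c. Points
  of the half-space are fixed; others are moved towards it by a positive amount not exceeding their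
  excess. The image need not lie in the half-space: a strict decrease of the fidelity is
  enough.\<close>

definition trunc :: "real^'m \<Rightarrow> real \<Rightarrow> real^'m \<Rightarrow> real^'m" where
  "trunc e c y = y - flat 0 (e \<bullet> y - c) *\<^sub>R e"

text \<open>Points outside the half-space are moved along -e by a length q, at most the component of
  y - f along e, which shortens the squared distance by at least q^2. This gain is what later
  detects points outside.\<close>

lemma trunc_distance:
  assumes e: "norm e = 1" and f: "e \<bullet> f \<le> c"
  shows "(norm (trunc e c y - f))\<^sup>2 + (flat 0 (e \<bullet> y - c))\<^sup>2 \<le> (norm (y - f))\<^sup>2"
proof -
  let ?q = "flat 0 (e \<bullet> y - c)"
  have "(norm (trunc e c y - f))\<^sup>2 = (norm ((y - f) - ?q *\<^sub>R e))\<^sup>2" by (simp add: trunc_def algebra_simps)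
  also have "\<dots> = (norm (y - f))\<^sup>2 - 2 * ?q * (e \<bullet> (y - f)) + ?q\<^sup>2 * (norm e)\<^sup>2"
    unfolding power2_norm_eq_inner by (simp add: inner_diff_left inner_diff_right inner_commute algebra_simps power2_eq_square)
  also have "\<dots> = (norm (y - f))\<^sup>2 - 2 * ?q * (e \<bullet> (y - f)) + ?q * ?q" using e by (simp add: power2_eq_square)
  finally have n: "(norm (trunc e c y - f))\<^sup>2 = (norm (y - f))\<^sup>2 - 2 * ?q * (e \<bullet> (y - f)) + ?q * ?q" .
  have "?q * ?q \<le> ?q * (e \<bullet> (y - f))"
  proof (cases "e \<bullet> y - c \<le> 0")
    case True
    then show ?thesis by (simp add: flat_def)
  next
    case False
    then have "?q \<le> e \<bullet> (y - f)" using flat0_le[of "e \<bullet> y - c"] f by (simp add: inner_diff_right)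
    then show ?thesis using flat_nonneg by (intro mult_left_mono) auto
  qed
  then show ?thesis unfolding n by (simp add: power2_eq_square)
qed

lemma trunc_continuous: "continuous_on UNIV (trunc e c)"
proof -
  have "continuous_on UNIV (\<lambda>y. flat 0 (e \<bullet> y - c))"
    by (rule continuous_on_compose2[OF flat_continuous]) (auto intro!: continuous_intros)
  then show ?thesis unfolding trunc_def[abs_def] by (intro continuous_intros)
qed

lemma trunc_lipschitz:
  assumes e: "norm e = 1"
  shows "norm (trunc e c y - trunc e c z) \<le> 2 * norm (y - z)"
proof -
  have "norm (trunc e c y - trunc e c z) = norm ((y - z) - (flat 0 (e \<bullet> y - c) - flat 0 (e \<bullet> z - c)) *\<^sub>R e)"
    by (simp add: trunc_def algebra_simps)
  also have "\<dots> \<le> norm (y - z) + \<bar>flat 0 (e \<bullet> y - c) - flat 0 (e \<bullet> z - c)\<bar>"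
    using norm_triangle_ineq4[of "y - z"] e by (metis mult.right_neutral norm_scaleR)
  also have "\<bar>flat 0 (e \<bullet> y - c) - flat 0 (e \<bullet> z - c)\<bar> \<le> \<bar>e \<bullet> (y - z)\<bar>"
    using flat0_lipschitz[of "e \<bullet> y - c" "e \<bullet> z - c"] by (simp add: inner_diff_right)
  also have "\<bar>e \<bullet> (y - z)\<bar> \<le> norm (y - z)" using Cauchy_Schwarz_ineq2[of e "y - z"] e by simp
  finally show ?thesis by simp
qed

lemma flat_comp_C1:
  fixes g :: "real^'n \<Rightarrow> real"
  assumes "g \<in> Ck_fun (Suc 0)"
  shows "(\<lambda>x. flat j (g x)) \<in> Ck_fun (Suc 0)"
    "pd \<alpha> (\<lambda>x. flat j (g x)) x = (flat (j + 2) (g x) - real j * flat (j + 1) (g x)) * pd \<alpha> g x"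
proof -
  let ?d = "\<lambda>x. flat (j + 2) (g x) - real j * flat (j + 1) (g x)"
  have D: "((\<lambda>x. flat j (g x)) has_derivative (\<lambda>h. (?d x *\<^sub>R grd g x) \<bullet> h)) (at x)" for x
    using has_derivative_compose[OF C1_has_derivative[OF assms] flat_deriv[unfolded has_field_derivative_def, of j "g x"]]
    by (simp add: mult.commute)
  have fc: "continuous_on UNIV (\<lambda>x. flat k (g x))" for k
    by (rule continuous_on_compose2[OF flat_continuous Ck_fun_continuous[OF assms]]) simp
  show "(\<lambda>x. flat j (g x)) \<in> Ck_fun (Suc 0)"
  proof (rule Ck_fun_SucI[OF D])
    have "continuous_on UNIV (\<lambda>x. (?d x) * pd \<alpha> g x)" for \<alpha>
      by (intro continuous_intros fc C1_continuous_partial[OF assms])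
    then show "(\<lambda>x. (?d x *\<^sub>R grd g x) $ \<alpha>) \<in> Ck_fun 0" for \<alpha> by (simp add: grd_def)
  qed
  show "pd \<alpha> (\<lambda>x. flat j (g x)) x = ?d x * pd \<alpha> g x"
    using fun_cong[OF has_derivative_inner_partial[OF D], of \<alpha> x] by (simp add: grd_def)
qed

text \<open>The transpose of the differential of the truncation maps admissible pairs to admissible pairs.\<close>

definition trunc_field :: "real^'m \<Rightarrow> (real^'n \<Rightarrow> real) \<Rightarrow> (real^'n \<Rightarrow> real^'m^'n) \<Rightarrow> real^'n \<Rightarrow> real^'m^'n" where
  "trunc_field e s \<Phi> x = (\<chi> \<alpha>. \<Phi> x $ \<alpha> - (flat 2 (s x) * (\<Phi> x $ \<alpha> \<bullet> e)) *\<^sub>R e)"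

lemma trunc_field_0: "\<Phi> x = 0 \<Longrightarrow> trunc_field e s \<Phi> x = 0"
  by (rule vec_eq_iff[THEN iffD2]) (simp add: trunc_field_def)

text \<open>Row by row, with q in [0, 1], the squared norm becomes |r|^2 - (2 q - q^2) (r \<bullet>
  e)^2. A smaller field with the same a remains admissible.\<close>

lemma trunc_field_norm:
  fixes \<Phi> :: "real^'n \<Rightarrow> real^'m^'n"
  assumes e: "norm e = 1"
  shows "norm (trunc_field e s \<Phi> x) \<le> norm (\<Phi> x)"
proof -
  have row: "norm (trunc_field e s \<Phi> x $ \<alpha>) \<le> norm (\<Phi> x $ \<alpha>)" for \<alpha>
  proof -
    let ?r = "\<Phi> x $ \<alpha>" and ?q = "flat 2 (s x)"
    have q: "0 \<le> ?q" "?q \<le> 1" using flat_nonneg flat2_le_1 by auto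
    have "(norm (?r - (?q * (?r \<bullet> e)) *\<^sub>R e))\<^sup>2 = (norm ?r)\<^sup>2 - 2 * ?q * (?r \<bullet> e)\<^sup>2 + ?q\<^sup>2 * (?r \<bullet> e)\<^sup>2 * (norm e)\<^sup>2"
      unfolding power2_norm_eq_inner by (simp add: inner_diff_left inner_diff_right inner_commute algebra_simps power2_eq_square)
    also have "\<dots> = (norm ?r)\<^sup>2 - (2 * ?q - ?q\<^sup>2) * (?r \<bullet> e)\<^sup>2" using e by (simp add: algebra_simps)
    also have "\<dots> \<le> (norm ?r)\<^sup>2"
    proof -
      have "?q\<^sup>2 \<le> 2 * ?q" using q mult_right_mono[of ?q 2 ?q] by (simp add: power2_eq_square)
      then show ?thesis by simp
    qed
    finally show ?thesis by (simp add: trunc_field_def power2_le_iff_abs_le)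
  qed
  have n: "norm M = L2_set (\<lambda>\<alpha>. norm (M $ \<alpha>)) UNIV" for M :: "real^'m^'n" by (rule norm_vec_def)
  show ?thesis unfolding n by (rule L2_set_mono[OF row norm_ge_zero])
qed

lemma trunc_field_C1:
  assumes s: "s \<in> Ck_fun (Suc 0)" and \<Phi>: "C1_field \<Phi>"
  shows "C1_field (trunc_field e s \<Phi>)"
proof -
  have e: "trunc_field e s \<Phi> x $ \<alpha> $ i = \<Phi> x $ \<alpha> $ i - (flat 2 (s x) * (\<Sum>j\<in>UNIV. e $ j * \<Phi> x $ \<alpha> $ j)) * e $ i" for x \<alpha> i
    by (simp add: trunc_field_def inner_vec_def mult.commute)
  show ?thesis
    unfolding C1_field_def e
    by (intro allI Ck_fun_diff Ck_fun_mult Ck_fun_sum Ck_fun_const flat_comp_C1 s C1_field_entry[OF \<Phi>])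
qed

text \<open>Integration by parts produces the gradient of the composition; the chain rule moves the
  differential of the truncation onto \<Phi>, and a second integration by parts restores the
  divergence form.\<close>

lemma trunc_field_chain:
  fixes g :: "real^'n \<Rightarrow> real^'m"
  assumes g: "\<And>i. (\<lambda>x. g x $ i) \<in> Ck_fun (Suc 0)" and \<Phi>: "C1_field \<Phi>" "csupp U \<Phi>"
  shows "(LBINT x. trunc e c (g x) \<bullet> dv \<Phi> x) = (LBINT x. g x \<bullet> dv (trunc_field e (\<lambda>x. e \<bullet> g x - c) \<Phi>) x)"
proof -
  define s where "s x = e \<bullet> g x - c" for x
  have s_eq: "s = (\<lambda>x. (\<Sum>j\<in>UNIV. e $ j * g x $ j) - c)" by (auto simp: s_def inner_vec_def)
  have sC: "s \<in> Ck_fun (Suc 0)"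
    unfolding s_eq by (intro Ck_fun_diff Ck_fun_sum Ck_fun_cmult Ck_fun_const g)
  have sD: "pd \<alpha> s x = (\<Sum>j\<in>UNIV. e $ j * pd \<alpha> (\<lambda>x. g x $ j) x)" for \<alpha> x
  proof -
    have "pd \<alpha> s x = pd \<alpha> (\<lambda>x. \<Sum>j\<in>UNIV. e $ j * g x $ j) x - 0"
      unfolding s_eq using partial_deriv_diff[where f = "\<lambda>x. \<Sum>j\<in>UNIV. e $ j * g x $ j" and g = "\<lambda>x. c" and k = 0 and l = 0]
        Ck_fun_sum[of UNIV "\<lambda>j x. e $ j * g x $ j" "Suc 0"] Ck_fun_cmult[OF g] by (simp del: Ck_fun.simps)
    also have "\<dots> = (\<Sum>j\<in>UNIV. pd \<alpha> (\<lambda>x. e $ j * g x $ j) x)"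
      using partial_deriv_sum[of UNIV "\<lambda>j x. e $ j * g x $ j" 0 \<alpha> x] Ck_fun_cmult[OF g] by (simp del: Ck_fun.simps)
    finally show ?thesis by (simp only: partial_deriv_cmult[OF g])
  qed
  have te: "trunc e c (g x) $ i = g x $ i - e $ i * flat 0 (s x)" for x i by (simp add: trunc_def s_def)
  have qC: "(\<lambda>x. e $ i * flat 0 (s x)) \<in> Ck_fun (Suc 0)" for i by (intro Ck_fun_cmult flat_comp_C1 sC)
  have tC: "(\<lambda>x. trunc e c (g x) $ i) \<in> Ck_fun (Suc 0)" for i
    unfolding te by (intro Ck_fun_diff g qC)
  have tD: "pd \<alpha> (\<lambda>x. trunc e c (g x) $ i) x = pd \<alpha> (\<lambda>x. g x $ i) x - e $ i * (flat 2 (s x) * pd \<alpha> s x)" for \<alpha> i x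
    unfolding te partial_deriv_diff[OF g qC] partial_deriv_cmult[OF flat_comp_C1(1)[OF sC]]
    using flat_comp_C1(2)[OF sC, of \<alpha> 0 x] by (simp add: numeral_2_eq_2)
  have tf: "C1_field (trunc_field e s \<Phi>)" by (rule trunc_field_C1[OF sC \<Phi>(1)])
  have tfs: "csupp U (trunc_field e s \<Phi>)" using \<Phi>(2) unfolding csupp_def by (meson trunc_field_0)
  have pw: "(\<Sum>i\<in>UNIV. pd \<alpha> (\<lambda>x. trunc e c (g x) $ i) x * \<Phi> x $ \<alpha> $ i)
      = (\<Sum>i\<in>UNIV. pd \<alpha> (\<lambda>x. g x $ i) x * trunc_field e s \<Phi> x $ \<alpha> $ i)" for \<alpha> x
  proof -
    have "(\<Sum>i\<in>UNIV. pd \<alpha> (\<lambda>x. trunc e c (g x) $ i) x * \<Phi> x $ \<alpha> $ i)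
      = (\<Sum>i\<in>UNIV. pd \<alpha> (\<lambda>x. g x $ i) x * \<Phi> x $ \<alpha> $ i) - flat 2 (s x) * pd \<alpha> s x * (\<Phi> x $ \<alpha> \<bullet> e)"
      unfolding tD by (simp add: algebra_simps sum_subtractf inner_vec_def sum_distrib_left)
    also have "flat 2 (s x) * pd \<alpha> s x * (\<Phi> x $ \<alpha> \<bullet> e)
      = (\<Sum>i\<in>UNIV. pd \<alpha> (\<lambda>x. g x $ i) x * (flat 2 (s x) * (\<Phi> x $ \<alpha> \<bullet> e) * e $ i))"
      unfolding sD by (simp add: sum_distrib_left sum_distrib_right mult_ac)
    finally show ?thesis by (simp add: trunc_field_def right_diff_distrib sum_subtractf)
  qed
  have "(LBINT x. trunc e c (g x) \<bullet> dv \<Phi> x)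
      = - (LBINT x. (\<Sum>\<alpha>\<in>UNIV. \<Sum>i\<in>UNIV. pd \<alpha> (\<lambda>x. trunc e c (g x) $ i) x * \<Phi> x $ \<alpha> $ i))"
    by (rule field_integration_by_parts[OF tC \<Phi>])
  also have "\<dots> = - (LBINT x. (\<Sum>\<alpha>\<in>UNIV. \<Sum>i\<in>UNIV. pd \<alpha> (\<lambda>x. g x $ i) x * trunc_field e s \<Phi> x $ \<alpha> $ i))"
    unfolding pw ..
  also have "\<dots> = (LBINT x. g x \<bullet> dv (trunc_field e s \<Phi>) x)"
    by (rule field_integration_by_parts[OF g tf tfs, symmetric])
  finally show ?thesis by (simp add: s_def[abs_def])
qed

text \<open>The chain rule is available for C^1 functions, so u is replaced by a mollification g.
  Self-adjointness moves the mollification onto the transformed test pair, which stays admissible;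
  the error between g and u is small by the Lipschitz bound for \<open>trunc\<close> and convergence
  in the square mean.\<close>

lemma Rfun_trunc:
  fixes u :: "real^'n \<Rightarrow> real^'m" and c :: real
  assumes u: "Xs \<Omega> u" and u2: "L1 (\<lambda>x. (norm (u x))\<^sup>2)" and op: "open \<Omega>" and bd: "bounded \<Omega>"
    and e: "norm e = 1" and R: "Rfun \<Omega> \<psi> u \<le> ennreal r" "r \<ge> 0"
  defines "v \<equiv> \<lambda>x. if x \<in> \<Omega> then trunc e c (u x) else 0"
  shows "Rfun \<Omega> \<psi> v \<le> ennreal r"
proof (rule Rfun_least, rule ennreal_leI, rule field_le_epsilon)
  fix a and \<Phi> :: "real^'n \<Rightarrow> real^'m^'n" and \<delta> :: real
  assume ad: "adm \<Omega> \<psi> a \<Phi>" and \<delta>: "\<delta> > 0"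
  have ui: "L1 u" and uoff: "\<And>x. x \<notin> \<Omega> \<Longrightarrow> u x = 0" using u by (auto simp: Xs_def)
  have [measurable]: "u \<in> borel_measurable borel" using ui by auto
  note \<Phi> = admD(1,4)[OF ad] and ai = admD(2)[OF ad]
  obtain S where S: "compact S" "S \<subseteq> \<Omega>" "\<And>x. x \<notin> S \<Longrightarrow> a x = 0" "\<And>x. x \<notin> S \<Longrightarrow> \<Phi> x = 0"
    using adm_support[OF ad] by metis
  obtain d0 T where T: "d0 > 0" "compact T" "S \<subseteq> T" "T \<subseteq> \<Omega>" "\<And>x y. x \<notin> T \<Longrightarrow> dist x y \<le> d0 \<Longrightarrow> y \<notin> S"
    using csupp_enlarge[OF S(1,2) op] by metis
  have [measurable]: "S \<in> sets borel" using S(1) by (simp add: borel_compact)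
  have iS: "L1 (indicator S :: _ \<Rightarrow> real)" using emeasure_compact_finite[OF S(1)] by (simp add: less_top)
  obtain B where B: "B > 0" "\<And>x. norm (dv \<Phi> x) \<le> B" using csupp_bounded[OF admD(7,8)[OF ad]] by metis
  have dvoff: "dv \<Phi> x = 0" if "x \<notin> S" for x by (rule dv_zero_off[OF compact_imp_closed[OF S(1)] S(4) that])
  define p where "p = measure lborel S + 1"
  have p: "p > 0" by (simp add: p_def add_nonneg_pos)
  \<comment> \<open>The error 2 B |g - u| is split into \<kappa> + (B^2/\<kappa>) |g - u|^2 on S;
    this choice lets the first term integrate to at most \<delta>/2.\<close>
  define \<kappa> where "\<kappa> = \<delta> / (2 * p)"
  have \<kappa>: "\<kappa> > 0" using \<delta> p by (simp add: \<kappa>_def)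
  have \<kappa>S: "\<kappa> * measure lborel S \<le> \<delta> / 2"
  proof -
    have "\<kappa> * measure lborel S \<le> \<kappa> * p" using \<kappa> by (intro mult_left_mono) (auto simp: p_def)
    also have "\<dots> = \<delta> / 2" using p by (simp add: \<kappa>_def)
    finally show ?thesis .
  qed
  \<comment> \<open>The accuracy in the square mean that makes the second term integrate to at most
    \<delta>/2.\<close>
  define e2 where "e2 = \<delta> * \<kappa> / (2 * B\<^sup>2)"
  have e2: "e2 > 0" "B\<^sup>2 / \<kappa> * e2 = \<delta> / 2" using \<delta> \<kappa> B(1) by (auto simp: e2_def)
  obtain d1 where d1: "d1 > 0" "\<And>\<epsilon> \<eta>. mollifier \<epsilon> \<eta> \<Longrightarrow> \<epsilon> \<le> d1 \<Longrightarrow> L1 (\<lambda>x. (norm (conv \<eta> u x - u x))\<^sup>2)"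
      "\<And>\<epsilon> \<eta>. mollifier \<epsilon> \<eta> \<Longrightarrow> \<epsilon> \<le> d1 \<Longrightarrow> (LBINT x. (norm (conv \<eta> u x - u x))\<^sup>2) \<le> e2"
    by (rule mollifier_sq_limit[OF ui u2 uoff op bd e2(1)], assumption, rule that) auto
  obtain \<eta> :: "real^'n \<Rightarrow> real" where \<eta>: "mollifier (min d0 d1) \<eta>" using mollifier_exists[of "min d0 d1"] T(1) d1(1) by auto
  have sq: "L1 (\<lambda>x. (norm (conv \<eta> u x - u x))\<^sup>2)" "(LBINT x. (norm (conv \<eta> u x - u x))\<^sup>2) \<le> e2"
    using d1(2,3)[OF \<eta>] by auto
  let ?g = "conv \<eta> u"
  have gC: "(\<lambda>x. ?g x $ i) \<in> Ck_fun (Suc 0)" for i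
    unfolding conv_vec_nth[OF \<eta> ui] by (rule mollifier_conv_Ck[OF \<eta> integrable_component[OF ui]])
  have gcont: "continuous_on UNIV ?g" by (rule conv_continuous[OF mollifierD(7)[OF \<eta>] mollifier_csupp[OF \<eta>] ui])
  define s where "s x = e \<bullet> ?g x - c" for x
  have sC: "s \<in> Ck_fun (Suc 0)"
  proof -
    have "s = (\<lambda>x. (\<Sum>j\<in>UNIV. e $ j * ?g x $ j) - c)" by (auto simp: s_def inner_vec_def)
    then show ?thesis using gC by (simp only:) (intro Ck_fun_diff Ck_fun_sum Ck_fun_cmult Ck_fun_const gC)
  qed
  let ?\<Psi> = "trunc_field e s \<Phi>"
  have \<Psi>: "C1_field ?\<Psi>" by (rule trunc_field_C1[OF sC \<Phi>(1)])
  have \<Psi>off: "?\<Psi> x = 0" if "x \<notin> S" for x by (rule trunc_field_0, rule S(4), rule that)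
  have \<Psi>s: "csupp \<Omega> ?\<Psi>" by (rule csuppI[OF S(1,2) \<Psi>off])
  have \<Psi>i: "L1 ?\<Psi>" by (rule csupp_integrable[OF C1_field_continuous[OF \<Psi>] \<Psi>s])
  have ad2: "adm \<Omega> \<psi> (conv \<eta> a) (conv \<eta> ?\<Psi>)"
  proof (rule admI[OF conv_field(1)[OF \<eta> \<Psi> \<Psi>s] conv_integral(1)[OF \<eta> ai] T(2,4)])
    show "conv \<eta> a x = 0" if "x \<notin> T" for x by (rule conv_csupp[OF \<eta> _ T(5) S(3) that]) auto
    show "conv \<eta> ?\<Psi> x = 0" if "x \<notin> T" for x by (rule conv_csupp[OF \<eta> _ T(5) \<Psi>off that]) auto
    show "conv \<eta> a x + norm (conv \<eta> ?\<Psi> x) * t \<le> \<psi> t" if "t \<ge> 0" for x t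
    proof (rule conv_slope[OF \<eta> ai \<Psi>i _ that])
      show "a x + norm (?\<Psi> x) * t \<le> \<psi> t" for x
        using admD(5)[OF ad that, of x] mult_right_mono[OF trunc_field_norm[OF e, of s \<Phi> x] that] by linarith
    qed
  qed
  have dvi: "L1 (dv ?\<Psi>)" by (rule csupp_integrable[OF dv_continuous[OF \<Psi>] dv_csupp[OF \<Psi>s]])
  have "(LBINT x. a x) - (LBINT x. trunc e c (?g x) \<bullet> dv \<Phi> x)
      = (LBINT x. conv \<eta> a x) - (LBINT x. u x \<bullet> dv (conv \<eta> ?\<Psi>) x)"
    unfolding conv_field(2)[OF \<eta> \<Psi> \<Psi>s] trunc_field_chain[OF gC \<Phi>] conv_integral(2)[OF \<eta> ai]
    using conv_adjoint[OF \<eta> ui dvi] by (simp add: s_def[abs_def])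
  also have "\<dots> \<le> r" by (rule Rfun_upper_real[OF ad2 R])
  finally have 1: "(LBINT x. a x) - (LBINT x. trunc e c (?g x) \<bullet> dv \<Phi> x) \<le> r" .
  note tc = trunc_continuous[of e c]
  have [measurable]: "trunc e c \<in> borel_measurable borel" "?g \<in> borel_measurable borel" "dv \<Phi> \<in> borel_measurable borel"
    using tc gcont admD(7)[OF ad] by (auto intro: cont_borel)
  have i1: "L1 (\<lambda>x. trunc e c (?g x) \<bullet> dv \<Phi> x)"
  proof (rule csupp_integrable)
    show "continuous_on UNIV (\<lambda>x. trunc e c (?g x) \<bullet> dv \<Phi> x)"
      by (intro continuous_on_inner continuous_on_compose2[OF tc gcont] admD(7)[OF ad]) auto
    show "csupp \<Omega> (\<lambda>x. trunc e c (?g x) \<bullet> dv \<Phi> x)" by (rule csuppI[OF S(1,2)]) (simp add: dvoff)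
  qed
  define D where "D x = (trunc e c (?g x) - trunc e c (u x)) \<bullet> dv \<Phi> x" for x
  have Dle: "\<bar>D x\<bar> \<le> \<kappa> * indicator S x + B\<^sup>2 / \<kappa> * (norm (?g x - u x))\<^sup>2" for x
  proof (cases "x \<in> S")
    case True
    let ?n = "norm (?g x - u x)"
    have "\<bar>D x\<bar> \<le> norm (trunc e c (?g x) - trunc e c (u x)) * norm (dv \<Phi> x)"
      unfolding D_def by (rule Cauchy_Schwarz_ineq2)
    also have "\<dots> \<le> (2 * ?n) * B" using trunc_lipschitz[OF e] B by (intro mult_mono) auto
    also have "\<dots> \<le> \<kappa> + B\<^sup>2 / \<kappa> * ?n\<^sup>2"
    proof -
      have "0 \<le> (\<kappa> - B * ?n)\<^sup>2" by simp
      then have "2 * ?n * B * \<kappa> \<le> \<kappa> * \<kappa> + B\<^sup>2 * ?n\<^sup>2" by (simp add: power2_diff power2_eq_square algebra_simps)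
      then show ?thesis using \<kappa> by (simp add: field_simps power2_eq_square)
    qed
    finally show ?thesis using True by simp
  next
    case False
    then show ?thesis using \<kappa> by (simp add: D_def dvoff)
  qed
  have Di: "L1 D"
  proof (rule integrable_bound[of _ "\<lambda>x. \<kappa> * indicator S x + B\<^sup>2 / \<kappa> * (norm (?g x - u x))\<^sup>2"])
    show "AE x in lborel. norm (D x) \<le> norm (\<kappa> * indicator S x + B\<^sup>2 / \<kappa> * (norm (?g x - u x))\<^sup>2)"
      unfolding real_norm_def by (intro AE_I2 order_trans[OF Dle abs_ge_self])
    show "D \<in> borel_measurable lborel" unfolding D_def[abs_def] by measurable
  qed (use iS sq(1) in auto)
  have "(LBINT x. D x) \<le> (LBINT x. \<kappa> * indicator S x + B\<^sup>2 / \<kappa> * (norm (?g x - u x))\<^sup>2)"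
    by (rule integral_mono[OF Di _ abs_le_D1[OF Dle]]) (use iS sq(1) in auto)
  also have "\<dots> = \<kappa> * measure lborel S + B\<^sup>2 / \<kappa> * (LBINT x. (norm (?g x - u x))\<^sup>2)"
    using iS sq(1) by simp
  also have "\<dots> \<le> \<delta> / 2 + B\<^sup>2 / \<kappa> * e2" using \<kappa> by (intro add_mono \<kappa>S mult_left_mono sq(2)) auto
  also have "\<dots> = \<delta>" unfolding e2(2) by simp
  finally have 2: "(LBINT x. D x) \<le> \<delta>" .
  have "(LBINT x. v x \<bullet> dv \<Phi> x) = (LBINT x. trunc e c (?g x) \<bullet> dv \<Phi> x - D x)"
  proof (intro integral_cong refl)
    fix x
    show "v x \<bullet> dv \<Phi> x = trunc e c (?g x) \<bullet> dv \<Phi> x - D x"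
      using dvoff[of x] S(2) by (cases "x \<in> S") (auto simp: v_def D_def inner_diff_left)
  qed
  also have "\<dots> = (LBINT x. trunc e c (?g x) \<bullet> dv \<Phi> x) - (LBINT x. D x)" using i1 Di by simp
  finally show "(LBINT x. a x) - (LBINT x. v x \<bullet> dv \<Phi> x) \<le> r + \<delta>" using 1 2 by linarith
qed

text \<open>The truncated minimizer has no larger energy, and its fidelity drops by at least a
  multiple of the integral of the squared displacement. Minimality forces this integral to vanish,
  while the displacement is positive wherever e \<bullet> u exceeds c.\<close>

lemma minimizer_half_space:
  fixes u f :: "real^'n \<Rightarrow> real^'m"
  assumes op: "open \<Omega>" and bd: "bounded \<Omega>" and f: "f \<in> borel_measurable borel" "L1 (\<lambda>x. (norm (f x))\<^sup>2)"
    "\<And>x. x \<notin> \<Omega> \<Longrightarrow> f x = 0" and lam: "lam > 0"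
    and u: "Xs \<Omega> u" "Fval \<Omega> \<psi> lam f u < \<infinity>" "\<And>w. Xs \<Omega> w \<Longrightarrow> Fval \<Omega> \<psi> lam f u \<le> Fval \<Omega> \<psi> lam f w"
    and e: "norm e = 1" and fe: "AE x in lborel. x \<in> \<Omega> \<longrightarrow> e \<bullet> f x \<le> c"
  shows "AE x in lborel. x \<in> \<Omega> \<longrightarrow> e \<bullet> u x \<le> c"
proof -
  obtain A where A: "A \<ge> 0" "Fval \<Omega> \<psi> lam f u = ennreal A" using u(2) by (metis ennreal_cases infinity_ennreal_def less_irrefl)
  have um[measurable]: "u \<in> borel_measurable borel" by (rule Xs_borel[OF u(1)])
  have fm[measurable]: "f \<in> borel_measurable borel" "\<Omega> \<in> sets borel" using f(1) op by auto
  have ui: "L1 u" and uoff: "\<And>x. x \<notin> \<Omega> \<Longrightarrow> u x = 0" using u(1) by (auto simp: Xs_def)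
  obtain r where r: "r \<ge> 0" "Rfun \<Omega> \<psi> u = ennreal r" "L1 (\<lambda>x. (norm (u x - f x))\<^sup>2)"
    "r + lam / 2 * (LBINT x. (norm (u x - f x))\<^sup>2) \<le> A"
    by (rule Fval_leE[OF _ A(1) lam um f(1), of \<Omega> \<psi>]) (use A(2) in auto)
  have u2: "L1 (\<lambda>x. (norm (u x))\<^sup>2)"
  proof (rule integrable_bound[of _ "\<lambda>x. 2 * (norm (u x - f x))\<^sup>2 + 2 * (norm (f x))\<^sup>2"])
    show "AE x in lborel. norm ((norm (u x))\<^sup>2) \<le> norm (2 * (norm (u x - f x))\<^sup>2 + 2 * (norm (f x))\<^sup>2)"
    proof (rule AE_I2)
      fix x
      have "(norm (u x))\<^sup>2 \<le> (norm (u x - f x) + norm (f x))\<^sup>2"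
        using norm_triangle_ineq[of "u x - f x" "f x"] by (intro power_mono) auto
      then show "norm ((norm (u x))\<^sup>2) \<le> norm (2 * (norm (u x - f x))\<^sup>2 + 2 * (norm (f x))\<^sup>2)"
        using sum_squares_bound[of "norm (u x - f x)" "norm (f x)"] by (simp add: power2_sum)
    qed
  qed (use r(3) f(2) in auto)
  define v where "v x = (if x \<in> \<Omega> then trunc e c (u x) else 0)" for x
  have Rv: "Rfun \<Omega> \<psi> v \<le> ennreal r"
    unfolding v_def[abs_def] using r by (intro Rfun_trunc[OF u(1) u2 op bd e]) auto
  note tc = trunc_continuous[of e c] flat_continuous[of 0]
  have [measurable]: "trunc e c \<in> borel_measurable borel" "flat 0 \<in> borel_measurable borel" using tc by (auto intro: cont_borel)
  have vm[measurable]: "v \<in> borel_measurable borel" unfolding v_def[abs_def] by measurable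
  define q where "q x = indicator \<Omega> x * (flat 0 (e \<bullet> u x - c))\<^sup>2" for x
  have [measurable]: "q \<in> borel_measurable borel" unfolding q_def[abs_def] by measurable
  have q0: "q x \<ge> 0" for x by (simp add: q_def)
  have ae: "AE x in lborel. (norm (v x - f x))\<^sup>2 + q x \<le> (norm (u x - f x))\<^sup>2"
    using fe
  proof eventually_elim
    case (elim x)
    show ?case
    proof (cases "x \<in> \<Omega>")
      case True
      then show ?thesis using trunc_distance[OF e, of "f x" c "u x"] elim by (simp add: v_def q_def)
    next
      case False
      then show ?thesis using uoff f(3) by (simp add: v_def q_def)
    qed
  qed
  have iv: "L1 (\<lambda>x. (norm (v x - f x))\<^sup>2)"
  proof (rule integrable_bound[OF r(3)])
    show "AE x in lborel. norm ((norm (v x - f x))\<^sup>2) \<le> norm ((norm (u x - f x))\<^sup>2)"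
      using ae
    proof eventually_elim
      case (elim x)
      then have "(norm (v x - f x))\<^sup>2 \<le> (norm (u x - f x))\<^sup>2" using q0[of x] by linarith
      then show ?case by (simp only: real_norm_def abs_power2)
    qed
  qed auto
  have iq: "L1 q"
  proof (rule integrable_bound[OF r(3)])
    show "AE x in lborel. norm (q x) \<le> norm ((norm (u x - f x))\<^sup>2)"
      using ae
    proof eventually_elim
      case (elim x)
      then have "q x \<le> (norm (u x - f x))\<^sup>2" using zero_le_power2[of "norm (v x - f x)"] by linarith
      then show ?case using q0[of x] by simp
    qed
  qed auto
  have vi: "L1 v"
  proof (rule integrable_bound[of _ "\<lambda>x. 2 * norm (u x) + norm (trunc e c 0) * indicator \<Omega> x"])
    show "L1 (\<lambda>x. 2 * norm (u x) + norm (trunc e c 0) * indicator \<Omega> x)"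
      using ui emeasure_bounded_finite[OF bd] by (auto simp: less_top)
    show "AE x in lborel. norm (v x) \<le> norm (2 * norm (u x) + norm (trunc e c 0) * indicator \<Omega> x)"
    proof (rule AE_I2)
      fix x
      have "norm (trunc e c (u x)) \<le> 2 * norm (u x) + norm (trunc e c 0)"
        using trunc_lipschitz[OF e, of c "u x" 0] norm_triangle_ineq2[of "trunc e c (u x)" "trunc e c 0"] by simp
      then show "norm (v x) \<le> norm (2 * norm (u x) + norm (trunc e c 0) * indicator \<Omega> x)" by (simp add: v_def)
    qed
  qed auto
  then have Xv: "Xs \<Omega> v" by (simp add: Xs_def v_def)
  have "ennreal A \<le> Fval \<Omega> \<psi> lam f v" using u(3)[OF Xv] A(2) by simp
  also have "\<dots> \<le> ennreal (r + lam / 2 * (LBINT x. (norm (v x - f x))\<^sup>2))"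
    by (rule Fval_leI[OF Rv r(1) lam iv])
  finally have "A \<le> r + lam / 2 * (LBINT x. (norm (v x - f x))\<^sup>2)"
    using r(1) lam by (subst (asm) ennreal_le_iff) (auto intro!: add_nonneg_nonneg mult_nonneg_nonneg integral_nonneg)
  then have "lam / 2 * (LBINT x. (norm (u x - f x))\<^sup>2) \<le> lam / 2 * (LBINT x. (norm (v x - f x))\<^sup>2)" using r(4) by linarith
  then have "(LBINT x. (norm (u x - f x))\<^sup>2) \<le> (LBINT x. (norm (v x - f x))\<^sup>2)" using lam by simp
  moreover have "(LBINT x. (norm (v x - f x))\<^sup>2 + q x) \<le> (LBINT x. (norm (u x - f x))\<^sup>2)"
    by (rule integral_mono_AE[OF _ r(3) ae]) (use iv iq in auto)
  ultimately have "(LBINT x. q x) \<le> 0" using iv iq by simp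
  then have "(LBINT x. q x) = 0" using q0 by (intro antisym) (auto intro: integral_nonneg)
  then have "AE x in lborel. q x = 0" using integral_nonneg_eq_0_iff_AE[OF iq] q0 by simp
  then show ?thesis
  proof eventually_elim
    case (elim x)
    show ?case
    proof
      assume "x \<in> \<Omega>"
      then show "e \<bullet> u x \<le> c" using elim flat_pos[of "e \<bullet> u x - c"] by (force simp: q_def)
    qed
  qed
qed

text \<open>A closed convex set is the intersection of the half-spaces cut out by the projections of the
  points of a countable dense set.\<close>

lemma minimizer_in_convex:
  fixes u f :: "real^'n \<Rightarrow> real^'m"
  assumes K: "closed K" "convex K" "K \<noteq> {}"
    and step: "\<And>e c. norm e = 1 \<Longrightarrow> AE x in lborel. x \<in> \<Omega> \<longrightarrow> e \<bullet> f x \<le> c \<Longrightarrow> AE x in lborel. x \<in> \<Omega> \<longrightarrow> e \<bullet> u x \<le> c"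
    and f: "AE x in lborel. x \<in> \<Omega> \<longrightarrow> f x \<in> K"
  shows "AE x in lborel. x \<in> \<Omega> \<longrightarrow> u x \<in> K"
proof -
  obtain D :: "(real^'m) set" where D: "countable D" "\<And>X. open X \<Longrightarrow> X \<noteq> {} \<Longrightarrow> \<exists>d\<in>D. d \<in> X"
    using countable_dense_exists by metis
  define n where "n y = (1 / norm (y - closest_point K y)) *\<^sub>R (y - closest_point K y)" for y
  define c where "c y = n y \<bullet> closest_point K y" for y
  have half: "norm (n y) = 1 \<and> (\<forall>z\<in>K. n y \<bullet> z \<le> c y)" if "y \<notin> K" for y
  proof -
    have ne: "y - closest_point K y \<noteq> 0" using that closest_point_in_set[OF K(1,3), of y] by auto
    have "n y \<bullet> z \<le> c y" if "z \<in> K" for z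
    proof -
      have "(y - closest_point K y) \<bullet> (z - closest_point K y) \<le> 0" by (rule closest_point_dot[OF K(2,1) that])
      then have "n y \<bullet> (z - closest_point K y) \<le> 0" unfolding n_def by (simp add: divide_nonpos_nonneg)
      then show ?thesis by (simp add: c_def inner_diff_right)
    qed
    then show ?thesis using ne by (simp add: n_def)
  qed
  have "AE x in lborel. \<forall>y\<in>D - K. x \<in> \<Omega> \<longrightarrow> n y \<bullet> u x \<le> c y"
  proof (rule AE_ball_countable[THEN iffD2], rule countable_subset[OF _ D(1)])
    show "\<forall>y\<in>D - K. AE x in lborel. x \<in> \<Omega> \<longrightarrow> n y \<bullet> u x \<le> c y"
    proof
      fix y assume "y \<in> D - K"
      then have h: "norm (n y) = 1" "\<And>z. z \<in> K \<Longrightarrow> n y \<bullet> z \<le> c y" using half by auto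
      show "AE x in lborel. x \<in> \<Omega> \<longrightarrow> n y \<bullet> u x \<le> c y"
        by (rule step[OF h(1)]) (use f h(2) in \<open>auto elim!: eventually_mono\<close>)
    qed
  qed auto
  then show ?thesis
  proof eventually_elim
    case (elim x)
    show ?case
    proof (intro impI, rule ccontr)
      assume x: "x \<in> \<Omega>" and out: "u x \<notin> K"
      have "open (- K)" "u x \<in> - K" using K(1) out by auto
      then obtain \<rho> where \<rho>: "\<rho> > 0" "ball (u x) \<rho> \<subseteq> - K" by (rule openE)
      \<comment> \<open>The point y is at distance more than 2 \<rho>/3 from K and less than
        \<rho>/3 from u x, so the half-space belonging to y excludes u x as well.\<close>
      obtain y where y: "y \<in> D" "y \<in> ball (u x) (\<rho> / 3)" using D(2)[of "ball (u x) (\<rho> / 3)"] \<rho>(1) by auto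
      then have yK: "y \<notin> K" using \<rho> by (auto simp: subset_iff)
      let ?p = "closest_point K y"
      have pK: "?p \<in> K" by (rule closest_point_in_set[OF K(1,3)])
      have "\<rho> \<le> dist (u x) ?p" using pK \<rho>(2) by (force simp: subset_iff)
      also have "\<dots> \<le> dist (u x) y + dist y ?p" by (rule dist_triangle)
      finally have far: "2 * \<rho> / 3 < norm (y - ?p)" using y(2) by (simp add: dist_norm)
      have "n y \<bullet> (y - ?p) = norm (y - ?p)"
        using far \<rho>(1) by (simp add: n_def dot_square_norm power2_eq_square)
      moreover have "\<bar>n y \<bullet> (u x - y)\<bar> \<le> norm (u x - y)"
        using Cauchy_Schwarz_ineq2[of "n y" "u x - y"] half[OF yK] by simp
      moreover have "norm (u x - y) < \<rho> / 3" using y(2) by (simp add: dist_norm)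
      moreover have "n y \<bullet> u x - c y = n y \<bullet> (u x - y) + n y \<bullet> (y - ?p)" by (simp add: c_def inner_diff_right)
      moreover have "n y \<bullet> u x \<le> c y" using elim x y(1) yK by blast
      ultimately show False using far \<rho>(1) by linarith
    qed
  qed
qed

section \<open>Partial smoothing\<close>

text \<open>The kernel of the operator \<open>Aop\<close> is symmetric and has total mass 1, so both the operator and its
  adjoint preserve constants. This is what makes the functional almost decrease.\<close>

definition rho :: "(real^'n \<Rightarrow> real) \<Rightarrow> (real^'n \<Rightarrow> real) \<Rightarrow> real^'n \<Rightarrow> real" where
  "rho \<zeta> \<eta> x = \<zeta> x * conv \<eta> \<zeta> x"

definition Aop :: "(real^'n \<Rightarrow> real) \<Rightarrow> (real^'n \<Rightarrow> real) \<Rightarrow> (real^'n \<Rightarrow> 'b::euclidean_space) \<Rightarrow> real^'n \<Rightarrow> 'b" where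
  "Aop \<zeta> \<eta> w x = (1 - rho \<zeta> \<eta> x) *\<^sub>R w x + \<zeta> x *\<^sub>R conv \<eta> (\<lambda>y. \<zeta> y *\<^sub>R w y) x"

locale smoothing =
  fixes \<Omega> :: "(real^'n) set" and \<zeta> \<eta> :: "real^'n \<Rightarrow> real" and \<epsilon> :: real
  assumes op: "open \<Omega>" and zC: "\<zeta> \<in> Ck_fun (Suc 0)" and zs: "csupp \<Omega> \<zeta>"
    and z01: "\<And>x. 0 \<le> \<zeta> x" "\<And>x. \<zeta> x \<le> 1" and eta: "mollifier \<epsilon> \<eta>"
begin

lemma z_cont: "continuous_on UNIV \<zeta>" using zC Ck_fun_continuous by blast
lemma z_int: "L1 \<zeta>" by (rule csupp_integrable[OF z_cont zs])
lemma z_abs: "\<bar>\<zeta> x\<bar> \<le> 1" using z01[of x] by simp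
lemma z_off: "x \<notin> \<Omega> \<Longrightarrow> \<zeta> x = 0" using zs by (auto simp: csupp_def)
lemma pz_cont: "continuous_on UNIV (pd \<alpha> \<zeta>)" by (rule C1_continuous_partial[OF zC])
lemma scale_int:
  fixes w :: "real^'n \<Rightarrow> 'b::euclidean_space"
  assumes "L1 w" "continuous_on UNIV b" "csupp U b"
  shows "L1 (\<lambda>x. b x *\<^sub>R w x)"
proof -
  obtain B where B: "\<And>x. \<bar>b x\<bar> \<le> B" using csupp_bounded[OF assms(2,3)] by (metis real_norm_def)
  show ?thesis by (rule integrable_bounded_scaleR[OF assms(1) _ B]) (use cont_borel[OF assms(2)] in simp)
qed

lemma zw_int: "L1 w \<Longrightarrow> L1 (\<lambda>x. \<zeta> x *\<^sub>R w x)" for w :: "real^'n \<Rightarrow> 'b::euclidean_space"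
  by (rule scale_int[OF _ z_cont zs])

lemma cz: "conv \<eta> \<zeta> \<in> Ck_fun k" "0 \<le> conv \<eta> \<zeta> x" "conv \<eta> \<zeta> x \<le> 1" "pd \<alpha> (conv \<eta> \<zeta>) = conv \<eta> (pd \<alpha> \<zeta>)"
proof -
  show "conv \<eta> \<zeta> \<in> Ck_fun k" by (rule mollifier_conv_Ck[OF eta z_int])
  have "conv \<eta> \<zeta> x \<in> {0..1}" by (rule mollifier_conv_in_convex[OF eta z_int]) (use z01 in auto)
  then show "0 \<le> conv \<eta> \<zeta> x" "conv \<eta> \<zeta> x \<le> 1" by auto
  show "pd \<alpha> (conv \<eta> \<zeta>) = conv \<eta> (pd \<alpha> \<zeta>)" by (rule mollifier_conv_partial[OF eta zC zs])
qed

abbreviation "\<rho> \<equiv> rho \<zeta> \<eta>"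
abbreviation "A \<equiv> Aop \<zeta> \<eta>"

lemma rho_C1: "\<rho> \<in> Ck_fun (Suc 0)"
  unfolding rho_def[abs_def] by (intro Ck_fun_mult zC cz)

lemma rho_partial: "pd \<alpha> \<rho> x = \<zeta> x * conv \<eta> (pd \<alpha> \<zeta>) x + pd \<alpha> \<zeta> x * conv \<eta> \<zeta> x"
  unfolding rho_def[abs_def] using partial_deriv_mult[OF zC cz(1)[of "Suc 0"], of \<alpha> x] by (simp add: cz(4))

lemma rho_bounds: "0 \<le> \<rho> x" "\<rho> x \<le> 1"
  using z01 cz(2,3) by (auto simp: rho_def intro!: mult_le_one)

lemma rho_supp: "csupp \<Omega> \<rho>" unfolding rho_def[abs_def] by (rule csupp_mult[OF zs])
lemma rho_cont: "continuous_on UNIV \<rho>" using rho_C1 Ck_fun_continuous by blast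

lemma one_rho_C1: "(\<lambda>x. 1 - \<rho> x) \<in> Ck_fun (Suc 0)" by (intro Ck_fun_diff Ck_fun_const rho_C1)
lemma one_rho_abs: "\<bar>1 - \<rho> x\<bar> \<le> 1" using rho_bounds[of x] by simp
lemma one_rho_cont: "continuous_on UNIV (\<lambda>x. 1 - \<rho> x)" using one_rho_C1 Ck_fun_continuous by blast

lemma one_rho_partial: "pd \<alpha> (\<lambda>x. 1 - \<rho> x) x = - pd \<alpha> \<rho> x"
  using partial_deriv_diff[OF Ck_fun_const[of 1 "Suc 0"] rho_C1, where \<alpha> = \<alpha> and x = x] by simp

text \<open>Where this holds, the factor 1 - \<rho> vanishes and w is replaced completely by
  smoothed values; this is how singular mass is removed.\<close>

lemma rho_one:
  assumes "\<And>y. dist x y < \<epsilon> \<Longrightarrow> \<zeta> y = 1"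
  shows "\<rho> x = 1"
proof -
  have "norm (conv \<eta> \<zeta> x - 1) \<le> 0"
    by (rule mollifier_conv_bound[OF eta z_int]) (use assms in auto)
  moreover have "\<zeta> x = 1" using assms[of x] mollifierD(9)[OF eta] by simp
  ultimately show ?thesis by (simp add: rho_def)
qed

lemma A_off: "\<zeta> x = 0 \<Longrightarrow> A w x = w x"
  by (simp add: Aop_def rho_def)

lemma first_int: "L1 w \<Longrightarrow> L1 (\<lambda>x. (1 - \<rho> x) *\<^sub>R w x)" for w :: "real^'n \<Rightarrow> 'b::euclidean_space"
  by (rule integrable_bounded_scaleR[OF _ _ one_rho_abs]) (use cont_borel[OF one_rho_cont] in auto)

lemma second_int: "L1 w \<Longrightarrow> L1 (\<lambda>x. \<zeta> x *\<^sub>R conv \<eta> (\<lambda>y. \<zeta> y *\<^sub>R w y) x)" for w :: "real^'n \<Rightarrow> 'b::euclidean_space"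
  by (intro zw_int conv_integral(1)[OF eta])

lemma A_int: "L1 w \<Longrightarrow> L1 (A w)" for w :: "real^'n \<Rightarrow> 'b::euclidean_space"
  unfolding Aop_def[abs_def] by (intro integrable_add first_int second_int)

lemma A_Xs: "Xs \<Omega> w \<Longrightarrow> Xs \<Omega> (A w)"
  by (auto simp: Xs_def A_off z_off A_int)

lemma conv_cont: "L1 g \<Longrightarrow> continuous_on UNIV (conv \<eta> g)" for g :: "real^'n \<Rightarrow> 'b::euclidean_space"
  by (rule conv_continuous[OF mollifierD(7)[OF eta] mollifier_csupp[OF eta]])

lemma A_adjoint:
  fixes w v :: "real^'n \<Rightarrow> 'b::euclidean_space"
  assumes w: "L1 w" and v: "continuous_on UNIV v" "csupp \<Omega> v"
  shows "(LBINT x. A w x \<bullet> v x) = (LBINT x. w x \<bullet> A v x)"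
proof -
  have vi: "L1 v" by (rule csupp_integrable[OF v])
  have zc: "continuous_on UNIV (\<lambda>x. \<zeta> x *\<^sub>R conv \<eta> (\<lambda>y. \<zeta> y *\<^sub>R v y) x)"
    by (intro continuous_on_scaleR z_cont conv_cont zw_int vi)
  have zsu: "csupp \<Omega> (\<lambda>x. \<zeta> x *\<^sub>R g x)" for g :: "real^'n \<Rightarrow> 'b" using zs by (auto simp: csupp_def)
  have i1: "L1 (\<lambda>x. (1 - \<rho> x) *\<^sub>R (w x \<bullet> v x))" by (intro first_int integrable_inner_csupp[OF w v])
  have i2: "L1 (\<lambda>x. (\<zeta> x *\<^sub>R conv \<eta> (\<lambda>y. \<zeta> y *\<^sub>R w y) x) \<bullet> v x)"
    by (rule integrable_inner_csupp[OF second_int[OF w] v])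
  have i3: "L1 (\<lambda>x. w x \<bullet> (\<zeta> x *\<^sub>R conv \<eta> (\<lambda>y. \<zeta> y *\<^sub>R v y) x))"
    by (rule integrable_inner_csupp[OF w zc zsu])
  have "(LBINT x. (\<zeta> x *\<^sub>R conv \<eta> (\<lambda>y. \<zeta> y *\<^sub>R w y) x) \<bullet> v x) = (LBINT x. conv \<eta> (\<lambda>y. \<zeta> y *\<^sub>R w y) x \<bullet> (\<zeta> x *\<^sub>R v x))"
    by simp
  also have "\<dots> = (LBINT x. (\<zeta> x *\<^sub>R w x) \<bullet> conv \<eta> (\<lambda>y. \<zeta> y *\<^sub>R v y) x)"
    by (rule conv_adjoint[OF eta zw_int[OF w] zw_int[OF vi]])
  finally have e: "(LBINT x. (\<zeta> x *\<^sub>R conv \<eta> (\<lambda>y. \<zeta> y *\<^sub>R w y) x) \<bullet> v x) = (LBINT x. w x \<bullet> (\<zeta> x *\<^sub>R conv \<eta> (\<lambda>y. \<zeta> y *\<^sub>R v y) x))"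
    by simp
  have "(LBINT x. A w x \<bullet> v x) = (LBINT x. (1 - \<rho> x) *\<^sub>R (w x \<bullet> v x)) + (LBINT x. (\<zeta> x *\<^sub>R conv \<eta> (\<lambda>y. \<zeta> y *\<^sub>R w y) x) \<bullet> v x)"
    using integral_add[OF i1 i2] by (simp add: Aop_def inner_add_left)
  also have "\<dots> = (LBINT x. w x \<bullet> A v x)"
    unfolding e using integral_add[OF i1 i3] by (simp add: Aop_def inner_add_right)
  finally show ?thesis .
qed

lemma A_integral:
  fixes a :: "real^'n \<Rightarrow> real"
  assumes a: "L1 a"
  shows "(LBINT x. A a x) = (LBINT x. a x)"
proof -
  have i: "L1 (\<lambda>x. \<rho> x * a x)"
    using scale_int[OF a rho_cont rho_supp] by simp
  have "(LBINT x. \<zeta> x *\<^sub>R conv \<eta> (\<lambda>y. \<zeta> y *\<^sub>R a y) x) = (LBINT x. conv \<eta> (\<lambda>y. \<zeta> y *\<^sub>R a y) x \<bullet> \<zeta> x)"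
    by (simp add: mult.commute)
  also have "\<dots> = (LBINT x. (\<zeta> x *\<^sub>R a x) \<bullet> conv \<eta> \<zeta> x)" by (rule conv_adjoint[OF eta zw_int[OF a] z_int])
  also have "\<dots> = (LBINT x. \<rho> x * a x)" by (simp add: rho_def mult_ac)
  finally have e: "(LBINT x. \<zeta> x *\<^sub>R conv \<eta> (\<lambda>y. \<zeta> y *\<^sub>R a y) x) = (LBINT x. \<rho> x * a x)" .
  have "(LBINT x. A a x) = (LBINT x. (1 - \<rho> x) *\<^sub>R a x) + (LBINT x. \<rho> x * a x)"
    unfolding Aop_def e[symmetric] by (rule integral_add[OF first_int[OF a] second_int[OF a]])
  also have "\<dots> = (LBINT x. a x)" using a i by (simp add: left_diff_distrib)
  finally show ?thesis .
qed

text \<open>The smoothed pair satisfies the constraint with \<psi> t times the convolution of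
  \<zeta>; after multiplication by \<zeta> this is \<rho> \<psi> t, and the factor 1 - \<rho> of the
  original pair completes it to \<psi> t. The unsymmetric choice (1 - \<zeta>) w + \<zeta> conv
  \<eta> w would have an adjoint of mass 1 - \<zeta> + conv \<eta> \<zeta>, which may exceed 1 and
  break the constraint.\<close>

lemma A_adm:
  fixes \<Phi> :: "real^'n \<Rightarrow> real^'m^'n"
  assumes ad: "adm \<Omega> \<psi> a \<Phi>" and psi: "\<And>t. t \<ge> 0 \<Longrightarrow> \<psi> t \<ge> 0"
  shows "adm \<Omega> \<psi> (A a) (A \<Phi>)"
proof -
  note \<Phi> = admD(1,4)[OF ad] and ai = admD(2)[OF ad]
  have pi: "L1 \<Phi>" by (rule csupp_integrable[OF admD(6)[OF ad] \<Phi>(2)])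
  obtain S where S: "compact S" "S \<subseteq> \<Omega>" "\<And>x. x \<notin> S \<Longrightarrow> a x = 0" "\<And>x. x \<notin> S \<Longrightarrow> \<Phi> x = 0"
    using adm_support[OF ad] by metis
  obtain T where T: "compact T" "T \<subseteq> \<Omega>" "\<And>x. x \<notin> T \<Longrightarrow> \<zeta> x = 0" using zs by (auto simp: csupp_def)
  have zP: "C1_field (\<lambda>x. \<zeta> x *\<^sub>R \<Phi> x)" "csupp \<Omega> (\<lambda>x. \<zeta> x *\<^sub>R \<Phi> x)"
    using C1_field_scale[OF zC \<Phi>(1)] zs by (auto simp: csupp_def)
  show ?thesis
  proof (rule admI[of _ _ "S \<union> T"])
    show "C1_field (A \<Phi>)" unfolding Aop_def[abs_def]
      by (intro C1_field_add C1_field_scale one_rho_C1 zC \<Phi>(1) conv_field(1)[OF eta zP])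
    show "L1 (A a)" by (rule A_int[OF ai])
    show "A a x = 0" "A \<Phi> x = 0" if "x \<notin> S \<union> T" for x using that by (auto simp: S(3,4) T(3) A_off)
    fix x t assume t: "(t::real) \<ge> 0"
    let ?za = "\<lambda>y. \<zeta> y *\<^sub>R a y" and ?zP = "\<lambda>y. \<zeta> y *\<^sub>R \<Phi> y"
    have "conv \<eta> ?za x + norm (conv \<eta> ?zP x) * t \<le> conv \<eta> ?za x + conv \<eta> (\<lambda>y. norm (?zP y)) x * t"
      by (intro add_left_mono mult_right_mono conv_norm_le[OF eta] t)
    also have "\<dots> = (LBINT y. \<eta> (x - y) * (?za y + norm (?zP y) * t))"
      unfolding conv_def using mollifier_conv_integrable[OF eta zw_int[OF ai], of x] mollifier_conv_integrable[OF eta integrable_norm[OF zw_int[OF pi]], of x]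
      by (simp add: distrib_left mult.assoc[symmetric])
    also have "\<dots> \<le> (LBINT y. \<psi> t * (\<eta> (x - y) *\<^sub>R \<zeta> y))"
    proof (rule integral_mono)
      have "L1 (\<lambda>y. ?za y + norm (?zP y) * t)" using zw_int[OF ai] integrable_norm[OF zw_int[OF pi]] by auto
      from mollifier_conv_integrable[OF eta this] show "L1 (\<lambda>y. \<eta> (x - y) * (?za y + norm (?zP y) * t))" by simp
      show "L1 (\<lambda>y. \<psi> t * (\<eta> (x - y) *\<^sub>R \<zeta> y))" using mollifier_conv_integrable[OF eta z_int, of x] by simp
      fix y
      have "?za y + norm (?zP y) * t = \<zeta> y * (a y + norm (\<Phi> y) * t)" using z01[of y] by (simp add: algebra_simps)
      also have "\<dots> \<le> \<zeta> y * \<psi> t" using admD(5)[OF ad t, of y] z01 by (intro mult_left_mono) auto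
      finally have "\<eta> (x - y) * (?za y + norm (?zP y) * t) \<le> \<eta> (x - y) * (\<zeta> y * \<psi> t)"
        using mollifierD(2)[OF eta] by (rule mult_left_mono)
      then show "\<eta> (x - y) * (?za y + norm (?zP y) * t) \<le> \<psi> t * (\<eta> (x - y) *\<^sub>R \<zeta> y)" by (simp add: mult_ac)
    qed
    also have "\<dots> = \<psi> t * conv \<eta> \<zeta> x" by (simp add: conv_def)
    finally have c: "conv \<eta> ?za x + norm (conv \<eta> ?zP x) * t \<le> \<psi> t * conv \<eta> \<zeta> x" .
    have "norm (A \<Phi> x) \<le> (1 - \<rho> x) * norm (\<Phi> x) + \<zeta> x * norm (conv \<eta> ?zP x)"
      unfolding Aop_def using rho_bounds[of x] z01[of x] by (intro norm_triangle_le) simp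
    then have "norm (A \<Phi> x) * t \<le> ((1 - \<rho> x) * norm (\<Phi> x) + \<zeta> x * norm (conv \<eta> ?zP x)) * t" using t by (rule mult_right_mono)
    then have "A a x + norm (A \<Phi> x) * t \<le> (1 - \<rho> x) * (a x + norm (\<Phi> x) * t) + \<zeta> x * (conv \<eta> ?za x + norm (conv \<eta> ?zP x) * t)"
      unfolding Aop_def[of \<zeta> \<eta> a] by (simp add: algebra_simps)
    also have "\<dots> \<le> (1 - \<rho> x) * \<psi> t + \<zeta> x * (\<psi> t * conv \<eta> \<zeta> x)"
      using admD(5)[OF ad t, of x] c rho_bounds[of x] z01[of x] by (intro add_mono mult_left_mono) auto
    also have "\<dots> = \<psi> t" by (simp add: rho_def algebra_simps)
    finally show "A a x + norm (A \<Phi> x) * t \<le> \<psi> t" .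
  qed (use S T in \<open>auto intro: compact_Un\<close>)
qed

section \<open>Commutator of the smoothing with differentiation\<close>

text \<open>This is the average of b(y) (w(y) - w(x)) with the weights
  \<open>\<eta> (x - y)\<close>. Only differences of w enter, so it is small wherever the
  oscillation is.\<close>

definition "defect w b x = conv \<eta> (\<lambda>y. b y *\<^sub>R w y) x - conv \<eta> b x *\<^sub>R w x"

text \<open>The terms of the product rule in which the derivative falls on the cutoff. By
  \<open>Cw_eq\<close> the zeroth order contributions combine with the derivative of \<rho>, so that
  only defects remain.\<close>

definition "Cw w \<alpha> x = pd \<alpha> \<zeta> x *\<^sub>R defect w \<zeta> x + \<zeta> x *\<^sub>R defect w (pd \<alpha> \<zeta>) x"

lemma A_defect: "A w x - w x = \<zeta> x *\<^sub>R defect w \<zeta> x"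
  by (simp add: Aop_def rho_def defect_def algebra_simps)

lemma Cw_eq: "Cw w \<alpha> x = pd \<alpha> \<zeta> x *\<^sub>R conv \<eta> (\<lambda>y. \<zeta> y *\<^sub>R w y) x
    + \<zeta> x *\<^sub>R conv \<eta> (\<lambda>y. pd \<alpha> \<zeta> y *\<^sub>R w y) x - pd \<alpha> \<rho> x *\<^sub>R w x"
  by (simp add: Cw_def defect_def rho_partial algebra_simps)

lemma Cw_int: "L1 w \<Longrightarrow> L1 (Cw w \<alpha>)" for w :: "real^'n \<Rightarrow> 'b::euclidean_space"
  unfolding Cw_eq[abs_def]
  by (intro integrable_add integrable_diff
      scale_int[OF _ pz_cont csupp_partial_deriv[OF zs]] scale_int[OF _ z_cont zs]
      scale_int[OF _ C1_continuous_partial[OF rho_C1] csupp_partial_deriv[OF rho_supp]] conv_integral(1)[OF eta])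

text \<open>Convolution commutes with differentiation, so the two operations fail to commute only
  through derivatives of \<zeta> and \<rho>. These terms are carried over to w by self-adjointness;
  no derivative of \<eta>, which would blow up with the scale, appears.\<close>

lemma A_commutator:
  fixes w :: "real^'n \<Rightarrow> real^'m"
  assumes w: "L1 w" and \<Phi>: "C1_field \<Phi>" "csupp \<Omega> \<Phi>"
  shows "(LBINT x. A w x \<bullet> dv \<Phi> x) = (LBINT x. w x \<bullet> dv (A \<Phi>) x) - (\<Sum>\<alpha>\<in>UNIV. LBINT x. Cw w \<alpha> x \<bullet> \<Phi> x $ \<alpha>)"
proof -
  have pc: "continuous_on UNIV \<Phi>" by (rule C1_field_continuous[OF \<Phi>(1)])
  have pi: "L1 \<Phi>" by (rule csupp_integrable[OF pc \<Phi>(2)])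
  have dc: "continuous_on UNIV (dv \<Phi>)" "csupp \<Omega> (dv \<Phi>)" using dv_continuous[OF \<Phi>(1)] dv_csupp[OF \<Phi>(2)] .
  have di: "L1 (dv \<Phi>)" by (rule csupp_integrable[OF dc])
  have zP: "C1_field (\<lambda>x. \<zeta> x *\<^sub>R \<Phi> x)" "csupp \<Omega> (\<lambda>x. \<zeta> x *\<^sub>R \<Phi> x)"
    using C1_field_scale[OF zC \<Phi>(1)] zs by (auto simp: csupp_def)
  have zPi: "L1 (\<lambda>x. \<zeta> x *\<^sub>R \<Phi> x)" by (rule zw_int[OF pi])
  have rc: "continuous_on UNIV (\<lambda>x. \<Phi> x $ \<alpha>)" "csupp \<Omega> (\<lambda>x. \<Phi> x $ \<alpha>)" for \<alpha>
    using \<Phi>(2) by (auto intro!: continuous_on_component pc simp: csupp_def)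
  have ri: "L1 (\<lambda>x. \<Phi> x $ \<alpha>)" for \<alpha> by (rule csupp_integrable[OF rc])
  let ?d = "\<lambda>\<alpha>. pd \<alpha> \<zeta>"
  let ?a = "\<lambda>\<alpha> x. \<zeta> x *\<^sub>R conv \<eta> (\<lambda>y. ?d \<alpha> y *\<^sub>R \<Phi> y $ \<alpha>) x"
  let ?b = "\<lambda>\<alpha> x. ?d \<alpha> x *\<^sub>R conv \<eta> (\<lambda>x. \<zeta> x *\<^sub>R \<Phi> x $ \<alpha>) x"
  let ?c = "\<lambda>\<alpha> x. pd \<alpha> \<rho> x *\<^sub>R \<Phi> x $ \<alpha>"
  let ?p = "\<lambda>\<alpha> x. ?d \<alpha> x *\<^sub>R conv \<eta> (\<lambda>y. \<zeta> y *\<^sub>R w y) x"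
  let ?q = "\<lambda>\<alpha> x. \<zeta> x *\<^sub>R conv \<eta> (\<lambda>y. ?d \<alpha> y *\<^sub>R w y) x"
  have dri: "L1 (\<lambda>x. ?d \<alpha> x *\<^sub>R \<Phi> x $ \<alpha>)" for \<alpha>
    by (rule scale_int[OF ri pz_cont csupp_partial_deriv[OF zs]])
  define X where "X x = (\<Sum>\<alpha>\<in>UNIV. ?d \<alpha> x *\<^sub>R \<Phi> x $ \<alpha>)" for x
  have Xi: "L1 X" unfolding X_def[abs_def] by (intro integrable_sum dri)
  have conv_row: "conv \<eta> (\<lambda>x. \<zeta> x *\<^sub>R \<Phi> x) x $ \<alpha> = conv \<eta> (\<lambda>x. \<zeta> x *\<^sub>R \<Phi> x $ \<alpha>) x" for x \<alpha>
    using conv_component[OF eta zPi bounded_linear_vec_nth] by simp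
  have convX: "conv \<eta> X x = (\<Sum>\<alpha>\<in>UNIV. conv \<eta> (\<lambda>y. ?d \<alpha> y *\<^sub>R \<Phi> y $ \<alpha>) x)" for x
    unfolding X_def conv_def using mollifier_conv_integrable[OF eta dri]
    by (simp add: scaleR_sum_right integral_sum)
  have dvz: "dv (\<lambda>x. \<zeta> x *\<^sub>R \<Phi> x) = (\<lambda>x. \<zeta> x *\<^sub>R dv \<Phi> x + X x)"
    unfolding X_def by (rule ext) (rule dv_scale[OF zC \<Phi>(1)])
  have conv_dvz: "conv \<eta> (dv (\<lambda>x. \<zeta> x *\<^sub>R \<Phi> x)) x = conv \<eta> (\<lambda>x. \<zeta> x *\<^sub>R dv \<Phi> x) x + conv \<eta> X x" for x
    unfolding dvz conv_def using mollifier_conv_integrable[OF eta zw_int[OF di], of x] mollifier_conv_integrable[OF eta Xi, of x]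
    by (simp add: scaleR_add_right)
  have dvA: "dv (A \<Phi>) x = A (dv \<Phi>) x + (\<Sum>\<alpha>\<in>UNIV. ?a \<alpha> x
      + ?b \<alpha> x - ?c \<alpha> x)" for x
  proof -
    have "dv (A \<Phi>) x = dv (\<lambda>x. (1 - \<rho> x) *\<^sub>R \<Phi> x) x + dv (\<lambda>x. \<zeta> x *\<^sub>R conv \<eta> (\<lambda>x. \<zeta> x *\<^sub>R \<Phi> x) x) x"
      unfolding Aop_def[abs_def] by (intro dv_add C1_field_scale one_rho_C1 zC \<Phi>(1) conv_field(1)[OF eta zP])
    also have "dv (\<lambda>x. (1 - \<rho> x) *\<^sub>R \<Phi> x) x = (1 - \<rho> x) *\<^sub>R dv \<Phi> x - (\<Sum>\<alpha>\<in>UNIV. ?c \<alpha> x)"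
      unfolding dv_scale[OF one_rho_C1 \<Phi>(1)] one_rho_partial by (simp add: sum_negf)
    also have "dv (\<lambda>x. \<zeta> x *\<^sub>R conv \<eta> (\<lambda>x. \<zeta> x *\<^sub>R \<Phi> x) x) x
        = \<zeta> x *\<^sub>R (conv \<eta> (\<lambda>x. \<zeta> x *\<^sub>R dv \<Phi> x) x + conv \<eta> X x) + (\<Sum>\<alpha>\<in>UNIV. ?b \<alpha> x)"
      unfolding dv_scale[OF zC conv_field(1)[OF eta zP]] conv_field(2)[OF eta zP] conv_dvz conv_row ..
    finally show ?thesis
      by (simp add: Aop_def[of \<zeta> \<eta> "dv \<Phi>"] convX scaleR_add_right scaleR_sum_right sum.distrib sum_subtractf)
  qed
  have zsu: "csupp \<Omega> (\<lambda>x. \<zeta> x *\<^sub>R g x)" for g :: "real^'n \<Rightarrow> real^'m" using zs by (auto simp: csupp_def)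
  have dsu: "csupp \<Omega> (\<lambda>x. ?d \<alpha> x *\<^sub>R g x)" for g :: "real^'n \<Rightarrow> real^'m" and \<alpha>
    using csupp_partial_deriv[OF zs, of \<alpha>] by (auto simp: csupp_def)
  have rsu: "csupp \<Omega> (\<lambda>x. pd \<alpha> \<rho> x *\<^sub>R g x)" for g :: "real^'n \<Rightarrow> real^'m" and \<alpha>
    using csupp_partial_deriv[OF rho_supp, of \<alpha>] by (auto simp: csupp_def)
  have j1: "L1 (\<lambda>x. w x \<bullet> ?a \<alpha> x)" for \<alpha>
    by (rule integrable_inner_csupp[OF w _ zsu]) (intro continuous_on_scaleR z_cont conv_cont dri)
  have j2: "L1 (\<lambda>x. w x \<bullet> ?b \<alpha> x)" for \<alpha>
    by (rule integrable_inner_csupp[OF w _ dsu]) (intro continuous_on_scaleR pz_cont conv_cont zw_int ri)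
  have j3: "L1 (\<lambda>x. w x \<bullet> ?c \<alpha> x)" for \<alpha>
    by (rule integrable_inner_csupp[OF w _ rsu]) (intro continuous_on_scaleR C1_continuous_partial[OF rho_C1] rc)
  have dwi: "L1 (\<lambda>y. ?d \<alpha> y *\<^sub>R w y)" for \<alpha> by (rule scale_int[OF w pz_cont csupp_partial_deriv[OF zs]])
  have k1: "L1 (\<lambda>x. ?p \<alpha> x \<bullet> \<Phi> x $ \<alpha>)" for \<alpha>
    by (rule integrable_inner_csupp[OF _ rc]) (intro scale_int[OF _ pz_cont csupp_partial_deriv[OF zs]] conv_integral(1)[OF eta] zw_int w)
  have k2: "L1 (\<lambda>x. ?q \<alpha> x \<bullet> \<Phi> x $ \<alpha>)" for \<alpha>
    by (rule integrable_inner_csupp[OF _ rc]) (intro zw_int conv_integral(1)[OF eta] dwi)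
  have t1: "(LBINT x. w x \<bullet> ?a \<alpha> x)
      = (LBINT x. ?p \<alpha> x \<bullet> \<Phi> x $ \<alpha>)" for \<alpha>
    using conv_adjoint[OF eta zw_int[OF w] dri[of \<alpha>]] by simp
  have t2: "(LBINT x. w x \<bullet> ?b \<alpha> x)
      = (LBINT x. ?q \<alpha> x \<bullet> \<Phi> x $ \<alpha>)" for \<alpha>
    using conv_adjoint[OF eta dwi[of \<alpha>] zw_int[OF ri[of \<alpha>]]] by simp
  have row: "(LBINT x. w x \<bullet> (?a \<alpha> x
      + ?b \<alpha> x - ?c \<alpha> x))
      = (LBINT x. Cw w \<alpha> x \<bullet> \<Phi> x $ \<alpha>)" for \<alpha>
  proof -
    have "(LBINT x. w x \<bullet> (?a \<alpha> x
      + ?b \<alpha> x - ?c \<alpha> x))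
      = (LBINT x. w x \<bullet> ?a \<alpha> x)
      + (LBINT x. w x \<bullet> ?b \<alpha> x) - (LBINT x. w x \<bullet> ?c \<alpha> x)"
      unfolding inner_add_right inner_diff_right
      by (subst integral_diff[OF integrable_add[OF j1 j2] j3], subst integral_add[OF j1 j2]) simp
    also have "\<dots> = (LBINT x. Cw w \<alpha> x \<bullet> \<Phi> x $ \<alpha>)"
    proof -
      have j3': "L1 (\<lambda>x. (pd \<alpha> \<rho> x *\<^sub>R w x) \<bullet> \<Phi> x $ \<alpha>)" using j3[of \<alpha>] by simp
      have "(LBINT x. Cw w \<alpha> x \<bullet> \<Phi> x $ \<alpha>)
        = (LBINT x. ?p \<alpha> x \<bullet> \<Phi> x $ \<alpha>)
        + (LBINT x. ?q \<alpha> x \<bullet> \<Phi> x $ \<alpha>) - (LBINT x. (pd \<alpha> \<rho> x *\<^sub>R w x) \<bullet> \<Phi> x $ \<alpha>)"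
        unfolding Cw_eq inner_add_left inner_diff_left
        by (subst integral_diff[OF integrable_add[OF k1 k2] j3'], subst integral_add[OF k1 k2]) simp
      then show ?thesis unfolding t1 t2 by simp
    qed
    finally show ?thesis .
  qed
  have rowi: "L1 (\<lambda>x. w x \<bullet> (?a \<alpha> x
      + ?b \<alpha> x - ?c \<alpha> x))" for \<alpha>
    unfolding inner_add_right inner_diff_right
    by (intro integrable_diff integrable_add j1 j2 j3)
  have Adi: "L1 (\<lambda>x. w x \<bullet> A (dv \<Phi>) x)"
  proof (rule integrable_inner_csupp[OF w])
    show "continuous_on UNIV (A (dv \<Phi>))" unfolding Aop_def[abs_def]
      by (intro continuous_on_add continuous_on_scaleR one_rho_cont z_cont dc(1) conv_cont zw_int di)
    show "csupp \<Omega> (A (dv \<Phi>))" unfolding Aop_def[abs_def]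
      using dc(2) by (intro csupp_add zsu) (auto simp: csupp_def)
  qed
  have "(LBINT x. w x \<bullet> dv (A \<Phi>) x) = (LBINT x. w x \<bullet> A (dv \<Phi>) x) + (\<Sum>\<alpha>\<in>UNIV. LBINT x. Cw w \<alpha> x \<bullet> \<Phi> x $ \<alpha>)"
    unfolding dvA inner_add_right inner_sum_right row[symmetric] using Adi rowi
    by (subst integral_add) (auto simp: integral_sum)
  then show ?thesis unfolding A_adjoint[OF w dc] by simp
qed

lemma defect_sq:
  fixes w :: "real^'n \<Rightarrow> 'b::euclidean_space"
  assumes w: "L1 w" and b: "continuous_on UNIV b" "csupp U b" "\<And>x. \<bar>b x\<bar> \<le> B"
  shows "ennreal ((norm (defect w b x))\<^sup>2) \<le> ennreal (B\<^sup>2) * oscillation \<eta> w x"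
proof -
  have [measurable]: "w \<in> borel_measurable borel" "b \<in> borel_measurable borel" "\<eta> \<in> borel_measurable borel"
    using w cont_borel[OF b(1)] mollifierD(8)[OF eta] by auto
  have bi: "L1 b" by (rule csupp_integrable[OF b(1,2)])
  have bwi: "L1 (\<lambda>y. b y *\<^sub>R w y)" by (rule scale_int[OF w b(1,2)])
  have i1: "L1 (\<lambda>y. \<eta> (x - y) *\<^sub>R (b y *\<^sub>R w y))" by (rule mollifier_conv_integrable[OF eta bwi])
  have i2: "L1 (\<lambda>y. (\<eta> (x - y) *\<^sub>R b y) *\<^sub>R w x)"
    using mollifier_conv_integrable[OF eta bi, of x] by (rule integrable_scaleR_left)
  have e: "\<eta> (x - y) *\<^sub>R (b y *\<^sub>R (w y - w x)) = \<eta> (x - y) *\<^sub>R (b y *\<^sub>R w y) - (\<eta> (x - y) *\<^sub>R b y) *\<^sub>R w x" for y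
    by (simp add: algebra_simps)
  have d: "defect w b x = (LBINT y. \<eta> (x - y) *\<^sub>R (b y *\<^sub>R (w y - w x)))"
    unfolding e defect_def conv_def
    by (subst integral_diff[OF i1 i2], subst integral_scaleR_left[OF mollifier_conv_integrable[OF eta bi]]) simp
  have "ennreal ((norm (defect w b x))\<^sup>2) \<le> (\<integral>\<^sup>+y. ennreal (\<eta> (x - y) * (norm (b y *\<^sub>R (w y - w x)))\<^sup>2) \<partial>lborel)"
    unfolding d by (rule mollifier_sq_mean[OF eta]) (use i1 i2 in \<open>auto simp only: e intro!: integrable_diff\<close>, measurable)
  also have "\<dots> \<le> (\<integral>\<^sup>+y. ennreal (B\<^sup>2) * ennreal (\<eta> (x - y) * (norm (w y - w x))\<^sup>2) \<partial>lborel)"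
  proof (rule nn_integral_mono)
    fix y
    have "(b y)\<^sup>2 \<le> B\<^sup>2" using b(3)[of y] by (metis abs_ge_zero order_trans power2_abs power_mono)
    then have "(norm (b y *\<^sub>R (w y - w x)))\<^sup>2 \<le> B\<^sup>2 * (norm (w y - w x))\<^sup>2" by (simp add: power_mult_distrib mult_right_mono)
    then have "\<eta> (x - y) * (norm (b y *\<^sub>R (w y - w x)))\<^sup>2 \<le> B\<^sup>2 * (\<eta> (x - y) * (norm (w y - w x))\<^sup>2)"
      using mult_left_mono[OF _ mollifierD(2)[OF eta, of "x - y"]] by (fastforce simp: mult_ac)
    then show "ennreal (\<eta> (x - y) * (norm (b y *\<^sub>R (w y - w x)))\<^sup>2) \<le> ennreal (B\<^sup>2) * ennreal (\<eta> (x - y) * (norm (w y - w x))\<^sup>2)"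
      using mollifierD(2)[OF eta, of "x - y"] by (simp add: ennreal_mult[symmetric] ennreal_leI)
  qed
  also have "\<dots> = ennreal (B\<^sup>2) * oscillation \<eta> w x"
    by (rule nn_integral_cmult) measurable
  finally show ?thesis .
qed

lemma A_sq_bound:
  fixes w :: "real^'n \<Rightarrow> 'b::euclidean_space"
  assumes w: "L1 w"
    and osc: "(\<integral>\<^sup>+x. oscillation \<eta> w x \<partial>lborel) \<le> ennreal e" and e: "e \<ge> 0"
  shows "L1 (\<lambda>x. (norm (A w x - w x))\<^sup>2)" "(LBINT x. (norm (A w x - w x))\<^sup>2) \<le> e"
proof -
  have [measurable]: "w \<in> borel_measurable borel" "A w \<in> borel_measurable borel" using w A_int[OF w] by auto
  have "(\<integral>\<^sup>+x. ennreal ((norm (A w x - w x))\<^sup>2) \<partial>lborel) \<le> (\<integral>\<^sup>+x. oscillation \<eta> w x \<partial>lborel)"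
  proof (rule nn_integral_mono)
    fix x
    have "(norm (A w x - w x))\<^sup>2 \<le> 1 * (norm (defect w \<zeta> x))\<^sup>2"
      unfolding A_defect norm_scaleR power_mult_distrib using z_abs[of x] by (intro mult_right_mono) (auto simp: power_le_one_iff abs_square_le_1)
    then have "ennreal ((norm (A w x - w x))\<^sup>2) \<le> ennreal ((norm (defect w \<zeta> x))\<^sup>2)" by (simp add: ennreal_leI)
    also have "\<dots> \<le> ennreal (1\<^sup>2) * oscillation \<eta> w x"
      by (rule defect_sq[OF w z_cont zs z_abs])
    finally show "ennreal ((norm (A w x - w x))\<^sup>2) \<le> oscillation \<eta> w x" by simp
  qed
  also have "\<dots> \<le> ennreal e" by (rule osc)
  finally have le: "(\<integral>\<^sup>+x. ennreal ((norm (A w x - w x))\<^sup>2) \<partial>lborel) \<le> ennreal e" .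
  then show i: "L1 (\<lambda>x. (norm (A w x - w x))\<^sup>2)"
    by (auto simp: integrable_iff_bounded intro: le_less_trans)
  then have "ennreal (LBINT x. (norm (A w x - w x))\<^sup>2) \<le> ennreal e"
    using le by (subst (asm) nn_integral_eq_integral) auto
  then show "(LBINT x. (norm (A w x - w x))\<^sup>2) \<le> e" using e by simp
qed

text \<open>A bound in the mean is obtained from the oscillation, a square mean quantity, at the
  price of \<kappa> times the measure of S; \<kappa> is fixed before the mollification
  scale.\<close>

lemma Cw_bound:
  fixes w :: "real^'n \<Rightarrow> 'b::euclidean_space"
  assumes w: "L1 w"
    and osc: "(\<integral>\<^sup>+x. oscillation \<eta> w x \<partial>lborel) \<le> ennreal e" and e: "e \<ge> 0"
    and B: "B \<ge> 1" "\<And>x. \<bar>pd \<alpha> \<zeta> x\<bar> \<le> B" and \<kappa>: "\<kappa> > 0"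
    and S: "compact S" "\<And>x. x \<notin> S \<Longrightarrow> \<zeta> x = 0"
  shows "(LBINT x. norm (Cw w \<alpha> x)) \<le> 2 * B * \<kappa> * measure lborel S + 2 * B\<^sup>2 / \<kappa> * e"
proof -
  have wm[measurable]: "w \<in> borel_measurable borel" "\<eta> \<in> borel_measurable borel" "S \<in> sets borel"
    using w mollifierD(8)[OF eta] S(1) by (auto simp: borel_compact)
  let ?o = "oscillation \<eta> w"
  have pw: "ennreal (norm (Cw w \<alpha> x)) \<le> ennreal (2 * B * \<kappa>) * indicator S x + ennreal (2 * B\<^sup>2 / \<kappa>) * ?o x" for x
  proof (cases "x \<in> S")
    case False
    have "pd \<alpha> \<zeta> x = 0" by (rule partial_deriv_zero_off[OF compact_imp_closed[OF S(1)] S(2) False])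
    then show ?thesis using S(2)[OF False] by (simp add: Cw_def)
  next
    case True
    let ?p = "norm (defect w \<zeta> x)" and ?q = "norm (defect w (pd \<alpha> \<zeta>) x)"
    \<comment> \<open>Young's inequality in a crude form; it turns the norm of a defect into its
      square.\<close>
    have am: "t \<le> \<kappa> + t\<^sup>2 / \<kappa>" if "t \<ge> 0" for t :: real
    proof -
      have "0 \<le> (t - \<kappa>)\<^sup>2 + t * \<kappa>" using that \<kappa> by simp
      then have "t * \<kappa> \<le> \<kappa>\<^sup>2 + t\<^sup>2" by (simp add: power2_diff mult.commute add.commute)
      then show ?thesis using \<kappa> by (simp add: field_simps power2_eq_square)
    qed
    have "norm (Cw w \<alpha> x) \<le> \<bar>pd \<alpha> \<zeta> x\<bar> * ?p + \<bar>\<zeta> x\<bar> * ?q"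
      unfolding Cw_def by (intro norm_triangle_le) simp
    also have "\<dots> \<le> B * ?p + 1 * ?q" by (intro add_mono mult_right_mono B z_abs) auto
    also have "\<dots> \<le> B * (\<kappa> + ?p\<^sup>2 / \<kappa>) + (\<kappa> + ?q\<^sup>2 / \<kappa>)" using B by (intro add_mono mult_left_mono) (auto intro: am order_trans[OF am])
    also have "\<dots> \<le> 2 * B * \<kappa> + (B * ?p\<^sup>2 / \<kappa> + ?q\<^sup>2 / \<kappa>)"
      using mult_right_mono[of 1 B \<kappa>] B \<kappa> by (simp add: algebra_simps)
    finally have "ennreal (norm (Cw w \<alpha> x)) \<le> ennreal (2 * B * \<kappa> + (B * ?p\<^sup>2 / \<kappa> + ?q\<^sup>2 / \<kappa>))" by (rule ennreal_leI)
    also have "\<dots> = ennreal (2 * B * \<kappa>) + (ennreal (B / \<kappa>) * ennreal (?p\<^sup>2) + ennreal (1 / \<kappa>) * ennreal (?q\<^sup>2))"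
      using B \<kappa> by (simp add: ennreal_mult[symmetric])
    also have "\<dots> \<le> ennreal (2 * B * \<kappa>) + (ennreal (B / \<kappa>) * (ennreal (1\<^sup>2) * ?o x) + ennreal (1 / \<kappa>) * (ennreal (B\<^sup>2) * ?o x))"
      by (intro add_left_mono add_mono mult_left_mono defect_sq[OF w z_cont zs z_abs]
          defect_sq[OF w pz_cont csupp_partial_deriv[OF zs] B(2)]) auto
    also have "\<dots> = ennreal (2 * B * \<kappa>) + (ennreal (B / \<kappa>) + ennreal (B\<^sup>2 / \<kappa>)) * ?o x"
      using B \<kappa> by (simp add: distrib_right mult.assoc[symmetric] ennreal_mult[symmetric])
    also have "\<dots> \<le> ennreal (2 * B * \<kappa>) + ennreal (2 * B\<^sup>2 / \<kappa>) * ?o x"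
    proof (intro add_left_mono mult_right_mono)
      have "B \<le> B\<^sup>2" using B by (simp add: power2_eq_square)
      then have "B / \<kappa> + B\<^sup>2 / \<kappa> \<le> 2 * B\<^sup>2 / \<kappa>" using \<kappa> by (simp add: divide_simps)
      then show "ennreal (B / \<kappa>) + ennreal (B\<^sup>2 / \<kappa>) \<le> ennreal (2 * B\<^sup>2 / \<kappa>)"
        by (subst ennreal_plus[symmetric]) (use B \<kappa> in \<open>auto intro!: ennreal_leI simp del: ennreal_plus\<close>)
    qed simp
    finally show ?thesis using True by simp
  qed
  have Ci: "L1 (Cw w \<alpha>)" by (rule Cw_int[OF w])
  have eS: "emeasure lborel S = ennreal (measure lborel S)" using emeasure_compact_finite[OF S(1)] by (simp add: emeasure_eq_ennreal_measure)
  have "ennreal (LBINT x. norm (Cw w \<alpha> x)) = (\<integral>\<^sup>+x. ennreal (norm (Cw w \<alpha> x)) \<partial>lborel)"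
    by (rule nn_integral_eq_integral[symmetric]) (use Ci in auto)
  also have "\<dots> \<le> (\<integral>\<^sup>+x. ennreal (2 * B * \<kappa>) * indicator S x + ennreal (2 * B\<^sup>2 / \<kappa>) * ?o x \<partial>lborel)"
    by (intro nn_integral_mono pw)
  also have "\<dots> = ennreal (2 * B * \<kappa>) * emeasure lborel S + ennreal (2 * B\<^sup>2 / \<kappa>) * (\<integral>\<^sup>+x. ?o x \<partial>lborel)"
    by (subst nn_integral_add) (auto simp: nn_integral_cmult nn_integral_cmult_indicator)
  also have "\<dots> \<le> ennreal (2 * B * \<kappa>) * ennreal (measure lborel S) + ennreal (2 * B\<^sup>2 / \<kappa>) * ennreal e"
    unfolding eS by (intro add_left_mono mult_left_mono osc) auto
  also have "\<dots> = ennreal (2 * B * \<kappa> * measure lborel S + 2 * B\<^sup>2 / \<kappa> * e)"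
    using B \<kappa> e by (simp add: ennreal_mult[symmetric] ennreal_plus[symmetric] del: ennreal_plus)
  finally show ?thesis using B \<kappa> e by (subst (asm) ennreal_le_iff) auto
qed

end

section \<open>Approximation by functions without singular part\<close>

text \<open>The indicator of the 2d/3-neighbourhood of K is mollified at scale d/3: the result is 1
  up to distance d/3 from K and 0 beyond distance d.\<close>

lemma cutoff_exists:
  fixes K :: "(real^'n) set"
  assumes K: "compact K" "K \<subseteq> V" "open V"
  obtains \<zeta> d where "d > 0" "\<zeta> \<in> Ck_fun (Suc 0)" "csupp V \<zeta>" "\<And>x. 0 \<le> \<zeta> x" "\<And>x. \<zeta> x \<le> 1"
    "\<And>x y. x \<in> K \<Longrightarrow> dist x y < d \<Longrightarrow> \<zeta> y = 1"
proof -
  obtain d T where T: "d > 0" "compact T" "K \<subseteq> T" "T \<subseteq> V" "\<And>x y. x \<notin> T \<Longrightarrow> dist x y \<le> d \<Longrightarrow> y \<notin> K"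
    using csupp_enlarge[OF K] by metis
  define L where "L = (\<Union>x\<in>K. cball x (2 * d / 3))"
  have L: "compact L" unfolding L_def by (rule compact_cball_Union[OF K(1)])
  then have [measurable]: "L \<in> sets borel" by (simp add: borel_compact)
  have iL: "L1 (indicator L :: _ \<Rightarrow> real)" using emeasure_compact_finite[OF L] by (simp add: less_top)
  have d3: "d / 3 > 0" using T(1) by simp
  obtain \<eta> :: "real^'n \<Rightarrow> real" where \<eta>: "mollifier (d / 3) \<eta>" using mollifier_exists[OF d3] .
  let ?z = "conv \<eta> (indicator L :: _ \<Rightarrow> real)"
  have "?z x \<in> {0..1}" for x by (rule mollifier_conv_in_convex[OF \<eta> iL]) (auto simp: indicator_def)
  then have z01: "0 \<le> ?z x" "?z x \<le> 1" for x by auto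
  have supp: "?z x = 0" if "x \<notin> T" for x
  proof (rule conv_zero_off[of "d / 3"])
    fix y assume y: "dist x y < d / 3"
    have "y \<notin> L"
    proof
      assume "y \<in> L"
      then obtain k where k: "k \<in> K" "dist k y \<le> 2 * d / 3" by (auto simp: L_def)
      have "dist x k \<le> dist x y + dist k y" by (metis dist_commute dist_triangle)
      then have "dist x k \<le> d" using y k(2) by linarith
      then show False using T(5)[OF that, of k] k(1) by blast
    qed
    then show "(indicator L y :: real) = 0" by simp
  qed (use mollifierD(3)[OF \<eta>] in auto)
  have one: "?z y = 1" if "x \<in> K" "dist x y < d / 3" for x y
  proof -
    have "norm (?z y - 1) \<le> 0"
    proof (rule mollifier_conv_bound[OF \<eta> iL])
      fix z assume z: "dist y z < d / 3"
      have "dist x z \<le> dist x y + dist y z" by (rule dist_triangle)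
      then have "z \<in> L" using that z unfolding L_def by (intro UN_I[of x]) auto
      then show "norm (indicator L z - 1 :: real) \<le> 0" by simp
    qed
    then show ?thesis by simp
  qed
  show thesis
    by (rule that[OF d3 mollifier_conv_Ck[OF \<eta> iL] csuppI[OF T(2,4) supp] z01 one])
qed

text \<open>The weight \<open>p\<close> records how much of the singular measure \<open>\<theta> \<sigma>\<close> of the original function survives
  in the singular part of \<open>w\<close>.\<close>

definition repr :: "(real^'n) set \<Rightarrow> (real^'n \<Rightarrow> real^'m^'n) \<Rightarrow> (real^'n) measure \<Rightarrow> (real^'n \<Rightarrow> real^'m) \<Rightarrow> (real^'n \<Rightarrow> real) \<Rightarrow> bool" where
  "repr \<Omega> \<theta> \<sigma> w p \<longleftrightarrow> (\<forall>\<alpha> i. \<exists>G. L1 G \<and> (\<forall>\<phi>. \<phi> \<in> Ck_fun (Suc 0) \<longrightarrow> csupp \<Omega> \<phi> \<longrightarrow>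
     (LBINT x. w x $ i * pd \<alpha> \<phi> x) = - ((LBINT x. G x * \<phi> x) + (\<integral>x. \<theta> x $ \<alpha> $ i * (p x * \<phi> x) \<partial>\<sigma>))))"

text \<open>The first part of A w is w times the C^1 function 1 - \<rho>, so the product rule
  multiplies the singular weight by it. The second part is C^1 and contributes only to the
  density.\<close>

lemma (in smoothing) A_repr:
  fixes w :: "real^'n \<Rightarrow> real^'m"
  assumes w: "L1 w" and r: "repr \<Omega> \<theta> \<sigma> w p"
  shows "repr \<Omega> \<theta> \<sigma> (A w) (\<lambda>x. p x * (1 - \<rho> x))"
  unfolding repr_def
proof (intro allI)
  fix \<alpha> :: 'n and i :: 'm
  obtain G where G: "L1 G" "\<And>\<phi>. \<phi> \<in> Ck_fun (Suc 0) \<Longrightarrow> csupp \<Omega> \<phi> \<Longrightarrow>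
     (LBINT x. w x $ i * pd \<alpha> \<phi> x) = - ((LBINT x. G x * \<phi> x) + (\<integral>x. \<theta> x $ \<alpha> $ i * (p x * \<phi> x) \<partial>\<sigma>))"
    using r unfolding repr_def by blast
  define g where "g x = w x $ i" for x
  have gi: "L1 g" unfolding g_def[abs_def] by (rule integrable_component[OF w])
  have zgi: "L1 (\<lambda>y. \<zeta> y * g y)" using zw_int[OF gi] by simp
  define b where "b x = \<zeta> x * conv \<eta> (\<lambda>y. \<zeta> y * g y) x" for x
  have bC: "b \<in> Ck_fun (Suc 0)" unfolding b_def[abs_def] by (intro Ck_fun_mult zC mollifier_conv_Ck[OF eta zgi])
  have bs: "csupp \<Omega> b" unfolding b_def[abs_def] by (rule csupp_mult[OF zs])
  have bc: "continuous_on UNIV b" using bC Ck_fun_continuous by blast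
  have Aw: "A w x $ i = (1 - \<rho> x) * g x + b x" for x
    unfolding Aop_def b_def g_def using conv_vec_nth[OF eta zw_int[OF w]] by simp
  define G' where "G' x = (1 - \<rho> x) * G x - g x * pd \<alpha> \<rho> x + pd \<alpha> b x" for x
  have i2: "L1 (\<lambda>x. (1 - \<rho> x) * G x)" using first_int[OF G(1)] by simp
  have i3: "L1 (\<lambda>x. g x * pd \<alpha> \<rho> x)"
    using integrable_inner_csupp[OF gi C1_continuous_partial[OF rho_C1] csupp_partial_deriv[OF rho_supp]] by simp
  have i4: "L1 (pd \<alpha> b)" by (rule csupp_integrable[OF C1_continuous_partial[OF bC] csupp_partial_deriv[OF bs]])
  have G'i: "L1 G'" unfolding G'_def[abs_def] using i2 i3 i4 by auto
  have "(LBINT x. A w x $ i * pd \<alpha> \<phi> x) = - ((LBINT x. G' x * \<phi> x) + (\<integral>x. \<theta> x $ \<alpha> $ i * (p x * (1 - \<rho> x) * \<phi> x) \<partial>\<sigma>))"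
    if \<phi>: "\<phi> \<in> Ck_fun (Suc 0)" "csupp \<Omega> \<phi>" for \<phi>
  proof -
    have pc: "continuous_on UNIV \<phi>" "continuous_on UNIV (pd \<alpha> \<phi>)" "csupp \<Omega> (pd \<alpha> \<phi>)"
      using \<phi> Ck_fun_continuous C1_continuous_partial csupp_partial_deriv by blast+
    define \<chi>' where "\<chi>' x = (1 - \<rho> x) * \<phi> x" for x
    have cC: "\<chi>' \<in> Ck_fun (Suc 0)" "csupp \<Omega> \<chi>'" unfolding \<chi>'_def[abs_def]
      by (intro Ck_fun_mult one_rho_C1 \<phi>, rule csupp_mult2[OF \<phi>(2)])
    have cc: "continuous_on UNIV (pd \<alpha> \<chi>')" by (rule C1_continuous_partial[OF cC(1)])
    have cD: "pd \<alpha> \<chi>' x = (1 - \<rho> x) * pd \<alpha> \<phi> x - pd \<alpha> \<rho> x * \<phi> x" for x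
      unfolding \<chi>'_def[abs_def] using partial_deriv_mult[OF one_rho_C1 \<phi>(1), of \<alpha> x] one_rho_partial by simp
    have j1: "L1 (\<lambda>x. g x * pd \<alpha> \<chi>' x)" using integrable_inner_csupp[OF gi cc csupp_partial_deriv[OF cC(2)]] by simp
    have j2: "L1 (\<lambda>x. (g x * pd \<alpha> \<rho> x) * \<phi> x)" using integrable_inner_csupp[OF i3 pc(1) \<phi>(2)] by simp
    have j3: "L1 (\<lambda>x. b x * pd \<alpha> \<phi> x)"
      by (rule csupp_integrable[OF continuous_on_mult[OF bc pc(2)] csupp_mult[OF bs]])
    have j4: "L1 (\<lambda>x. ((1 - \<rho> x) * G x) * \<phi> x)" using integrable_inner_csupp[OF i2 pc(1) \<phi>(2)] by simp
    have j5: "L1 (\<lambda>x. pd \<alpha> b x * \<phi> x)" using integrable_inner_csupp[OF i4 pc(1) \<phi>(2)] by simp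
    have "(LBINT x. A w x $ i * pd \<alpha> \<phi> x)
        = (LBINT x. g x * pd \<alpha> \<chi>' x + (g x * pd \<alpha> \<rho> x) * \<phi> x + b x * pd \<alpha> \<phi> x)"
      by (intro integral_cong refl) (simp add: Aw cD algebra_simps)
    also have "\<dots> = (LBINT x. g x * pd \<alpha> \<chi>' x) + (LBINT x. (g x * pd \<alpha> \<rho> x) * \<phi> x) + (LBINT x. b x * pd \<alpha> \<phi> x)"
      using j1 j2 j3 by simp
    also have "(LBINT x. g x * pd \<alpha> \<chi>' x) = - ((LBINT x. G x * \<chi>' x) + (\<integral>x. \<theta> x $ \<alpha> $ i * (p x * \<chi>' x) \<partial>\<sigma>))"
      unfolding g_def by (rule G(2)[OF cC])
    also have "(LBINT x. b x * pd \<alpha> \<phi> x) = - (LBINT x. pd \<alpha> b x * \<phi> x)"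
      by (rule integration_by_parts[OF bC \<phi>])
    also have "(LBINT x. G x * \<chi>' x) = (LBINT x. ((1 - \<rho> x) * G x) * \<phi> x)" by (simp add: \<chi>'_def mult_ac)
    also have "(\<integral>x. \<theta> x $ \<alpha> $ i * (p x * \<chi>' x) \<partial>\<sigma>) = (\<integral>x. \<theta> x $ \<alpha> $ i * (p x * (1 - \<rho> x) * \<phi> x) \<partial>\<sigma>)" by (simp add: \<chi>'_def mult_ac)
    finally have 1: "(LBINT x. A w x $ i * pd \<alpha> \<phi> x)
      = - ((LBINT x. ((1 - \<rho> x) * G x) * \<phi> x) + (\<integral>x. \<theta> x $ \<alpha> $ i * (p x * (1 - \<rho> x) * \<phi> x) \<partial>\<sigma>))
        + (LBINT x. (g x * pd \<alpha> \<rho> x) * \<phi> x) + - (LBINT x. pd \<alpha> b x * \<phi> x)" .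
    have "(LBINT x. G' x * \<phi> x) = (LBINT x. ((1 - \<rho> x) * G x) * \<phi> x - (g x * pd \<alpha> \<rho> x) * \<phi> x + pd \<alpha> b x * \<phi> x)"
      by (simp add: G'_def algebra_simps)
    also have "\<dots> = (LBINT x. ((1 - \<rho> x) * G x) * \<phi> x) - (LBINT x. (g x * pd \<alpha> \<rho> x) * \<phi> x) + (LBINT x. pd \<alpha> b x * \<phi> x)"
      using j2 j4 j5 by simp
    finally show ?thesis using 1 by simp
  qed
  then show "\<exists>G. L1 G \<and> (\<forall>\<phi>. \<phi> \<in> Ck_fun (Suc 0) \<longrightarrow> csupp \<Omega> \<phi> \<longrightarrow>
     (LBINT x. A w x $ i * pd \<alpha> \<phi> x) = - ((LBINT x. G x * \<phi> x) + (\<integral>x. \<theta> x $ \<alpha> $ i * (p x * (1 - \<rho> x) * \<phi> x) \<partial>\<sigma>)))"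
    using G'i by blast
qed

text \<open>The field h equals \<theta> on the part of Z in V, which carries \<sigma> on V but no
  Lebesgue mass. Smooth fields close to h both for |H| dx and for \<sigma> make the first integral
  negligible and the second close to the mass of V.\<close>

lemma singular_part_unique:
  fixes H :: "real^'n \<Rightarrow> real^'m^'n"
  assumes bv: "bvd \<Omega> w G \<theta> \<sigma>" and V: "open V" and H: "L1 H"
    and eq: "\<And>\<Phi>. C1_field \<Phi> \<Longrightarrow> csupp V \<Phi> \<Longrightarrow> (LBINT x. H x \<bullet> \<Phi> x) + (\<integral>x. \<theta> x \<bullet> \<Phi> x \<partial>\<sigma>) = 0"
  shows "emeasure \<sigma> V = 0"
proof -
  have sb: "sets \<sigma> = sets borel" and s\<sigma>: "emeasure \<sigma> UNIV < \<infinity>"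
    and \<theta>[measurable]: "\<theta> \<in> borel_measurable borel" and \<theta>1: "AE x in \<sigma>. norm (\<theta> x) = 1"
    using bv by (auto simp: bvd_def)
  obtain Z where Z[measurable]: "Z \<in> sets borel" and Z0: "emeasure lborel Z = 0" "emeasure \<sigma> (UNIV - Z) = 0"
    using bv by (auto simp: bvd_def)
  interpret \<sigma>: finite_measure \<sigma> by (rule bvd_theta_integrable(2)[OF bv])
  have [measurable]: "V \<in> sets borel" "H \<in> borel_measurable borel" using V H by auto
  define h where "h x = (if x \<in> Z \<inter> V \<and> norm (\<theta> x) = 1 then \<theta> x else 0)" for x
  have hm[measurable]: "h \<in> borel_measurable borel" unfolding h_def[abs_def] by measurable
  have hC: "h x \<in> cball 0 1" for x by (simp add: h_def)
  have hoff: "h x = 0" if "x \<notin> V" for x using that by (simp add: h_def)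
  define N where "N = density lborel (\<lambda>x. ennreal (norm (H x)))"
  have sN: "sets N = sets borel" by (simp add: N_def)
  have fN: "emeasure N UNIV < \<infinity>"
    using H by (simp add: N_def emeasure_density integrable_iff_bounded)
  obtain \<mu> where s\<mu>: "sets \<mu> = sets borel" "emeasure \<mu> UNIV < \<infinity>" and le: "N \<le> \<mu>" "\<sigma> \<le> \<mu>"
    using dominating_measure[OF sN fN sb s\<sigma>] .
  interpret \<mu>: finite_measure \<mu>
    by (rule finite_measureI) (use s\<mu> sets_eq_imp_space_eq[OF s\<mu>(1)] in auto)
  have hi: "integrable \<mu> h"
    using hC by (intro \<mu>.integrable_const_bound[of _ 1]) (auto simp: measurable_cong_sets[OF s\<mu>(1) refl])
  have "measure \<sigma> V \<le> 0 + e" if "e > 0" for e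
  proof -
    have e2: "e / 2 > 0" using that by simp
    obtain \<Phi> where \<Phi>: "continuous_on UNIV \<Phi>" "csupp V \<Phi>" "\<And>x. \<Phi> x \<in> cball 0 1" "(\<integral>x. norm (\<Phi> x - h x) \<partial>\<mu>) < e / 2"
      "\<And>T k. bounded_linear T \<Longrightarrow> (\<lambda>x. T (\<Phi> x)) \<in> Ck_fun k"
      by (rule smooth_dense[OF s\<mu> V hi closed_cball convex_cball _ hC hoff e2], simp, assumption, rule that) auto
    have C1: "C1_field \<Phi>"
      unfolding C1_field_def
      by (intro allI \<Phi>(5) bounded_linear_compose[OF bounded_linear_vec_nth bounded_linear_vec_nth])
    have [measurable]: "\<Phi> \<in> borel_measurable borel" using \<Phi>(1) by (rule cont_borel)
    define d where "d x = norm (\<Phi> x - h x)" for x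
    have [measurable]: "d \<in> borel_measurable borel" unfolding d_def[abs_def] by measurable
    have di: "integrable \<mu> d" unfolding d_def[abs_def]
      by (intro integrable_norm integrable_diff hi csupp_integrable_finite[OF s\<mu> \<Phi>(1,2)])
    have dN: "integrable N d" "(\<integral>x. d x \<partial>N) < e / 2" and d\<sigma>: "integrable \<sigma> d" "(\<integral>x. d x \<partial>\<sigma>) < e / 2"
      using le_measure_integral[OF le(1) _ di] le_measure_integral[OF le(2) _ di] \<Phi>(4) sN sb s\<mu>(1)
      by (auto simp: d_def[abs_def])
    have k: "(\<lambda>x. norm (H x)) \<in> borel_measurable lborel" "AE x in lborel. 0 \<le> norm (H x)" "d \<in> borel_measurable lborel" by auto
    have dl: "L1 (\<lambda>x. norm (H x) * d x)" "(LBINT x. norm (H x) * d x) < e / 2"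
      using dN integrable_density[OF k(3,1,2)] integral_density[OF k(3,1,2)] by (simp_all add: N_def)
    have iH: "L1 (\<lambda>x. H x \<bullet> \<Phi> x)" by (rule integrable_inner_csupp[OF H \<Phi>(1,2)])
    have "(LBINT x. - (norm (H x) * d x)) \<le> (LBINT x. H x \<bullet> \<Phi> x)"
    proof (rule integral_mono_AE)
      have "AE x in lborel. x \<notin> Z" using Z0 by (intro AE_not_in) (auto simp: null_sets_def)
      then show "AE x in lborel. - (norm (H x) * d x) \<le> H x \<bullet> \<Phi> x"
      proof eventually_elim
        case (elim x)
        then have "d x = norm (\<Phi> x)" by (simp add: d_def h_def)
        then show ?case using Cauchy_Schwarz_ineq2[of "H x" "\<Phi> x"] by simp
      qed
    qed (use dl iH in auto)
    then have "- (e / 2) < (LBINT x. H x \<bullet> \<Phi> x)" using dl(2) by simp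
    moreover have Vi: "integrable \<sigma> (indicator V :: _ \<Rightarrow> real)" using sb by (simp add: \<sigma>.emeasure_eq_measure)
    have \<theta>i: "integrable \<sigma> (\<lambda>x. \<theta> x \<bullet> \<Phi> x)"
    proof (rule \<sigma>.integrable_const_bound[of _ 1])
      show "AE x in \<sigma>. norm (\<theta> x \<bullet> \<Phi> x) \<le> 1"
        using \<theta>1
      proof eventually_elim
        case (elim x)
        then show ?case using Cauchy_Schwarz_ineq2[of "\<theta> x" "\<Phi> x"] \<Phi>(3)[of x] by simp
      qed
    qed (simp add: measurable_cong_sets[OF sb refl])
    moreover have "(\<integral>x. indicator V x - d x \<partial>\<sigma>) \<le> (\<integral>x. \<theta> x \<bullet> \<Phi> x \<partial>\<sigma>)"
    proof (rule integral_mono_AE)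
      have "AE x in \<sigma>. x \<notin> UNIV - Z" using AE_not_in[of "UNIV - Z" \<sigma>] Z0 sb by (auto simp: null_sets_def)
      with \<theta>1 show "AE x in \<sigma>. indicator V x - d x \<le> \<theta> x \<bullet> \<Phi> x"
      proof eventually_elim
        case (elim x)
        have "\<theta> x \<bullet> h x = indicator V x" using elim by (auto simp: h_def dot_square_norm indicator_def)
        moreover have "\<theta> x \<bullet> (h x - \<Phi> x) \<le> d x"
          using norm_cauchy_schwarz[of "\<theta> x" "h x - \<Phi> x"] elim by (simp add: d_def norm_minus_commute)
        ultimately show ?case by (simp add: inner_diff_right)
      qed
    qed (use Vi d\<sigma> \<theta>i in auto)
    moreover have "(\<integral>x. indicator V x - d x \<partial>\<sigma>) = measure \<sigma> V - (\<integral>x. d x \<partial>\<sigma>)"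
      using Vi d\<sigma>(1) sb bvd_theta_integrable(3)[OF bv] by simp
    moreover have "(LBINT x. H x \<bullet> \<Phi> x) + (\<integral>x. \<theta> x \<bullet> \<Phi> x \<partial>\<sigma>) = 0" by (rule eq[OF C1 \<Phi>(2)])

    ultimately show ?thesis using d\<sigma>(2) by linarith
  qed
  then have "measure \<sigma> V \<le> 0" by (rule field_le_epsilon)
  then show ?thesis using measure_nonneg[of \<sigma> V] by (simp add: \<sigma>.emeasure_eq_measure)
qed

lemma norm_sq_add_le:
  fixes a b :: "'a::real_inner"
  assumes "\<kappa> > 0"
  shows "(norm (a + b))\<^sup>2 \<le> (1 + \<kappa>) * (norm a)\<^sup>2 + (1 + 1 / \<kappa>) * (norm b)\<^sup>2"
proof -
  have "0 \<le> (norm (\<kappa> *\<^sub>R a - b))\<^sup>2 / \<kappa>" using assms by simp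
  also have "(norm (\<kappa> *\<^sub>R a - b))\<^sup>2 = \<kappa> * (\<kappa> * (norm a)\<^sup>2) - 2 * \<kappa> * (a \<bullet> b) + (norm b)\<^sup>2"
    by (simp add: power2_norm_eq_inner inner_diff inner_commute)
  finally have "0 \<le> \<kappa> * (norm a)\<^sup>2 - 2 * (a \<bullet> b) + (norm b)\<^sup>2 / \<kappa>"
    using assms by (simp add: diff_divide_distrib add_divide_distrib)
  then show ?thesis
    by (simp add: power2_norm_eq_inner inner_add inner_commute algebra_simps)
qed

text \<open>The smoothing is moved onto the test pair, which stays admissible and yields at most r.
  What is left over is one commutator for each of the CARD('n) directions, each at most p c since
  |\<Phi>| \<le> p.\<close>

lemma (in smoothing) A_Rfun:
  fixes w :: "real^'n \<Rightarrow> real^'m"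
  assumes w: "L1 w" and R: "Rfun \<Omega> \<psi> w \<le> ennreal r" "r \<ge> 0"
    and psi: "\<And>t. t \<ge> 0 \<Longrightarrow> \<psi> t \<ge> 0" and p: "\<And>a (\<Phi> :: real^'n \<Rightarrow> real^'m^'n) x. adm \<Omega> \<psi> a \<Phi> \<Longrightarrow> norm (\<Phi> x) \<le> p"
    and c: "\<And>\<alpha>. (LBINT x. norm (Cw w \<alpha> x)) \<le> c" and p0: "p \<ge> 0"
  shows "Rfun \<Omega> \<psi> (A w) \<le> ennreal (r + of_nat CARD('n) * (p * c))"
proof (rule Rfun_least, rule ennreal_leI)
  fix a and \<Phi> :: "real^'n \<Rightarrow> real^'m^'n" assume ad: "adm \<Omega> \<psi> a \<Phi>"
  have "(LBINT x. Cw w \<alpha> x \<bullet> \<Phi> x $ \<alpha>) \<le> p * c" for \<alpha>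
  proof -
    have "Cw w \<alpha> x \<bullet> \<Phi> x $ \<alpha> \<le> p * norm (Cw w \<alpha> x)" for x
    proof -
      have "Cw w \<alpha> x \<bullet> \<Phi> x $ \<alpha> \<le> norm (Cw w \<alpha> x) * norm (\<Phi> x $ \<alpha>)" by (rule norm_cauchy_schwarz)
      also have "\<dots> \<le> norm (Cw w \<alpha> x) * p"
        using order_trans[OF Finite_Cartesian_Product.norm_nth_le p[OF ad]] by (intro mult_left_mono) auto
      finally show ?thesis by (simp add: mult.commute)
    qed
    moreover have "L1 (\<lambda>x. Cw w \<alpha> x \<bullet> \<Phi> x $ \<alpha>)"
      using admD(4)[OF ad] by (intro integrable_inner_csupp[OF Cw_int[OF w]] continuous_on_component admD(6)[OF ad]) (auto simp: csupp_def)
    ultimately have "(LBINT x. Cw w \<alpha> x \<bullet> \<Phi> x $ \<alpha>) \<le> (LBINT x. p * norm (Cw w \<alpha> x))"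
      using Cw_int[OF w, of \<alpha>] by (intro integral_mono) auto
    also have "\<dots> \<le> p * c" using mult_left_mono[OF c[of \<alpha>] p0] by simp
    finally show ?thesis .
  qed
  then have "(\<Sum>\<alpha>\<in>UNIV. LBINT x. Cw w \<alpha> x \<bullet> \<Phi> x $ \<alpha>) \<le> of_nat CARD('n) * (p * c)"
    using sum_bounded_above[of UNIV "\<lambda>\<alpha>. LBINT x. Cw w \<alpha> x \<bullet> \<Phi> x $ \<alpha>" "p * c"] by simp
  moreover have "(LBINT x. A a x) - (LBINT x. w x \<bullet> dv (A \<Phi>) x) \<le> r"
    by (rule Rfun_upper_real[OF A_adm[OF ad psi] R])
  ultimately show "(LBINT x. a x) - (LBINT x. A w x \<bullet> dv \<Phi> x) \<le> r + of_nat CARD('n) * (p * c)"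
    unfolding A_commutator[OF w admD(1,4)[OF ad]] A_integral[OF admD(2)[OF ad]] by simp
qed

text \<open>Four errors receive \<delta>/4 each: the two terms of \<open>Cw_bound\<close> raise the
  energy, and the two correction terms of \<open>norm_sq_add_le\<close> raise the fidelity.\<close>

lemma (in psi) smoothing_step:
  fixes w f :: "real^'n \<Rightarrow> real^'m"
  assumes op: "open \<Omega>" and bd: "bounded \<Omega>" and w: "Xs \<Omega> w"
    and f: "f \<in> borel_measurable borel" "L1 (\<lambda>x. (norm (f x))\<^sup>2)" and lam: "lam > 0"
    and F: "Fval \<Omega> \<psi> lam f w \<le> ennreal A0" and A0: "A0 \<ge> 0"
    and z: "\<zeta> \<in> Ck_fun (Suc 0)" "csupp \<Omega> \<zeta>" "\<And>x. 0 \<le> \<zeta> x" "\<And>x. \<zeta> x \<le> 1" and \<delta>: "\<delta> > 0" "\<delta>0 > 0"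
  shows "\<exists>\<epsilon> \<eta>. mollifier \<epsilon> \<eta> \<and> \<epsilon> \<le> \<delta>0 \<and> Fval \<Omega> \<psi> lam f (Aop \<zeta> \<eta> w) \<le> ennreal (A0 + \<delta>)
    \<and> L1 (\<lambda>x. (norm (Aop \<zeta> \<eta> w x - w x))\<^sup>2) \<and> (LBINT x. (norm (Aop \<zeta> \<eta> w x - w x))\<^sup>2) \<le> \<delta>"
proof -
  have wi: "L1 w" and off: "x \<notin> \<Omega> \<Longrightarrow> w x = 0" for x using w by (auto simp: Xs_def)
  have [measurable]: "w \<in> borel_measurable borel" "f \<in> borel_measurable borel" using Xs_borel[OF w] f by auto
  obtain r where r: "r \<ge> 0" "Rfun \<Omega> \<psi> w = ennreal r" "L1 (\<lambda>x. (norm (w x - f x))\<^sup>2)"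
    "r + lam / 2 * (LBINT x. (norm (w x - f x))\<^sup>2) \<le> A0"
    by (rule Fval_leE[OF F A0 lam Xs_borel[OF w] f(1)], rule that)
  define I where "I = (LBINT x. (norm (w x - f x))\<^sup>2)"
  have I0: "I \<ge> 0" unfolding I_def by simp
  have w2: "L1 (\<lambda>x. (norm (w x))\<^sup>2)"
  proof (rule integrable_bound)
    show "L1 (\<lambda>x. 2 * (norm (w x - f x))\<^sup>2 + 2 * (norm (f x))\<^sup>2)" using r(3) f(2) by auto
    show "AE x in lborel. norm ((norm (w x))\<^sup>2) \<le> norm (2 * (norm (w x - f x))\<^sup>2 + 2 * (norm (f x))\<^sup>2)"
    proof (rule AE_I2)
      fix x
      show "norm ((norm (w x))\<^sup>2) \<le> norm (2 * (norm (w x - f x))\<^sup>2 + 2 * (norm (f x))\<^sup>2)"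
        using norm_sq_add_le[of 1 "w x - f x" "f x"] by simp
    qed
  qed auto
  obtain B where B: "B \<ge> 1" "\<And>\<alpha> x. \<bar>pd \<alpha> \<zeta> x\<bar> \<le> B"
  proof -
    have "\<forall>\<alpha>. \<exists>b. \<forall>x. \<bar>pd \<alpha> \<zeta> x\<bar> \<le> b"
      using csupp_bounded[OF C1_continuous_partial[OF z(1)] csupp_partial_deriv[OF z(2)]] by (metis real_norm_def)
    then obtain b where b: "\<And>\<alpha> x. \<bar>pd \<alpha> \<zeta> x\<bar> \<le> b \<alpha>" by metis
    show thesis
    proof (rule that[of "1 + (\<Sum>\<alpha>\<in>UNIV. \<bar>b \<alpha>\<bar>)"])
      fix \<alpha> x
      have "b \<alpha> \<le> (\<Sum>\<alpha>\<in>UNIV. \<bar>b \<alpha>\<bar>)" using member_le_sum[of \<alpha> UNIV "\<lambda>\<alpha>. \<bar>b \<alpha>\<bar>"] by simp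
      then show "\<bar>pd \<alpha> \<zeta> x\<bar> \<le> 1 + (\<Sum>\<alpha>\<in>UNIV. \<bar>b \<alpha>\<bar>)" using b[of \<alpha> x] by linarith
    qed (simp add: sum_nonneg)
  qed
  obtain S where S: "compact S" "\<And>x. x \<notin> S \<Longrightarrow> \<zeta> x = 0" using z(2) by (auto simp: csupp_def)
  define c where "c = of_nat CARD('n) * pinf"
  define m where "m = measure lborel S"
  have cm: "c \<ge> 0" "m \<ge> 0" using pinf_nonneg by (auto simp: c_def m_def)
  \<comment> \<open>\<kappa> absorbs the term of the commutator bound that is free of oscillation,
    and \<kappa>' the relative increase of the fidelity. The added 1 avoids division by 0.\<close>
  define \<kappa> where "\<kappa> = \<delta> / (4 * (2 * B * m * c + 1))"
  define \<kappa>' where "\<kappa>' = \<delta> / (4 * (lam / 2 * I + 1))"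
  have den: "2 * B * m * c + 1 > 0" "lam / 2 * I + 1 > 0" "2 * B\<^sup>2 * c + 1 > 0"
    using B(1) cm lam I0 by (auto intro!: add_nonneg_pos mult_nonneg_nonneg)
  have \<kappa>: "\<kappa> > 0" "\<kappa>' > 0" unfolding \<kappa>_def \<kappa>'_def by (intro divide_pos_pos mult_pos_pos \<delta> den zero_less_numeral)+
  \<comment> \<open>The admissible total oscillation, chosen after \<kappa> and \<kappa>': small
    enough for the distance to w, for the commutator term and for the fidelity term.\<close>
  define E where "E = min \<delta> (min (\<delta> * \<kappa> / (4 * (2 * B\<^sup>2 * c + 1))) (\<delta> / (4 * (lam / 2 * (1 + 1 / \<kappa>')))))"
  have lk: "lam / 2 * (1 + 1 / \<kappa>') > 0" using lam \<kappa> by (intro mult_pos_pos add_pos_pos) auto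
  have E: "E > 0" using \<delta> \<kappa> den lk by (simp add: E_def)
  have frac: "y * (t / (4 * (y + 1))) \<le> t / 4" if "y \<ge> 0" "t \<ge> 0" for y t :: real
    using that by (simp add: divide_simps) (simp add: algebra_simps)
  have frac2: "t / (4 * y) * y = t / 4" if "y > 0" for y t :: real using that by simp
  have b1: "c * (2 * B * \<kappa> * m) \<le> \<delta> / 4"
    using frac[of "2 * B * m * c" \<delta>] B cm \<delta> by (simp add: \<kappa>_def mult_ac)
  have b2: "c * (2 * B\<^sup>2 / \<kappa> * E) \<le> \<delta> / 4"
  proof -
    have "c * (2 * B\<^sup>2 / \<kappa> * E) \<le> c * (2 * B\<^sup>2 / \<kappa> * (\<delta> * \<kappa> / (4 * (2 * B\<^sup>2 * c + 1))))"
      using cm \<kappa> by (intro mult_left_mono) (auto simp: E_def)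
    also have "\<dots> = (2 * B\<^sup>2 * c) * (\<delta> / (4 * (2 * B\<^sup>2 * c + 1)))" using \<kappa> by (simp add: mult_ac)
    also have "\<dots> \<le> \<delta> / 4" by (rule frac) (use cm \<delta> in auto)
    finally show ?thesis .
  qed
  have b3: "lam / 2 * (\<kappa>' * I) \<le> \<delta> / 4"
    using frac[of "lam / 2 * I" \<delta>] lam I0 \<delta> by (simp add: \<kappa>'_def mult_ac)
  have b4: "lam / 2 * ((1 + 1 / \<kappa>') * E) \<le> \<delta> / 4"
  proof -
    have "E * (lam / 2 * (1 + 1 / \<kappa>')) \<le> \<delta> / (4 * (lam / 2 * (1 + 1 / \<kappa>'))) * (lam / 2 * (1 + 1 / \<kappa>'))"
      using lk by (intro mult_right_mono) (auto simp: E_def)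
    also have "\<dots> = \<delta> / 4" by (rule frac2[OF lk])
    finally show ?thesis by (simp add: mult_ac)
  qed
  obtain d where d: "d > 0" "\<And>\<epsilon> \<eta>. mollifier \<epsilon> \<eta> \<Longrightarrow> \<epsilon> \<le> d \<Longrightarrow>
      (\<integral>\<^sup>+x. oscillation \<eta> w x \<partial>lborel) \<le> ennreal E"
    by (rule mollifier_oscillation[OF Xs_borel[OF w] w2 off op bd E], assumption, rule that) auto
  define \<epsilon> where "\<epsilon> = min d \<delta>0"
  have \<epsilon>: "\<epsilon> > 0" "\<epsilon> \<le> d" "\<epsilon> \<le> \<delta>0" using d \<delta> by (auto simp: \<epsilon>_def)
  obtain \<eta> :: "real^'n \<Rightarrow> real" where \<eta>: "mollifier \<epsilon> \<eta>" using mollifier_exists[OF \<epsilon>(1)] .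
  interpret smoothing \<Omega> \<zeta> \<eta> \<epsilon> by unfold_locales (use op z \<eta> in auto)
  note osc = d(2)[OF \<eta> \<epsilon>(2)]
  note sq = A_sq_bound[OF wi osc less_imp_le[OF E]]
  have [measurable]: "A w \<in> borel_measurable borel" using Xs_borel[OF A_Xs[OF w]] .
  have "Rfun \<Omega> \<psi> (A w) \<le> ennreal (r + of_nat CARD('n) * (pinf * (2 * B * \<kappa> * m + 2 * B\<^sup>2 / \<kappa> * E)))"
    unfolding m_def using r(1,2) pinf_nonneg psi_nn adm_field_le Cw_bound[OF wi osc less_imp_le[OF E] B \<kappa>(1) S]
    by (intro A_Rfun[OF wi]) auto
  also have "\<dots> \<le> ennreal (r + \<delta> / 2)"
  proof (rule ennreal_leI)
    have "of_nat CARD('n) * (pinf * (a + b)) = c * a + c * b" for a b by (simp add: c_def algebra_simps)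
    then show "r + of_nat CARD('n) * (pinf * (2 * B * \<kappa> * m + 2 * B\<^sup>2 / \<kappa> * E)) \<le> r + \<delta> / 2" using b1 b2 by simp
  qed
  finally have R: "Rfun \<Omega> \<psi> (A w) \<le> ennreal (r + \<delta> / 2)" .
  let ?b = "\<lambda>x. (1 + \<kappa>') * (norm (w x - f x))\<^sup>2 + (1 + 1 / \<kappa>') * (norm (A w x - w x))\<^sup>2"
  have bi: "L1 ?b" using r(3) sq(1) by auto
  have pw: "(norm (A w x - f x))\<^sup>2 \<le> ?b x" for x
    using norm_sq_add_le[OF \<kappa>(2), of "w x - f x" "A w x - w x"] by simp
  have fi: "L1 (\<lambda>x. (norm (A w x - f x))\<^sup>2)"
    by (rule integrable_bound[OF bi]) (auto intro!: AE_I2 order_trans[OF pw])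
  have "(LBINT x. (norm (A w x - f x))\<^sup>2) \<le> (LBINT x. ?b x)" by (rule integral_mono[OF fi bi pw])
  also have "\<dots> = (1 + \<kappa>') * I + (1 + 1 / \<kappa>') * (LBINT x. (norm (A w x - w x))\<^sup>2)" using r(3) sq(1) by (simp add: I_def)
  also have "\<dots> \<le> (1 + \<kappa>') * I + (1 + 1 / \<kappa>') * E" using sq(2) \<kappa> by (intro add_left_mono mult_left_mono) auto
  finally have "lam / 2 * (LBINT x. (norm (A w x - f x))\<^sup>2) \<le> lam / 2 * ((1 + \<kappa>') * I + (1 + 1 / \<kappa>') * E)"
    using lam by (intro mult_left_mono) auto
  also have "\<dots> = lam / 2 * I + lam / 2 * (\<kappa>' * I) + lam / 2 * ((1 + 1 / \<kappa>') * E)" by (simp add: algebra_simps)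
  finally have t: "r + \<delta> / 2 + lam / 2 * (LBINT x. (norm (A w x - f x))\<^sup>2) \<le> A0 + \<delta>" using b3 b4 r(4)[folded I_def] by linarith
  have "Fval \<Omega> \<psi> lam f (A w) \<le> ennreal (A0 + \<delta>)"
    by (rule order_trans[OF Fval_leI[OF R _ lam fi]]) (use r(1) \<delta> t in \<open>auto intro: ennreal_leI\<close>)
  moreover have "(LBINT x. (norm (A w x - w x))\<^sup>2) \<le> \<delta>" using sq(2) by (simp add: E_def)
  ultimately show ?thesis using \<eta> \<epsilon>(3) sq(1) by blast
qed

text \<open>The cutoff is 1 up to distance d from K, and the scale is kept at most d, so
  \<open>rho_one\<close> applies on K and clears the singular weight there. Off V the cutoff
  vanishes and w is untouched.\<close>

lemma (in psi) localized_step: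
  fixes w f :: "real^'n \<Rightarrow> real^'m"
  assumes op: "open \<Omega>" and bd: "bounded \<Omega>" and w: "Xs \<Omega> w"
    and f: "f \<in> borel_measurable borel" "L1 (\<lambda>x. (norm (f x))\<^sup>2)" and lam: "lam > 0"
    and F: "Fval \<Omega> \<psi> lam f w \<le> ennreal A0" and A0: "A0 \<ge> 0"
    and K: "compact K" "K \<subseteq> V" "open V" "V \<subseteq> \<Omega>" and \<delta>: "\<delta> > 0" and r: "repr \<Omega> \<theta> \<sigma> w p"
  shows "\<exists>w' p'. Xs \<Omega> w' \<and> Fval \<Omega> \<psi> lam f w' \<le> ennreal (A0 + \<delta>) \<and> repr \<Omega> \<theta> \<sigma> w' p'
    \<and> L1 (\<lambda>x. (norm (w' x - w x))\<^sup>2) \<and> (LBINT x. (norm (w' x - w x))\<^sup>2) \<le> \<delta>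
    \<and> (\<forall>x. x \<notin> V \<longrightarrow> w' x = w x) \<and> (\<forall>x\<in>K. p' x = 0) \<and> (\<forall>x. p x = 0 \<longrightarrow> p' x = 0)"
proof -
  obtain \<zeta> d where z: "d > 0" "\<zeta> \<in> Ck_fun (Suc 0)" "csupp V \<zeta>" "\<And>x. 0 \<le> \<zeta> x" "\<And>x. \<zeta> x \<le> 1"
    "\<And>x y. x \<in> K \<Longrightarrow> dist x y < d \<Longrightarrow> \<zeta> y = 1"
    by (rule cutoff_exists[OF K(1,2,3)], rule that, assumption+)
  have zs: "csupp \<Omega> \<zeta>" by (rule csupp_mono[OF z(3) K(4)])
  obtain \<epsilon> \<eta> where s: "mollifier \<epsilon> \<eta>" "\<epsilon> \<le> d" "Fval \<Omega> \<psi> lam f (Aop \<zeta> \<eta> w) \<le> ennreal (A0 + \<delta>)"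
    "L1 (\<lambda>x. (norm (Aop \<zeta> \<eta> w x - w x))\<^sup>2)" "(LBINT x. (norm (Aop \<zeta> \<eta> w x - w x))\<^sup>2) \<le> \<delta>"
    using smoothing_step[OF op bd w f lam F A0 z(2) zs z(4,5) \<delta> z(1)] by blast
  interpret smoothing \<Omega> \<zeta> \<eta> \<epsilon> by unfold_locales (use op z zs s in auto)
  have "Xs \<Omega> (A w)" by (rule A_Xs[OF w])
  moreover have "repr \<Omega> \<theta> \<sigma> (A w) (\<lambda>x. p x * (1 - \<rho> x))" using w r by (intro A_repr) (auto simp: Xs_def)
  moreover have "A w x = w x" if "x \<notin> V" for x using z(3) that by (intro A_off) (auto simp: csupp_def)
  moreover have "p x * (1 - \<rho> x) = 0" if "x \<in> K" for x using rho_one[of x] z(6)[OF that] s(2) by simp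
  ultimately show ?thesis using s(3,4,5) by (intro exI[of _ "A w"] exI[of _ "\<lambda>x. p x * (1 - \<rho> x)"]) auto
qed

text \<open>On U the gradient of u agrees with that of w, which is given by a density since p
  vanishes. Subtracting it from G gives an integrable H whose sum with the singular part of u is 0
  on U.\<close>

lemma repr_singular_null:
  fixes u w :: "real^'n \<Rightarrow> real^'m"
  assumes bv: "bvd \<Omega> u G \<theta>' \<sigma>'" and op: "open \<Omega>" and U: "open U" "U \<subseteq> \<Omega>"
    and r: "repr \<Omega> \<theta> \<sigma> w p" and p: "\<And>x. x \<in> U \<Longrightarrow> p x = 0"
    and w: "L1 w" and uw: "AE x in lborel. x \<in> U \<longrightarrow> u x = w x"
  shows "emeasure \<sigma>' U = 0"
proof -
  have ui: "L1 u" and Gi: "L1 G" using bv by (auto simp: bvd_def)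
  obtain g where g: "\<And>\<alpha> i. L1 (g \<alpha> i)" "\<And>\<alpha> i \<phi>. \<phi> \<in> Ck_fun (Suc 0) \<Longrightarrow> csupp \<Omega> \<phi> \<Longrightarrow>
     (LBINT x. w x $ i * pd \<alpha> \<phi> x) = - ((LBINT x. g \<alpha> i x * \<phi> x) + (\<integral>x. \<theta> x $ \<alpha> $ i * (p x * \<phi> x) \<partial>\<sigma>))"
  proof -
    define R where "R \<alpha> i G \<longleftrightarrow> L1 G \<and> (\<forall>\<phi>. \<phi> \<in> Ck_fun (Suc 0) \<longrightarrow> csupp \<Omega> \<phi> \<longrightarrow>
     (LBINT x. w x $ i * pd \<alpha> \<phi> x) = - ((LBINT x. G x * \<phi> x) + (\<integral>x. \<theta> x $ \<alpha> $ i * (p x * \<phi> x) \<partial>\<sigma>)))" for \<alpha> i G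
    have "\<forall>\<alpha> i. \<exists>G. R \<alpha> i G" using r unfolding repr_def R_def .
    then obtain g where "\<And>\<alpha> i. R \<alpha> i (g \<alpha> i)" by metis
    then show thesis unfolding R_def by (intro that[of g]) blast+
  qed
  define H where "H x = G x - (\<Sum>\<alpha>\<in>UNIV. \<Sum>i\<in>UNIV. g \<alpha> i x *\<^sub>R axis \<alpha> (axis i 1))" for x
  have Hi: "L1 H" unfolding H_def[abs_def]
    by (intro integrable_diff Gi integrable_sum integrable_scaleR_left g(1))
  have Hc: "H x $ \<alpha> $ i = G x $ \<alpha> $ i - g \<alpha> i x" for x \<alpha> i
  proof -
    have "(\<Sum>\<alpha>\<in>UNIV. \<Sum>i\<in>UNIV. g \<alpha> i x *\<^sub>R axis \<alpha> (axis i (1::real))) $ \<alpha> $ i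
        = (\<Sum>\<beta>\<in>UNIV. \<Sum>j\<in>UNIV. if \<beta> = \<alpha> then (if j = i then g \<beta> j x else 0) else 0)"
      unfolding sum_component by (intro sum.cong refl) (auto simp: axis_def)
    also have "\<dots> = (\<Sum>\<beta>\<in>UNIV. if \<beta> = \<alpha> then g \<alpha> i x else 0)" by (intro sum.cong refl) simp
    also have "\<dots> = g \<alpha> i x" by simp
    finally show ?thesis by (simp add: H_def)
  qed
  show ?thesis
  proof (rule singular_part_unique[OF bv U(1) Hi])
    fix \<Phi> :: "real^'n \<Rightarrow> real^'m^'n" assume \<Phi>: "C1_field \<Phi>" "csupp U \<Phi>"
    have s: "csupp \<Omega> \<Phi>" by (rule csupp_mono[OF \<Phi>(2) U(2)])
    note c1 = C1_field_entry[OF \<Phi>(1)] and cs = csupp_entry[OF s]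
    have cont: "continuous_on UNIV (\<lambda>x. \<Phi> x $ \<alpha> $ i)" for \<alpha> i using c1 Ck_fun_continuous by blast
    have off: "\<Phi> x = 0" if "x \<notin> U" for x using \<Phi>(2) that by (auto simp: csupp_def)
    have p0: "p x * \<Phi> x $ \<alpha> $ i = 0" for x \<alpha> i by (cases "x \<in> U") (simp_all add: p off)
    have c: "(LBINT x. u x $ i * pd \<alpha> (\<lambda>x. \<Phi> x $ \<alpha> $ i) x) = - (LBINT x. g \<alpha> i x * \<Phi> x $ \<alpha> $ i)" for \<alpha> i
    proof -
      have pU: "csupp U (pd \<alpha> (\<lambda>x. \<Phi> x $ \<alpha> $ i))" by (rule csupp_partial_deriv[OF csupp_entry[OF \<Phi>(2)]])
      note pc = C1_continuous_partial[OF c1, of \<alpha> \<alpha> i]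
      have "(LBINT x. u x $ i * pd \<alpha> (\<lambda>x. \<Phi> x $ \<alpha> $ i) x) = (LBINT x. w x $ i * pd \<alpha> (\<lambda>x. \<Phi> x $ \<alpha> $ i) x)"
      proof (rule integral_cong_AE)
        show "AE x in lborel. u x $ i * pd \<alpha> (\<lambda>x. \<Phi> x $ \<alpha> $ i) x = w x $ i * pd \<alpha> (\<lambda>x. \<Phi> x $ \<alpha> $ i) x"
          using uw
        proof eventually_elim
          case (elim x)
          then show ?case using pU by (cases "x \<in> U") (auto simp: csupp_def)
        qed
      qed (use integrable_component[OF ui] integrable_component[OF w] cont_borel[OF pc] in auto)
      also have "\<dots> = - (LBINT x. g \<alpha> i x * \<Phi> x $ \<alpha> $ i)" unfolding g(2)[OF c1 cs] p0 by simp
      finally show ?thesis .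
    qed
    have gi: "L1 (\<lambda>x. g \<alpha> i x * \<Phi> x $ \<alpha> $ i)" for \<alpha> i
      using integrable_inner_csupp[OF g(1) cont cs] by simp
    have Gi': "L1 (\<lambda>x. G x $ \<alpha> $ i * \<Phi> x $ \<alpha> $ i)" for \<alpha> i
      using integrable_inner_csupp[OF integrable_entry[OF Gi] cont cs] by simp
    have "L1 (\<lambda>x. u x $ i * pd \<alpha> (\<lambda>x. \<Phi> x $ \<alpha> $ i) x)" for \<alpha> i
      using integrable_inner_csupp[OF integrable_component[OF ui] C1_continuous_partial[OF c1] csupp_partial_deriv[OF cs]] by simp
    then have "(LBINT x. u x \<bullet> dv \<Phi> x) = (\<Sum>i\<in>UNIV. \<Sum>\<alpha>\<in>UNIV. LBINT x. u x $ i * pd \<alpha> (\<lambda>x. \<Phi> x $ \<alpha> $ i) x)"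
      by (simp add: inner_vec_def dv_def sum_distrib_left integral_sum)
    also have "\<dots> = - (\<Sum>\<alpha>\<in>UNIV. \<Sum>i\<in>UNIV. LBINT x. g \<alpha> i x * \<Phi> x $ \<alpha> $ i)"
      unfolding c sum_negf by (subst sum.swap) simp
    finally have 1: "(LBINT x. G x \<bullet> \<Phi> x) + (\<integral>x. \<theta>' x \<bullet> \<Phi> x \<partial>\<sigma>') = (\<Sum>\<alpha>\<in>UNIV. \<Sum>i\<in>UNIV. LBINT x. g \<alpha> i x * \<Phi> x $ \<alpha> $ i)"
      using bvd_field(1)[OF bv op \<Phi>(1) s] by simp
    have "(LBINT x. H x \<bullet> \<Phi> x) = (\<Sum>\<alpha>\<in>UNIV. \<Sum>i\<in>UNIV. LBINT x. (G x $ \<alpha> $ i - g \<alpha> i x) * \<Phi> x $ \<alpha> $ i)"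
      unfolding Hc[symmetric] by (rule integral_inner_entries(2)) (use gi Gi' in \<open>auto simp: Hc left_diff_distrib\<close>)
    also have "\<dots> = (\<Sum>\<alpha>\<in>UNIV. \<Sum>i\<in>UNIV. LBINT x. G x $ \<alpha> $ i * \<Phi> x $ \<alpha> $ i) - (\<Sum>\<alpha>\<in>UNIV. \<Sum>i\<in>UNIV. LBINT x. g \<alpha> i x * \<Phi> x $ \<alpha> $ i)"
      using gi Gi' by (simp add: left_diff_distrib sum_subtractf)
    also have "(\<Sum>\<alpha>\<in>UNIV. \<Sum>i\<in>UNIV. LBINT x. G x $ \<alpha> $ i * \<Phi> x $ \<alpha> $ i) = (LBINT x. G x \<bullet> \<Phi> x)"
      by (rule integral_inner_entries(2)[OF Gi', symmetric])
    finally show "(LBINT x. H x \<bullet> \<Phi> x) + (\<integral>x. \<theta>' x \<bullet> \<Phi> x \<partial>\<sigma>') = 0" using 1 by simp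
  qed
qed

lemma exhaustion:
  fixes \<Omega> :: "(real^'n) set"
  assumes op: "open \<Omega>" and bd: "bounded \<Omega>"
  obtains U C where "\<And>k::nat. open (U k)" "\<And>k. compact (C k)" "\<And>k. U k \<subseteq> C k" "\<And>k. C k \<subseteq> U (Suc k)"
    "C 0 = {}" "(\<Union>k. U k) = \<Omega>"
proof -
  define D where "D x = infdist x (- \<Omega>)" for x
  have ne: "- \<Omega> \<noteq> {}" using bd not_bounded_UNIV by (metis Compl_empty_eq double_compl)
  have cl: "closed (- \<Omega>)" using op by (simp add: closed_Compl)
  have D0: "D x \<ge> 0" "D x > 0 \<longleftrightarrow> x \<in> \<Omega>" for x
    using in_closed_iff_infdist_zero[OF cl ne, of x] infdist_nonneg[of x "- \<Omega>"] by (auto simp: D_def less_le)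
  have Dc: "continuous_on UNIV D" unfolding D_def[abs_def] by (intro continuous_intros)
  \<comment> \<open>The sets where the distance exceeds 1/k, written as products so that index 0
    gives the empty set instead of a division by 0.\<close>
  define U where "U k = {x. 1 < D x * real k}" for k
  define C where "C k = {x. 1 \<le> D x * real k}" for k
  have pos: "x \<in> \<Omega>" if "0 < D x * real k" for x k using that D0(1)[of x] D0(2)[of x] by (cases "D x = 0") auto
  show thesis
  proof
    show "open (U k)" for k unfolding U_def by (intro open_Collect_less continuous_intros Dc)
    show "compact (C k)" for k
    proof -
      have "C k \<subseteq> \<Omega>"
      proof
        fix x assume "x \<in> C k"
        then have "0 < D x * real k" by (simp add: C_def)
        then show "x \<in> \<Omega>" by (rule pos)
      qed
      moreover have "closed (C k)" unfolding C_def by (intro closed_Collect_le continuous_intros Dc)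
      ultimately show ?thesis using bounded_subset[OF bd] by (simp add: compact_eq_bounded_closed)
    qed
    show "U k \<subseteq> C k" for k by (auto simp: U_def C_def)
    show "C k \<subseteq> U (Suc k)" for k
    proof
      fix x assume x: "x \<in> C k"
      then have "0 < D x" using D0(1)[of x] by (cases "D x = 0") (auto simp: C_def)
      then show "x \<in> U (Suc k)" using x by (simp add: C_def U_def algebra_simps)
    qed
    show "C 0 = {}" by (simp add: C_def)
    show "(\<Union>k. U k) = \<Omega>"
    proof
      show "(\<Union>k. U k) \<subseteq> \<Omega>" 
      proof (rule UN_least, rule subsetI)
        fix k x assume "x \<in> U k"
        then have "0 < D x * real k" by (simp add: U_def)
        then show "x \<in> \<Omega>" by (rule pos)
      qed
      show "\<Omega> \<subseteq> (\<Union>k. U k)"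
      proof
        fix x assume "x \<in> \<Omega>"
        then have "0 < D x" using D0 by simp
        then obtain k where "1 < real k * D x" using ex_less_of_nat_mult by blast
        then show "x \<in> (\<Union>k. U k)" by (auto simp: U_def mult.commute)
      qed
    qed
  qed
qed

text \<open>Smoothing successively on a locally finite cover by annuli removes the singular part.\<close>

lemma (in psi) W11_approximation:
  fixes w f :: "real^'n \<Rightarrow> real^'m"
  assumes op: "open \<Omega>" and bd: "bounded \<Omega>" and w: "Xs \<Omega> w"
    and f: "f \<in> borel_measurable borel" "L1 (\<lambda>x. (norm (f x))\<^sup>2)" and lam: "lam > 0"
    and F: "Fval \<Omega> \<psi> lam f w \<le> ennreal A0" and A0: "A0 \<ge> 0" and \<delta>: "\<delta> > 0"
  shows "\<exists>v G \<theta> \<sigma>. Xs \<Omega> v \<and> bvd \<Omega> v G \<theta> \<sigma> \<and> emeasure \<sigma> UNIV = 0 \<and> Fval \<Omega> \<psi> lam f v \<le> ennreal (A0 + \<delta>)"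
proof -
  have wi: "L1 w" using w by (simp add: Xs_def)
  have fin: "Rfun \<Omega> \<psi> v < \<infinity>" if v: "Xs \<Omega> v" "Fval \<Omega> \<psi> lam f v \<le> ennreal a" "a \<ge> 0" for v a
    by (rule Fval_leE[OF v(2,3) lam Xs_borel[OF v(1)] f(1)]) simp
  obtain G0 \<theta> \<sigma> where bv0: "bvd \<Omega> w G0 \<theta> \<sigma>" using Rfun_imp_bvd[OF wi op bd fin[OF w F A0]] by blast
  have r0: "repr \<Omega> \<theta> \<sigma> w (\<lambda>_. 1)" unfolding repr_def
  proof (intro allI exI[where x = "\<lambda>x. G0 x $ _ $ _"] conjI impI)
    fix \<alpha> :: 'n and i :: 'm
    show "L1 (\<lambda>x. G0 x $ \<alpha> $ i)" using bv0 by (auto simp: bvd_def intro: integrable_entry)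
    fix \<phi> :: "real^'n \<Rightarrow> real" assume "\<phi> \<in> Ck_fun (Suc 0)" "csupp \<Omega> \<phi>"
    then show "(LBINT x. w x $ i * pd \<alpha> \<phi> x)
      = - ((LBINT x. G0 x $ \<alpha> $ i * \<phi> x) + (\<integral>x. \<theta> x $ \<alpha> $ i * (1 * \<phi> x) \<partial>\<sigma>))"
      unfolding mult_1_left by (rule bvd_C1[OF bv0 op])
  qed
  obtain U C where UC: "\<And>k::nat. open (U k)" "\<And>k. compact (C k)" "\<And>k. U k \<subseteq> C k" "\<And>k. C k \<subseteq> U (Suc k)"
    "C 0 = {}" "(\<Union>k. U k) = \<Omega>"
    by (rule exhaustion[OF op bd], rule that)
  have C_mono: "C j \<subseteq> C k" if "j \<le> k" for j k
    by (rule lift_Suc_mono_le[OF _ that]) (use UC(3,4) in blast)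
  \<comment> \<open>The budget \<delta> is spent geometrically: after k steps the share 1 - 2^(-k)
    may be used up.\<close>
  define P where "P k s \<longleftrightarrow> Xs \<Omega> (fst s) \<and> Fval \<Omega> \<psi> lam f (fst s) \<le> ennreal (A0 + \<delta> * (1 - (1/2) ^ k)) \<and> repr \<Omega> \<theta> \<sigma> (fst s) (snd s)"
    for k :: nat and s :: "(real^'n \<Rightarrow> real^'m) \<times> (real^'n \<Rightarrow> real)"
  \<comment> \<open>For k = 0 the truncated subtraction gives \<open>C 0\<close>, the empty set, so
    the first step is unconstrained. The rate (1/4)^k is that of
    \<open>geometric_limit\<close>.\<close>
  define Q where "Q k s t \<longleftrightarrow> L1 (\<lambda>x. (norm (fst t x - fst s x))\<^sup>2)
      \<and> (LBINT x. (norm (fst t x - fst s x))\<^sup>2) \<le> (1/4) ^ k \<and> (\<forall>x. x \<in> C (k - 1) \<longrightarrow> fst t x = fst s x)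
      \<and> (\<forall>x\<in>C (Suc k) - U k. snd t x = 0) \<and> (\<forall>x. snd s x = 0 \<longrightarrow> snd t x = 0)"
    for k :: nat and s t :: "(real^'n \<Rightarrow> real^'m) \<times> (real^'n \<Rightarrow> real)"
  have "\<exists>s. P 0 s" using w F r0 by (intro exI[of _ "(w, \<lambda>_. 1)"]) (simp add: P_def)
  moreover have "\<exists>t. P (Suc k) t \<and> Q k s t" if Ps: "P k s" for k s
  proof -
    have s: "Xs \<Omega> (fst s)" "Fval \<Omega> \<psi> lam f (fst s) \<le> ennreal (A0 + \<delta> * (1 - (1/2) ^ k))" "repr \<Omega> \<theta> \<sigma> (fst s) (snd s)"
      using Ps by (auto simp: P_def)
    have a: "A0 + \<delta> * (1 - (1/2) ^ k) \<ge> 0" using A0 \<delta> by (simp add: power_le_one)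
    \<comment> \<open>The first bound is the increment of the energy budget, the second the distance
      allowed for convergence.\<close>
    define e where "e = min (\<delta> * (1/2) ^ Suc k) ((1/4) ^ k)"
    have e: "e > 0" "e \<le> \<delta> * (1/2) ^ Suc k" "e \<le> (1/4) ^ k" using \<delta> by (auto simp: e_def)
    \<comment> \<open>The step clears a closed annulus and works in a slightly larger open one that
      avoids \<open>C (k - 1)\<close>; hence each point of \<Omega> is modified only finitely
      often.\<close>
    have V: "compact (C (Suc k) - U k)" "C (Suc k) - U k \<subseteq> U (Suc (Suc k)) - C (k - 1)" "open (U (Suc (Suc k)) - C (k - 1))"
      "U (Suc (Suc k)) - C (k - 1) \<subseteq> \<Omega>"
    proof -
      have "C (k - 1) \<subseteq> U k" using UC(4)[of "k - 1"] UC(5) by (cases k) auto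
      then show "C (Suc k) - U k \<subseteq> U (Suc (Suc k)) - C (k - 1)" using UC(4)[of "Suc k"] by blast
      show "compact (C (Suc k) - U k)" by (intro compact_diff UC)
      show "open (U (Suc (Suc k)) - C (k - 1))" by (intro open_Diff compact_imp_closed UC)
      show "U (Suc (Suc k)) - C (k - 1) \<subseteq> \<Omega>" using UC(6) by blast
    qed
    obtain w' p' where wp: "Xs \<Omega> w'" "Fval \<Omega> \<psi> lam f w' \<le> ennreal (A0 + \<delta> * (1 - (1/2) ^ k) + e)" "repr \<Omega> \<theta> \<sigma> w' p'"
      "L1 (\<lambda>x. (norm (w' x - fst s x))\<^sup>2)" "(LBINT x. (norm (w' x - fst s x))\<^sup>2) \<le> e"
      "\<forall>x. x \<notin> U (Suc (Suc k)) - C (k - 1) \<longrightarrow> w' x = fst s x" "\<forall>x\<in>C (Suc k) - U k. p' x = 0" "\<forall>x. snd s x = 0 \<longrightarrow> p' x = 0"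
      using localized_step[OF op bd s(1) f lam s(2) a V e(1) s(3)] by blast
    have "A0 + \<delta> * (1 - (1/2) ^ k) + e \<le> A0 + \<delta> * (1 - (1/2) ^ Suc k)" using e(2) by (simp add: algebra_simps)
    from order_trans[OF wp(2) ennreal_leI[OF this]] have "P (Suc k) (w', p')" using wp(1,3) by (simp add: P_def)
    moreover have "Q k s (w', p')" using wp(4-8) e(3) by (auto simp: Q_def)
    ultimately show ?thesis by blast
  qed
  ultimately obtain S where S: "\<And>k. P k (S k)" "\<And>k. Q k (S k) (S (Suc k))"
    using dependent_nat_choice[of P Q] by blast
  define v where "v k = fst (S k)" for k
  define p where "p k = snd (S k)" for k
  have v: "Xs \<Omega> (v k)" "Fval \<Omega> \<psi> lam f (v k) \<le> ennreal (A0 + \<delta> * (1 - (1/2) ^ k))" "repr \<Omega> \<theta> \<sigma> (v k) (p k)" for k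
    using S(1)[of k] by (auto simp: P_def v_def p_def)
  have q: "L1 (\<lambda>x. (norm (v (Suc k) x - v k x))\<^sup>2)" "(LBINT x. (norm (v (Suc k) x - v k x))\<^sup>2) \<le> (1/4) ^ k"
    "x \<in> C (k - 1) \<Longrightarrow> v (Suc k) x = v k x" "x \<in> C (Suc k) - U k \<Longrightarrow> p (Suc k) x = 0" "p k x = 0 \<Longrightarrow> p (Suc k) x = 0" for k x
    using S(2)[of k] by (auto simp: Q_def v_def p_def)
  have v_const: "v (Suc (j + k)) x = v (Suc j) x" if "x \<in> C j" for j k x
  proof (induction k)
    case (Suc k)
    have "x \<in> C (Suc (j + k) - 1)" using C_mono[of j "j + k"] that by auto
    then have "v (Suc (Suc (j + k))) x = v (Suc (j + k)) x" by (rule q(3))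
    then show ?case using Suc by simp
  qed simp
  have p_zero: "p k x = 0" if "x \<in> C k" for k x
    using that
  proof (induction k)
    case (Suc k)
    then show ?case using q(4)[of x k] q(5)[of k x] UC(3)[of k] by blast
  qed (simp add: UC(5))
  obtain u h where u: "Xs \<Omega> u" "AE x in lborel. (\<lambda>k. v k x) \<longlonglongrightarrow> u x" "L1 h"
    "\<And>k. AE x in lborel. norm (v k x) \<le> h x"
    by (rule geometric_limit[OF v(1) op bd q(1,2)], rule that)
  have lim: "(\<lambda>k. A0 + \<delta> * (1 - (1/2) ^ k)) \<longlonglongrightarrow> A0 + \<delta> * (1 - 0)" by (intro tendsto_intros LIMSEQ_power_zero) simp
  have "Fval \<Omega> \<psi> lam f u \<le> ennreal (A0 + \<delta> * (1 - 0))"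
    by (rule Fval_lsc[OF v(1) u(1,2,3,4) f(1) lam psi_nn v(2) _ lim]) (use A0 \<delta> in \<open>auto simp: power_le_one\<close>)
  then have Fu: "Fval \<Omega> \<psi> lam f u \<le> ennreal (A0 + \<delta>)" by simp
  have ui: "L1 u" using u(1) by (simp add: Xs_def)
  have "A0 + \<delta> \<ge> 0" using A0 \<delta> by simp
  then obtain G \<theta>' \<sigma>' where bv: "bvd \<Omega> u G \<theta>' \<sigma>'" using Rfun_imp_bvd[OF ui op bd fin[OF u(1) Fu]] by blast
  \<comment> \<open>On \<open>U j\<close> the sequence is constant from index j + 1 on and the
    weight of that member vanishes, so the limit has no singular part there.\<close>
  have "emeasure \<sigma>' (U j) = 0" for j
  proof (rule repr_singular_null[OF bv op UC(1) _ v(3)[of "Suc j"]])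
    show "U j \<subseteq> \<Omega>" using UC(6) by blast
    show "p (Suc j) x = 0" if "x \<in> U j" for x using that p_zero[of x "Suc j"] UC(3)[of j] C_mono[OF le_SucI[OF le_refl], of j] by blast
    show "L1 (v (Suc j))" using v(1) by (simp add: Xs_def)
    show "AE x in lborel. x \<in> U j \<longrightarrow> u x = v (Suc j) x"
      using u(2)
    proof (eventually_elim, intro impI)
      fix x assume l: "(\<lambda>k. v k x) \<longlonglongrightarrow> u x" and "x \<in> U j"
      then have "x \<in> C j" using UC(3) by blast
      then have "(\<lambda>k. v (k + Suc j) x) = (\<lambda>_. v (Suc j) x)" using v_const[of x j] by (simp add: add.commute)
      then show "u x = v (Suc j) x" using LIMSEQ_ignore_initial_segment[OF l, of "Suc j"] by (simp add: LIMSEQ_const_iff)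
    qed
  qed
  then have "emeasure \<sigma>' (\<Union>j. U j) = 0"
    using bv UC(1) by (intro emeasure_UN_eq_0) (auto simp: bvd_def)
  then have "emeasure \<sigma>' \<Omega> = 0" using UC(6) by simp
  moreover have "emeasure \<sigma>' UNIV \<le> emeasure \<sigma>' \<Omega> + emeasure \<sigma>' (UNIV - \<Omega>)"
    using emeasure_subadditive[of \<Omega> \<sigma>' "UNIV - \<Omega>"] bv op by (simp add: bvd_def)
  ultimately have "emeasure \<sigma>' UNIV = 0" using bv by (simp add: bvd_def)
  then show ?thesis using u(1) bv Fu by blast
qed

section \<open>Borel representatives\<close>

text \<open>Interface between Lebesgue measurable functions on \<Omega> and the Borel functions used
  in the analysis: w0 agrees with w almost everywhere on \<Omega> and is 0 outside.\<close>

definition rep :: "(real^'n) set \<Rightarrow> (real^'n \<Rightarrow> 'b::euclidean_space) \<Rightarrow> (real^'n \<Rightarrow> 'b) \<Rightarrow> bool" where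
  "rep \<Omega> w w0 \<longleftrightarrow> w \<in> borel_measurable (lebesgue_on \<Omega>) \<and> w0 \<in> borel_measurable borel
     \<and> (\<forall>x. x \<notin> \<Omega> \<longrightarrow> w0 x = 0) \<and> (AE x in lebesgue_on \<Omega>. w x = w0 x)"

lemma borel_lebesgue_on:
  assumes "g \<in> borel_measurable borel"
  shows "g \<in> borel_measurable (lebesgue_on \<Omega>)"
proof -
  have "g \<in> borel_measurable lebesgue" using assms by (intro measurable_completion) simp
  then show ?thesis by (rule measurable_restrict_space1)
qed

lemma rep_refl: "w \<in> borel_measurable borel \<Longrightarrow> (\<And>x. x \<notin> \<Omega> \<Longrightarrow> w x = 0) \<Longrightarrow> rep \<Omega> w w"
  by (simp add: rep_def borel_lebesgue_on)

lemma AE_lebesgue_on_iff: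
  assumes "open \<Omega>"
  shows "(AE x in lebesgue_on \<Omega>. P x) \<longleftrightarrow> (AE x in lborel. x \<in> \<Omega> \<longrightarrow> P x)"
  using assms by (simp add: AE_restrict_space_iff AE_completion_iff)

lemma rep_exists:
  fixes w :: "real^'n \<Rightarrow> 'b::euclidean_space"
  assumes op: "open \<Omega>" and m: "w \<in> borel_measurable (lebesgue_on \<Omega>)"
  shows "\<exists>w0. rep \<Omega> w w0"
proof -
  define v where "v x = (if x \<in> \<Omega> then w x else 0)" for x
  have v: "v \<in> borel_measurable lebesgue"
    unfolding v_def[abs_def] by (subst borel_measurable_if) (use op m in auto)
  have "\<forall>b. \<exists>g. g \<in> borel_measurable borel \<and> (AE x in lborel. v x \<bullet> b = g x)"
  proof
    fix b
    have "(\<lambda>x. v x \<bullet> b) \<in> borel_measurable lebesgue" using v by measurable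
    from completion_ex_borel_measurable_real[OF this] show "\<exists>g. g \<in> borel_measurable borel \<and> (AE x in lborel. v x \<bullet> b = g x)"
      by auto
  qed
  then obtain g where g: "\<And>b. g b \<in> borel_measurable borel" "\<And>b. AE x in lborel. v x \<bullet> b = g b x" by metis
  define w0 where "w0 x = (if x \<in> \<Omega> then \<Sum>b\<in>Basis. g b x *\<^sub>R b else 0)" for x
  have [measurable]: "g b \<in> borel_measurable borel" "\<Omega> \<in> sets borel" for b using g(1) op by auto
  have "AE x in lborel. \<forall>b\<in>Basis. v x \<bullet> b = g b x" by (intro AE_finite_allI g(2)) simp
  then have "AE x in lborel. x \<in> \<Omega> \<longrightarrow> w x = w0 x"
  proof eventually_elim
    case (elim x)
    have "v x = (\<Sum>b\<in>Basis. g b x *\<^sub>R b)" using elim euclidean_representation[of "v x"] by simp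
    then show ?case by (cases "x \<in> \<Omega>") (simp_all add: v_def w0_def)
  qed
  moreover have "w0 \<in> borel_measurable borel" unfolding w0_def[abs_def] by measurable
  ultimately have "rep \<Omega> w w0" using m by (simp add: rep_def AE_lebesgue_on_iff[OF op]) (simp add: w0_def)
  then show ?thesis by blast
qed

lemma lebesgue_on_integral:
  fixes g :: "real^'n \<Rightarrow> 'b::euclidean_space"
  assumes op: "open \<Omega>" and g: "g \<in> borel_measurable borel" "\<And>x. x \<notin> \<Omega> \<Longrightarrow> g x = 0"
  shows "(\<integral>x. g x \<partial>lebesgue_on \<Omega>) = (LBINT x. g x)" "integrable (lebesgue_on \<Omega>) g \<longleftrightarrow> L1 g"
proof -
  have e: "indicator \<Omega> x *\<^sub>R g x = g x" for x using g(2)[of x] by (simp add: indicator_def)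
  show "(\<integral>x. g x \<partial>lebesgue_on \<Omega>) = (LBINT x. g x)"
    using op g(1) by (subst integral_restrict_space) (auto simp: e integral_completion)
  show "integrable (lebesgue_on \<Omega>) g \<longleftrightarrow> L1 g"
    using op g(1) by (subst integrable_restrict_space) (auto simp: e integrable_completion)
qed

lemma rep_integral:
  fixes w :: "real^'n \<Rightarrow> 'b::euclidean_space"
  assumes op: "open \<Omega>" and r: "rep \<Omega> w w0"
  shows "integrable (lebesgue_on \<Omega>) w \<longleftrightarrow> L1 w0" "(\<integral>x. w x \<partial>lebesgue_on \<Omega>) = (LBINT x. w0 x)"
proof -
  have m: "w \<in> borel_measurable (lebesgue_on \<Omega>)" "w0 \<in> borel_measurable borel" "\<And>x. x \<notin> \<Omega> \<Longrightarrow> w0 x = 0" "AE x in lebesgue_on \<Omega>. w x = w0 x"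
    using r by (auto simp: rep_def)
  show "integrable (lebesgue_on \<Omega>) w \<longleftrightarrow> L1 w0"
    using lebesgue_on_integral(2)[OF op m(2,3)] integrable_cong_AE[OF m(1) borel_lebesgue_on[OF m(2)] m(4)] by blast
  show "(\<integral>x. w x \<partial>lebesgue_on \<Omega>) = (LBINT x. w0 x)"
    using lebesgue_on_integral(1)[OF op m(2,3)] integral_cong_AE[OF m(1) borel_lebesgue_on[OF m(2)] m(4)] by simp
qed

lemma rep_linear_mult:
  fixes w :: "real^'n \<Rightarrow> 'b::euclidean_space"
  assumes r: "rep \<Omega> w w0" and T: "bounded_linear T" and g: "continuous_on UNIV g"
  shows "rep \<Omega> (\<lambda>x. T (w x) * g x :: real) (\<lambda>x. T (w0 x) * g x)"
proof -
  have m: "w \<in> borel_measurable (lebesgue_on \<Omega>)" "w0 \<in> borel_measurable borel" using r by (auto simp: rep_def)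
  have "T \<in> borel_measurable borel" by (rule cont_borel[OF linear_continuous_on[OF T]])
  note T' = measurable_compose[OF _ this]
  have "(\<lambda>x. T (w x) * g x) \<in> borel_measurable (lebesgue_on \<Omega>)" "(\<lambda>x. T (w0 x) * g x) \<in> borel_measurable borel"
    by (intro borel_measurable_times T' m borel_lebesgue_on cont_borel[OF g])+
  then show ?thesis using r by (auto simp: rep_def linear_0[OF bounded_linear.linear[OF T]] elim: eventually_mono)
qed

lemma rep_nn_integral:
  fixes H :: "real^'n \<Rightarrow> real"
  assumes op: "open \<Omega>" and e: "AE x in lebesgue_on \<Omega>. h x = H x" and H: "\<And>x. x \<notin> \<Omega> \<Longrightarrow> H x = 0"
  shows "(\<integral>\<^sup>+x. ennreal (h x) \<partial>lebesgue_on \<Omega>) = (\<integral>\<^sup>+x. ennreal (H x) \<partial>lborel)"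
proof -
  have "(\<integral>\<^sup>+x. ennreal (h x) \<partial>lebesgue_on \<Omega>) = (\<integral>\<^sup>+x. ennreal (H x) \<partial>lebesgue_on \<Omega>)"
    by (rule nn_integral_cong_AE) (use e in \<open>auto elim: eventually_mono\<close>)
  also have "\<dots> = (\<integral>\<^sup>+x. ennreal (H x) * indicator \<Omega> x \<partial>lborel)"
    using op by (subst nn_integral_restrict_space) (auto simp: nn_integral_completion)
  also have "\<dots> = (\<integral>\<^sup>+x. ennreal (H x) \<partial>lborel)"
    by (intro nn_integral_cong) (use H in \<open>auto simp: indicator_def\<close>)
  finally show ?thesis .
qed

section \<open>The functionals \<open>Kfun\<close> and \<open>Jfun\<close> as the relaxed
  energy\<close>

lemma BV_decomp_iff_bvd:
  fixes w w0 :: "real^'n \<Rightarrow> real^'m"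
  assumes op: "open \<Omega>" and w: "rep \<Omega> w w0" and G: "rep \<Omega> G G0"
  shows "BV_decomp \<Omega> w G \<theta> \<sigma> \<longleftrightarrow> bvd \<Omega> w0 G0 \<theta> \<sigma>"
proof -
  have 1: "(\<integral>x. w x $ i * pd \<alpha> \<phi> x \<partial>lebesgue_on \<Omega>) = (LBINT x. w0 x $ i * pd \<alpha> \<phi> x)"
    "(\<integral>x. G x $ \<alpha> $ i * \<phi> x \<partial>lebesgue_on \<Omega>) = (LBINT x. G0 x $ \<alpha> $ i * \<phi> x)" if "test_fun \<Omega> \<phi>" for \<phi> \<alpha> i
  proof -
    have "\<phi> \<in> Ck_fun (Suc 0)" using that by (auto simp: test_fun_iff simp del: Ck_fun.simps)
    then have c: "continuous_on UNIV \<phi>" "continuous_on UNIV (pd \<alpha> \<phi>)" using Ck_fun_continuous C1_continuous_partial by blast+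
    show "(\<integral>x. w x $ i * pd \<alpha> \<phi> x \<partial>lebesgue_on \<Omega>) = (LBINT x. w0 x $ i * pd \<alpha> \<phi> x)"
      by (rule rep_integral(2)[OF op rep_linear_mult[OF w bounded_linear_vec_nth c(2)]])
    show "(\<integral>x. G x $ \<alpha> $ i * \<phi> x \<partial>lebesgue_on \<Omega>) = (LBINT x. G0 x $ \<alpha> $ i * \<phi> x)"
      by (rule rep_integral(2)[OF op rep_linear_mult[OF G bounded_linear_compose[OF bounded_linear_vec_nth bounded_linear_vec_nth] c(1)]])
  qed
  have 2: "emeasure lebesgue Z = emeasure lborel Z" if "Z \<in> sets borel" for Z :: "(real^'n) set" using that by simp
  have 3: "\<theta> \<in> borel_measurable \<sigma> \<longleftrightarrow> \<theta> \<in> borel_measurable borel" if "sets \<sigma> = sets borel"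
    by (simp add: measurable_cong_sets[OF that refl])
  have 4: "\<forall>x. x \<notin> \<Omega> \<longrightarrow> G0 x = 0" using G by (simp add: rep_def)
  show ?thesis
    unfolding BV_decomp_def bvd_def using rep_integral(1)[OF op w] rep_integral(1)[OF op G] 1 2 3 4 by (auto cong: bex_cong)
qed

lemma null_integral:
  fixes g :: "'a \<Rightarrow> real"
  assumes "emeasure \<sigma> (space \<sigma>) = 0"
  shows "(\<integral>x. g x \<partial>\<sigma>) = 0"
proof -
  have "AE x in \<sigma>. False" using assms by (auto simp: AE_iff_measurable[OF _ refl])
  then have "AE x in \<sigma>. g x = 0" by eventually_elim simp
  then show ?thesis by (rule integral_eq_zero_AE)
qed

text \<open>For the zero measure the condition |\<theta>| = 1 holds almost everywhere whatever
  \<theta> is, so the value 0 is as good as any.\<close>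

lemma BV_decomp_null:
  fixes w :: "real^'n \<Rightarrow> real^'m"
  assumes "integrable (lebesgue_on \<Omega>) w" "integrable (lebesgue_on \<Omega>) G" "weak_grad \<Omega> w G"
  shows "BV_decomp \<Omega> w G (\<lambda>_. 0) (null_measure borel)"
proof -
  have "AE x in null_measure borel. norm (0 :: real^'m^'n) = 1" by (rule AE_I'[of UNIV]) (auto simp: null_sets_def)
  then show ?thesis using assms by (auto simp: BV_decomp_def weak_grad_def intro!: bexI[of _ "{}"])
qed

lemma weak_grad_of_null:
  fixes w :: "real^'n \<Rightarrow> real^'m"
  assumes bv: "BV_decomp \<Omega> w G \<theta> \<sigma>" and 0: "emeasure \<sigma> UNIV = 0"
  shows "weak_grad \<Omega> w G"
proof -
  have "space \<sigma> = UNIV" using bv sets_eq_imp_space_eq[of \<sigma> borel] by (simp add: BV_decomp_def)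
  then have "(\<integral>x. g x \<partial>\<sigma>) = 0" for g :: "real^'n \<Rightarrow> real" using 0 by (intro null_integral) simp
  then show ?thesis using bv by (simp add: BV_decomp_def weak_grad_def)
qed

lemma W11_BV: "W11 \<Omega> w \<Longrightarrow> BV \<Omega> w"
  using BV_decomp_null unfolding W11_def BV_def by blast

lemma BV_Xs:
  assumes op: "open \<Omega>" and "BV \<Omega> w"
  shows "\<exists>w0. rep \<Omega> w w0 \<and> Xs \<Omega> w0"
proof -
  have wi: "integrable (lebesgue_on \<Omega>) w" using assms(2) by (auto simp: BV_def BV_decomp_def)
  then obtain w0 where r: "rep \<Omega> w w0" using rep_exists[OF op borel_measurable_integrable] by blast
  have "L1 w0" using wi rep_integral(1)[OF op r] by simp
  then have "Xs \<Omega> w0" using r by (auto simp: Xs_def rep_def)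
  with r show ?thesis by blast
qed

context psi
begin

text \<open>By duality the value depends on w and f only, not on the chosen decomposition. Therefore
  the choice operator in \<open>Kfun\<close> and \<open>Jfun\<close> selects from a single
  value.\<close>

lemma BV_value:
  fixes w f :: "real^'n \<Rightarrow> real^'m"
  assumes op: "open \<Omega>" and bd: "bounded \<Omega>" and w: "rep \<Omega> w w0" and f: "rep \<Omega> f f0" and bv: "BV_decomp \<Omega> w G \<theta> \<sigma>"
  shows "(\<integral>\<^sup>+x. ennreal (\<psi> (norm (G x))) \<partial>lebesgue_on \<Omega>) + ennreal pinf * emeasure \<sigma> \<Omega>
      + ennreal (lam / 2) * (\<integral>\<^sup>+x. ennreal ((norm (w x - f x))\<^sup>2) \<partial>lebesgue_on \<Omega>) = Fval \<Omega> \<psi> lam f0 w0"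
proof -
  have "integrable (lebesgue_on \<Omega>) G" using bv by (simp add: BV_decomp_def)
  then obtain G0 where G: "rep \<Omega> G G0" using rep_exists[OF op borel_measurable_integrable] by blast
  have b: "bvd \<Omega> w0 G0 \<theta> \<sigma>" using bv BV_decomp_iff_bvd[OF op w G] by simp
  interpret finite_measure \<sigma> by (rule bvd_theta_integrable(2)[OF b])
  have sb: "sets \<sigma> = sets borel" "emeasure \<sigma> (UNIV - \<Omega>) = 0" "L1 G0" using b by (auto simp: bvd_def)
  have "emeasure \<sigma> UNIV = emeasure \<sigma> \<Omega> + emeasure \<sigma> (UNIV - \<Omega>)"
    using op sb(1) by (subst plus_emeasure) auto
  then have s: "emeasure \<sigma> \<Omega> = ennreal (measure \<sigma> UNIV)" using sb(2) by (simp add: emeasure_eq_measure)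
  have "(\<integral>\<^sup>+x. ennreal (\<psi> (norm (G x))) \<partial>lebesgue_on \<Omega>) = (\<integral>\<^sup>+x. ennreal (\<psi> (norm (G0 x))) \<partial>lborel)"
    using G psi_0 by (intro rep_nn_integral[OF op]) (auto simp: rep_def elim: eventually_mono)
  also have "\<dots> = ennreal (LBINT x. \<psi> (norm (G0 x)))"
    using psi_nn by (intro nn_integral_eq_integral psi_integrable sb) auto
  finally have "(\<integral>\<^sup>+x. ennreal (\<psi> (norm (G x))) \<partial>lebesgue_on \<Omega>) + ennreal pinf * emeasure \<sigma> \<Omega> = ennreal (bval G0 \<sigma>)"
    using pinf_nonneg psi_nn by (simp add: s bval_def ennreal_mult[symmetric])
  also have "\<dots> = Rfun \<Omega> \<psi> w0" by (rule duality[OF b op bd, symmetric])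
  finally have R: "(\<integral>\<^sup>+x. ennreal (\<psi> (norm (G x))) \<partial>lebesgue_on \<Omega>) + ennreal pinf * emeasure \<sigma> \<Omega> = Rfun \<Omega> \<psi> w0" .
  have "AE x in lebesgue_on \<Omega>. w x = w0 x" "AE x in lebesgue_on \<Omega>. f x = f0 x" using w f by (auto simp: rep_def)
  then have "AE x in lebesgue_on \<Omega>. (norm (w x - f x))\<^sup>2 = (norm (w0 x - f0 x))\<^sup>2" by eventually_elim simp
  then have "(\<integral>\<^sup>+x. ennreal ((norm (w x - f x))\<^sup>2) \<partial>lebesgue_on \<Omega>) = (\<integral>\<^sup>+x. ennreal ((norm (w0 x - f0 x))\<^sup>2) \<partial>lborel)"
    by (rule rep_nn_integral[OF op]) (use w f in \<open>simp add: rep_def\<close>)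
  with R show ?thesis by (simp add: Fval_def)
qed

lemma Kfun_eq:
  fixes w f :: "real^'n \<Rightarrow> real^'m"
  assumes op: "open \<Omega>" and bd: "bounded \<Omega>" and w: "rep \<Omega> w w0" and f: "rep \<Omega> f f0" and bv: "BV \<Omega> w"
  shows "Kfun \<Omega> \<psi> pinf lam f w = Fval \<Omega> \<psi> lam f0 w0"
  unfolding Kfun_def
proof (rule some_equality)
  obtain G \<theta> \<sigma> where "BV_decomp \<Omega> w G \<theta> \<sigma>" using bv unfolding BV_def by blast
  then show "\<exists>G \<theta> \<sigma>. BV_decomp \<Omega> w G \<theta> \<sigma> \<and> Fval \<Omega> \<psi> lam f0 w0 = (\<integral>\<^sup>+x. ennreal (\<psi> (norm (G x))) \<partial>lebesgue_on \<Omega>)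
      + ennreal pinf * emeasure \<sigma> \<Omega> + ennreal (lam / 2) * (\<integral>\<^sup>+x. ennreal ((norm (w x - f x))\<^sup>2) \<partial>lebesgue_on \<Omega>)"
    using BV_value[OF op bd w f, symmetric] by blast
qed (elim exE conjE, erule trans, rule BV_value[OF op bd w f])

lemma Jfun_eq:
  fixes w f :: "real^'n \<Rightarrow> real^'m"
  assumes op: "open \<Omega>" and bd: "bounded \<Omega>" and w: "rep \<Omega> w w0" and f: "rep \<Omega> f f0" and W: "W11 \<Omega> w"
  shows "Jfun \<Omega> \<psi> lam f w = Fval \<Omega> \<psi> lam f0 w0"
proof -
  have v: "(\<integral>\<^sup>+x. ennreal (\<psi> (norm (G x))) \<partial>lebesgue_on \<Omega>)
      + ennreal (lam / 2) * (\<integral>\<^sup>+x. ennreal ((norm (w x - f x))\<^sup>2) \<partial>lebesgue_on \<Omega>) = Fval \<Omega> \<psi> lam f0 w0"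
    if "integrable (lebesgue_on \<Omega>) G" "weak_grad \<Omega> w G" for G
    using BV_value[OF op bd w f BV_decomp_null[OF _ that], of lam] W by (simp add: W11_def)
  show ?thesis
    unfolding Jfun_def
  proof (rule some_equality)
    obtain G where "integrable (lebesgue_on \<Omega>) G" "weak_grad \<Omega> w G" using W unfolding W11_def by blast
    then show "\<exists>G. integrable (lebesgue_on \<Omega>) G \<and> weak_grad \<Omega> w G \<and> Fval \<Omega> \<psi> lam f0 w0 = (\<integral>\<^sup>+x. ennreal (\<psi> (norm (G x))) \<partial>lebesgue_on \<Omega>)
      + ennreal (lam / 2) * (\<integral>\<^sup>+x. ennreal ((norm (w x - f x))\<^sup>2) \<partial>lebesgue_on \<Omega>)"
      using v[symmetric] by blast
  qed (elim exE conjE, erule trans, rule v)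
qed

lemma Fval_finite_BV:
  fixes f w :: "real^'n \<Rightarrow> real^'m"
  assumes op: "open \<Omega>" and bd: "bounded \<Omega>" and w: "Xs \<Omega> w" and F: "Fval \<Omega> \<psi> lam f w < \<infinity>"
  shows "BV \<Omega> w"
proof -
  have wi: "L1 w" using w by (simp add: Xs_def)
  have "Rfun \<Omega> \<psi> w < \<infinity>" using F by (simp add: Fval_def less_top[symmetric])
  then obtain G \<theta> \<sigma> where b: "bvd \<Omega> w G \<theta> \<sigma>" using Rfun_imp_bvd[OF wi op bd] by blast
  then have "rep \<Omega> w w" "rep \<Omega> G G" using w by (auto simp: Xs_def bvd_def intro!: rep_refl)
  then show ?thesis using BV_decomp_iff_bvd[OF op] b unfolding BV_def by blast
qed

text \<open>Minimizing over all of \<open>Xs\<close> instead of BV loses nothing: a minimizer has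
  finite energy and hence belongs to BV, and every BV function has a representative in
  \<open>Xs\<close>.\<close>

lemma relaxed_problem:
  fixes f :: "real^'n \<Rightarrow> real^'m"
  assumes op: "open \<Omega>" and bd: "bounded \<Omega>" and ne: "\<Omega> \<noteq> {}" and lam: "lam > 0" and K: "closed Kc" "convex Kc"
    and f: "f \<in> borel_measurable (lebesgue_on \<Omega>)" "integrable (lebesgue_on \<Omega>) (\<lambda>x. (norm (f x))\<^sup>2)"
    and fK: "AE x in lebesgue_on \<Omega>. f x \<in> Kc"
  shows "(\<exists>u. BV \<Omega> u
            \<and> (\<forall>w. BV \<Omega> w \<longrightarrow> Kfun \<Omega> \<psi> pinf lam f u \<le> Kfun \<Omega> \<psi> pinf lam f w)
            \<and> (\<forall>v. BV \<Omega> v \<and> (\<forall>w. BV \<Omega> w \<longrightarrow> Kfun \<Omega> \<psi> pinf lam f v \<le> Kfun \<Omega> \<psi> pinf lam f w)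
                   \<longrightarrow> (AE x in lebesgue_on \<Omega>. v x = u x))
            \<and> (AE x in lebesgue_on \<Omega>. u x \<in> Kc))
         \<and> (INF w \<in> {w. BV \<Omega> w}. Kfun \<Omega> \<psi> pinf lam f w) = (INF w \<in> {w. W11 \<Omega> w}. Jfun \<Omega> \<psi> lam f w)"
proof -
  obtain f0 where rf: "rep \<Omega> f f0" using rep_exists[OF op f(1)] by blast
  have f0: "f0 \<in> borel_measurable borel" "\<And>x. x \<notin> \<Omega> \<Longrightarrow> f0 x = 0" "AE x in lebesgue_on \<Omega>. f x = f0 x" using rf by (auto simp: rep_def)
  have "rep \<Omega> (\<lambda>x. (norm (f x))\<^sup>2) (\<lambda>x. (norm (f0 x))\<^sup>2)"
    using f(2) f0 by (auto simp: rep_def elim: eventually_mono)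
  then have f02: "L1 (\<lambda>x. (norm (f0 x))\<^sup>2)" using rep_integral(1)[OF op] f(2) by blast
  obtain u where u: "Xs \<Omega> u" "Fval \<Omega> \<psi> lam f0 u < \<infinity>" "\<And>w. Xs \<Omega> w \<Longrightarrow> Fval \<Omega> \<psi> lam f0 u \<le> Fval \<Omega> \<psi> lam f0 w"
    using minimizer_exists[where \<Omega> = \<Omega> and \<psi> = \<psi> and f = f0, OF op bd f0(1) f02 lam psi_nn psi_0] by blast
  have Xr: "rep \<Omega> v v" if "Xs \<Omega> v" for v :: "real^'n \<Rightarrow> real^'m" using Xs_borel[OF that] that by (intro rep_refl) (auto simp: Xs_def)
  have BVu: "BV \<Omega> u" by (rule Fval_finite_BV[OF op bd u(1,2)])
  have Ku: "Kfun \<Omega> \<psi> pinf lam f u = Fval \<Omega> \<psi> lam f0 u" by (rule Kfun_eq[OF op bd Xr[OF u(1)] rf BVu])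
  have min: "Kfun \<Omega> \<psi> pinf lam f u \<le> Kfun \<Omega> \<psi> pinf lam f w" if w: "BV \<Omega> w" for w
  proof -
    obtain w0 where w0: "rep \<Omega> w w0" "Xs \<Omega> w0" using BV_Xs[OF op w] by blast
    show ?thesis unfolding Ku Kfun_eq[OF op bd w0(1) rf w] by (rule u(3)[OF w0(2)])
  qed
  have uniq: "AE x in lebesgue_on \<Omega>. v x = u x" if v: "BV \<Omega> v" "\<forall>w. BV \<Omega> w \<longrightarrow> Kfun \<Omega> \<psi> pinf lam f v \<le> Kfun \<Omega> \<psi> pinf lam f w" for v
  proof -
    obtain v0 where v0: "rep \<Omega> v v0" "Xs \<Omega> v0" using BV_Xs[OF op v(1)] by blast
    have le: "Fval \<Omega> \<psi> lam f0 v0 \<le> Fval \<Omega> \<psi> lam f0 u"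
      using v(2) BVu unfolding Ku[symmetric] Kfun_eq[OF op bd v0(1) rf v(1), symmetric] by blast
    have "AE x in lborel. v0 x = u x" by (rule minimizer_unique[OF f0(1) lam u(1,2) u(3) v0(2) le], assumption)
    then have "AE x in lebesgue_on \<Omega>. v0 x = u x" unfolding AE_lebesgue_on_iff[OF op] by eventually_elim simp
    moreover have "AE x in lebesgue_on \<Omega>. v x = v0 x" using v0(1) by (simp add: rep_def)
    ultimately show ?thesis by eventually_elim simp
  qed
  \<comment> \<open>A nonempty open set has positive measure, so f takes values in Kc somewhere;
    nearest point projections onto Kc then exist.\<close>
  have Kne: "Kc \<noteq> {}"
  proof
    assume "Kc = {}"
    then have "AE x in lborel. x \<notin> \<Omega>" using fK by (simp add: AE_lebesgue_on_iff[OF op])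
    then have "emeasure lborel \<Omega> = 0" using op by (subst (asm) AE_iff_measurable[of \<Omega>]) auto
    then show False using open_not_negligible[OF op ne] op by (simp add: negligible_iff_null_sets null_sets_def)
  qed
  have f0K: "AE x in lborel. x \<in> \<Omega> \<longrightarrow> f0 x \<in> Kc"
    using fK f0(3) unfolding AE_lebesgue_on_iff[OF op] by eventually_elim auto
  have "AE x in lborel. x \<in> \<Omega> \<longrightarrow> u x \<in> Kc"
    by (rule minimizer_in_convex[OF K Kne _ f0K])
      (rule minimizer_half_space[OF op bd f0(1) f02 f0(2) lam u], assumption+)
  then have inK: "AE x in lebesgue_on \<Omega>. u x \<in> Kc" unfolding AE_lebesgue_on_iff[OF op] .
  have JK: "Jfun \<Omega> \<psi> lam f w = Kfun \<Omega> \<psi> pinf lam f w" if w: "W11 \<Omega> w" for w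
  proof -
    obtain w0 where w0: "rep \<Omega> w w0" using BV_Xs[OF op W11_BV[OF w]] by blast
    show ?thesis unfolding Kfun_eq[OF op bd w0 rf W11_BV[OF w]] by (rule Jfun_eq[OF op bd w0 rf w])
  qed
  obtain A where A: "A \<ge> 0" "Fval \<Omega> \<psi> lam f0 u = ennreal A" using u(2) by (metis ennreal_cases infinity_ennreal_def less_irrefl)
  \<comment> \<open>It is enough to approximate the minimizer, whose value is the infimum over BV.
    The opposite inequality holds because both functionals agree on W11.\<close>
  have "(INF w \<in> {w. W11 \<Omega> w}. Jfun \<Omega> \<psi> lam f w) \<le> Kfun \<Omega> \<psi> pinf lam f u"
    unfolding Ku
  proof (rule ennreal_le_epsilon)
    fix e :: real assume e: "e > 0"
    have FA: "Fval \<Omega> \<psi> lam f0 u \<le> ennreal A" using A by simp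
    obtain v G \<theta> \<sigma> where v: "Xs \<Omega> v" "bvd \<Omega> v G \<theta> \<sigma>" "emeasure \<sigma> UNIV = 0" "Fval \<Omega> \<psi> lam f0 v \<le> ennreal (A + e)"
      using W11_approximation[OF op bd u(1) f0(1) f02 lam FA A(1) e] by blast
    have rv: "rep \<Omega> v v" by (rule Xr[OF v(1)])
    have "rep \<Omega> G G" using v(2) by (intro rep_refl) (auto simp: bvd_def)
    then have "BV_decomp \<Omega> v G \<theta> \<sigma>" using BV_decomp_iff_bvd[OF op rv] v(2) by blast
    from this weak_grad_of_null[OF this v(3)] have W: "W11 \<Omega> v" unfolding W11_def BV_decomp_def by blast
    have "(INF w \<in> {w. W11 \<Omega> w}. Jfun \<Omega> \<psi> lam f w) \<le> Jfun \<Omega> \<psi> lam f v" using W by (intro INF_lower) simp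
    also have "\<dots> = Fval \<Omega> \<psi> lam f0 v" by (rule Jfun_eq[OF op bd rv rf W])
    also have "\<dots> \<le> Fval \<Omega> \<psi> lam f0 u + ennreal e" using v(4) A e by simp
    finally show "(INF w \<in> {w. W11 \<Omega> w}. Jfun \<Omega> \<psi> lam f w) \<le> Fval \<Omega> \<psi> lam f0 u + ennreal e" .
  qed
  then have "(INF w \<in> {w. W11 \<Omega> w}. Jfun \<Omega> \<psi> lam f w) \<le> (INF w \<in> {w. BV \<Omega> w}. Kfun \<Omega> \<psi> pinf lam f w)"
    by (intro INF_greatest) (auto intro: order_trans min)
  moreover have "(INF w \<in> {w. BV \<Omega> w}. Kfun \<Omega> \<psi> pinf lam f w) \<le> (INF w \<in> {w. W11 \<Omega> w}. Jfun \<Omega> \<psi> lam f w)"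
    by (intro INF_greatest) (auto simp: JK intro!: INF_lower W11_BV)
  ultimately show ?thesis using BVu min uniq inK by (intro conjI antisym exI[of _ u]) blast+
qed

end

section \<open>From the hypotheses on the integrand to the locale\<close>

text \<open>Positivity of \<psi>'' makes \<psi>' increasing, and the bound \<nu>1 makes it converge
  to its supremum; \<open>Lim at_top \<psi>'\<close> is thereby an actual limit.\<close>

lemma psi_locale:
  assumes nn: "\<forall>y\<ge>0. \<psi> y \<ge> 0" and d1: "\<forall>y\<ge>0. (\<psi> has_real_derivative \<psi>' y) (at y within {0..})"
    and d2: "\<forall>y\<ge>0. (\<psi>' has_real_derivative \<psi>'' y) (at y within {0..})" and 0: "\<psi> 0 = 0"
    and nu: "\<nu>2 > 0" and h1: "\<forall>y\<ge>0. \<psi>' y \<le> \<nu>1" and h2: "\<forall>y\<ge>0. \<psi> y \<ge> \<nu>2 * y - \<nu>3" and h3: "\<forall>y\<ge>0. \<psi>'' y > 0"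
  shows "psi \<psi> \<psi>' (Lim at_top \<psi>') \<nu>2 \<nu>3"
proof -
  have mono: "\<psi>' x \<le> \<psi>' y" if xy: "0 \<le> x" "x \<le> y" for x y
  proof (cases "x = y")
    case False
    then have "x < y" using xy by simp
    moreover have "(\<psi>' has_derivative (\<lambda>h. \<psi>'' t * h)) (at t within {x..y})" if t: "x \<le> t" "t \<le> y" for t
    proof -
      have "(\<psi>' has_real_derivative \<psi>'' t) (at t within {x..y})" by (rule DERIV_subset[OF d2[rule_format, of t]]) (use t xy in auto)
      then show ?thesis by (simp add: has_field_derivative_def mult_commute_abs)
    qed
    ultimately obtain z where z: "z \<in> {x<..<y}" "\<psi>' y - \<psi>' x = \<psi>'' z * (y - x)" using mvt_simple[of x y \<psi>' "\<lambda>t h. \<psi>'' t * h"] by blast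
    then have "\<psi>'' z * (y - x) \<ge> 0" using h3 xy by (intro mult_nonneg_nonneg) (auto simp: less_imp_le)
    then show ?thesis using z(2) by simp
  qed simp
  define L where "L = (SUP y\<in>{0..}. \<psi>' y)"
  have bdd: "bdd_above (\<psi>' ` {0..})" using h1 by (auto simp: bdd_above_def)
  have L: "(\<psi>' \<longlongrightarrow> L) at_top"
  proof (rule increasing_tendsto)
    show "\<forall>\<^sub>F y in at_top. \<psi>' y \<le> L"
      using eventually_ge_at_top[of 0] by eventually_elim (auto simp: L_def intro: cSUP_upper bdd)
    fix a assume "a < L"
    then obtain y where y: "y \<ge> 0" "a < \<psi>' y" unfolding L_def by (subst (asm) less_cSUP_iff[OF _ bdd]) auto
    show "\<forall>\<^sub>F t in at_top. a < \<psi>' t"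
      using eventually_ge_at_top[of y] by eventually_elim (use y mono in \<open>force intro: less_le_trans\<close>)
  qed
  have "Lim at_top \<psi>' = L" by (rule tendsto_Lim[OF _ L]) simp
  then show ?thesis
    using L mono d1 nn 0 nu h2 DERIV_continuous_on[of "{0..}" \<psi>' \<psi>''] d2 by unfold_locales auto
qed

theorem theorem2p1:
  fixes \<Omega> :: "(real^'n) set" and Kc :: "(real^'m) set" and f :: "real^'n \<Rightarrow> real^'m"
    and \<psi> \<psi>' \<psi>'' :: "real \<Rightarrow> real" and lam \<nu>1 \<nu>2 \<nu>3 :: real
  assumes dom: "bounded_lipschitz_domain \<Omega>"
    and lam: "lam > 0"
    and K: "closed Kc" "convex Kc"
    and f_L2: "f \<in> borel_measurable (lebesgue_on \<Omega>)"
              "integrable (lebesgue_on \<Omega>) (\<lambda>x. (norm (f x))\<^sup>2)"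
    and f_K: "AE x in lebesgue_on \<Omega>. f x \<in> Kc"
    and psi_nonneg: "\<forall>y\<ge>0. \<psi> y \<ge> 0"
    and psi_d1: "\<forall>y\<ge>0. (\<psi> has_real_derivative \<psi>' y) (at y within {0..})"
    and psi_d2: "\<forall>y\<ge>0. (\<psi>' has_real_derivative \<psi>'' y) (at y within {0..})"
    and psi_C2: "continuous_on {0..} \<psi>''"
    and psi0: "\<psi> 0 = 0"
    and nu: "\<nu>1 > 0" "\<nu>2 > 0"
    and psi_h1: "\<forall>y\<ge>0. \<psi>' y \<le> \<nu>1"
    and psi_h2: "\<forall>y\<ge>0. \<psi> y \<ge> \<nu>2 * y - \<nu>3"
    and psi_h3: "\<forall>y\<ge>0. \<psi>'' y > 0"
  shows "(\<exists>u. BV \<Omega> u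
            \<and> (\<forall>w. BV \<Omega> w \<longrightarrow> Kfun \<Omega> \<psi> (Lim at_top \<psi>') lam f u \<le> Kfun \<Omega> \<psi> (Lim at_top \<psi>') lam f w)
            \<and> (\<forall>v. BV \<Omega> v \<and> (\<forall>w. BV \<Omega> w \<longrightarrow> Kfun \<Omega> \<psi> (Lim at_top \<psi>') lam f v \<le> Kfun \<Omega> \<psi> (Lim at_top \<psi>') lam f w)
                   \<longrightarrow> (AE x in lebesgue_on \<Omega>. v x = u x))
            \<and> (AE x in lebesgue_on \<Omega>. u x \<in> Kc))
         \<and> (INF w \<in> {w. BV \<Omega> w}. Kfun \<Omega> \<psi> (Lim at_top \<psi>') lam f w)
             = (INF w \<in> {w. W11 \<Omega> w}. Jfun \<Omega> \<psi> lam f w)"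
proof -
  interpret psi \<psi> \<psi>' "Lim at_top \<psi>'" \<nu>2 \<nu>3
    by (rule psi_locale[OF psi_nonneg psi_d1 psi_d2 psi0 nu(2) psi_h1 psi_h2 psi_h3])
  show ?thesis
    using dom by (intro relaxed_problem lam K f_L2 f_K) (auto simp: bounded_lipschitz_domain_def)
qed

end
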